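(* Let $P$ be a regular polygon with an odd number $d\ge 3$ of sides, and let $\psi_P$ be its slap map. Then $\psi_P$ has a unique ergodic acip if $d=3$ or $d=5$, and exactly $d$ ergodic acip's if $d\ge 7$. For every odd $d\ge 3$, every ergodic acip of $\psi_P$ has exactly $2^{m(d)}$ mixing components, where $m(d)$ is the integer part of $-\log_2\bigl(-\log_2\cos(\pi/d)\bigr)$. In particular, $m(3)=0$, $m(5)=1$ and $m(7)=2$.
   Context: Slap map: let $P$ be a non-self-intersecting polygon with perimeter $L$, and let $s\in[0,L]$ be the arc length parameter of $\partial P$. For a point $s\in\partial P$ (not a vertex), let $\rho$ be the ray starting at $s$, directed inside $P$ and orthogonal to $\partial P$ at $s$, and let $s'$ be the point of $\rho\cap\partial P$, different from $s$, which is closest to $s$. The slap map of $P$ is the piecewise affine map $\psi_P\colon[0,L]\to[0,L]$, $s\mapsto s'$ (its values at the finitely many exceptional points are irrelevant). An acip of a map $f$ of an interval $I$ is an $f$-invariant Borel probability measure that is absolutely continuous with respect to Lebesgue measure on $I$. Mixing components: for a piecewise expanding map $f$ and an ergodic acip $\nu$ of $f$ with support $\Lambda$, there are an integer $k\ge 1$ and disjoint measurable sets $\Sigma_1,\dots,\Sigma_k$ with $\Lambda=\Sigma_1\cup\dots\cup\Sigma_k$ (up to null sets), cyclically permuted by $f$, such that $f^k|_{\Sigma_1}$ is exact with respect to the (normalized) restriction of $\nu$ to $\Sigma_1$. The sets $\Sigma_j$ are the mixing components of $\nu$, and $k$ is the mixing period (the number of mixing components). *)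

theory Defs
  imports "HOL-Probability.Probability"
begin

section \<open>Polygons and their slap maps\<close>

text \<open>A polygon is given by the cyclic list of its vertices in the complex plane, so \<open>d\<close> vertices
  mean \<open>d\<close> sides. The definitions are meant for polygons without self-intersections.\<close>

definition vertex :: "complex list \<Rightarrow> nat \<Rightarrow> complex" where
  "vertex P i = P ! (i mod length P)"

definition polygon_boundary :: "complex list \<Rightarrow> complex set" where
  "polygon_boundary P = (\<Union>i<length P. closed_segment (vertex P i) (vertex P (Suc i)))"

definition vertex_param :: "complex list \<Rightarrow> nat \<Rightarrow> real" where
  "vertex_param P i = (\<Sum>j<i. dist (vertex P j) (vertex P (Suc j)))"

definition perimeter :: "complex list \<Rightarrow> real" where
  "perimeter P = vertex_param P (length P)"

text \<open>The side carrying the parameter \<open>s\<close>; at a vertex this is the side that ends there,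
  except that \<open>s = 0\<close> belongs to side \<open>0\<close>.\<close>

definition side_at :: "complex list \<Rightarrow> real \<Rightarrow> nat" where
  "side_at P s = (LEAST i. s \<le> vertex_param P (Suc i))"

definition tangent :: "complex list \<Rightarrow> real \<Rightarrow> complex" where
  "tangent P s = sgn (vertex P (Suc (side_at P s)) - vertex P (side_at P s))"

text \<open>Arc length parametrization of the boundary by \<open>{0..perimeter P}\<close>, starting at \<open>vertex P 0\<close>.\<close>

definition boundary_point :: "complex list \<Rightarrow> real \<Rightarrow> complex" where
  "boundary_point P s =
     vertex P (side_at P s) + (s - vertex_param P (side_at P s)) *\<^sub>R tangent P s"

definition inner_normal :: "complex list \<Rightarrow> real \<Rightarrow> complex" where
  "inner_normal P s = (THE u. norm u = 1 \<and> u \<bullet> tangent P s = 0 \<and>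
     (\<forall>\<^sub>F t in at_right 0. boundary_point P s + t *\<^sub>R u \<in> inside (polygon_boundary P)))"

definition slap_ray :: "complex list \<Rightarrow> real \<Rightarrow> complex set" where
  "slap_ray P s = {boundary_point P s + t *\<^sub>R inner_normal P s |t. 0 \<le> t}"

definition slap_point :: "complex list \<Rightarrow> real \<Rightarrow> complex" where
  "slap_point P s = (let H = slap_ray P s \<inter> polygon_boundary P - {boundary_point P s} in
     (THE z. z \<in> H \<and> (\<forall>w\<in>H. dist (boundary_point P s) z \<le> dist (boundary_point P s) w)))"

text \<open>The parameters \<open>0\<close> and \<open>perimeter P\<close> describe the same point, so parameters of image
  points are taken in the half-open interval. The value at the exceptional parameters (vertices)
  is irrelevant and set to \<open>0\<close>.\<close>

definition slap_map :: "complex list \<Rightarrow> real \<Rightarrow> real" where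
  "slap_map P s =
     (if s \<in> {0..perimeter P} \<and> boundary_point P s \<notin> set P
      then (THE s'. s' \<in> {0..<perimeter P} \<and> boundary_point P s' = slap_point P s)
      else 0)"

text \<open>Regular polygons of arbitrary centre \<open>c\<close>, size \<open>norm a\<close> and rotation \<open>Arg a\<close>, with the
  vertices listed counterclockwise.\<close>

definition regular_polygon :: "nat \<Rightarrow> complex list \<Rightarrow> bool" where
  "regular_polygon d P \<longleftrightarrow> d \<ge> 3 \<and>
     (\<exists>c a. a \<noteq> 0 \<and> P = map (\<lambda>j. c + a * cis (2 * pi * real j / real d)) [0..<d])"

section \<open>Absolutely continuous invariant probabilities\<close>

definition invariant_measure :: "('a \<Rightarrow> 'a) \<Rightarrow> 'a measure \<Rightarrow> bool" where
  "invariant_measure f \<mu> \<longleftrightarrow> f \<in> measurable \<mu> \<mu> \<and> distr \<mu> \<mu> f = \<mu>"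

definition ergodic :: "('a \<Rightarrow> 'a) \<Rightarrow> 'a measure \<Rightarrow> bool" where
  "ergodic f \<mu> \<longleftrightarrow> invariant_measure f \<mu> \<and>
     (\<forall>A\<in>sets \<mu>. f -` A \<inter> space \<mu> = A \<longrightarrow> measure \<mu> A = 0 \<or> measure \<mu> A = 1)"

text \<open>Exactness: the tail sigma-algebra \<open>\<Inter>n. f\<^sup>-\<^sup>n(sets \<mu>)\<close> is trivial.\<close>

definition exact :: "('a \<Rightarrow> 'a) \<Rightarrow> 'a measure \<Rightarrow> bool" where
  "exact f \<mu> \<longleftrightarrow> invariant_measure f \<mu> \<and>
     (\<forall>A. (\<forall>n. \<exists>B\<in>sets \<mu>. A = (f ^^ n) -` B \<inter> space \<mu>) \<longrightarrow>
        measure \<mu> A = 0 \<or> measure \<mu> A = 1)"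

definition acip :: "real set \<Rightarrow> (real \<Rightarrow> real) \<Rightarrow> real measure \<Rightarrow> bool" where
  "acip I f \<mu> \<longleftrightarrow> prob_space \<mu> \<and> sets \<mu> = sets (restrict_space borel I) \<and>
     absolutely_continuous (restrict_space lborel I) \<mu> \<and> invariant_measure f \<mu>"

definition ergodic_acip :: "real set \<Rightarrow> (real \<Rightarrow> real) \<Rightarrow> real measure \<Rightarrow> bool" where
  "ergodic_acip I f \<mu> \<longleftrightarrow> acip I f \<mu> \<and> ergodic f \<mu>"

definition measure_support :: "real measure \<Rightarrow> real set" where
  "measure_support \<mu> =
     {x\<in>space \<mu>. \<forall>U. open U \<longrightarrow> x \<in> U \<longrightarrow> measure \<mu> (U \<inter> space \<mu>) > 0}"

text \<open>The sets \<open>\<Sigma> 0, \<dots>, \<Sigma> (k - 1)\<close> are mixing components of \<open>\<mu>\<close>; all set relations other than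
  disjointness hold up to \<open>\<mu>\<close>-null sets. Since \<open>f ^^ k\<close> maps \<open>\<Sigma> 0\<close> into itself only up to a
  null set, its exactness on \<open>\<Sigma> 0\<close> is expressed with the normalized restriction
  \<open>uniform_measure \<mu> (\<Sigma> 0)\<close>, that is \<open>A \<mapsto> \<mu> (\<Sigma> 0 \<inter> A) / \<mu> (\<Sigma> 0)\<close>, as a measure
  on \<open>space \<mu>\<close>.\<close>

definition mixing_components ::
    "(real \<Rightarrow> real) \<Rightarrow> real measure \<Rightarrow> nat \<Rightarrow> (nat \<Rightarrow> real set) \<Rightarrow> bool" where
  "mixing_components f \<mu> k \<Sigma> \<longleftrightarrow> k \<ge> 1 \<and>
     (\<forall>j<k. \<Sigma> j \<in> sets \<mu>) \<and> disjoint_family_on \<Sigma> {..<k} \<and>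
     (AE x in \<mu>. x \<in> measure_support \<mu> \<longleftrightarrow> x \<in> (\<Union>j<k. \<Sigma> j)) \<and>
     (\<forall>j<k. AE x in \<mu>. x \<in> \<Sigma> j \<longleftrightarrow> f x \<in> \<Sigma> (Suc j mod k)) \<and>
     exact (f ^^ k) (uniform_measure \<mu> (\<Sigma> 0))"

definition mixing_exponent :: "nat \<Rightarrow> int" where
  "mixing_exponent d = \<lfloor>- log 2 (- log 2 (cos (pi / real d)))\<rfloor>"

end

theory Submission
  imports Defs
begin

text \<open>Cut the boundary into its \<open>2 d\<close> half sides and parametrize each of them by the distance \<open>z\<close>
  to the vertex of the polygon on it, rescaled to \<open>{0..1}\<close>. Opposite to a side lie a vertex and the two sides meeting there,
  so the slap map becomes a skew product: the core of the tent map with slope \<open>\<beta> = 1 / cos (\<pi> / d)\<close>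
  acts on \<open>z\<close>, and its left and right branch permute the half sides by maps \<open>a\<close> and \<open>b\<close>.

  As long as the slope \<open>\<sigma>\<close> satisfies \<open>\<sigma>\<^sup>2 \<le> 2\<close>, the second iterate maps an interval at the left end
  of the core to itself as a skew product of the same type, with slope \<open>\<sigma>\<^sup>2\<close> and fibre
  maps \<open>b \<circ> b\<close> and \<open>b \<circ> a\<close>. After \<open>m\<close> such steps, where \<open>m\<close> is the mixing exponent, \<open>\<sigma>\<^sup>2 > 2\<close>
  and every interval eventually covers the whole core, on all half sides of one orbit of the fibre
  maps. For \<open>m \<ge> 2\<close> the left fibre map is the identity and the right one an involution without fixed
  points, so there are \<open>d\<close> orbits; for \<open>d = 3\<close> and \<open>d = 5\<close> there is only one.

  A covered interval stays almost completely covered if intervals are replaced by sets of positive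
  measure, because the branches are affine with constant slope and short pieces are negligible.
  Hence every orbit carries exactly one ergodic acip, whose mixing components are the \<open>2 ^ m\<close> images of
  the renormalized core; existence comes from the explicit invariant density of the tent map.\<close>

section \<open>Mixing components of invariant measures\<close>

text \<open>The slope is 1 / cos(pi / d) because projection along the normal of one side onto an
  opposite side, inclined at the angle pi / d, stretches lengths by this factor. The image of a half
  side may run past the middle of the target side, and measuring distances to the nearest vertex
  folds it there; this fold is the turning point of the tent map. After m renormalisations the slope
  is \<open>\<beta> ^ 2 ^ m\<close>, and the last of them was possible exactly if this is at most 2.
  The mixing exponent is the largest such m. Two obstacles shape the argument. Exactness needs all
  half sides of an orbit covered at one common time, so words in the fibre maps must be compared at
  equal length. And the set relations hold only up to null sets, while ergodicity and exactness
  speak of exactly invariant sets; hence the auxiliary limsup sets and saturations, and a set of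
  full measure on which the dynamics holds pointwise. The sign of the explicit density is left open:
  its absolute value is at first only subinvariant, and finite total mass turns this into
  invariance.\<close>

lemma invariant_measureD:
  assumes "invariant_measure f \<mu>" "A \<in> sets \<mu>"
  shows "measure \<mu> (f -` A \<inter> space \<mu>) = measure \<mu> A"
proof -
  have "f \<in> measurable \<mu> \<mu>" "distr \<mu> \<mu> f = \<mu>" using assms(1) by (auto simp: invariant_measure_def)
  then show ?thesis using assms(2) measure_distr[of f \<mu> \<mu> A] by simp
qed

lemma invariant_measure_funpow:
  assumes "invariant_measure f \<mu>"
  shows "invariant_measure (f ^^ n) \<mu>"
proof (induction n)
  case 0
  then show ?case by (simp add: invariant_measure_def id_def distr_id2)
next
  case (Suc n)
  have *: "f \<in> measurable \<mu> \<mu>" "distr \<mu> \<mu> f = \<mu>" "f ^^ n \<in> measurable \<mu> \<mu>" "distr \<mu> \<mu> (f ^^ n) = \<mu>"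
    using assms Suc by (auto simp: invariant_measure_def)
  have "distr \<mu> \<mu> (f \<circ> f ^^ n) = distr (distr \<mu> \<mu> (f ^^ n)) \<mu> f"
    using * by (subst distr_distr) auto
  moreover have "f \<circ> f ^^ n \<in> measurable \<mu> \<mu>" using * by (intro measurable_comp)
  ultimately show ?case unfolding invariant_measure_def funpow.simps using * by metis
qed

lemma invariant_measureI:
  assumes "finite_measure \<mu>" "f \<in> measurable \<mu> \<mu>"
    and "\<And>A. A \<in> sets \<mu> \<Longrightarrow> measure \<mu> (f -` A \<inter> space \<mu>) = measure \<mu> A"
  shows "invariant_measure f \<mu>"
proof -
  interpret finite_measure \<mu> by fact
  have "distr \<mu> \<mu> f = \<mu>"
    by (rule measure_eqI) (use assms in \<open>auto simp: emeasure_distr emeasure_eq_measure\<close>)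
  then show ?thesis using assms by (simp add: invariant_measure_def)
qed

text \<open>The complement of the support is covered by null basic open sets, and a countable basis
  has only countably many of them.\<close>

lemma AE_measure_support:
  fixes \<mu> :: "real measure"
  assumes "prob_space \<mu>" "sets \<mu> = sets (restrict_space borel I)"
  shows "AE x in \<mu>. x \<in> measure_support \<mu>"
proof -
  interpret prob_space \<mu> by fact
  have open_sets: "U \<inter> space \<mu> \<in> sets \<mu>" if "open U" for U
  proof -
    have "I \<inter> U \<in> sets (restrict_space borel I)"
      using that by (auto simp: sets_restrict_space)
    then show ?thesis using assms(2) sets_eq_imp_space_eq[OF assms(2)]
      by (simp add: space_restrict_space Int_commute)
  qed
  obtain B :: "real set set" where B: "countable B" "topological_basis B"
    using ex_countable_basis by blast
  let ?B = "{U \<in> B. measure \<mu> (U \<inter> space \<mu>) = 0}"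
  have opB: "open U" if "U \<in> B" for U using B(2) that by (rule topological_basis_open)
  have "AE x in \<mu>. \<forall>U\<in>?B. x \<notin> U \<inter> space \<mu>"
  proof (subst AE_ball_countable)
    show "countable ?B" using B(1) by simp
    show "\<forall>U\<in>?B. AE x in \<mu>. x \<notin> U \<inter> space \<mu>"
    proof
      fix U assume "U \<in> ?B"
      then have "U \<inter> space \<mu> \<in> null_sets \<mu>"
        using open_sets[OF opB] by (auto simp: null_sets_def emeasure_eq_measure)
      then show "AE x in \<mu>. x \<notin> U \<inter> space \<mu>" by (rule AE_not_in)
    qed
  qed
  then show ?thesis
  proof (rule AE_mp, intro AE_I2 impI)
    fix x assume x: "x \<in> space \<mu>" and *: "\<forall>U\<in>?B. x \<notin> U \<inter> space \<mu>"
    show "x \<in> measure_support \<mu>" unfolding measure_support_def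
    proof (safe intro!: x)
      fix U assume "open U" "x \<in> U"
      then obtain V where V: "V \<in> B" "x \<in> V" "V \<subseteq> U" using B(2) by (meson topological_basisE)
      have "0 < measure \<mu> (V \<inter> space \<mu>)" using * V x by (simp add: zero_less_measure_iff) (metis IntI measure_le_0_iff zero_less_measure_iff)
      also have "\<dots> \<le> measure \<mu> (U \<inter> space \<mu>)"
        using V open_sets[OF \<open>open U\<close>] by (intro finite_measure_mono) auto
      finally show "0 < measure \<mu> (U \<inter> space \<mu>)" .
    qed
  qed
qed

text \<open>If both \<open>k\<close> and \<open>k'\<close> are mixing periods, then \<open>\<Sigma> j\<close> is invariant under \<open>f ^^ (k * k')\<close> up to
  a null set; the \<open>limsup\<close> set below is an exactly invariant version of it, so exactness forces
  \<open>\<Sigma>' 0\<close> into a single \<open>\<Sigma> j\<close>.\<close>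

lemma mixing_components_measure:
  assumes "prob_space \<mu>" "invariant_measure f \<mu>" "AE x in \<mu>. x \<in> measure_support \<mu>"
    and mc: "mixing_components f \<mu> k \<Sigma>" and "j < k"
  shows "measure \<mu> (\<Sigma> j) = 1 / real k"
proof -
  interpret prob_space \<mu> by fact
  have S: "\<Sigma> i \<in> sets \<mu>" if "i < k" for i using mc that by (simp add: mixing_components_def)
  have k: "k \<ge> 1" using mc by (simp add: mixing_components_def)
  have fm: "f \<in> measurable \<mu> \<mu>" using assms(2) by (simp add: invariant_measure_def)
  have step: "measure \<mu> (\<Sigma> i) = measure \<mu> (\<Sigma> (Suc i mod k))" if "i < k" for i
  proof -
    have "AE x in \<mu>. x \<in> \<Sigma> i \<longleftrightarrow> f x \<in> \<Sigma> (Suc i mod k)"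
      using mc that by (simp add: mixing_components_def)
    then have "measure \<mu> (\<Sigma> i) = measure \<mu> (f -` \<Sigma> (Suc i mod k) \<inter> space \<mu>)"
      using S[of i] S[of "Suc i mod k"] k fm that
      by (intro finite_measure_eq_AE) (auto intro!: measurable_sets)
    then show ?thesis using invariant_measureD[OF assms(2) S[of "Suc i mod k"]] k by simp
  qed
  have eq: "measure \<mu> (\<Sigma> i) = measure \<mu> (\<Sigma> 0)" if "i < k" for i
    using that
  proof (induction i)
    case (Suc i)
    then show ?case using step[of i] by simp
  qed simp
  have "AE x in \<mu>. x \<in> (\<Union>i<k. \<Sigma> i)"
    using mc assms(3) by (auto simp: mixing_components_def)
  then have "prob (\<Union>i<k. \<Sigma> i) = 1" using S by (subst prob_eq_1) auto
  moreover have "prob (\<Union>i<k. \<Sigma> i) = (\<Sum>i<k. prob (\<Sigma> i))"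
    using mc S by (intro finite_measure_finite_Union) (auto simp: mixing_components_def)
  moreover have "(\<Sum>i<k. prob (\<Sigma> i)) = (\<Sum>i<k. prob (\<Sigma> 0))" by (rule sum.cong[OF refl], rule eq) simp
  ultimately have "real k * prob (\<Sigma> 0) = 1" by simp
  then show ?thesis using eq[OF \<open>j < k\<close>] k by (simp add: field_simps)
qed

text \<open>Once \<open>\<Sigma>' 0\<close> lies in a single \<open>\<Sigma> j\<close> up to a null
  set, comparing the masses \<open>1 / k'\<close> and \<open>1 / k\<close> gives
  \<open>k \<le> k'\<close>. The two decompositions can be exchanged, so the number of components is
  determined.\<close>

lemma mixing_period_le:
  assumes P: "prob_space \<mu>" and inv: "invariant_measure f \<mu>" and supp: "AE x in \<mu>. x \<in> measure_support \<mu>"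
    and mc: "mixing_components f \<mu> k \<Sigma>" and mc': "mixing_components f \<mu> k' \<Sigma>'"
  shows "k \<le> k'"
proof -
  interpret prob_space \<mu> by fact
  have S: "\<Sigma> i \<in> sets \<mu>" if "i < k" for i using mc that by (simp add: mixing_components_def)
  have S': "\<Sigma>' 0 \<in> sets \<mu>" using mc' by (simp add: mixing_components_def)
  have k: "k \<ge> 1" "k' \<ge> 1" using mc mc' by (auto simp: mixing_components_def)
  have fm: "f ^^ n \<in> measurable \<mu> \<mu>" for n
    using invariant_measure_funpow[OF inv] by (simp add: invariant_measure_def)
  have pos': "measure \<mu> (\<Sigma>' 0) = 1 / real k'"
    using mixing_components_measure[OF P inv supp mc', of 0] k by simp
  have "AE x in \<mu>. x \<in> (\<Union>i<k. \<Sigma> i)"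
    using mc supp by (auto simp: mixing_components_def)
  then have un: "AE x in \<mu>. x \<in> \<Sigma>' 0 \<longrightarrow> x \<in> (\<Union>i<k. \<Sigma> i)" by auto
  obtain j where j: "j < k" "measure \<mu> (\<Sigma>' 0 \<inter> \<Sigma> j) > 0"
  proof (rule ccontr)
    assume *: "\<not> thesis"
    have "measure \<mu> (\<Sigma>' 0) \<le> measure \<mu> (\<Union>i<k. \<Sigma>' 0 \<inter> \<Sigma> i)"
      using un S S' by (intro finite_measure_mono_AE) auto
    also have "\<dots> \<le> (\<Sum>i<k. measure \<mu> (\<Sigma>' 0 \<inter> \<Sigma> i))"
      using S S' by (intro finite_measure_subadditive_finite) auto
    also have "\<dots> = 0" using * that
      by (intro sum.neutral) (metis lessThan_iff measure_nonneg order_le_less)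
    finally show False using pos' k by simp
  qed
  define g where "g = f ^^ (k * k')"
  define A where "A = {x \<in> space \<mu>. \<exists>\<^sub>\<infinity>n. (g ^^ n) x \<in> \<Sigma> j}"
  have gm: "g ^^ n \<in> measurable \<mu> \<mu>" for n
    unfolding g_def funpow_mult by (rule fm)
  have space: "(f ^^ n) x \<in> space \<mu>" if "x \<in> space \<mu>" for n x
    using fm[of n] that by (auto simp: measurable_def)
  have Am: "A \<in> sets \<mu>"
  proof -
    have "A = (\<Inter>m. \<Union>n\<in>{m..}. (g ^^ n) -` \<Sigma> j \<inter> space \<mu>) \<inter> space \<mu>"
      by (auto simp: A_def INFM_nat_le Bex_def)
    also have "\<dots> \<in> sets \<mu>" using gm S[OF j(1)]
      by (intro sets.Int sets.countable_INT sets.countable_UN) (auto intro!: measurable_sets)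
    finally show ?thesis .
  qed
  have shift: "(\<exists>\<^sub>\<infinity>n. (g ^^ n) ((g ^^ m) x) \<in> \<Sigma> j) \<longleftrightarrow> (\<exists>\<^sub>\<infinity>n. (g ^^ n) x \<in> \<Sigma> j)" for m x
  proof -
    have "(g ^^ n) ((g ^^ m) x) = (g ^^ (n + m)) x" for n by (simp add: funpow_add)
    moreover have "(\<exists>\<^sub>\<infinity>n. (g ^^ (n + m)) x \<in> \<Sigma> j) \<longleftrightarrow> (\<exists>\<^sub>\<infinity>n. (g ^^ n) x \<in> \<Sigma> j)"
    proof
      show "\<exists>\<^sub>\<infinity>n. (g ^^ n) x \<in> \<Sigma> j" if "\<exists>\<^sub>\<infinity>n. (g ^^ (n + m)) x \<in> \<Sigma> j"
        using that unfolding INFM_nat_le by (meson le_add1 le_trans)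
      show "\<exists>\<^sub>\<infinity>n. (g ^^ (n + m)) x \<in> \<Sigma> j" if *: "\<exists>\<^sub>\<infinity>n. (g ^^ n) x \<in> \<Sigma> j"
        unfolding INFM_nat_le
      proof
        fix q
        obtain n where "n \<ge> q + m" "(g ^^ n) x \<in> \<Sigma> j" using * unfolding INFM_nat_le by blast
        then show "\<exists>n\<ge>q. (g ^^ (n + m)) x \<in> \<Sigma> j" by (intro exI[of _ "n - m"]) auto
      qed
    qed
    ultimately show ?thesis by simp
  qed
  have Ainv: "(g ^^ m) -` A \<inter> space \<mu> = A" for m
    using shift[of m] gm[of m] by (auto simp: A_def measurable_def)
  have ex: "exact (f ^^ k') (uniform_measure \<mu> (\<Sigma>' 0))" using mc' by (simp add: mixing_components_def)
  have "\<exists>B\<in>sets \<mu>. A = ((f ^^ k') ^^ n) -` B \<inter> space \<mu>" for n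
  proof -
    \<comment> \<open>Padding the exponent: \<open>(f ^^ k') ^^ (k * n - n)\<close> after
      \<open>(f ^^ k') ^^ n\<close> is \<open>g ^^ n\<close>, under which \<open>A\<close> is
      invariant. The subtraction is genuine because \<open>k \<ge> 1\<close>.\<close>
    define B where "B = ((f ^^ k') ^^ (k * n - n)) -` A \<inter> space \<mu>"
    have "B \<in> sets \<mu>" unfolding B_def funpow_mult using Am fm by (intro measurable_sets) auto
    moreover have "((f ^^ k') ^^ n) -` B \<inter> space \<mu> = A"
    proof -
      have "((f ^^ k') ^^ n) -` B \<inter> space \<mu> = {x \<in> space \<mu>. ((f ^^ k') ^^ (k * n - n)) (((f ^^ k') ^^ n) x) \<in> A}"
        using space by (auto simp: B_def funpow_mult)
      also have "\<dots> = {x \<in> space \<mu>. ((f ^^ k') ^^ (k * n - n + n)) x \<in> A}"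
        by (simp add: funpow_add)
      also have "(f ^^ k') ^^ (k * n - n + n) = g ^^ n"
        using k by (simp add: g_def funpow_mult mult_ac)
      finally show ?thesis using Ainv[of n] by auto
    qed
    ultimately show ?thesis by blast
  qed
  then have "measure (uniform_measure \<mu> (\<Sigma>' 0)) A = 0 \<or> measure (uniform_measure \<mu> (\<Sigma>' 0)) A = 1"
    using ex by (simp add: exact_def)
  moreover have "measure (uniform_measure \<mu> (\<Sigma>' 0)) A = measure \<mu> (\<Sigma>' 0 \<inter> A) / measure \<mu> (\<Sigma>' 0)"
    using pos' k S' Am by (subst measure_uniform_measure) (auto simp: emeasure_eq_measure)
  moreover have "measure \<mu> (\<Sigma>' 0) \<noteq> 0" using pos' k by simp
  ultimately have dich: "measure \<mu> (\<Sigma>' 0 \<inter> A) = 0 \<or> measure \<mu> (\<Sigma>' 0 \<inter> A) = measure \<mu> (\<Sigma>' 0)"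
    by auto
  have nsing: "AE x in \<mu>. Q ((f ^^ n) x)" if "AE x in \<mu>. Q x" for Q n
  proof -
    have d: "distr \<mu> \<mu> (f ^^ n) = \<mu>"
      using invariant_measure_funpow[OF inv, of n] by (simp add: invariant_measure_def)
    have "AE x in distr \<mu> \<mu> (f ^^ n). Q x" unfolding d by (fact that)
    from AE_distrD[OF fm[of n] this] show ?thesis .
  qed
  have "AE x in \<mu>. \<forall>n. \<forall>i<k. (f ^^ n) x \<in> \<Sigma> i \<longleftrightarrow> f ((f ^^ n) x) \<in> \<Sigma> (Suc i mod k)"
  proof (subst AE_all_countable, rule allI, subst AE_all_countable, rule allI)
    fix n i
    show "AE x in \<mu>. i < k \<longrightarrow> ((f ^^ n) x \<in> \<Sigma> i \<longleftrightarrow> f ((f ^^ n) x) \<in> \<Sigma> (Suc i mod k))"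
      using mc by (cases "i < k") (auto simp: mixing_components_def intro!: nsing)
  qed
  \<comment> \<open>Almost every orbit visits the components in cyclic order, so at the multiples of
    \<open>k * k'\<close> it is always or never in \<open>\<Sigma> j\<close>.\<close>
  then have "AE x in \<mu>. x \<in> A \<longleftrightarrow> x \<in> \<Sigma> j"
  proof (rule AE_mp, intro AE_I2 impI)
    fix x assume x: "x \<in> space \<mu>"
      and *: "\<forall>n. \<forall>i<k. (f ^^ n) x \<in> \<Sigma> i \<longleftrightarrow> f ((f ^^ n) x) \<in> \<Sigma> (Suc i mod k)"
    have "x \<in> \<Sigma> i \<longleftrightarrow> (f ^^ n) x \<in> \<Sigma> ((i + n) mod k)" if "i < k" for n i
    proof (induction n)
      case (Suc n)
      then show ?case using *[rule_format, of "(i + n) mod k" n] k by (simp add: mod_Suc_eq)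
    qed (use that in simp)
    from this[OF j(1)] have "x \<in> \<Sigma> j \<longleftrightarrow> (f ^^ (k * k' * n)) x \<in> \<Sigma> ((j + k * k' * n) mod k)" for n .
    then have "(g ^^ n) x \<in> \<Sigma> j \<longleftrightarrow> x \<in> \<Sigma> j" for n
      using j(1) by (simp add: g_def funpow_mult mult.assoc)
    then show "x \<in> A \<longleftrightarrow> x \<in> \<Sigma> j" using x by (simp add: A_def)
  qed
  then have "AE x in \<mu>. x \<in> \<Sigma>' 0 \<inter> A \<longleftrightarrow> x \<in> \<Sigma>' 0 \<inter> \<Sigma> j" by auto
  then have "measure \<mu> (\<Sigma>' 0 \<inter> A) = measure \<mu> (\<Sigma>' 0 \<inter> \<Sigma> j)"
    using S' Am S[OF j(1)] by (intro finite_measure_eq_AE) auto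
  then have "measure \<mu> (\<Sigma>' 0) = measure \<mu> (\<Sigma>' 0 \<inter> \<Sigma> j)" using dich j by simp
  also have "\<dots> \<le> measure \<mu> (\<Sigma> j)" using S' S[OF j(1)] by (intro finite_measure_mono) auto
  also have "\<dots> = 1 / real k" using mixing_components_measure[OF P inv supp mc j(1)] .
  finally show ?thesis using pos' k by (simp add: field_simps)
qed

section \<open>Cyclic systems and their ergodic components\<close>

locale nonsingular_map = finite_measure M for M :: "'a measure" +
  fixes f :: "'a \<Rightarrow> 'a"
  assumes meas: "f \<in> measurable M M"
    and nonsing: "\<And>N. N \<in> null_sets M \<Longrightarrow> f -` N \<inter> space M \<in> null_sets M"
begin

definition acip_on :: "'a measure \<Rightarrow> bool" where
  "acip_on \<mu> \<longleftrightarrow> prob_space \<mu> \<and> sets \<mu> = sets M \<and> absolutely_continuous M \<mu> \<and> invariant_measure f \<mu>"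

lemma meas_funpow: "f ^^ n \<in> measurable M M"
proof (induction n)
  case (Suc n)
  then show ?case using measurable_comp[OF Suc meas] by (simp only: funpow.simps)
qed (simp add: id_def)

lemma space_funpow: "x \<in> space M \<Longrightarrow> (f ^^ n) x \<in> space M"
  using meas_funpow[of n] by (auto simp: measurable_def)

lemma AE_shift:
  assumes "AE x in M. Q x"
  shows "AE x in M. Q (f x)"
proof -
  obtain N where N: "N \<in> null_sets M" "{x \<in> space M. \<not> Q x} \<subseteq> N"
    using assms by (auto simp: eventually_ae_filter)
  have "{x \<in> space M. \<not> Q (f x)} \<subseteq> f -` N \<inter> space M"
    using N(2) space_funpow[of _ 1] by auto
  then show ?thesis using nonsing[OF N(1)] unfolding eventually_ae_filter by blast
qed

lemma AE_shift_funpow: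
  assumes "AE x in M. Q x"
  shows "AE x in M. Q ((f ^^ n) x)"
  using assms
proof (induction n arbitrary: Q)
  case (Suc n)
  show ?case using Suc.IH[OF AE_shift[OF Suc.prems]] by (simp add: funpow_swap1)
qed simp

lemma acip_AE:
  assumes "acip_on \<mu>" "AE x in M. Q x"
  shows "AE x in \<mu>. Q x"
  using assms by (auto simp: acip_on_def intro: absolutely_continuous_AE)

lemma acip_space: "acip_on \<mu> \<Longrightarrow> space \<mu> = space M"
  by (auto simp: acip_on_def dest: sets_eq_imp_space_eq)

text \<open>The Radon-Nikodym density is taken real-valued, so that the densities of two measures
  can be subtracted.\<close>

lemma acip_density:
  assumes "acip_on \<mu>"
  obtains D :: "'a \<Rightarrow> real" where "D \<in> borel_measurable M" "\<And>x. 0 \<le> D x" "integrable M D"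
    "\<And>E. E \<in> sets M \<Longrightarrow> measure \<mu> E = (\<integral>x. indicator E x * D x \<partial>M)"
proof -
  interpret mu: prob_space \<mu> using assms by (simp add: acip_on_def)
  have sets: "sets \<mu> = sets M" and ac: "absolutely_continuous M \<mu>" using assms by (auto simp: acip_on_def)
  obtain D where D: "D \<in> borel_measurable M" "AE x in M. RN_deriv M \<mu> x = ennreal (D x)" "\<And>x. 0 \<le> D x"
    using real_RN_deriv[OF mu.finite_measure_axioms ac sets] by metis
  have "\<mu> = density M (RN_deriv M \<mu>)" using density_RN_deriv[OF ac sets] by simp
  also have "\<dots> = density M (\<lambda>x. ennreal (D x))" using D by (intro density_cong) auto
  finally have mu: "\<mu> = density M (\<lambda>x. ennreal (D x))" .
  have em: "emeasure \<mu> E = (\<integral>\<^sup>+x. ennreal (indicator E x * D x) \<partial>M)" if "E \<in> sets M" for E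
    unfolding mu using D(1) that
    by (subst emeasure_density) (auto intro!: nn_integral_cong split: split_indicator)
  have ms: "measure \<mu> E = (\<integral>x. indicator E x * D x \<partial>M)" if "E \<in> sets M" for E
    using em[OF that] D that by (subst integral_eq_nn_integral) (auto simp: measure_def)
  have "(\<integral>\<^sup>+x. ennreal (D x) \<partial>M) = emeasure \<mu> (space M)"
    using em[of "space M"] by (auto intro!: nn_integral_cong)
  also have "\<dots> < \<infinity>" by (simp add: mu.emeasure_eq_measure)
  finally have "integrable M D" using D by (intro integrableI_nonneg) auto
  then show thesis using that D ms by blast
qed

end

text \<open>The sets \<open>Z l\<close> are the seeds of the ergodic components: \<open>G\<close> is a set of full measure on which
  a point of \<open>Z l\<close> returns to the union of all \<open>Z l'\<close> exactly at the multiples of \<open>k\<close>, and then to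
  \<open>Z l\<close> itself. The assumption \<open>cover\<close> says that every set of positive measure is spread
  almost completely over some \<open>Z l\<close> by an iterate of \<open>f\<close>.\<close>

locale cyclic_system = nonsingular_map +
  fixes r k :: nat and Z :: "nat \<Rightarrow> 'a set" and G :: "'a set"
  assumes k: "k \<ge> 1"
    and Z_sets: "\<And>l. l < r \<Longrightarrow> Z l \<in> sets M"
    and Z_pos: "\<And>l. l < r \<Longrightarrow> measure M (Z l) > 0"
    and Z_disj: "\<And>l l'. l < r \<Longrightarrow> l' < r \<Longrightarrow> l \<noteq> l' \<Longrightarrow> Z l \<inter> Z l' = {}"
    and G_sets: "G \<in> sets M"
    and G_null: "space M - G \<in> null_sets M"
    and G_step: "\<And>x. x \<in> G \<Longrightarrow> f x \<in> G"
    and G_return: "\<And>x l. x \<in> G \<Longrightarrow> l < r \<Longrightarrow> x \<in> Z l \<Longrightarrow> (f ^^ k) x \<in> Z l"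
    and G_escape: "\<And>x l l' j. x \<in> G \<Longrightarrow> l < r \<Longrightarrow> l' < r \<Longrightarrow> x \<in> Z l \<Longrightarrow> 0 < j \<Longrightarrow> j < k \<Longrightarrow> (f ^^ j) x \<notin> Z l'"
    and cover: "\<And>A e. A \<in> sets M \<Longrightarrow> measure M A > 0 \<Longrightarrow> e > 0 \<Longrightarrow>
       \<exists>n. \<exists>l<r. \<forall>B\<in>sets M. (AE x in M. x \<in> A \<longrightarrow> (f ^^ n) x \<in> B) \<longrightarrow> measure M (Z l - B) < e"
begin

text \<open>The class of the arrival time in \<open>Z l\<close> modulo \<open>k\<close>. Writing it
  as \<open>k dvd n + j\<close> avoids subtraction: one step of \<open>f\<close> lowers the arrival
  time \<open>n\<close> by one and raises \<open>j\<close> by one. These sets will be the mixing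
  components.\<close>

definition phase :: "nat \<Rightarrow> nat \<Rightarrow> 'a set" where
  "phase l j = {x \<in> G. \<exists>n. (f ^^ n) x \<in> Z l \<and> k dvd n + j}"

definition basin :: "nat \<Rightarrow> 'a set" where
  "basin l = {x \<in> G. \<exists>n. (f ^^ n) x \<in> Z l}"

lemma G_space: "x \<in> G \<Longrightarrow> x \<in> space M"
  using G_sets sets.sets_into_space by blast

lemma AE_G: "AE x in M. x \<in> G"
  using AE_not_in[OF G_null] by (rule AE_mp) auto

lemma G_funpow: "x \<in> G \<Longrightarrow> (f ^^ n) x \<in> G"
  by (induction n) (auto intro: G_step)

lemma return_mult: "x \<in> G \<Longrightarrow> l < r \<Longrightarrow> x \<in> Z l \<Longrightarrow> (f ^^ (k * p)) x \<in> Z l"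
proof (induction p)
  case (Suc p)
  then have "(f ^^ k) ((f ^^ (k * p)) x) \<in> Z l" by (intro G_return G_funpow) auto
  then show ?case by (simp add: funpow_add)
qed simp

text \<open>From the visit at time \<open>n\<close> the point is moved on by multiples of
  \<open>k\<close>, which keeps it in \<open>Z l\<close>, until fewer than \<open>k\<close> steps
  remain before time \<open>m\<close>; \<open>G_escape\<close> then forbids any remainder other than
  zero.\<close>

lemma same_phase:
  assumes "x \<in> G" "l < r" "l' < r" "(f ^^ n) x \<in> Z l" "(f ^^ m) x \<in> Z l'" "n \<le> m"
  shows "l = l'" "k dvd m - n"
proof -
  define y where "y = (f ^^ n) x"
  define w where "w = (f ^^ (k * ((m - n) div k))) y"
  define j where "j = (m - n) mod k"
  have y: "y \<in> G" "y \<in> Z l" using assms by (auto simp: y_def G_funpow)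
  have w: "w \<in> G" "w \<in> Z l" using y assms by (auto simp: w_def G_funpow return_mult)
  have "(f ^^ j) w = (f ^^ (j + (k * ((m - n) div k) + n))) x"
    by (simp add: w_def y_def funpow_add)
  also have "j + (k * ((m - n) div k) + n) = m" using \<open>n \<le> m\<close> mult_div_mod_eq[of k "m - n"] by (simp add: j_def)
  finally have jw: "(f ^^ j) w \<in> Z l'" using assms by simp
  have "j < k" using k by (simp add: j_def)
  then have j0: "j = 0" using G_escape[OF w(1) assms(2,3) w(2), of j] jw by auto
  then show "k dvd m - n" by (simp add: j_def dvd_eq_mod_eq_0)
  show "l = l'" using j0 jw w(2) Z_disj[of l l'] assms by auto
qed

lemma phase_unique:
  assumes "x \<in> phase l j" "x \<in> phase l' j'" "l < r" "l' < r" "j < k" "j' < k"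
  shows "l = l' \<and> j = j'"
proof -
  have main: "l = l' \<and> j = j'"
    if "x \<in> G" "l < r" "l' < r" "(f ^^ n) x \<in> Z l" "(f ^^ m) x \<in> Z l'" "n \<le> m" "k dvd n + j" "k dvd m + j'"
      "j < k" "j' < k" for n m l l' j j'
  proof -
    have "k dvd m - n" "l = l'" using same_phase that by blast+
    then have "k dvd (m + j') - (m - n)" using dvd_diff_nat[OF that(8)] by blast
    moreover have "(m + j') - (m - n) = n + j'" using that(6) by simp
    ultimately have "k dvd n + j'" by simp
    have "j = j'"
    proof (rule ccontr)
      assume "j \<noteq> j'"
      then consider "j < j'" | "j' < j" by linarith
      then show False
      proof cases
        case 1
        have "k dvd (n + j') - (n + j)" by (rule dvd_diff_nat[OF \<open>k dvd n + j'\<close> that(7)])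
        then show False using 1 that(10) nat_dvd_not_less[of "j' - j" k] by simp
      next
        case 2
        have "k dvd (n + j) - (n + j')" by (rule dvd_diff_nat[OF that(7) \<open>k dvd n + j'\<close>])
        then show False using 2 that(9) nat_dvd_not_less[of "j - j'" k] by simp
      qed
    qed
    then show ?thesis using that \<open>l = l'\<close> by simp
  qed
  obtain n m where "x \<in> G" "(f ^^ n) x \<in> Z l" "k dvd n + j" "(f ^^ m) x \<in> Z l'" "k dvd m + j'"
    using assms by (auto simp: phase_def)
  then show ?thesis using main[of l l' n m j j'] main[of l' l m n j' j] assms by (cases "n \<le> m") auto
qed

lemma phase_step:
  assumes "x \<in> G" "l < r"
  shows "x \<in> phase l j \<longleftrightarrow> f x \<in> phase l (Suc j mod k)"
proof
  have dv: "k dvd n + Suc j mod k \<longleftrightarrow> k dvd Suc n + j" for n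
    by (simp add: dvd_eq_mod_eq_0 mod_add_right_eq)
  {
    assume "x \<in> phase l j"
    then obtain n where n: "(f ^^ n) x \<in> Z l" "k dvd n + j" by (auto simp: phase_def)
    \<comment> \<open>The arrival time \<open>n\<close> may be zero, leaving no step to split off; a
      full period is added beforehand.\<close>
    have "(f ^^ (k + n)) x \<in> Z l" using n assms G_return[OF G_funpow] by (simp add: funpow_add)
    moreover have e: "k + n = Suc (k - 1 + n)" using k by simp
    ultimately have "(f ^^ (k - 1 + n)) (f x) \<in> Z l" unfolding e funpow_Suc_right comp_apply by blast
    moreover have "k dvd Suc (k - 1 + n) + j" using n k by (simp add: add.assoc)
    ultimately show "f x \<in> phase l (Suc j mod k)"
      using G_step[OF assms(1)] by (auto simp: phase_def dv)
  next
    assume "f x \<in> phase l (Suc j mod k)"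
    then obtain n where n: "(f ^^ n) (f x) \<in> Z l" "k dvd Suc n + j" by (auto simp: phase_def dv)
    then have "(f ^^ Suc n) x \<in> Z l" by (simp add: funpow_Suc_right del: funpow.simps)
    then show "x \<in> phase l j" using n assms unfolding phase_def by blast
  }
qed

lemma phase_sets: "l < r \<Longrightarrow> phase l j \<in> sets M"
proof -
  assume l: "l < r"
  have "phase l j = G \<inter> (\<Union>n\<in>{n. k dvd n + j}. (f ^^ n) -` Z l \<inter> space M)"
    using G_space by (auto simp: phase_def)
  also have "\<dots> \<in> sets M" 
    by (intro sets.Int G_sets sets.countable_UN'' measurable_sets[OF meas_funpow] Z_sets[OF l]) auto
  finally show ?thesis .
qed

lemma basin_eq: "basin l = (\<Union>j<k. phase l j)"
proof -
  have "\<exists>j<k. k dvd n + j" for n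
  proof -
    define j where "j = (k - n mod k) mod k"
    have "n mod k \<le> k" using k by (simp add: less_imp_le)
    then have "(n + j) mod k = 0" unfolding j_def
      by (metis add.commute le_add_diff_inverse mod_add_left_eq mod_add_right_eq mod_self)
    then have "k dvd n + j" by (rule mod_0_imp_dvd)
    moreover have "j < k" using k by (simp add: j_def)
    ultimately show ?thesis by blast
  qed
  then show ?thesis by (fastforce simp: basin_def phase_def)
qed

lemma basin_sets: "l < r \<Longrightarrow> basin l \<in> sets M"
  unfolding basin_eq using phase_sets by auto

lemma basin_unique:
  assumes "x \<in> basin l" "x \<in> basin l'" "l < r" "l' < r"
  shows "l = l'"
  using assms phase_unique unfolding basin_eq by blast

lemma basin_step:
  assumes "x \<in> G" "l < r"
  shows "f x \<in> basin l \<longleftrightarrow> x \<in> basin l"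
proof
  assume "x \<in> basin l"
  then obtain j where "j < k" "x \<in> phase l j" by (auto simp: basin_eq)
  then have "f x \<in> phase l (Suc j mod k)" using phase_step assms by blast
  then show "f x \<in> basin l" using k by (auto simp: basin_eq)
next
  assume "f x \<in> basin l"
  then obtain n where "(f ^^ n) (f x) \<in> Z l" by (auto simp: basin_def)
  then have "(f ^^ Suc n) x \<in> Z l" by (simp add: funpow_Suc_right del: funpow.simps)
  then show "x \<in> basin l" using assms unfolding basin_def by blast
qed

lemma Z_phase: "x \<in> G \<Longrightarrow> x \<in> Z l \<Longrightarrow> x \<in> phase l 0"
  unfolding phase_def by (auto intro!: exI[of _ 0])

lemma Z_basin: "x \<in> G \<Longrightarrow> x \<in> Z l \<Longrightarrow> x \<in> basin l"
  unfolding basin_def by (auto intro!: exI[of _ 0])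

text \<open>Iterates of a forward invariant \<open>A\<close> stay in \<open>A\<close>, so
  \<open>cover\<close> applies with \<open>B = A\<close> for every bound. The index \<open>l\<close>
  depends on the bound, but there are finitely many indices, so for one of them
  \<open>Z l - A\<close> is null.\<close>

lemma invariant_contains_Z:
  assumes A: "A \<in> sets M" "measure M A > 0" and fwd: "AE x in M. x \<in> A \<longrightarrow> f x \<in> A"
  obtains l where "l < r" "AE x in M. x \<in> Z l \<longrightarrow> x \<in> A"
proof -
  have fwd': "AE x in M. x \<in> A \<longrightarrow> (f ^^ n) x \<in> A" for n
  proof (induction n)
    case (Suc n)
    have "AE x in M. (f ^^ n) x \<in> A \<longrightarrow> f ((f ^^ n) x) \<in> A"
      using AE_shift_funpow[OF fwd] by simp
    with Suc show ?case by eventually_elim auto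
  qed simp
  have cov: "\<exists>l<r. measure M (Z l - A) < e" if "e > 0" for e
    using cover[OF A that] fwd' A(1) by blast
  have "\<exists>l<r. measure M (Z l - A) = 0"
  proof (rule ccontr)
    assume *: "\<not> ?thesis"
    define e where "e = Min ((\<lambda>l. measure M (Z l - A)) ` {..<r})"
    have r: "{..<r} \<noteq> {}" using cov[of 1] by auto
    have "e > 0" unfolding e_def using r * by (subst Min_gr_iff) (auto simp: zero_less_measure_iff)
    then obtain l where "l < r" "measure M (Z l - A) < e" using cov by blast
    moreover have "e \<le> measure M (Z l - A)" unfolding e_def using \<open>l < r\<close> by (intro Min_le) auto
    ultimately show False by simp
  qed
  then obtain l where l: "l < r" "measure M (Z l - A) = 0" by blast
  then have "Z l - A \<in> null_sets M" using Z_sets A by (auto simp: null_sets_def emeasure_eq_measure)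
  then have "AE x in M. x \<notin> Z l - A" by (rule AE_not_in)
  then have "AE x in M. x \<in> Z l \<longrightarrow> x \<in> A" by eventually_elim auto
  then show thesis using l that by blast
qed

lemma not_AE_Z:
  assumes "l < r" "AE x in M. x \<notin> Z l"
  shows False
proof -
  have "Z l \<in> null_sets M" using AE_iff_null_sets[OF Z_sets[OF assms(1)]] assms(2) by blast
  then have "measure M (Z l) = 0" by (simp add: measure_def null_setsD1)
  then show False using Z_pos[OF assms(1)] by simp
qed

text \<open>The part of \<open>G\<close> outside all basins is forward invariant; with positive
  measure it would contain almost all of some \<open>Z l\<close>, which lies in its own
  basin.\<close>

lemma AE_basin: "AE x in M. \<exists>l<r. x \<in> basin l"
proof -
  define A where "A = G - (\<Union>l<r. basin l)"
  have A: "A \<in> sets M" using G_sets basin_sets by (auto simp: A_def)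
  have "measure M A = 0"
  proof (rule ccontr)
    assume "measure M A \<noteq> 0"
    then have pos: "measure M A > 0" by (simp add: zero_less_measure_iff)
    obtain l where l: "l < r" "AE x in M. x \<in> Z l \<longrightarrow> x \<in> A"
      by (rule invariant_contains_Z[OF A pos]) (auto simp: A_def G_step basin_step)
    have "AE x in M. x \<notin> Z l" using l(2) AE_G
      by eventually_elim (use l(1) Z_basin in \<open>auto simp: A_def\<close>)
    then show False using not_AE_Z l(1) by blast
  qed
  then have "A \<in> null_sets M" using A by (auto simp: null_sets_def emeasure_eq_measure)
  then have "AE x in M. x \<notin> A" by (rule AE_not_in)
  with AE_G show ?thesis by eventually_elim (auto simp: A_def)
qed

lemma phase_funpow:
  assumes "x \<in> G" "l < r" "j < k"
  shows "x \<in> phase l j \<longleftrightarrow> (f ^^ n) x \<in> phase l ((j + n) mod k)"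
proof (induction n)
  case (Suc n)
  have "(f ^^ n) x \<in> phase l ((j + n) mod k) \<longleftrightarrow> f ((f ^^ n) x) \<in> phase l (Suc ((j + n) mod k) mod k)"
    by (rule phase_step[OF G_funpow[OF assms(1)] assms(2)])
  also have "Suc ((j + n) mod k) mod k = (j + Suc n) mod k" by (simp add: mod_Suc_eq)
  finally have "(f ^^ n) x \<in> phase l ((j + n) mod k) \<longleftrightarrow> (f ^^ Suc n) x \<in> phase l ((j + Suc n) mod k)"
    by (simp only: funpow.simps comp_apply)
  with Suc show ?case by blast
qed (use assms in simp)

lemma invariant_in_basin:
  assumes A: "A \<in> sets M" "measure M A > 0" and "l < r"
    and sub: "AE x in M. x \<in> A \<longrightarrow> x \<in> basin l" and fwd: "AE x in M. x \<in> A \<longrightarrow> f x \<in> A"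
  shows "AE x in M. x \<in> Z l \<longrightarrow> x \<in> A"
proof -
  obtain q where q: "q < r" "AE x in M. x \<in> Z q \<longrightarrow> x \<in> A"
    using invariant_contains_Z[OF A fwd] by blast
  have "q = l"
  proof (rule ccontr)
    assume "q \<noteq> l"
    have "AE x in M. x \<notin> Z q" using q(2) sub AE_G
      by eventually_elim (use \<open>q \<noteq> l\<close> q(1) \<open>l < r\<close> Z_basin basin_unique in blast)
    then show False using not_AE_Z q(1) by blast
  qed
  with q show ?thesis by simp
qed

section \<open>Absolutely continuous invariant measures carried by a basin\<close>

lemma acip_measure_zero:
  assumes "acip_on \<mu>" "E \<in> sets M" "measure M E = 0"
  shows "measure \<mu> E = 0"
proof -
  have "E \<in> null_sets M" using assms by (auto simp: null_sets_def emeasure_eq_measure)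
  then have "E \<in> null_sets \<mu>" using assms(1) by (auto simp: acip_on_def absolutely_continuous_def)
  then show ?thesis by (auto simp: measure_def)
qed

lemma acip_pos: "acip_on \<mu> \<Longrightarrow> E \<in> sets M \<Longrightarrow> measure \<mu> E > 0 \<Longrightarrow> measure M E > 0"
  using acip_measure_zero[of \<mu> E] by (cases "measure M E = 0") (auto simp: zero_less_measure_iff)

text \<open>Both \<open>E\<close> and its complement in \<open>basin l\<close> are forward invariant
  on \<open>G\<close>. If both had positive mass, almost all of \<open>Z l\<close> would lie in each
  of two disjoint sets.\<close>

lemma acip_dichotomy:
  assumes mu: "acip_on \<mu>" and l: "l < r" "measure \<mu> (basin l) = 1"
    and E: "E \<in> sets M" "\<And>x. x \<in> G \<Longrightarrow> f x \<in> E \<longleftrightarrow> x \<in> E"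
  shows "measure \<mu> E = 0 \<or> measure \<mu> E = 1"
proof (rule ccontr)
  assume neg: "\<not> ?thesis"
  interpret mu: prob_space \<mu> using mu by (simp add: acip_on_def)
  have sets: "sets \<mu> = sets M" using mu by (simp add: acip_on_def)
  have bl: "basin l \<in> sets \<mu>" "E \<in> sets \<mu>" using basin_sets l E sets by auto
  have aeb: "AE x in \<mu>. x \<in> basin l" using bl l(2) by (simp add: mu.prob_eq_1)
  have 1: "measure \<mu> (E \<inter> basin l) = measure \<mu> E"
    using bl aeb by (intro mu.finite_measure_eq_AE) auto
  have 2: "measure \<mu> (basin l - E) = 1 - measure \<mu> E"
  proof -
    have "measure \<mu> (basin l - E) = measure \<mu> (space \<mu> - E)"
      using bl aeb sets.sets_into_space[OF bl(1)] by (intro mu.finite_measure_eq_AE) auto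
    then show ?thesis using mu.prob_compl[OF bl(2)] by simp
  qed
  have le: "measure \<mu> E \<le> 1" by simp
  have pos: "measure \<mu> (E \<inter> basin l) > 0" "measure \<mu> (basin l - E) > 0"
    unfolding 1 2 using neg le measure_nonneg[of \<mu> E] by linarith+
  have inG: "x \<in> basin l \<Longrightarrow> x \<in> G" for x by (simp add: basin_def)
  have a: "AE x in M. x \<in> Z l \<longrightarrow> x \<in> E \<inter> basin l"
    using acip_pos[OF mu _ pos(1)] bl sets E(2) basin_step[OF inG l(1)] inG
    by (intro invariant_in_basin l) auto
  have b: "AE x in M. x \<in> Z l \<longrightarrow> x \<in> basin l - E"
    using acip_pos[OF mu _ pos(2)] bl sets E(2) basin_step[OF inG l(1)] inG
    by (intro invariant_in_basin l) auto
  have "AE x in M. x \<notin> Z l" using a b by eventually_elim auto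
  then show False using not_AE_Z l(1) by blast
qed

text \<open>Let \<open>g\<close> be the difference of the densities. No set has a larger integral of
  \<open>g\<close> than the set where \<open>g > 0\<close>, and its preimage has the same integral,
  so it is forward invariant up to a null set; likewise for \<open>g < 0\<close>. The two sets
  cannot both contain almost all of \<open>Z l\<close>, so \<open>g\<close> has one sign, and its
  integral is zero.\<close>

lemma acip_unique:
  assumes mu: "acip_on \<mu>" and mu': "acip_on \<mu>'" and l: "l < r"
    and b: "measure \<mu> (basin l) = 1" and b': "measure \<mu>' (basin l) = 1"
  shows "\<mu> = \<mu>'"
proof -
  interpret mu: prob_space \<mu> using mu by (simp add: acip_on_def)
  interpret mu': prob_space \<mu>' using mu' by (simp add: acip_on_def)
  have sets: "sets \<mu> = sets M" "sets \<mu>' = sets M" using mu mu' by (auto simp: acip_on_def)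
  have sp: "space \<mu> = space M" "space \<mu>' = space M" using acip_space mu mu' by auto
  obtain D where D: "D \<in> borel_measurable M" "\<And>x. 0 \<le> D x" "integrable M D"
    "\<And>E. E \<in> sets M \<Longrightarrow> measure \<mu> E = (\<integral>x. indicator E x * D x \<partial>M)"
    using acip_density[OF mu] by metis
  obtain D' where D': "D' \<in> borel_measurable M" "\<And>x. 0 \<le> D' x" "integrable M D'"
    "\<And>E. E \<in> sets M \<Longrightarrow> measure \<mu>' E = (\<integral>x. indicator E x * D' x \<partial>M)"
    using acip_density[OF mu'] by metis
  define g where "g x = D x - D' x" for x
  have "g = (\<lambda>x. D x - D' x)" by (simp add: g_def fun_eq_iff)
  then have g: "g \<in> borel_measurable M" "integrable M g" using D(1,3) D'(1,3) by auto
  have ind: "integrable M (\<lambda>x. indicator E x * h x)" if "integrable M h" "E \<in> sets M" for h :: "'a \<Rightarrow> real" and E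
    using integrable_mult_indicator[OF that(2,1)] by simp
  have diff: "measure \<mu> E - measure \<mu>' E = (\<integral>x. indicator E x * g x \<partial>M)" if "E \<in> sets M" for E
    using D D' that ind[OF D(3) that] ind[OF D'(3) that] by (simp add: g_def algebra_simps)
  have vanish: "AE x in M. x \<notin> basin l \<longrightarrow> h x = 0"
    if h: "h \<in> borel_measurable M" "\<And>x. 0 \<le> h x" "integrable M h"
      "\<And>E. E \<in> sets M \<Longrightarrow> measure \<rho> E = (\<integral>x. indicator E x * h x \<partial>M)"
      and rho: "prob_space \<rho>" "sets \<rho> = sets M" "measure \<rho> (basin l) = 1" for h :: "'a \<Rightarrow> real" and \<rho>
  proof -
    interpret rho: prob_space \<rho> by fact
    have bl: "basin l \<in> sets M" using basin_sets l by simp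
    have "measure \<rho> (space M - basin l) = 0"
      using rho.prob_compl[of "basin l"] rho bl sets_eq_imp_space_eq[OF rho(2)] by simp
    then have "(\<integral>x. indicator (space M - basin l) x * h x \<partial>M) = 0" using h(4)[of "space M - basin l"] bl by simp
    then have "AE x in M. indicator (space M - basin l) x * h x = 0"
      using h bl by (subst (asm) integral_nonneg_eq_0_iff_AE) (auto intro!: ind)
    then show ?thesis by (rule AE_mp) (auto split: split_indicator_asm)
  qed
  have "AE x in M. x \<notin> basin l \<longrightarrow> D x = 0" "AE x in M. x \<notin> basin l \<longrightarrow> D' x = 0"
    using vanish[OF D mu.prob_space_axioms sets(1) b] vanish[OF D' mu'.prob_space_axioms sets(2) b']
    by blast+
  then have v: "AE x in M. x \<notin> basin l \<longrightarrow> D x = 0 \<and> D' x = 0"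
    by eventually_elim auto
  have fwd: "AE x in M. x \<in> A \<longrightarrow> f x \<in> A"
    if A: "A = {x \<in> space M. 0 < s * g x}" and "s = 1 \<or> s = -1" for A and s :: real
  proof -
    have Am: "A \<in> sets M" unfolding A using g by measurable
    define E where "E = f -` A \<inter> space M"
    have Em: "E \<in> sets M" unfolding E_def using Am meas by (rule measurable_sets[rotated])
    have "measure \<mu> E = measure \<mu> A" "measure \<mu>' E = measure \<mu>' A"
      using invariant_measureD[of f \<mu> A] invariant_measureD[of f \<mu>' A] mu mu' Am sp
      by (auto simp: acip_on_def E_def)
    then have "(\<integral>x. indicator A x * g x \<partial>M) = (\<integral>x. indicator E x * g x \<partial>M)"
      using diff[OF Am] diff[OF Em] by simp
    then have "(\<integral>x. s * (indicator A x * g x - indicator E x * g x) \<partial>M) = 0"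
      using ind[OF g(2) Am] ind[OF g(2) Em] by simp
    \<comment> \<open>The integrand is nonnegative everywhere because \<open>A\<close> is exactly
      the set where \<open>s * g > 0\<close>.\<close>
    then have "AE x in M. s * (indicator A x * g x - indicator E x * g x) = 0"
      using ind[OF g(2) Am] ind[OF g(2) Em]
      by (subst (asm) integral_nonneg_eq_0_iff_AE)
        (auto simp: A not_less algebra_simps split: split_indicator)
    then show ?thesis
      by (rule AE_mp) (use that(2) in \<open>auto simp: A E_def split: split_indicator_asm\<close>)
  qed
  have null: "\<exists>s. (s = 1 \<or> s = -1) \<and> measure M {x \<in> space M. 0 < s * g x} = 0"
  proof (rule ccontr)
    assume neg: "\<not> ?thesis"
    have main: "AE x in M. x \<in> Z l \<longrightarrow> x \<in> {x \<in> space M. 0 < s * g x}" if s: "s = 1 \<or> s = -1" for s :: real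
    proof (rule invariant_in_basin[OF _ _ l _ fwd[OF refl s]])
      show "{x \<in> space M. 0 < s * g x} \<in> sets M" using g by measurable
      show "0 < measure M {x \<in> space M. 0 < s * g x}" using neg s by (auto simp: zero_less_measure_iff)
      show "AE x in M. x \<in> {x \<in> space M. 0 < s * g x} \<longrightarrow> x \<in> basin l"
        using v by eventually_elim (auto simp: g_def)
    qed
    have "AE x in M. x \<in> Z l \<longrightarrow> 0 < g x" "AE x in M. x \<in> Z l \<longrightarrow> 0 < - g x"
      using main[of 1] main[of "-1"] by auto
    then have "AE x in M. x \<notin> Z l" by eventually_elim auto
    then show False using not_AE_Z l by blast
  qed
  then obtain s :: real where s: "s = 1 \<or> s = -1" "measure M {x \<in> space M. 0 < s * g x} = 0" by blast
  have "{x \<in> space M. 0 < s * g x} \<in> sets M" using g by measurable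
  then have "{x \<in> space M. 0 < s * g x} \<in> null_sets M" using s(2)
    by (auto simp: null_sets_def emeasure_eq_measure)
  then have "AE x in M. x \<notin> {x \<in> space M. 0 < s * g x}" by (rule AE_not_in)
  then have nn: "AE x in M. 0 \<le> - s * g x" by (rule AE_mp) auto
  have "(\<integral>x. indicator (space M) x * g x \<partial>M) = 0"
    using diff[of "space M"] mu.prob_space mu'.prob_space sp by simp
  then have "(\<integral>x. - s * g x \<partial>M) = 0"
    using Bochner_Integration.integral_cong[of M M "\<lambda>x. indicator (space M) x * g x" g] by simp
  then have "AE x in M. - s * g x = 0"
    using nn g by (subst (asm) integral_nonneg_eq_0_iff_AE) auto
  then have g0: "AE x in M. g x = 0" by (rule AE_mp) (use s in auto)
  have "measure \<mu> E = measure \<mu>' E" if "E \<in> sets M" for E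
  proof -
    have "(\<integral>x. indicator E x * g x \<partial>M) = 0"
      using g0 by (intro integral_eq_zero_AE) auto
    then show ?thesis using diff[OF that] by simp
  qed
  then show ?thesis using sets
    by (intro measure_eqI) (auto simp: mu.emeasure_eq_measure mu'.emeasure_eq_measure)
qed

lemma ergodic_acip_basin:
  assumes mu: "acip_on \<mu>" and erg: "ergodic f \<mu>"
  shows "\<exists>l<r. measure \<mu> (basin l) = 1"
proof -
  interpret mu: prob_space \<mu> using mu by (simp add: acip_on_def)
  have sets: "sets \<mu> = sets M" using mu by (simp add: acip_on_def)
  have sp: "space \<mu> = space M" using acip_space mu by auto
  have dich: "measure \<mu> (basin l) = 0 \<or> measure \<mu> (basin l) = 1" if l: "l < r" for l
  proof -
    \<comment> \<open>This saturation of the basin is invariant at every point, as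
      \<open>ergodic\<close> demands; on \<open>G\<close> it is the basin itself.\<close>
    define E where "E = {x \<in> space M. \<exists>n. (f ^^ n) x \<in> basin l}"
    have "E = (\<Union>n. (f ^^ n) -` basin l \<inter> space M)" by (auto simp: E_def)
    also have "\<dots> \<in> sets M" using basin_sets[OF l] meas_funpow by (auto intro!: measurable_sets)
    finally have Em: "E \<in> sets M" .
    have "f x \<in> E \<longleftrightarrow> x \<in> E" if x: "x \<in> space M" for x
    proof
      assume "f x \<in> E"
      then obtain n where "(f ^^ n) (f x) \<in> basin l" by (auto simp: E_def)
      then have "(f ^^ Suc n) x \<in> basin l" by (simp only: funpow_Suc_right comp_apply)
      then show "x \<in> E" using x unfolding E_def by blast
    next
      assume "x \<in> E"
      then obtain n where n: "(f ^^ n) x \<in> basin l" by (auto simp: E_def)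
      then have "(f ^^ n) x \<in> G" by (simp add: basin_def)
      then have "(f ^^ Suc n) x \<in> basin l" using n basin_step[OF _ l] by simp
      then have "(f ^^ n) (f x) \<in> basin l" by (simp only: funpow_Suc_right comp_apply)
      then show "f x \<in> E" using space_funpow[OF x, of 1] by (auto simp: E_def)
    qed
    then have "f -` E \<inter> space \<mu> = E" using sets.sets_into_space[OF Em] by (auto simp: sp)
    then have "measure \<mu> E = 0 \<or> measure \<mu> E = 1" using erg Em sets by (simp add: ergodic_def)
    moreover have "measure \<mu> E = measure \<mu> (basin l)"
    proof (rule mu.finite_measure_eq_AE)
      have inG: "(f ^^ n) x \<in> basin l \<longleftrightarrow> x \<in> basin l" if "x \<in> G" for x n
        by (induction n) (auto simp: basin_step[OF G_funpow[OF that] l])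
      show "AE x in \<mu>. x \<in> E \<longleftrightarrow> x \<in> basin l"
        using acip_AE[OF mu AE_G] by (rule AE_mp) (auto simp: E_def inG G_space)
    qed (use Em basin_sets l sets in auto)
    ultimately show ?thesis by simp
  qed
  have "AE x in \<mu>. x \<in> (\<Union>l<r. basin l)" using acip_AE[OF mu AE_basin] by (rule AE_mp) auto
  then have "measure \<mu> (\<Union>l<r. basin l) = 1" using basin_sets sets by (subst mu.prob_eq_1) auto
  moreover have "measure \<mu> (\<Union>l<r. basin l) \<le> (\<Sum>l<r. measure \<mu> (basin l))"
    using basin_sets sets by (intro mu.finite_measure_subadditive_finite) auto
  moreover have "(\<Sum>l<r. measure \<mu> (basin l)) = 0" if "\<forall>l<r. measure \<mu> (basin l) = 0"
    using that by simp
  ultimately have "\<not> (\<forall>l<r. measure \<mu> (basin l) = 0)" by (metis not_one_le_zero)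
  then show ?thesis using dich by blast
qed

text \<open>An inequality is assumed for \<nu> because its density will be the absolute value of a
  signed one. The normalized restriction of \<nu> to a basin is the required measure, since basins
  are invariant on \<open>G\<close>.\<close>

lemma ergodic_acip_exists:
  assumes nu: "finite_measure \<nu>" "sets \<nu> = sets M" "absolutely_continuous M \<nu>"
    and sub: "\<And>E. E \<in> sets M \<Longrightarrow> measure \<nu> E \<le> measure \<nu> (f -` E \<inter> space M)"
    and l: "l < r" "measure \<nu> (Z l) > 0"
  shows "\<exists>\<mu>. acip_on \<mu> \<and> ergodic f \<mu> \<and> measure \<mu> (basin l) = 1"
proof -
  interpret nu: finite_measure \<nu> by fact
  have sp: "space \<nu> = space M" using nu(2) by (rule sets_eq_imp_space_eq)
  have fm: "f -` E \<inter> space M \<in> sets M" if "E \<in> sets M" for E using meas that by (rule measurable_sets)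
  have AEn: "AE x in M. Q x \<Longrightarrow> AE x in \<nu>. Q x" for Q
    using nu by (auto intro: absolutely_continuous_AE)
  have eq: "measure \<nu> (f -` E \<inter> space M) = measure \<nu> E" if E: "E \<in> sets M" for E
  proof -
    have "f -` (space M - E) \<inter> space M = space M - (f -` E \<inter> space M)"
      using measurable_space[OF meas] by auto
    then have "measure \<nu> (space M) - measure \<nu> E \<le> measure \<nu> (space M) - measure \<nu> (f -` E \<inter> space M)"
      using sub[of "space M - E"] nu.finite_measure_compl[of E] nu.finite_measure_compl[of "f -` E \<inter> space M"]
        fm[OF E] E by (simp add: nu(2) sp)
    then show ?thesis using sub[OF E] by simp
  qed
  have bl: "basin l \<in> sets M" using basin_sets l by simp
  have "measure \<nu> (Z l) \<le> measure \<nu> (basin l)"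
    using AEn[OF AE_G] Z_basin bl nu(2) by (intro nu.finite_measure_mono_AE) auto
  then have pos: "measure \<nu> (basin l) > 0" using l by simp
  define \<mu> where "\<mu> = uniform_measure \<nu> (basin l)"
  have P: "prob_space \<mu>" unfolding \<mu>_def
    using pos by (intro prob_space_uniform_measure) (auto simp: nu.emeasure_eq_measure)
  have sets: "sets \<mu> = sets M" by (simp add: \<mu>_def nu)
  have ms: "measure \<mu> E = measure \<nu> (basin l \<inter> E) / measure \<nu> (basin l)" if "E \<in> sets M" for E
    unfolding \<mu>_def using pos bl that nu(2) by (subst measure_uniform_measure) (auto simp: nu.emeasure_eq_measure)
  interpret mu: prob_space \<mu> by (rule P)
  have spm: "space \<mu> = space M" using sets by (rule sets_eq_imp_space_eq)
  have inv: "invariant_measure f \<mu>"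
  proof (rule invariant_measureI)
    show "f \<in> measurable \<mu> \<mu>" using meas sets by (simp cong: measurable_cong_sets)
    fix A assume "A \<in> sets \<mu>"
    then have A: "A \<in> sets M" by (simp add: sets)
    have "measure \<nu> (basin l \<inter> (f -` A \<inter> space M)) = measure \<nu> (f -` (basin l \<inter> A) \<inter> space M)"
    proof (rule nu.finite_measure_eq_AE)
      show "AE x in \<nu>. x \<in> basin l \<inter> (f -` A \<inter> space M) \<longleftrightarrow> x \<in> f -` (basin l \<inter> A) \<inter> space M"
        using AEn[OF AE_G] by eventually_elim (use basin_step l(1) in blast)
      show "basin l \<inter> (f -` A \<inter> space M) \<in> sets \<nu>" "f -` (basin l \<inter> A) \<inter> space M \<in> sets \<nu>"
        unfolding nu(2) using bl A fm by blast+
    qed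
    then show "measure \<mu> (f -` A \<inter> space \<mu>) = measure \<mu> A"
      using ms[OF A] ms[OF fm[OF A]] eq[of "basin l \<inter> A"] bl A by (simp add: spm)
  qed (rule mu.finite_measure_axioms)
  have ac: "absolutely_continuous M \<mu>" unfolding absolutely_continuous_def
  proof
    fix N assume N: "N \<in> null_sets M"
    then have "N \<in> null_sets \<nu>" using nu(3) by (auto simp: absolutely_continuous_def)
    then have "basin l \<inter> N \<in> null_sets \<nu>" using bl nu(2) by (intro null_set_Int1) auto
    then have "measure \<nu> (basin l \<inter> N) = 0" by (auto simp: measure_def)
    moreover have "N \<in> sets M" using N by auto
    ultimately have "measure \<mu> N = 0" using ms[of N] by simp
    then show "N \<in> null_sets \<mu>" using \<open>N \<in> sets M\<close> by (auto simp: null_sets_def mu.emeasure_eq_measure sets)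
  qed
  have acip: "acip_on \<mu>" using P sets inv ac by (simp add: acip_on_def)
  have one: "measure \<mu> (basin l) = 1" using ms[OF bl] pos by simp
  have "ergodic f \<mu>" unfolding ergodic_def
  proof (intro conjI ballI impI inv)
    fix A assume "A \<in> sets \<mu>" "f -` A \<inter> space \<mu> = A"
    then show "measure \<mu> A = 0 \<or> measure \<mu> A = 1"
      using G_space by (intro acip_dichotomy[OF acip l(1) one]) (auto simp: sets spm)
  qed
  with acip one show ?thesis by blast
qed

text \<open>Otherwise there are sets of \<open>M\<close>-measure below \<open>(1/2)^n\<close> and
  \<mu>-measure at least \<open>e\<close>. By Borel-Cantelli their limsup is null for
  \<open>M\<close>, hence for \<mu>, while continuity from above gives it \<mu>-measure at least
  \<open>e\<close>.\<close>

lemma acip_continuity: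
  assumes mu: "acip_on \<mu>" and e: "e > 0"
  obtains \<delta> where "\<delta> > 0" "\<And>E. E \<in> sets M \<Longrightarrow> measure M E < \<delta> \<Longrightarrow> measure \<mu> E < e"
proof (rule ccontr)
  interpret mu: prob_space \<mu> using mu by (simp add: acip_on_def)
  have sets: "sets \<mu> = sets M" using mu by (simp add: acip_on_def)
  assume neg: "\<not> thesis"
  have "\<exists>E\<in>sets M. measure M E < (1/2)^n \<and> measure \<mu> E \<ge> e" for n
    using neg that[of "(1/2)^n"] by (force simp: not_less)
  then obtain E where E: "\<And>n. E n \<in> sets M" "\<And>n. measure M (E n) < (1/2)^n" "\<And>n. measure \<mu> (E n) \<ge> e"
    by metis
  have "summable (\<lambda>n. measure M (E n))"
    by (rule summable_comparison_test'[of "\<lambda>n. (1/2)^n" 0]) (use E(2) in \<open>auto intro: less_imp_le summable_geometric\<close>)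
  then have "limsup E \<in> null_sets M"
    using E(1) by (intro borel_cantelli_limsup1) (auto simp: emeasure_eq_measure)
  then have "limsup E \<in> null_sets \<mu>" using mu by (auto simp: acip_on_def absolutely_continuous_def)
  then have 0: "measure \<mu> (limsup E) = 0" by (auto simp: measure_def)
  define T where "T m = (\<Union>n\<in>{m..}. E n)" for m
  have T: "T m \<in> sets \<mu>" for m unfolding T_def sets using E(1) by auto
  have "limsup E = (\<Inter>m. T m)" by (simp add: limsup_INF_SUP T_def)
  moreover have "(\<lambda>m. measure \<mu> (T m)) \<longlonglongrightarrow> measure \<mu> (\<Inter>m. T m)"
  proof (rule mu.finite_Lim_measure_decseq)
    show "decseq T" unfolding decseq_def T_def by (intro allI impI UN_mono) auto
  qed (use T in auto)
  moreover have "e \<le> measure \<mu> (T m)" for m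
  proof -
    have "E m \<subseteq> T m" by (auto simp: T_def)
    then show ?thesis using mu.finite_measure_mono[OF _ T] E(3)[of m] by (meson order_trans)
  qed
  ultimately have "e \<le> measure \<mu> (limsup E)" by (intro LIMSEQ_le_const) auto
  then show False using 0 e by simp
qed

text \<open>The points of \<open>phase l 0\<close> that have arrived in \<open>Z l\<close> by time
  \<open>k * p\<close> increase with \<open>p\<close> to the whole phase. Each of these sets lies in
  a preimage of \<open>Z l \<inter> G\<close>, whose mass is that of \<open>Z l \<inter> G\<close>.
  So the points still under way form a null set.\<close>

lemma phase_measure:
  assumes mu: "acip_on \<mu>" and l: "l < r"
  shows "measure \<mu> (phase l 0) = measure \<mu> (Z l \<inter> G)"
proof -
  interpret mu: prob_space \<mu> using mu by (simp add: acip_on_def)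
  have sets: "sets \<mu> = sets M" using mu by (simp add: acip_on_def)
  have sp: "space \<mu> = space M" using acip_space mu by auto
  have Zm: "Z l \<inter> G \<in> sets M" using Z_sets[OF l] G_sets by auto
  define S where "S p = phase l 0 \<inter> (f ^^ (k * p)) -` (Z l \<inter> G)" for p
  have S_eq: "S p = phase l 0 \<inter> ((f ^^ (k * p)) -` (Z l \<inter> G) \<inter> space M)" for p
    using G_space by (auto simp: S_def phase_def)
  have pre: "(f ^^ n) -` (Z l \<inter> G) \<inter> space M \<in> sets M" for n by (intro measurable_sets[OF meas_funpow] Zm)
  have Sm: "S p \<in> sets \<mu>" for p unfolding S_eq sets using pre phase_sets[OF l] by blast
  have "incseq S"
  proof (rule incseq_SucI, rule subsetI)
    fix p x assume x: "x \<in> S p"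
    then have "x \<in> G" by (auto simp: S_def phase_def)
    have "(f ^^ k) ((f ^^ (k * p)) x) \<in> Z l \<inter> G"
      using x G_return[OF G_funpow[OF \<open>x \<in> G\<close>] l] G_funpow[OF \<open>x \<in> G\<close>] G_funpow by (auto simp: S_def)
    then show "x \<in> S (Suc p)" using x by (auto simp: S_def funpow_add)
  qed
  moreover have "(\<Union>p. S p) = phase l 0"
  proof (intro equalityI subsetI)
    fix x assume x: "x \<in> phase l 0"
    then obtain p where "(f ^^ (k * p)) x \<in> Z l" "x \<in> G" by (auto simp: phase_def dvd_def)
    then have "x \<in> S p" using x G_funpow by (auto simp: S_def)
    then show "x \<in> (\<Union>p. S p)" by blast
  qed (auto simp: S_def)
  ultimately have "(\<lambda>p. measure \<mu> (S p)) \<longlonglongrightarrow> measure \<mu> (phase l 0)"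
    using mu.finite_Lim_measure_incseq[of S] Sm by auto
  moreover have "measure \<mu> (S p) \<le> measure \<mu> (Z l \<inter> G)" for p
  proof -
    have "measure \<mu> (S p) \<le> measure \<mu> ((f ^^ (k * p)) -` (Z l \<inter> G) \<inter> space \<mu>)"
      using pre by (intro mu.finite_measure_mono) (auto simp: S_eq sets sp)
    then show ?thesis
      using invariant_measureD[OF invariant_measure_funpow, of f \<mu> "Z l \<inter> G"] mu Zm by (simp add: acip_on_def)
  qed
  ultimately have "measure \<mu> (phase l 0) \<le> measure \<mu> (Z l \<inter> G)" by (intro LIMSEQ_le_const2) auto
  moreover have "measure \<mu> (Z l \<inter> G) \<le> measure \<mu> (phase l 0)"
    using phase_sets[OF l] Z_phase sets by (intro mu.finite_measure_mono) auto
  ultimately show ?thesis by simp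
qed

text \<open>The spreading assumption yields some seed \<open>Z q\<close> and some time
  \<open>n\<close>, which have to be the right ones: a point of \<open>A \<inter> Z l\<close> lands
  in \<open>Z q\<close>, and \<open>same_phase\<close> then forces \<open>q = l\<close> and
  \<open>k dvd n\<close>.\<close>

lemma tail_spread:
  assumes A: "A \<in> sets M" "measure M (A \<inter> Z l) > 0" and l: "l < r" and e: "e > 0"
  obtains p where "\<And>B. B \<in> sets M \<Longrightarrow> A = (f ^^ (k * p)) -` B \<inter> space M \<Longrightarrow> measure M (Z l - B) < e"
proof -
  define A' where "A' = A \<inter> Z l \<inter> G"
  have A': "A' \<in> sets M" using A Z_sets[OF l] G_sets by (auto simp: A'_def)
  have "measure M A' = measure M (A \<inter> Z l)"
  proof (rule finite_measure_eq_AE)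
    show "AE x in M. x \<in> A' \<longleftrightarrow> x \<in> A \<inter> Z l" using AE_G by eventually_elim (auto simp: A'_def)
  qed (use A' A(1) Z_sets[OF l] in auto)
  then have pos: "measure M A' > 0" using A by simp
  \<comment> \<open>Being at most the measure of every seed, \<open>e'\<close> excludes that the
    image of \<open>A'\<close> misses \<open>Z q\<close> altogether.\<close>
  define e' where "e' = Min (insert e ((\<lambda>q. measure M (Z q)) ` {..<r}))"
  have e': "e' > 0" "e' \<le> e" "\<And>q. q < r \<Longrightarrow> e' \<le> measure M (Z q)"
    using e Z_pos by (auto simp: e'_def)
  obtain n q where q: "q < r"
    and nq: "\<And>B. B \<in> sets M \<Longrightarrow> (AE x in M. x \<in> A' \<longrightarrow> (f ^^ n) x \<in> B) \<Longrightarrow> measure M (Z q - B) < e'"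
    using cover[OF A' pos e'(1)] by blast
  have "\<exists>x\<in>A'. (f ^^ n) x \<in> Z q"
  proof (rule ccontr)
    assume neg: "\<not> ?thesis"
    have "AE x in M. x \<in> A' \<longrightarrow> (f ^^ n) x \<in> space M - Z q"
      using neg space_funpow by (intro AE_I2) auto
    then have "measure M (Z q - (space M - Z q)) < e'" using nq[of "space M - Z q"] Z_sets[OF q] by auto
    moreover have "Z q - (space M - Z q) = Z q" using sets.sets_into_space[OF Z_sets[OF q]] by auto
    ultimately show False using e'(3)[OF q] by simp
  qed
  then obtain x where x: "x \<in> A'" "(f ^^ n) x \<in> Z q" by blast
  have "l = q" "k dvd n" using same_phase[of x l q 0 n] x l q by (auto simp: A'_def)
  then obtain p where p: "n = k * p" by (auto simp: dvd_def)
  show thesis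
  proof (rule that[of p])
    fix B assume B: "B \<in> sets M" "A = (f ^^ (k * p)) -` B \<inter> space M"
    have "measure M (Z q - B) < e'" by (rule nq[OF B(1)]) (auto simp: A'_def B(2) p)
    then show "measure M (Z l - B) < e" using e'(2) \<open>l = q\<close> by simp
  qed
qed

text \<open>A tail set \<open>A\<close> is for each \<open>p\<close> the preimage of some
  \<open>B\<close> under \<open>f ^^ (k * p)\<close>. If \<open>A\<close> has positive mass, some
  such \<open>B\<close> fills \<open>Z l\<close> up to small \<open>M\<close>-measure, hence up to
  small \<mu>-measure. By invariance \<open>A\<close> and \<open>B\<close> have the same mass in
  \<open>phase l 0\<close>, so \<open>A\<close> has full mass there.\<close>

lemma phase_exact:
  assumes mu: "acip_on \<mu>" and l: "l < r" and pos: "measure \<mu> (phase l 0) > 0"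
  shows "exact (f ^^ k) (uniform_measure \<mu> (phase l 0))"
proof -
  interpret mu: prob_space \<mu> using mu by (simp add: acip_on_def)
  have sets: "sets \<mu> = sets M" using mu by (simp add: acip_on_def)
  have sp: "space \<mu> = space M" using acip_space mu by auto
  have Pm: "phase l 0 \<in> sets M" using phase_sets l by blast
  define \<kappa> where "\<kappa> = uniform_measure \<mu> (phase l 0)"
  have sk: "sets \<kappa> = sets M" by (simp add: \<kappa>_def sets)
  have spk: "space \<kappa> = space M" using sk by (rule sets_eq_imp_space_eq)
  have ms: "measure \<kappa> E = measure \<mu> (phase l 0 \<inter> E) / measure \<mu> (phase l 0)" if "E \<in> sets M" for E
    unfolding \<kappa>_def using pos that sets Pm by (subst measure_uniform_measure) (auto simp: mu.emeasure_eq_measure)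
  have pk: "prob_space \<kappa>" unfolding \<kappa>_def
    using pos by (intro prob_space_uniform_measure) (auto simp: mu.emeasure_eq_measure)
  interpret kappa: prob_space \<kappa> by (rule pk)
  have pull: "measure \<mu> (phase l 0 \<inter> ((f ^^ (k * p)) -` E \<inter> space M)) = measure \<mu> (phase l 0 \<inter> E)"
    if E: "E \<in> sets M" for E p
  proof -
    have "measure \<mu> (phase l 0 \<inter> ((f ^^ (k * p)) -` E \<inter> space M))
        = measure \<mu> ((f ^^ (k * p)) -` (phase l 0 \<inter> E) \<inter> space \<mu>)"
    proof (rule mu.finite_measure_eq_AE)
      show "AE x in \<mu>. x \<in> phase l 0 \<inter> ((f ^^ (k * p)) -` E \<inter> space M) \<longleftrightarrow>
          x \<in> (f ^^ (k * p)) -` (phase l 0 \<inter> E) \<inter> space \<mu>"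
        using acip_AE[OF mu AE_G]
      proof (rule AE_mp, intro AE_I2 impI)
        fix x assume "x \<in> space \<mu>" "x \<in> G"
        then show "x \<in> phase l 0 \<inter> ((f ^^ (k * p)) -` E \<inter> space M) \<longleftrightarrow>
          x \<in> (f ^^ (k * p)) -` (phase l 0 \<inter> E) \<inter> space \<mu>"
          using phase_funpow[of x l 0 "k * p"] l k by (auto simp: sp)
      qed
      show "phase l 0 \<inter> ((f ^^ (k * p)) -` E \<inter> space M) \<in> mu.events"
        unfolding sets by (intro sets.Int Pm measurable_sets[OF meas_funpow] E)
      show "(f ^^ (k * p)) -` (phase l 0 \<inter> E) \<inter> space \<mu> \<in> mu.events"
        unfolding sets sp by (intro measurable_sets[OF meas_funpow] sets.Int Pm E)
    qed
    then show ?thesis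
      using invariant_measureD[OF invariant_measure_funpow, of f \<mu> "phase l 0 \<inter> E"] mu Pm E by (simp add: acip_on_def)
  qed
  have "invariant_measure (f ^^ k) \<kappa>"
  proof (rule invariant_measureI)
    show "f ^^ k \<in> measurable \<kappa> \<kappa>" using meas_funpow sk by (simp cong: measurable_cong_sets)
    fix A assume "A \<in> sets \<kappa>"
    then have A: "A \<in> sets M" by (simp add: sk)
    then show "measure \<kappa> ((f ^^ k) -` A \<inter> space \<kappa>) = measure \<kappa> A"
      using ms[OF measurable_sets[OF meas_funpow A]] ms[OF A] pull[OF A, of 1] by (simp add: spk)
  qed (rule kappa.finite_measure_axioms)
  moreover have "measure \<kappa> A = 0 \<or> measure \<kappa> A = 1"
    if tail: "\<forall>n. \<exists>B\<in>sets \<kappa>. A = ((f ^^ k) ^^ n) -` B \<inter> space \<kappa>" for A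
  proof (cases "measure \<kappa> A = 0")
    case False
    have tail': "\<exists>B\<in>sets M. A = (f ^^ (k * n)) -` B \<inter> space M" for n
      using tail[rule_format, of n] by (simp add: sk spk funpow_mult mult.commute)
    have Am: "A \<in> sets M" using tail'[of 0] by auto
    have "measure \<mu> (phase l 0 - Z l \<inter> G) = 0"
      using phase_measure[OF mu l] Z_phase[of _ l] Pm Z_sets[OF l] G_sets
      by (subst mu.finite_measure_Diff) (auto simp: sets)
    have nz: "measure \<mu> (phase l 0 \<inter> A) \<noteq> 0" using False ms[OF Am] by auto
    have "measure \<mu> (phase l 0 \<inter> A) \<le> measure \<mu> ((phase l 0 - Z l \<inter> G) \<union> (A \<inter> Z l))"
      using Pm Z_sets[OF l] G_sets Am by (intro mu.finite_measure_mono) (auto simp: sets)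
    also have "\<dots> \<le> measure \<mu> (phase l 0 - Z l \<inter> G) + measure \<mu> (A \<inter> Z l)"
      using Pm Z_sets[OF l] G_sets Am by (intro measure_Un_le) (auto simp: sets)
    finally have "measure \<mu> (A \<inter> Z l) > 0"
      using \<open>measure \<mu> (phase l 0 - Z l \<inter> G) = 0\<close> nz
        measure_nonneg[of \<mu> "phase l 0 \<inter> A"] by linarith
    then have AZ: "measure M (A \<inter> Z l) > 0" using acip_pos[OF mu] Am Z_sets[OF l] by auto
    have spread: "measure \<mu> (phase l 0) - e \<le> measure \<mu> (phase l 0 \<inter> A)" if e: "e > 0" for e
    proof -
      obtain \<delta> where \<delta>: "\<delta> > 0" "\<And>E. E \<in> sets M \<Longrightarrow> measure M E < \<delta> \<Longrightarrow> measure \<mu> E < e"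
        using acip_continuity[OF mu e] by blast
      obtain p where p: "\<And>B. B \<in> sets M \<Longrightarrow> A = (f ^^ (k * p)) -` B \<inter> space M \<Longrightarrow> measure M (Z l - B) < \<delta>"
        using tail_spread[OF Am AZ l \<delta>(1)] by blast
      obtain B where B: "B \<in> sets M" "A = (f ^^ (k * p)) -` B \<inter> space M" using tail' by blast
      have small: "measure \<mu> (Z l - B) < e" using \<delta>(2) p[OF B] B(1) Z_sets[OF l] by blast
      have "measure \<mu> (phase l 0) = measure \<mu> (Z l \<inter> G)" by (rule phase_measure[OF mu l])
      also have "\<dots> \<le> measure \<mu> ((phase l 0 \<inter> B) \<union> (Z l - B))"
        using Pm Z_sets[OF l] B Z_phase by (intro mu.finite_measure_mono) (auto simp: sets)
      also have "\<dots> \<le> measure \<mu> (phase l 0 \<inter> B) + measure \<mu> (Z l - B)"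
        using Pm Z_sets[OF l] B by (intro measure_Un_le) (auto simp: sets)
      also have "measure \<mu> (phase l 0 \<inter> B) = measure \<mu> (phase l 0 \<inter> A)"
        using pull[OF B(1), of p] by (simp add: B(2))
      finally show ?thesis using small by simp
    qed
    have "measure \<mu> (phase l 0) \<le> measure \<mu> (phase l 0 \<inter> A)"
    proof (rule field_le_epsilon)
      fix e :: real assume "0 < e"
      then show "measure \<mu> (phase l 0) \<le> measure \<mu> (phase l 0 \<inter> A) + e" using spread[of e] by linarith
    qed
    moreover have "measure \<mu> (phase l 0 \<inter> A) \<le> measure \<mu> (phase l 0)"
      using Pm by (intro mu.finite_measure_mono) (auto simp: sets)
    ultimately show ?thesis using ms[OF Am] pos by simp
  qed simp
  ultimately show ?thesis unfolding exact_def \<kappa>_def[symmetric] by blast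
qed

text \<open>The phases are permuted cyclically, so they have equal mass and cannot all be null in a
  basin of mass one.\<close>

lemma phase_zero_pos:
  assumes mu: "acip_on \<mu>" and l: "l < r" "measure \<mu> (basin l) = 1"
  shows "measure \<mu> (phase l 0) > 0"
proof (rule ccontr)
  interpret mu: prob_space \<mu> using mu by (simp add: acip_on_def)
  have sets: "sets \<mu> = sets M" using mu by (simp add: acip_on_def)
  have sp: "space \<mu> = space M" using acip_space mu by auto
  assume "\<not> measure \<mu> (phase l 0) > 0"
  then have "measure \<mu> (phase l 0) = 0" by (simp add: zero_less_measure_iff)
  moreover have "measure \<mu> (phase l j) = measure \<mu> (phase l 0)" if "j < k" for j
  proof -
    have "measure \<mu> (phase l 0) = measure \<mu> ((f ^^ j) -` phase l j \<inter> space \<mu>)"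
    proof (rule mu.finite_measure_eq_AE)
      show "AE x in \<mu>. x \<in> phase l 0 \<longleftrightarrow> x \<in> (f ^^ j) -` phase l j \<inter> space \<mu>"
        using acip_AE[OF mu AE_G]
      proof (rule AE_mp, intro AE_I2 impI)
        fix x assume "x \<in> space \<mu>" "x \<in> G"
        then show "x \<in> phase l 0 \<longleftrightarrow> x \<in> (f ^^ j) -` phase l j \<inter> space \<mu>"
          using phase_funpow[of x l 0 j] l k that by (auto simp: sp)
      qed
      show "phase l 0 \<in> mu.events" "(f ^^ j) -` phase l j \<inter> space \<mu> \<in> mu.events"
        unfolding sets sp using phase_sets[OF l(1)] measurable_sets[OF meas_funpow] by blast+
    qed
    then show ?thesis
      using invariant_measureD[OF invariant_measure_funpow, of f \<mu> "phase l j"] mu phase_sets[OF l(1)]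
      by (simp add: acip_on_def)
  qed
  moreover have "measure \<mu> (basin l) \<le> (\<Sum>j<k. measure \<mu> (phase l j))"
    unfolding basin_eq using phase_sets l sets by (intro mu.finite_measure_subadditive_finite) auto
  ultimately show False using l by simp
qed

text \<open>Applied to complements, the inequality is reversed, because the total mass is
  finite.\<close>

lemma dominated_invariant:
  assumes nu: "finite_measure \<nu>" "sets \<nu> = sets M"
    and sub: "\<And>E. E \<in> sets M \<Longrightarrow> measure \<nu> E \<le> measure \<nu> (f -` E \<inter> space M)"
    and E: "E \<in> sets M"
  shows "measure \<nu> (f -` E \<inter> space M) = measure \<nu> E"
proof -
  interpret nu: finite_measure \<nu> by fact
  have sp: "space \<nu> = space M" using nu(2) by (rule sets_eq_imp_space_eq)
  have fm: "f -` E \<inter> space M \<in> sets M" using meas E by (rule measurable_sets)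
  have "f -` (space M - E) \<inter> space M = space M - (f -` E \<inter> space M)"
    using measurable_space[OF meas] by auto
  then have "measure \<nu> (space M) - measure \<nu> E \<le> measure \<nu> (space M) - measure \<nu> (f -` E \<inter> space M)"
    using sub[of "space M - E"] nu.finite_measure_compl[of E] nu.finite_measure_compl[of "f -` E \<inter> space M"] fm E
    by (simp add: nu(2) sp)
  then show ?thesis using sub[OF E] by simp
qed

text \<open>Almost every orbit enters a seed. If all seeds were null for \<nu>, so would be their
  countably many preimages, which exhaust the space up to a null set.\<close>

lemma seed_charged:
  assumes nu: "finite_measure \<nu>" "sets \<nu> = sets M" "absolutely_continuous M \<nu>"
    and sub: "\<And>E. E \<in> sets M \<Longrightarrow> measure \<nu> E \<le> measure \<nu> (f -` E \<inter> space M)"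
    and pos: "measure \<nu> (space M) > 0"
  shows "\<exists>l<r. measure \<nu> (Z l) > 0"
proof (rule ccontr)
  assume neg: "\<not> ?thesis"
  interpret nu: finite_measure \<nu> by fact
  have sp: "space \<nu> = space M" using nu(2) by (rule sets_eq_imp_space_eq)
  have Z0: "measure \<nu> (Z l) = 0" if "l < r" for l using neg that by (simp add: zero_less_measure_iff)
  have null: "(f ^^ n) -` Z l \<inter> space M \<in> null_sets \<nu>" if l: "l < r" for l n
  proof -
    have "measure \<nu> ((f ^^ n) -` Z l \<inter> space M) = 0"
    proof (induction n)
      case 0
      have "(f ^^ 0) -` Z l \<inter> space M = Z l" using sets.sets_into_space[OF Z_sets[OF l]] by auto
      then show ?case using Z0[OF l] by simp
    next
      case (Suc n)
      have m: "(f ^^ n) -` Z l \<inter> space M \<in> sets M" using meas_funpow Z_sets[OF l] by (rule measurable_sets)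
      have e: "(f ^^ Suc n) -` Z l \<inter> space M = f -` ((f ^^ n) -` Z l \<inter> space M) \<inter> space M"
        using measurable_space[OF meas] unfolding funpow_Suc_right by auto
      show ?case unfolding e using dominated_invariant[OF nu(1,2) sub m] Suc by (simp only:)
    qed
    moreover have "(f ^^ n) -` Z l \<inter> space M \<in> sets \<nu>" unfolding nu(2) using meas_funpow Z_sets[OF l] by (rule measurable_sets)
    ultimately show ?thesis by (simp add: null_sets_def nu.emeasure_eq_measure)
  qed
  have un: "(\<Union>l<r. \<Union>n. (f ^^ n) -` Z l \<inter> space M) \<in> null_sets \<nu>"
    using null by (intro null_sets_UN') auto
  have "AE x in \<nu>. \<exists>l<r. x \<in> basin l" using AE_basin nu(2,3) by (auto intro: absolutely_continuous_AE)
  then have "AE x in \<nu>. x \<in> (\<Union>l<r. \<Union>n. (f ^^ n) -` Z l \<inter> space M)"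
    by eventually_elim (auto simp: basin_def dest: G_space)
  moreover have "AE x in \<nu>. x \<notin> (\<Union>l<r. \<Union>n. (f ^^ n) -` Z l \<inter> space M)" using un by (rule AE_not_in)
  ultimately have "AE x in \<nu>. x \<notin> space \<nu>" by eventually_elim blast
  then have "space \<nu> \<in> null_sets \<nu>" by (subst AE_iff_null_sets) auto
  then have "measure \<nu> (space M) = 0" by (simp add: sp measure_def null_setsD1)
  then show False using pos by simp
qed

lemma ergodic_acip_enumeration:
  assumes nu: "finite_measure \<nu>" "sets \<nu> = sets M" "absolutely_continuous M \<nu>"
    and sub: "\<And>E. E \<in> sets M \<Longrightarrow> measure \<nu> E \<le> measure \<nu> (f -` E \<inter> space M)"
    and pos: "\<And>l. l < r \<Longrightarrow> measure \<nu> (Z l) > 0"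
  obtains m where "bij_betw m {..<r} {\<mu>. acip_on \<mu> \<and> ergodic f \<mu>}"
    "\<And>l. l < r \<Longrightarrow> measure (m l) (basin l) = 1"
proof -
  have "\<exists>\<mu>. acip_on \<mu> \<and> ergodic f \<mu> \<and> measure \<mu> (basin l) = 1" if "l < r" for l
    by (rule ergodic_acip_exists[OF nu sub that pos[OF that]])
  then obtain m where m: "\<And>l. l < r \<Longrightarrow> acip_on (m l) \<and> ergodic f (m l) \<and> measure (m l) (basin l) = 1"
    by metis
  have "inj_on m {..<r}"
  proof (rule inj_onI)
    fix l l' assume l: "l \<in> {..<r}" "l' \<in> {..<r}" "m l = m l'"
    show "l = l'"
    proof (rule ccontr)
      assume ne: "l \<noteq> l'"
      interpret mu: prob_space "m l" using m l by (simp add: acip_on_def)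
      have b: "basin l \<in> sets (m l)" "basin l' \<in> sets (m l)" using basin_sets m l by (auto simp: acip_on_def)
      have "basin l \<inter> basin l' = {}" using basin_unique l ne by auto
      then have "measure (m l) (basin l \<union> basin l') = measure (m l) (basin l) + measure (m l) (basin l')"
        using b by (intro mu.finite_measure_Union)
      also have "\<dots> = 2" using m[of l] m[of l'] l by simp
      finally show False using mu.prob_le_1[of "basin l \<union> basin l'"] by simp
    qed
  qed
  moreover have "m ` {..<r} = {\<mu>. acip_on \<mu> \<and> ergodic f \<mu>}"
  proof (intro equalityI subsetI)
    fix \<mu> assume \<mu>: "\<mu> \<in> {\<mu>. acip_on \<mu> \<and> ergodic f \<mu>}"
    then obtain l where l: "l < r" "measure \<mu> (basin l) = 1" using ergodic_acip_basin[of \<mu>] by auto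
    then have "\<mu> = m l" using acip_unique[of \<mu> "m l" l] \<mu> m by auto
    then show "\<mu> \<in> m ` {..<r}" using l by auto
  qed (use m in auto)
  ultimately show thesis using that[of m] m by (auto simp: bij_betw_def)
qed

end

text \<open>Stated outside the locale because \<open>measure_support\<close> is defined for measures
  on the real line.\<close>

lemma cyclic_mixing_components:
  fixes M :: "real measure"
  assumes "cyclic_system M f r k Z G" "nonsingular_map.acip_on M f \<mu>" "l < r"
    and "measure \<mu> (cyclic_system.basin f Z G l) = 1" and supp: "AE x in \<mu>. x \<in> measure_support \<mu>"
  shows "mixing_components f \<mu> k (cyclic_system.phase f k Z G l)"
proof -
  interpret cyclic_system M f r k Z G by fact
  interpret mu: prob_space \<mu> using assms(2) by (simp add: acip_on_def)
  have sets: "sets \<mu> = sets M" using assms(2) by (simp add: acip_on_def)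
  have bl: "basin l \<in> sets \<mu>" using basin_sets assms(3) sets by simp
  have "AE x in \<mu>. x \<in> basin l" using bl assms(4) by (simp add: mu.prob_eq_1)
  then have "AE x in \<mu>. x \<in> measure_support \<mu> \<longleftrightarrow> x \<in> (\<Union>j<k. phase l j)"
    using supp unfolding basin_eq by eventually_elim blast
  moreover have "AE x in \<mu>. x \<in> phase l j \<longleftrightarrow> f x \<in> phase l (Suc j mod k)" for j
    using acip_AE[OF assms(2) AE_G] by eventually_elim (rule phase_step[OF _ assms(3)])
  moreover have "disjoint_family_on (phase l) {..<k}"
    using phase_unique assms(3) by (fastforce simp: disjoint_family_on_def)
  moreover have "exact (f ^^ k) (uniform_measure \<mu> (phase l 0))"
    by (rule phase_exact[OF assms(2,3) phase_zero_pos[OF assms(2,3,4)]])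
  ultimately show ?thesis using k phase_sets[OF assms(3)] by (simp add: mixing_components_def sets)
qed

section \<open>Piecewise affine expanding maps\<close>

lemma emeasure_affine_vimage:
  fixes B :: "real set"
  assumes "k \<noteq> 0" "B \<in> sets borel"
  shows "emeasure lborel B = ennreal \<bar>k\<bar> * emeasure lborel ((\<lambda>x. k * x + e) -` B)"
proof -
  have "emeasure lborel B = emeasure (density (distr lborel borel (\<lambda>x. e + k * x)) (\<lambda>_. ennreal \<bar>k\<bar>)) B"
    using lborel_real_affine[OF assms(1), of e] by simp
  also have "\<dots> = ennreal \<bar>k\<bar> * emeasure (distr lborel borel (\<lambda>x. e + k * x)) B"
    using assms(2) by (subst emeasure_density_const) auto
  also have "emeasure (distr lborel borel (\<lambda>x. e + k * x)) B = emeasure lborel ((\<lambda>x. e + k * x) -` B \<inter> space lborel)"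
    using assms(2) by (intro emeasure_distr) auto
  also have "(\<lambda>x. e + k * x) -` B \<inter> space lborel = (\<lambda>x. k * x + e) -` B" by (simp add: add.commute)
  finally show ?thesis .
qed

text \<open>A weak form of the Lebesgue density theorem. An open \<open>T\<close> slightly larger
  than \<open>A\<close> contains nonoverlapping intervals that cover \<open>A\<close>; since
  \<open>A\<close> fills at most the fraction \<open>q\<close> of each, its measure is at most
  \<open>q\<close> times that of \<open>T\<close>.\<close>

lemma null_if_thin:
  fixes A :: "real set"
  assumes L: "0 < L" and A: "A \<in> sets borel" "A \<subseteq> {0..L}" and q: "0 \<le> q" "q < 1"
    and thin: "\<And>u v. 0 \<le> u \<Longrightarrow> u < v \<Longrightarrow> v \<le> L \<Longrightarrow> emeasure lborel (A \<inter> {u<..<v}) \<le> ennreal (q * (v - u))"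
  shows "emeasure lborel A = 0"
proof (rule ccontr)
  assume pos: "emeasure lborel A \<noteq> 0"
  have "emeasure lborel A \<le> emeasure lborel {0..L}" using A by (intro emeasure_mono) auto
  then have fin: "emeasure lborel A \<noteq> \<infinity>" using L by (auto simp: top_unique)
  define a where "a = measure lborel A"
  have ea: "emeasure lborel A = ennreal a" using fin by (simp add: a_def emeasure_eq_ennreal_measure)
  have "a \<noteq> 0" "0 \<le> a" using pos ea by (metis ennreal_0, simp add: a_def)
  then have a: "a > 0" by simp
  \<comment> \<open>With this choice
    \<open>q * (a + d) \<le> q * a + d = a * (1 + q) / 2 < a\<close>.\<close>
  define d where "d = a * (1 - q) / 2"
  have d: "0 < d" using a q by (simp add: d_def)
  obtain T where T: "open T" "A \<subseteq> T" "emeasure lborel (T - A) < ennreal d"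
    using outer_regular_lborel[OF A(1) d] by blast
  have "emeasure lborel T \<le> emeasure lborel (A \<union> (T - A))" using A T by (intro emeasure_mono) auto
  also have "\<dots> \<le> emeasure lborel A + emeasure lborel (T - A)" using A T by (intro emeasure_subadditive) auto
  also have "\<dots> \<le> ennreal a + ennreal d" using T(3) by (simp add: ea less_imp_le add_left_mono)
  finally have eT: "emeasure lborel T \<le> ennreal (a + d)" using a d by simp
  \<comment> \<open>The gauge keeps the intervals of the covering inside \<open>T\<close>, because
    each has its tag in \<open>A \<subseteq> T\<close>.\<close>
  define g where "g x = (if x \<in> T then T else UNIV)" for x
  have g: "gauge g" using T(1) by (auto simp: gauge_def g_def)
  have p: "A \<subseteq> cbox 0 L" "box 0 L \<noteq> {}" using A(2) L by auto
  have "\<exists>\<D>. countable \<D> \<and> \<Union>\<D> \<subseteq> cbox 0 L \<and> (\<forall>K\<in>\<D>. interior K \<noteq> {} \<and> (\<exists>c d. K = cbox c d)) \<and>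
      pairwise (\<lambda>A B. interior A \<inter> interior B = {}) \<D> \<and> (\<forall>K\<in>\<D>. \<exists>x \<in> A \<inter> K. K \<subseteq> g x) \<and> A \<subseteq> \<Union>\<D>"
  proof (rule covering_lemma[OF p g])
    fix \<D> assume a: "countable \<D>" "\<Union>\<D> \<subseteq> cbox 0 L"
      "\<And>K. K \<in> \<D> \<Longrightarrow> interior K \<noteq> {} \<and> (\<exists>c d. K = cbox c d)"
      "pairwise (\<lambda>A B. interior A \<inter> interior B = {}) \<D>"
      "\<And>K. K \<in> \<D> \<Longrightarrow> \<exists>x \<in> A \<inter> K. K \<subseteq> g x"
      "\<And>u v. cbox u v \<in> \<D> \<Longrightarrow> \<exists>n. \<forall>i \<in> Basis. v \<bullet> i - u \<bullet> i = (L \<bullet> i - 0 \<bullet> i) / 2 ^ n" "A \<subseteq> \<Union>\<D>"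
    show ?thesis by (rule exI[of _ \<D>], intro conjI ballI a(1,2,4,7)) (use a(3,5) in blast)+
  qed
  then obtain \<D> where D0: "countable \<D> \<and> \<Union>\<D> \<subseteq> cbox 0 L \<and> (\<forall>K\<in>\<D>. interior K \<noteq> {} \<and> (\<exists>c d. K = cbox c d)) \<and>
      pairwise (\<lambda>A B. interior A \<inter> interior B = {}) \<D> \<and> (\<forall>K\<in>\<D>. \<exists>x \<in> A \<inter> K. K \<subseteq> g x) \<and> A \<subseteq> \<Union>\<D>"
    by (elim exE)
  note D = D0[THEN conjunct1] D0[THEN conjunct2, THEN conjunct1]
    D0[THEN conjunct2, THEN conjunct2, THEN conjunct1, rule_format]
    D0[THEN conjunct2, THEN conjunct2, THEN conjunct2, THEN conjunct1]
    D0[THEN conjunct2, THEN conjunct2, THEN conjunct2, THEN conjunct2, THEN conjunct1, rule_format]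
    D0[THEN conjunct2, THEN conjunct2, THEN conjunct2, THEN conjunct2, THEN conjunct2]
  have int: "\<exists>u v. interior K = {u<..<v} \<and> K = {u..v} \<and> 0 \<le> u \<and> u < v \<and> v \<le> L" if K: "K \<in> \<D>" for K
  proof -
    obtain u v where uv: "K = {u..v}" using D(3)[OF K] by auto
    then have "u < v" using D(3)[OF K] by auto
    have "K \<subseteq> {0..L}" using D(2) K by auto
    then have "0 \<le> u" "v \<le> L" using uv \<open>u < v\<close> by auto
    then show ?thesis using uv \<open>u < v\<close> by auto
  qed
  have sub: "interior K \<subseteq> T" if "K \<in> \<D>" for K
    using D(5)[OF that] T(2) interior_subset[of K] by (auto simp: g_def split: if_splits)
  have disj: "disjoint_family_on interior \<D>" "disjoint_family_on (\<lambda>K. A \<inter> interior K) \<D>"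
    using D(4) by (auto simp: disjoint_family_on_def pairwise_def)
  have thin': "emeasure lborel (A \<inter> interior K) \<le> ennreal q * emeasure lborel (interior K)" if K: "K \<in> \<D>" for K
  proof -
    obtain u v where uv: "interior K = {u<..<v}" "0 \<le> u" "u < v" "v \<le> L" using int[OF K] by blast
    have "emeasure lborel (A \<inter> interior K) \<le> ennreal (q * (v - u))" unfolding uv(1) using thin uv by blast
    also have "\<dots> = ennreal q * ennreal (v - u)" using q by (simp add: ennreal_mult')
    also have "ennreal (v - u) = emeasure lborel (interior K)" using uv by simp
    finally show ?thesis .
  qed
  have bd: "\<Union>\<D> - (\<Union>K\<in>\<D>. interior K) \<in> null_sets lborel"
  proof -
    have "\<Union>\<D> - (\<Union>K\<in>\<D>. interior K) \<subseteq> (\<Union>K\<in>\<D>. K - interior K)" by blast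
    have "finite (K - interior K)" if "K \<in> \<D>" for K
    proof -
      obtain u v where "interior K = {u<..<v}" "K = {u..v}" using int[OF \<open>K \<in> \<D>\<close>] by blast
      then have "K - interior K \<subseteq> {u, v}" by auto
      then show ?thesis using finite_subset by blast
    qed
    then have "countable (\<Union>K\<in>\<D>. K - interior K)" using countable_UN[OF D(1), of "\<lambda>K. K - interior K"] countable_finite by blast
    with \<open>\<Union>\<D> - (\<Union>K\<in>\<D>. interior K) \<subseteq> (\<Union>K\<in>\<D>. K - interior K)\<close>
    have "countable (\<Union>\<D> - (\<Union>K\<in>\<D>. interior K))" by (rule countable_subset)
    then show ?thesis by (rule countable_imp_null_set_lborel)
  qed
  have im: "(\<Union>K\<in>\<D>. A \<inter> interior K) \<in> sets lborel" using D(1) A(1) by (intro sets.countable_UN'') auto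
  have "A \<subseteq> (\<Union>K\<in>\<D>. A \<inter> interior K) \<union> (\<Union>\<D> - (\<Union>K\<in>\<D>. interior K))" using D(6) by blast
  then have "emeasure lborel A \<le> emeasure lborel ((\<Union>K\<in>\<D>. A \<inter> interior K) \<union> (\<Union>\<D> - (\<Union>K\<in>\<D>. interior K)))"
    using im bd by (intro emeasure_mono sets.Un) auto
  also have "\<dots> = emeasure lborel (\<Union>K\<in>\<D>. A \<inter> interior K)"
    using bd im by (intro emeasure_Un_null_set)
  also have "\<dots> = (\<integral>\<^sup>+K. emeasure lborel (A \<inter> interior K) \<partial>count_space \<D>)"
    using D(1) A(1) disj by (intro emeasure_UN_countable) auto
  also have "\<dots> \<le> (\<integral>\<^sup>+K. ennreal q * emeasure lborel (interior K) \<partial>count_space \<D>)"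
    using thin' by (intro nn_integral_mono) auto
  also have "\<dots> = ennreal q * (\<integral>\<^sup>+K. emeasure lborel (interior K) \<partial>count_space \<D>)"
    by (intro nn_integral_cmult) auto
  also have "(\<integral>\<^sup>+K. emeasure lborel (interior K) \<partial>count_space \<D>) = emeasure lborel (\<Union>K\<in>\<D>. interior K)"
    using D(1) disj by (intro emeasure_UN_countable[symmetric]) auto
  also have "emeasure lborel (\<Union>K\<in>\<D>. interior K) \<le> emeasure lborel T"
    using sub T(1) by (intro emeasure_mono) auto
  finally have "ennreal a \<le> ennreal q * emeasure lborel T" by (simp add: ea mult_left_mono)
  also have "\<dots> \<le> ennreal q * ennreal (a + d)" using eT by (intro mult_left_mono) auto
  finally have "ennreal a \<le> ennreal (q * (a + d))" using q by (simp flip: ennreal_mult')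
  then have "a \<le> q * (a + d)" using q a d by (subst (asm) ennreal_le_iff) auto
  also have "\<dots> \<le> q * a + d" using q d by (simp add: algebra_simps mult_left_le_one_le)
  also have "\<dots> < a"
  proof -
    have "d < a * (1 - q)" using d unfolding d_def by simp
    then show ?thesis by (simp add: algebra_simps)
  qed
  finally show False by simp
qed

section \<open>Affine pieces and their iterates\<close>

definition affine_on :: "(real \<Rightarrow> real) \<Rightarrow> real \<Rightarrow> real \<Rightarrow> real \<Rightarrow> bool" where
  "affine_on g \<gamma> u v \<longleftrightarrow> (\<exists>s e. (s = 1 \<or> s = -1) \<and> (\<forall>x\<in>{u<..<v}. g x = s * \<gamma> * x + e))"

lemma affine_on_mono: "affine_on g \<gamma> u v \<Longrightarrow> u \<le> u' \<Longrightarrow> v' \<le> v \<Longrightarrow> affine_on g \<gamma> u' v'"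
  by (fastforce simp: affine_on_def)

lemma affine_on_image:
  assumes "affine_on g \<gamma> u v" "0 < \<gamma>" "u < v"
  obtains u' v' where "g ` {u<..<v} = {u'<..<v'}" "v' - u' = \<gamma> * (v - u)"
proof -
  obtain s e where s: "s = 1 \<or> s = -1" and g0: "\<forall>x\<in>{u<..<v}. g x = s * \<gamma> * x + e"
    using assms(1) unfolding affine_on_def by blast
  have g: "g x = s * \<gamma> * x + e" if "x \<in> {u<..<v}" for x using g0 that by blast
  have im: "g ` {u<..<v} = (\<lambda>x. s * \<gamma> * x + e) ` {u<..<v}" using g by (intro image_cong) auto
  show thesis
  proof (cases "s = 1")
    case True
    have "y \<in> (\<lambda>x. s * \<gamma> * x + e) ` {u<..<v}" if "\<gamma> * u + e < y" "y < \<gamma> * v + e" for y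
      by (rule image_eqI[where x = "(y - e) / \<gamma>"]) (use that True assms in \<open>auto simp: field_simps\<close>)
    then have "(\<lambda>x. s * \<gamma> * x + e) ` {u<..<v} = {\<gamma> * u + e<..<\<gamma> * v + e}" using True assms by auto
    then show thesis using im by (intro that[of "\<gamma> * u + e" "\<gamma> * v + e"]) (auto simp: algebra_simps)
  next
    case False
    then have s: "s = -1" using s by simp
    have "y \<in> (\<lambda>x. s * \<gamma> * x + e) ` {u<..<v}" if "e - \<gamma> * v < y" "y < e - \<gamma> * u" for y
      by (rule image_eqI[where x = "(e - y) / \<gamma>"]) (use that s assms in \<open>auto simp: field_simps\<close>)
    then have "(\<lambda>x. s * \<gamma> * x + e) ` {u<..<v} = {e - \<gamma> * v<..<e - \<gamma> * u}" using s assms by auto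
    then show thesis using im by (intro that[of "e - \<gamma> * v" "e - \<gamma> * u"]) (auto simp: algebra_simps)
  qed
qed

lemma affine_on_measure:
  assumes "affine_on g \<gamma> u v" "0 < \<gamma>" "E \<in> sets borel"
  shows "{u<..<v} \<inter> g -` E \<in> sets borel"
    and "emeasure lborel (g ` {u<..<v} \<inter> E) = ennreal \<gamma> * emeasure lborel ({u<..<v} \<inter> g -` E)"
proof -
  obtain s e where s: "s = 1 \<or> s = -1" and g0: "\<forall>x\<in>{u<..<v}. g x = s * \<gamma> * x + e"
    using assms(1) unfolding affine_on_def by blast
  have g: "g x = s * \<gamma> * x + e" if "x \<in> {u<..<v}" for x using g0 that by blast
  have m: "(\<lambda>x. s * \<gamma> * x + e) -` E \<in> sets borel"
    using measurable_sets[of "\<lambda>x. s * \<gamma> * x + e" borel borel E] assms(3) by simp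
  have eq: "{u<..<v} \<inter> g -` E = {u<..<v} \<inter> (\<lambda>x. s * \<gamma> * x + e) -` E" using g by auto
  then show "{u<..<v} \<inter> g -` E \<in> sets borel" using m by auto
  show "emeasure lborel (g ` {u<..<v} \<inter> E) = ennreal \<gamma> * emeasure lborel ({u<..<v} \<inter> g -` E)"
  proof (cases "u < v")
    case True
    obtain u' v' where im: "g ` {u<..<v} = {u'<..<v'}" by (rule affine_on_image[OF assms(1,2) True])
    have k: "s * \<gamma> \<noteq> 0" "\<bar>s * \<gamma>\<bar> = \<gamma>" using s assms(2) by auto
    have "(\<lambda>x. s * \<gamma> * x + e) -` (g ` {u<..<v} \<inter> E) = {u<..<v} \<inter> g -` E"
    proof -
      have inI: "x \<in> {u<..<v}" if x: "s * \<gamma> * x + e \<in> g ` {u<..<v}" for x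
      proof -
        obtain y where y: "y \<in> {u<..<v}" "s * \<gamma> * x + e = g y" using x by blast
        then have "s * \<gamma> * x = s * \<gamma> * y" using g by auto
        then have "x = y" using k by simp
        with y show ?thesis by simp
      qed
      show ?thesis
      proof (intro equalityI subsetI)
        fix x assume "x \<in> (\<lambda>x. s * \<gamma> * x + e) -` (g ` {u<..<v} \<inter> E)"
        then show "x \<in> {u<..<v} \<inter> g -` E" using inI[of x] g[of x] by simp
      next
        fix x assume "x \<in> {u<..<v} \<inter> g -` E"
        then have "x \<in> {u<..<v}" "g x \<in> E" by auto
        then show "x \<in> (\<lambda>x. s * \<gamma> * x + e) -` (g ` {u<..<v} \<inter> E)" using imageI[of x "{u<..<v}" g] g[of x] by simp
      qed
    qed
    then show ?thesis
      using emeasure_affine_vimage[OF k(1), of "g ` {u<..<v} \<inter> E" e] assms(3) im k by auto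
  qed simp
qed

lemma affine_on_comp:
  assumes "affine_on g \<gamma> u v" "affine_on f \<gamma>' u' v'" "g ` {u<..<v} \<subseteq> {u'<..<v'}"
  shows "affine_on (f \<circ> g) (\<gamma>' * \<gamma>) u v"
proof -
  obtain s e where s: "s = 1 \<or> s = -1" and g: "\<forall>x\<in>{u<..<v}. g x = s * \<gamma> * x + e"
    using assms(1) unfolding affine_on_def by blast
  obtain s' e' where s': "s' = 1 \<or> s' = -1" and f: "\<forall>x\<in>{u'<..<v'}. f x = s' * \<gamma>' * x + e'"
    using assms(2) unfolding affine_on_def by blast
  have "(f \<circ> g) x = (s' * s) * (\<gamma>' * \<gamma>) * x + (s' * \<gamma>' * e + e')" if "x \<in> {u<..<v}" for x
  proof -
    have "g x \<in> {u'<..<v'}" using assms(3) that by blast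
    then have "f (g x) = s' * \<gamma>' * g x + e'" using f by blast
    then show ?thesis using g that by (simp add: algebra_simps)
  qed
  moreover have "s' * s = 1 \<or> s' * s = -1" using s s' by auto
  ultimately show ?thesis unfolding affine_on_def by blast
qed

text \<open>Finite fibres keep the set of break points finite under composition, where the break
  points of the outer map are pulled back. All branches have the same slope up to sign, so pieces of
  an iterate can be compared by length alone.\<close>

locale pw_affine =
  fixes L \<gamma> :: real and f :: "real \<Rightarrow> real" and D :: "real set"
  assumes L: "0 < L" and \<gamma>: "1 < \<gamma>" and D: "finite D"
    and range: "\<And>x. x \<in> {0..L} \<Longrightarrow> f x \<in> {0..L}"
    and fibre: "\<And>y. finite {x \<in> {0..L}. f x = y}"
    and affine: "\<And>u v. 0 \<le> u \<Longrightarrow> u < v \<Longrightarrow> v \<le> L \<Longrightarrow> {u<..<v} \<inter> D = {} \<Longrightarrow> affine_on f \<gamma> u v"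
begin

definition M :: "real measure" where "M = restrict_space lborel {0..L}"

lemma sets_M: "A \<in> sets M \<longleftrightarrow> A \<in> sets borel \<and> A \<subseteq> {0..L}"
  unfolding M_def by (subst sets_restrict_space_iff) auto

lemma space_M: "space M = {0..L}"
  by (simp add: M_def space_restrict_space)

lemma emeasure_M: "A \<subseteq> {0..L} \<Longrightarrow> emeasure M A = emeasure lborel A"
  unfolding M_def by (intro emeasure_restrict_space) auto

lemma measure_M: "A \<subseteq> {0..L} \<Longrightarrow> measure M A = measure lborel A"
  by (simp add: measure_def emeasure_M)

sublocale M: finite_measure M
  by (rule finite_measureI) (use L in \<open>simp add: space_M emeasure_M\<close>)

lemma interval_sub: "0 \<le> u \<Longrightarrow> v \<le> L \<Longrightarrow> {u<..<v} \<subseteq> {0..L}"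
  by auto

lemma interval_M: "0 \<le> u \<Longrightarrow> v \<le> L \<Longrightarrow> {u<..<v} \<in> sets M"
  by (auto simp: sets_M)

lemma measure_interval: "0 \<le> u \<Longrightarrow> u \<le> v \<Longrightarrow> v \<le> L \<Longrightarrow> measure M {u<..<v} = v - u"
  by (subst measure_M[OF interval_sub]) auto

lemma range_funpow: "x \<in> {0..L} \<Longrightarrow> (f ^^ n) x \<in> {0..L}"
  by (induction n) (use range in auto)

lemma image_interval:
  assumes "0 \<le> u" "u < v" "v \<le> L" "affine_on (f ^^ n) (\<gamma> ^ n) u v"
  obtains u' v' where "(f ^^ n) ` {u<..<v} = {u'<..<v'}" "v' - u' = \<gamma> ^ n * (v - u)" "0 \<le> u'" "u' < v'" "v' \<le> L"
proof -
  have pos: "0 < \<gamma> ^ n" using \<gamma> by simp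
  obtain u' v' where uv: "(f ^^ n) ` {u<..<v} = {u'<..<v'}" "v' - u' = \<gamma> ^ n * (v - u)"
    by (rule affine_on_image[OF assms(4) pos assms(2)])
  have "0 < \<gamma> ^ n * (v - u)" using pos assms by simp
  then have lt: "u' < v'" using uv(2) by linarith
  have "(f ^^ n) x \<in> {0..L}" if "x \<in> {u<..<v}" for x using that assms by (intro range_funpow) auto
  then have "{u'<..<v'} \<subseteq> {0..L}" unfolding uv(1)[symmetric] by blast
  then have "0 \<le> u' \<and> v' \<le> L" using lt by (simp add: greaterThanLessThan_subseteq_atLeastAtMost_iff)
  then show thesis using that uv lt by blast
qed

lemma vimage_interval:
  assumes "0 \<le> u" "u < v" "v \<le> L" "affine_on (f ^^ n) (\<gamma> ^ n) u v" "E \<in> sets M"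
  shows "{u<..<v} \<inter> (f ^^ n) -` E \<in> sets M"
    and "measure M ((f ^^ n) ` {u<..<v} \<inter> E) = \<gamma> ^ n * measure M ({u<..<v} \<inter> (f ^^ n) -` E)"
proof -
  have pos: "0 < \<gamma> ^ n" using \<gamma> by simp
  have E: "E \<in> sets borel" "E \<subseteq> {0..L}" using assms(5) by (auto simp: sets_M)
  have s: "{u<..<v} \<inter> (f ^^ n) -` E \<subseteq> {0..L}" using interval_sub[OF assms(1,3)] by blast
  show "{u<..<v} \<inter> (f ^^ n) -` E \<in> sets M"
    using affine_on_measure(1)[OF assms(4) pos E(1)] s by (simp add: sets_M)
  have s': "(f ^^ n) ` {u<..<v} \<inter> E \<subseteq> {0..L}" using E by blast
  show "measure M ((f ^^ n) ` {u<..<v} \<inter> E) = \<gamma> ^ n * measure M ({u<..<v} \<inter> (f ^^ n) -` E)"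
    unfolding measure_M[OF s] measure_M[OF s'] unfolding measure_def
    using affine_on_measure(2)[OF assms(4) pos E(1)] pos by (simp add: enn2real_mult)
qed

lemma affine_Suc:
  assumes "0 \<le> u" "u < v" "v \<le> L" "affine_on (f ^^ n) (\<gamma> ^ n) u v"
    and "(f ^^ n) ` {u<..<v} \<subseteq> {u'<..<v'}" "0 \<le> u'" "u' < v'" "v' \<le> L" "{u'<..<v'} \<inter> D = {}"
  shows "affine_on (f ^^ Suc n) (\<gamma> ^ Suc n) u v"
  using affine_on_comp[OF assms(4) affine[OF assms(6-9)] assms(5)] by (simp only: funpow.simps power_Suc)

lemma singleton_null: "measure M {x} = 0"
proof (cases "x \<in> {0..L}")
  case True
  then show ?thesis by (subst measure_M) auto
next
  case False
  then have "{x} \<notin> sets M" by (simp add: sets_M)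
  then show ?thesis by (rule measure_notin_sets)
qed

lemma countable_null: "countable N \<Longrightarrow> N \<subseteq> {0..L} \<Longrightarrow> N \<in> null_sets M"
  using countable_imp_null_set_lborel[of N] by (auto simp: null_sets_def sets_M emeasure_M)

text \<open>Since \<open>\<gamma> > 2\<close>, an interval that is cut at most once per step grows on average, so short pieces
  cannot carry a fixed fraction of a set.\<close>

lemma growth:
  assumes "2 < \<gamma>"
  obtains \<delta> where "0 < \<delta>" "\<And>A \<epsilon>. A \<in> sets M \<Longrightarrow> measure M A > 0 \<Longrightarrow> 0 < \<epsilon> \<Longrightarrow> \<epsilon> < 1 \<Longrightarrow>
    \<exists>n u v. 0 \<le> u \<and> u < v \<and> v \<le> L \<and> affine_on (f ^^ n) (\<gamma> ^ n) u v \<and> \<delta> \<le> \<gamma> ^ n * (v - u) \<and>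
      measure M ({u<..<v} - A) < \<epsilon> * (v - u)"
proof -
  \<comment> \<open>Distances between distinct break points: an image shorter than their minimum
    contains at most one break point.\<close>
  define S where "S = (\<lambda>(x, y). \<bar>x - y\<bar>) ` {(x, y) \<in> D \<times> D. x \<noteq> y}"
  have finS: "finite S" unfolding S_def
    by (rule finite_imageI) (rule finite_subset[of _ "D \<times> D"], use D in auto)
  define \<delta> where "\<delta> = Min (insert 1 S)"
  have \<delta>: "0 < \<delta>" unfolding \<delta>_def using finS by (subst Min_gr_iff) (auto simp: S_def)
  have gap: "\<delta> \<le> \<bar>x - y\<bar>" if "x \<in> D" "y \<in> D" "x \<noteq> y" for x y
  proof -
    have "\<bar>x - y\<bar> \<in> S" unfolding S_def using that by force
    then show ?thesis unfolding \<delta>_def using finS by (intro Min_le) auto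
  qed
  have "\<exists>n u v. 0 \<le> u \<and> u < v \<and> v \<le> L \<and> affine_on (f ^^ n) (\<gamma> ^ n) u v \<and> \<delta> \<le> \<gamma> ^ n * (v - u) \<and>
      measure M ({u<..<v} - A) < \<epsilon> * (v - u)"
    if A: "A \<in> sets M" "measure M A > 0" and \<epsilon>: "0 < \<epsilon>" "\<epsilon> < 1" for A \<epsilon>
  proof (rule ccontr)
    assume neg: "\<not> ?thesis"
    \<comment> \<open>The excess of \<open>A\<close> over the density \<open>1 - \<epsilon>\<close>
      in an interval. By the negated goal it is at most zero on every piece with a long image; on
      any piece it is at most \<epsilon> times the length.\<close>
    define ex where "ex u v = measure M ({u<..<v} \<inter> A) - (1 - \<epsilon>) * (v - u)" for u v
    have Jm: "{u<..<v} \<inter> A \<in> sets M" if "0 \<le> u" "v \<le> L" for u v using A interval_M[OF that] by blast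
    have long: "ex u v \<le> 0" if "0 \<le> u" "u < v" "v \<le> L" "affine_on (f ^^ n) (\<gamma> ^ n) u v" "\<delta> \<le> \<gamma> ^ n * (v - u)" for u v n
    proof -
      have "\<epsilon> * (v - u) \<le> measure M ({u<..<v} - A)" using neg that by (meson not_le)
      also have "{u<..<v} - A = {u<..<v} - ({u<..<v} \<inter> A)" by blast
      also have "measure M \<dots> = measure M {u<..<v} - measure M ({u<..<v} \<inter> A)"
        using that by (intro M.finite_measure_Diff interval_M Jm) auto
      finally show ?thesis using measure_interval[of u v] that by (simp add: ex_def algebra_simps)
    qed
    have triv: "ex u v \<le> \<epsilon> * (v - u)" if "0 \<le> u" "u < v" "v \<le> L" for u v
    proof -
      have "measure M ({u<..<v} \<inter> A) \<le> measure M {u<..<v}"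
        using that by (intro M.finite_measure_mono interval_M) auto
      then show ?thesis using measure_interval[of u v] that by (simp add: ex_def algebra_simps)
    qed
    have split: "ex u v \<le> ex u x + ex x v" if "0 \<le> u" "u < x" "x < v" "v \<le> L" for u x v
    proof -
      have "measure M ({u<..<v} \<inter> A) \<le> measure M (({u<..<x} \<inter> A \<union> {x<..<v} \<inter> A) \<union> {x})"
        using that by (intro M.finite_measure_mono sets.Un Jm) (auto simp: sets_M)
      also have "\<dots> \<le> measure M ({u<..<x} \<inter> A \<union> {x<..<v} \<inter> A) + measure M {x}"
        using that by (intro measure_Un_le sets.Un Jm) (auto simp: sets_M)
      also have "measure M ({u<..<x} \<inter> A \<union> {x<..<v} \<inter> A) \<le> measure M ({u<..<x} \<inter> A) + measure M ({x<..<v} \<inter> A)"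
        using that by (intro measure_Un_le Jm) auto
      finally show ?thesis by (simp add: ex_def singleton_null algebra_simps)
    qed
    \<comment> \<open>After \<open>k\<close> further steps there are at most \<open>2 ^ k\<close>
      short pieces, each of length below \<open>\<delta> / \<gamma> ^ (n + k)\<close>; pieces that
      became long on the way contribute nothing positive.\<close>
    have main: "ex u v \<le> 2 ^ k * (\<epsilon> * \<delta> / \<gamma> ^ (n + k))"
      if "0 \<le> u" "u < v" "v \<le> L" "affine_on (f ^^ n) (\<gamma> ^ n) u v" "\<gamma> ^ n * (v - u) < \<delta>" for k n u v
      using that
    proof (induction k arbitrary: n u v)
      case 0
      have "v - u \<le> \<delta> / \<gamma> ^ n" using 0 \<gamma> by (simp add: field_simps)
      then have "\<epsilon> * (v - u) \<le> \<epsilon> * (\<delta> / \<gamma> ^ n)" using \<epsilon> by (intro mult_left_mono) auto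
      then show ?case using triv[of u v] 0 by simp
    next
      case (Suc k)
      define b where "b = 2 ^ k * (\<epsilon> * \<delta> / \<gamma> ^ (n + Suc k))"
      have b: "0 \<le> b" using \<epsilon> \<delta> \<gamma> by (simp add: b_def)
      have piece: "ex x y \<le> b" if "0 \<le> x" "x < y" "y \<le> L" "affine_on (f ^^ Suc n) (\<gamma> ^ Suc n) x y" for x y
      proof (cases "\<delta> \<le> \<gamma> ^ Suc n * (y - x)")
        case True
        then show ?thesis using long[OF that] b by linarith
      next
        case False
        then show ?thesis using Suc.IH[OF that] by (simp add: b_def)
      qed
      obtain u' v' where im: "(f ^^ n) ` {u<..<v} = {u'<..<v'}" "v' - u' = \<gamma> ^ n * (v - u)" "0 \<le> u'" "u' < v'" "v' \<le> L"
        by (rule image_interval[OF Suc.prems(1-4)])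
      have "ex u v \<le> b + b"
      proof (cases "{u'<..<v'} \<inter> D = {}")
        case True
        have "affine_on (f ^^ Suc n) (\<gamma> ^ Suc n) u v"
          by (rule affine_Suc[OF Suc.prems(1-4)]) (use im True in auto)
        then show ?thesis using piece[OF Suc.prems(1-3)] b by simp
      next
        case False
        then obtain p where p: "p \<in> D" "p \<in> {u'<..<v'}" by blast
        have only: "q = p" if "q \<in> D" "q \<in> {u'<..<v'}" for q
        proof (rule ccontr)
          assume "q \<noteq> p"
          then have "\<delta> \<le> \<bar>q - p\<bar>" using gap that(1) p(1) by blast
          also have "\<bar>q - p\<bar> < v' - u'" using that p(2) by auto
          finally show False using im(2) Suc.prems(5) by simp
        qed
        have "p \<in> (f ^^ n) ` {u<..<v}" using p(2) im(1) by simp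
        then obtain x where x: "x \<in> {u<..<v}" "(f ^^ n) x = p" by blast
        have av: "affine_on (f ^^ n) (\<gamma> ^ n) u x" "affine_on (f ^^ n) (\<gamma> ^ n) x v"
          using affine_on_mono[OF Suc.prems(4)] x by auto
        have sub: "affine_on (f ^^ Suc n) (\<gamma> ^ Suc n) y z"
          if yz: "y = u \<and> z = x \<or> y = x \<and> z = v" for y z
        proof -
          have o: "0 \<le> y" "y < z" "z \<le> L" "affine_on (f ^^ n) (\<gamma> ^ n) y z" using yz x av Suc.prems by auto
          obtain y' z' where im': "(f ^^ n) ` {y<..<z} = {y'<..<z'}" "z' - y' = \<gamma> ^ n * (z - y)" "0 \<le> y'" "y' < z'" "z' \<le> L"
            by (rule image_interval[OF o])
          have "x \<notin> {y<..<z}" "{y<..<z} \<subseteq> {u<..<v}" using yz x by auto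
          have "p \<notin> (f ^^ n) ` {y<..<z}"
          proof
            assume "p \<in> (f ^^ n) ` {y<..<z}"
            then obtain w where w: "w \<in> {y<..<z}" "(f ^^ n) w = p" by auto
            obtain s e where s: "s = 1 \<or> s = -1" "\<forall>x\<in>{u<..<v}. (f ^^ n) x = s * \<gamma> ^ n * x + e"
              using Suc.prems(4) unfolding affine_on_def by blast
            have "s * \<gamma> ^ n * w = s * \<gamma> ^ n * x"
              using s(2)[rule_format, of w] s(2)[rule_format, of x] w x \<open>{y<..<z} \<subseteq> {u<..<v}\<close> by auto
            then have "w = x" using s(1) \<gamma> by auto
            then show False using w(1) \<open>x \<notin> {y<..<z}\<close> by simp
          qed
          moreover have "{y'<..<z'} \<subseteq> {u'<..<v'}"
            unfolding im(1)[symmetric] im'(1)[symmetric] using \<open>{y<..<z} \<subseteq> {u<..<v}\<close> by blast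
          ultimately have "{y'<..<z'} \<inter> D = {}" using only im'(1) by blast
          then show ?thesis by (intro affine_Suc[OF o _ im'(3-5)]) (use im' in auto)
        qed
        have "ex u x \<le> b" "ex x v \<le> b" using piece sub x Suc.prems by auto
        moreover have "ex u v \<le> ex u x + ex x v" using split[of u x v] x Suc.prems by auto
        ultimately show ?thesis by linarith
      qed
      also have "b + b = 2 ^ Suc k * (\<epsilon> * \<delta> / \<gamma> ^ (n + Suc k))" by (simp add: b_def)
      finally show ?case .
    qed
    \<comment> \<open>From \<open>n = 0\<close> the bound tends to zero as \<open>k\<close> grows,
      because \<open>\<gamma> > 2\<close>. So \<open>A\<close> nowhere exceeds the density
      \<open>1 - \<epsilon>\<close> and is null.\<close>
    have le0: "ex u v \<le> 0" if uv: "0 \<le> u" "u < v" "v \<le> L" for u v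
    proof -
      have aff: "affine_on (f ^^ 0) (\<gamma> ^ 0) u v" unfolding affine_on_def by (intro exI[of _ 1] exI[of _ 0]) simp
      show ?thesis
      proof (cases "\<delta> \<le> \<gamma> ^ 0 * (v - u)")
        case True
        then show ?thesis using long[OF uv aff] by simp
      next
        case False
        have "ex u v \<le> (2 / \<gamma>) ^ k * (\<epsilon> * \<delta>)" for k
          using main[OF uv aff, of k] False by (simp add: power_divide)
        moreover have "(\<lambda>k. (2 / \<gamma>) ^ k * (\<epsilon> * \<delta>)) \<longlonglongrightarrow> 0 * (\<epsilon> * \<delta>)"
          using assms by (intro tendsto_mult LIMSEQ_realpow_zero tendsto_const) auto
        ultimately show ?thesis by (intro LIMSEQ_le_const[of "\<lambda>k. (2 / \<gamma>) ^ k * (\<epsilon> * \<delta>)"]) auto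
      qed
    qed
    have "emeasure lborel A = 0"
    proof (rule null_if_thin[OF L])
      show "A \<in> sets borel" "A \<subseteq> {0..L}" using A by (auto simp: sets_M)
      show "0 \<le> 1 - \<epsilon>" "1 - \<epsilon> < 1" using \<epsilon> by auto
      fix u v :: real assume uv: "0 \<le> u" "u < v" "v \<le> L"
      have s: "{u<..<v} \<inter> A \<subseteq> {0..L}" using A by (auto simp: sets_M)
      have "emeasure lborel (A \<inter> {u<..<v}) = ennreal (measure M ({u<..<v} \<inter> A))"
        using M.emeasure_eq_measure[of "{u<..<v} \<inter> A"] emeasure_M[OF s] by (simp add: Int_commute)
      also have "\<dots> \<le> ennreal ((1 - \<epsilon>) * (v - u))" using le0[OF uv] by (intro ennreal_leI) (simp add: ex_def)
      finally show "emeasure lborel (A \<inter> {u<..<v}) \<le> ennreal ((1 - \<epsilon>) * (v - u))" .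
    qed
    then show False using A emeasure_M[of A] by (simp add: sets_M measure_def)
  qed
  with \<delta> show thesis using that by blast
qed

end

lemma pw_affine_comp:
  assumes "pw_affine L \<gamma> f D" "pw_affine L \<gamma>' g D'"
  shows "pw_affine L (\<gamma> * \<gamma>') (f \<circ> g) (D' \<union> {x \<in> {0..L}. g x \<in> D})"
proof -
  interpret f: pw_affine L \<gamma> f D by fact
  interpret g: pw_affine L \<gamma>' g D' by fact
  show ?thesis
  proof
    show "0 < L" by (rule f.L)
    show "1 < \<gamma> * \<gamma>'" using f.\<gamma> g.\<gamma> by (rule less_1_mult)
    have "{x \<in> {0..L}. g x \<in> D} = (\<Union>y\<in>D. {x \<in> {0..L}. g x = y})" by blast
    then show "finite (D' \<union> {x \<in> {0..L}. g x \<in> D})" using f.D g.D g.fibre by simp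
    show "(f \<circ> g) x \<in> {0..L}" if "x \<in> {0..L}" for x using f.range[OF g.range[OF that]] by simp
    show "finite {x \<in> {0..L}. (f \<circ> g) x = y}" for y
    proof -
      have "{x \<in> {0..L}. (f \<circ> g) x = y} \<subseteq> (\<Union>w\<in>{w \<in> {0..L}. f w = y}. {x \<in> {0..L}. g x = w})"
        using g.range by auto
      then show ?thesis by (rule finite_subset) (intro finite_UN_I f.fibre g.fibre)
    qed
    fix u v assume uv: "0 \<le> u" "u < v" "v \<le> L" "{u<..<v} \<inter> (D' \<union> {x \<in> {0..L}. g x \<in> D}) = {}"
    have ag: "affine_on g \<gamma>' u v" using uv by (intro g.affine) auto
    have "affine_on (g ^^ 1) (\<gamma>' ^ 1) u v" using ag by simp
    obtain u' v' where im0: "(g ^^ 1) ` {u<..<v} = {u'<..<v'}" "v' - u' = \<gamma>' ^ 1 * (v - u)" "0 \<le> u'" "u' < v'" "v' \<le> L"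
      by (rule g.image_interval[OF uv(1-3) \<open>affine_on (g ^^ 1) (\<gamma>' ^ 1) u v\<close>])
    then have im: "g ` {u<..<v} = {u'<..<v'}" "0 \<le> u'" "u' < v'" "v' \<le> L" by simp_all
    have "{u'<..<v'} \<inter> D = {}"
    proof -
      have "g x \<notin> D" if "x \<in> {u<..<v}" for x using uv that by auto
      then show ?thesis unfolding im(1)[symmetric] by blast
    qed
    then have "affine_on f \<gamma> u' v'" using im by (intro f.affine) auto
    then show "affine_on (f \<circ> g) (\<gamma> * \<gamma>') u v" using affine_on_comp[OF ag] im(1) by simp
  qed
qed

text \<open>Serves to raise the slope above 2, as the growth argument demands.\<close>

lemma pw_affine_power:
  assumes "pw_affine L \<gamma> f D"
  shows "\<exists>D'. pw_affine L (\<gamma> ^ Suc n) (f ^^ Suc n) D'"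
proof (induction n)
  case 0
  then show ?case using assms by auto
next
  case (Suc n)
  then obtain D' where "pw_affine L (\<gamma> ^ Suc n) (f ^^ Suc n) D'" by blast
  from pw_affine_comp[OF assms this] show ?case by (simp only: funpow.simps power_Suc) blast
qed

section \<open>Measurability, nonsingularity and coverings\<close>

context pw_affine
begin

lemma meas_f: "f \<in> measurable M M"
proof -
  define U where "U = {0<..<L} - D"
  have oU: "open U" unfolding U_def using D by (intro open_Diff finite_imp_closed) auto
  have cont: "isCont f x" if x: "x \<in> U" for x
  proof -
    obtain e where e: "e > 0" "ball x e \<subseteq> U" using oU x openE by blast
    have b: "{x - e<..<x + e} \<subseteq> U" using e(2) by (simp add: ball_eq_greaterThanLessThan)
    then have "x - e < x + e" "{x - e<..<x + e} \<subseteq> {0..L}" using e by (auto simp: U_def)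
    then have "0 \<le> x - e" "x + e \<le> L" by (simp_all add: greaterThanLessThan_subseteq_atLeastAtMost_iff)
    then have "affine_on f \<gamma> (x - e) (x + e)" using b e by (intro affine) (auto simp: U_def)
    then obtain s c where sc: "\<forall>y\<in>{x - e<..<x + e}. f y = s * \<gamma> * y + c" unfolding affine_on_def by blast
    have "\<forall>\<^sub>F y in nhds x. f y = s * \<gamma> * y + c"
      using sc e by (intro eventually_nhds_in_open[of "{x - e<..<x + e}", THEN eventually_mono]) auto
    then show ?thesis by (subst isCont_cong) (auto intro!: continuous_intros)
  qed
  \<comment> \<open>Setting the map to zero outside \<open>U\<close> gives a function on the whole
    line with finitely many discontinuities; on \<open>{0..L}\<close> it differs from
    \<open>f\<close> at finitely many points only.\<close>
  define h where "h x = (if x \<in> U then f x else 0)" for x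
  have "continuous_on (- ({0, L} \<union> D)) h"
  proof (intro continuous_at_imp_continuous_on ballI)
    fix x assume x: "x \<in> - ({0, L} \<union> D)"
    show "isCont h x"
    proof (cases "x \<in> U")
      case True
      have "\<forall>\<^sub>F y in nhds x. h y = f y"
        using eventually_nhds_in_open[OF oU True] by eventually_elim (simp add: h_def)
      then show ?thesis using cont[OF True] by (subst isCont_cong)
    next
      case False
      then have "x \<in> - {0..L}" using x by (auto simp: U_def)
      then have "\<forall>\<^sub>F y in nhds x. y \<in> - {0..L}" by (intro eventually_nhds_in_open) auto
      then have "\<forall>\<^sub>F y in nhds x. h y = 0" by eventually_elim (auto simp: h_def U_def)
      then show ?thesis by (subst isCont_cong) auto
    qed
  qed
  then have "h \<in> borel_measurable borel"
    using D by (intro borel_measurable_continuous_countable_exceptions[of "{0, L} \<union> D"]) (auto intro: countable_finite)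
  then have "h \<in> borel_measurable M" unfolding M_def by (intro measurable_restrict_space1) simp
  moreover have "h x \<in> {0..L}" if "x \<in> space M" for x using range that L by (auto simp: h_def space_M)
  ultimately have hM: "h \<in> measurable M M"
    unfolding M_def by (intro measurable_restrict_space2) (auto simp: space_M[unfolded M_def])
  show ?thesis
  proof (rule measurable_discrete_difference[OF hM, of "({0, L} \<union> D) \<inter> {0..L}"])
    show "countable (({0, L} \<union> D) \<inter> {0..L})" using D by (intro countable_finite) auto
    show "{x} \<in> sets M" if "x \<in> ({0, L} \<union> D) \<inter> {0..L}" for x using that by (auto simp: sets_M)
    show "f x \<in> space M" if "x \<in> ({0, L} \<union> D) \<inter> {0..L}" for x using that range by (auto simp: space_M)
    show "h x = f x" if "x \<in> space M" "x \<notin> ({0, L} \<union> D) \<inter> {0..L}" for x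
      using that by (auto simp: h_def U_def space_M)
  qed
qed

lemma nonsing_f:
  assumes N: "N \<in> null_sets M"
  shows "f -` N \<inter> space M \<in> null_sets M"
proof -
  \<comment> \<open>Countably many rational intervals free of break points cover all but finitely
    many points, and \<open>f\<close> is affine on each.\<close>
  define I where "I = {(p, q) \<in> \<rat> \<times> \<rat>. 0 \<le> p \<and> p < q \<and> q \<le> L \<and> {p<..<q} \<inter> D = {}}"
  have cI: "countable I"
    by (rule countable_subset[of _ "\<rat> \<times> \<rat>"]) (auto simp: I_def intro: countable_SIGMA countable_rat)
  have Nm: "N \<in> sets M" using N by auto
  have null: "{p<..<q} \<inter> f -` N \<in> null_sets M" if "(p, q) \<in> I" for p q :: real
  proof -
    have pq: "0 \<le> p" "p < q" "q \<le> L" and a: "affine_on (f ^^ 1) (\<gamma> ^ 1) p q" using that affine[of p q] by (auto simp: I_def)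
    have "f ` {p<..<q} \<inter> N \<in> null_sets M"
    proof (rule null_sets_subset[OF N])
      obtain p' q' where im: "(f ^^ 1) ` {p<..<q} = {p'<..<q'}" "q' - p' = \<gamma> ^ 1 * (q - p)" "0 \<le> p'" "p' < q'" "q' \<le> L"
        by (rule image_interval[OF pq a])
      then show "f ` {p<..<q} \<inter> N \<in> sets M" using Nm interval_M by auto
    qed auto
    then have "\<gamma> ^ 1 * measure M ({p<..<q} \<inter> f -` N) = 0"
      using vimage_interval(2)[OF pq a Nm] by (simp add: measure_def null_setsD1)
    then have "measure M ({p<..<q} \<inter> f -` N) = 0" using \<gamma> by simp
    then show ?thesis using vimage_interval(1)[OF pq a Nm] by (simp add: null_sets_def M.emeasure_eq_measure)
  qed
  have "(\<Union>(p, q)\<in>I. {p<..<q} \<inter> f -` N) \<in> null_sets M"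
    using cI null by (intro null_sets_UN') auto
  moreover have "({0, L} \<union> D) \<inter> {0..L} \<in> null_sets M" using D by (intro countable_null countable_finite) auto
  ultimately have un: "(\<Union>(p, q)\<in>I. {p<..<q} \<inter> f -` N) \<union> (({0, L} \<union> D) \<inter> {0..L}) \<in> null_sets M" by (rule null_sets.Un)
  show ?thesis
  proof (rule null_sets_subset[OF un])
    show "f -` N \<inter> space M \<in> sets M" using meas_f Nm by (rule measurable_sets)
    show "f -` N \<inter> space M \<subseteq> (\<Union>(p, q)\<in>I. {p<..<q} \<inter> f -` N) \<union> (({0, L} \<union> D) \<inter> {0..L})"
    proof
      fix x assume x: "x \<in> f -` N \<inter> space M"
      show "x \<in> (\<Union>(p, q)\<in>I. {p<..<q} \<inter> f -` N) \<union> (({0, L} \<union> D) \<inter> {0..L})"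
      proof (cases "x \<in> {0<..<L} - D")
        case True
        have "open ({0<..<L} - D)" using D by (intro open_Diff finite_imp_closed) auto
        then obtain e where e: "e > 0" "ball x e \<subseteq> {0<..<L} - D" using True openE by blast
        then have b: "{x - e<..<x + e} \<subseteq> {0<..<L} - D" by (simp add: ball_eq_greaterThanLessThan)
        obtain p where p: "p \<in> \<rat>" "x - e < p" "p < x" using Rats_dense_in_real[of "x - e" x] e by auto
        obtain q where q: "q \<in> \<rat>" "x < q" "q < x + e" using Rats_dense_in_real[of x "x + e"] e by auto
        have "p \<in> {x - e<..<x + e}" "q \<in> {x - e<..<x + e}" using p q by auto
        then have "0 < p" "q < L" using b by auto
        moreover have "{p<..<q} \<subseteq> {x - e<..<x + e}" using p q by auto
        then have "{p<..<q} \<inter> D = {}" using b by blast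
        ultimately have "(p, q) \<in> I" using p q by (auto simp: I_def)
        moreover have "x \<in> {p<..<q} \<inter> f -` N" using x p q by auto
        ultimately show ?thesis by (intro UnI1 UN_I[of "(p, q)"]) auto
      qed (use x in \<open>auto simp: space_M\<close>)
    qed
  qed
qed

sublocale nonsingular_map M f
  by unfold_locales (use meas_f nonsing_f in auto)

text \<open>The measure-theoretic trace of a branch of \<open>f ^^ n\<close> that maps a part of
  \<open>K\<close> onto \<open>V\<close> with slope \<open>\<gamma> ^ n\<close>. As an inequality
  for all \<open>E\<close> it composes, and it survives unions of images, which come from several
  branches.\<close>

definition covers :: "real set \<Rightarrow> nat \<Rightarrow> real set \<Rightarrow> bool" where
  "covers K n V \<longleftrightarrow> (\<forall>E\<in>sets M. measure M (V \<inter> E) \<le> \<gamma> ^ n * measure M (K \<inter> (f ^^ n) -` E))"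

lemma vimage_M: "K \<in> sets M \<Longrightarrow> E \<in> sets M \<Longrightarrow> K \<inter> (f ^^ n) -` E \<in> sets M"
proof -
  assume K: "K \<in> sets M" "E \<in> sets M"
  have "K \<inter> (f ^^ n) -` E = K \<inter> ((f ^^ n) -` E \<inter> space M)" using sets.sets_into_space[OF K(1)] by blast
  also have "\<dots> \<in> sets M" using K measurable_sets[OF meas_funpow K(2)] by blast
  finally show ?thesis .
qed

lemma covers_sub: "K \<in> sets M \<Longrightarrow> W \<subseteq> K \<Longrightarrow> covers K 0 W"
  unfolding covers_def by (auto intro!: M.finite_measure_mono)

lemma covers_trans:
  assumes "covers K n V" "covers V m W" "K \<in> sets M" "V \<in> sets M"
  shows "covers K (n + m) W"
  unfolding covers_def
proof
  fix E assume E: "E \<in> sets M"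
  define E' where "E' = (f ^^ m) -` E \<inter> space M"
  have E': "E' \<in> sets M" unfolding E'_def using meas_funpow E by (rule measurable_sets)
  have "measure M (W \<inter> E) \<le> \<gamma> ^ m * measure M (V \<inter> (f ^^ m) -` E)" using assms(2) E unfolding covers_def by blast
  also have "V \<inter> (f ^^ m) -` E = V \<inter> E'" using sets.sets_into_space[OF assms(4)] by (auto simp: E'_def)
  also have "\<gamma> ^ m * measure M (V \<inter> E') \<le> \<gamma> ^ m * (\<gamma> ^ n * measure M (K \<inter> (f ^^ n) -` E'))"
    using assms(1) E' \<gamma> unfolding covers_def by (intro mult_left_mono) auto
  also have "K \<inter> (f ^^ n) -` E' = K \<inter> (f ^^ (n + m)) -` E"
  proof -
    have "(f ^^ n) x \<in> E' \<longleftrightarrow> (f ^^ (n + m)) x \<in> E" if "x \<in> K" for x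
    proof -
      have "(f ^^ (n + m)) x = (f ^^ m) ((f ^^ n) x)" by (simp add: add.commute[of n m] funpow_add)
      moreover have "(f ^^ n) x \<in> space M" using space_funpow[of x n] sets.sets_into_space[OF assms(3)] that by blast
      ultimately show ?thesis by (simp add: E'_def)
    qed
    then show ?thesis by blast
  qed
  finally show "measure M (W \<inter> E) \<le> \<gamma> ^ (n + m) * measure M (K \<inter> (f ^^ (n + m)) -` E)"
    by (simp add: power_add mult_ac)
qed

text \<open>Every point of the union is charged to one member only: \<open>E\<close> is split along
  the members, and the corresponding preimages in \<open>K\<close> are disjoint.\<close>

lemma covers_Union:
  assumes "finite J" "K \<in> sets M" "\<And>j. j \<in> J \<Longrightarrow> V j \<in> sets M \<and> covers K n (V j)"
  shows "covers K n (\<Union>j\<in>J. V j)"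
  using assms(1,3)
proof (induction J)
  case empty
  then show ?case using \<gamma> by (simp add: covers_def)
next
  case (insert j J)
  define W where "W = (\<Union>j\<in>J. V j)"
  have W: "W \<in> sets M" unfolding W_def using insert by (intro sets.finite_UN) auto
  have cW: "covers K n W" unfolding W_def using insert by blast
  have Vj: "V j \<in> sets M" "covers K n (V j)" using insert by auto
  show ?case unfolding covers_def
  proof
    fix E assume E: "E \<in> sets M"
    have "(\<Union>j\<in>insert j J. V j) \<inter> E = (W \<inter> E) \<union> (V j \<inter> (E - W))" by (auto simp: W_def)
    then have "measure M ((\<Union>j\<in>insert j J. V j) \<inter> E) \<le> measure M (W \<inter> (E \<inter> W)) + measure M (V j \<inter> (E - W))"
      using measure_Un_le[of "W \<inter> E" M "V j \<inter> (E - W)"] W Vj E by (simp add: Int_left_commute Int_commute)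
    also have "\<dots> \<le> \<gamma> ^ n * measure M (K \<inter> (f ^^ n) -` (E \<inter> W)) + \<gamma> ^ n * measure M (K \<inter> (f ^^ n) -` (E - W))"
      using cW[unfolded covers_def, rule_format, of "E \<inter> W"] Vj(2)[unfolded covers_def, rule_format, of "E - W"] E W
      by (intro add_mono) blast+
    also have "\<dots> = \<gamma> ^ n * (measure M (K \<inter> (f ^^ n) -` (E \<inter> W)) + measure M (K \<inter> (f ^^ n) -` (E - W)))"
      by (simp add: distrib_left)
    also have "measure M (K \<inter> (f ^^ n) -` (E \<inter> W)) + measure M (K \<inter> (f ^^ n) -` (E - W))
        = measure M ((K \<inter> (f ^^ n) -` (E \<inter> W)) \<union> (K \<inter> (f ^^ n) -` (E - W)))"
      using E W assms(2) by (intro M.finite_measure_Union[symmetric] vimage_M) auto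
    also have "(K \<inter> (f ^^ n) -` (E \<inter> W)) \<union> (K \<inter> (f ^^ n) -` (E - W)) = K \<inter> (f ^^ n) -` E" by blast
    finally show "measure M ((\<Union>j\<in>insert j J. V j) \<inter> E) \<le> \<gamma> ^ n * measure M (K \<inter> (f ^^ n) -` E)" .
  qed
qed

lemma covers_affine:
  assumes "0 \<le> u" "u < v" "v \<le> L" "affine_on (f ^^ n) (\<gamma> ^ n) u v"
  shows "covers {u<..<v} n ((f ^^ n) ` {u<..<v})"
  unfolding covers_def using vimage_interval(2)[OF assms] by simp

text \<open>By the growth lemma some image has length at least \<open>\<delta>\<close>, hence contains one of finitely many grid
  intervals; this bounds the time needed to reach some \<open>Z l\<close> independently of \<open>e\<close>.\<close>

lemma spread:
  assumes cov: "\<And>u v. 0 \<le> u \<Longrightarrow> u < v \<Longrightarrow> v \<le> L \<Longrightarrow> \<exists>n. \<exists>l<r. covers {u<..<v} n (Z l)"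
    and Z: "\<And>l. l < r \<Longrightarrow> Z l \<in> sets M"
    and A: "A \<in> sets M" "measure M A > 0" and e: "e > 0"
  shows "\<exists>n. \<exists>l<r. \<forall>B\<in>sets M. (AE x in M. x \<in> A \<longrightarrow> (f ^^ n) x \<in> B) \<longrightarrow> measure M (Z l - B) < e"
proof -
  \<comment> \<open>An iterate with slope above 2, to which \<open>growth\<close> applies.\<close>
  obtain N where N: "2 < \<gamma> ^ N" using real_arch_pow[OF \<gamma>, of 2] by blast
  then have "N \<noteq> 0" by (intro notI) simp
  then obtain N' where N': "N = Suc N'" using not0_implies_Suc by blast
  obtain D' where "pw_affine L (\<gamma> ^ N) (f ^^ N) D'"
    using pw_affine_power[OF pw_affine_axioms, of N'] unfolding N' by blast
  then interpret g: pw_affine L "\<gamma> ^ N" "f ^^ N" D' .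
  obtain \<delta> where \<delta>: "0 < \<delta>" and grow: "\<And>\<epsilon>. 0 < \<epsilon> \<Longrightarrow> \<epsilon> < 1 \<Longrightarrow>
    \<exists>n u v. 0 \<le> u \<and> u < v \<and> v \<le> L \<and> affine_on ((f ^^ N) ^^ n) ((\<gamma> ^ N) ^ n) u v \<and> \<delta> \<le> (\<gamma> ^ N) ^ n * (v - u) \<and>
      measure M ({u<..<v} - A) < \<epsilon> * (v - u)"
    using g.growth[OF N] A by metis
  \<comment> \<open>An interval of length at least \<open>\<delta> = 2 * h\<close> contains a full
    grid cell of length \<open>h\<close>.\<close>
  define h where "h = \<delta> / 2"
  have h: "h > 0" using \<delta> by (simp add: h_def)
  define J where "J = {j::nat. real j * h + h \<le> L}"
  have finJ: "finite J"
  proof -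
    obtain m :: nat where m: "L < real m * h" using reals_Archimedean3[OF h] by blast
    have "j < m" if "j \<in> J" for j
    proof -
      have "real j * h + h \<le> L" using that by (simp add: J_def)
      then have "real j * h < real m * h" using m h by linarith
      then show ?thesis using mult_less_cancel_right_pos[OF h] by simp
    qed
    then show ?thesis using finite_nat_set_iff_bounded by blast
  qed
  define P where "P j nl \<longleftrightarrow> snd nl < r \<and> covers {real j * h<..<real j * h + h} (fst nl) (Z (snd nl))" for j nl
  have "\<forall>j\<in>J. \<exists>nl. P j nl"
  proof
    fix j assume "j \<in> J"
    then obtain n l where "l < r" "covers {real j * h<..<real j * h + h} n (Z l)"
      using cov[of "real j * h" "real j * h + h"] h by (auto simp: J_def)
    then have "P j (n, l)" by (simp add: P_def)
    then show "\<exists>nl. P j nl" by blast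
  qed
  then obtain F where F: "\<And>j. j \<in> J \<Longrightarrow> P j (F j)" by metis
  \<comment> \<open>Bounds the slopes of the coverings of all grid cells. It is fixed before
    \<epsilon>, so that \<epsilon> can absorb it.\<close>
  define C where "C = (\<Sum>j\<in>J. \<gamma> ^ fst (F j)) + 1"
  have Cj: "\<gamma> ^ fst (F j) \<le> C" if "j \<in> J" for j
  proof -
    have "\<gamma> ^ fst (F j) \<le> (\<Sum>j\<in>J. \<gamma> ^ fst (F j))" using finJ that \<gamma> by (intro member_le_sum) auto
    then show ?thesis by (simp add: C_def)
  qed
  have C: "C > 0" unfolding C_def using \<gamma> by (intro add_nonneg_pos sum_nonneg) auto
  define \<epsilon> where "\<epsilon> = min (1 / 2) (e / (C * L))"
  have \<epsilon>: "0 < \<epsilon>" "\<epsilon> < 1" "\<epsilon> * (C * L) \<le> e"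
  proof -
    have CL: "0 < C * L" using C L by simp
    then show "0 < \<epsilon>" "\<epsilon> < 1" using e by (auto simp: \<epsilon>_def)
    have "\<epsilon> * (C * L) \<le> (e / (C * L)) * (C * L)" using CL by (intro mult_right_mono) (auto simp: \<epsilon>_def)
    moreover have "(e / (C * L)) * (C * L) = e" using C L by simp
    ultimately show "\<epsilon> * (C * L) \<le> e" by linarith
  qed
  obtain n u v where uv: "0 \<le> u" "u < v" "v \<le> L" and aff: "affine_on (f ^^ (N * n)) (\<gamma> ^ (N * n)) u v"
    and long: "\<delta> \<le> \<gamma> ^ (N * n) * (v - u)" and dense: "measure M ({u<..<v} - A) < \<epsilon> * (v - u)"
    using grow[OF \<epsilon>(1,2)] unfolding funpow_mult power_mult[symmetric] by blast
  define q where "q = N * n"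
  obtain u' v' where im: "(f ^^ q) ` {u<..<v} = {u'<..<v'}" "v' - u' = \<gamma> ^ q * (v - u)" "0 \<le> u'" "u' < v'" "v' \<le> L"
    by (rule image_interval[OF uv aff[folded q_def]])
  \<comment> \<open>The first grid point that is not to the left of \<open>u'\<close>; rounding
    loses less than \<open>h\<close>.\<close>
  define j where "j = nat \<lceil>u' / h\<rceil>"
  have rj: "real j = of_int \<lceil>u' / h\<rceil>" using im(3) h by (simp add: j_def)
  have "u' / h \<le> real j" "real j < u' / h + 1" unfolding rj by linarith+
  then have jh: "u' \<le> real j * h" "real j * h < u' + h" using h by (simp_all add: field_simps)
  have "u' + 2 * h \<le> v'" using im(2) long by (simp add: h_def q_def)
  then have jv: "real j * h + h \<le> v'" using jh by linarith
  have jJ: "j \<in> J" using jv im(5) by (simp add: J_def)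
  define n' where "n' = fst (F j)"
  define l where "l = snd (F j)"
  have l: "l < r" and cl: "covers {real j * h<..<real j * h + h} n' (Z l)"
    using F[OF jJ] by (auto simp: P_def n'_def l_def)
  have c1: "covers {u<..<v} q {u'<..<v'}" using covers_affine[OF uv aff[folded q_def]] im(1) by simp
  have c2: "covers {u'<..<v'} 0 {real j * h<..<real j * h + h}"
    using jh jv im by (intro covers_sub interval_M) auto
  have c: "covers {u<..<v} (q + 0 + n') (Z l)"
    using jv jh im uv by (intro covers_trans[OF covers_trans[OF c1 c2] cl] interval_M) auto
  show ?thesis
  proof (intro exI[of _ "q + n'"] exI[of _ l] conjI l ballI impI)
    fix B assume B: "B \<in> sets M" and AB: "AE x in M. x \<in> A \<longrightarrow> (f ^^ (q + n')) x \<in> B"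
    have ZB: "Z l - B \<in> sets M" using Z[OF l] B by blast
    have "measure M (Z l - B) = measure M (Z l \<inter> (Z l - B))" by (simp add: Int_absorb1)
    also have "\<dots> \<le> \<gamma> ^ (q + n') * measure M ({u<..<v} \<inter> (f ^^ (q + n')) -` (Z l - B))"
      using c ZB by (simp add: covers_def)
    also have "measure M ({u<..<v} \<inter> (f ^^ (q + n')) -` (Z l - B)) \<le> measure M ({u<..<v} - A)"
    proof (rule M.finite_measure_mono_AE)
      show "AE x in M. x \<in> {u<..<v} \<inter> (f ^^ (q + n')) -` (Z l - B) \<longrightarrow> x \<in> {u<..<v} - A"
        using AB by eventually_elim auto
      show "{u<..<v} - A \<in> sets M" using interval_M[OF uv(1,3)] A(1) by blast
    qed
    also have "\<dots> < \<epsilon> * (v - u)" by (rule dense)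
    finally have "measure M (Z l - B) < \<gamma> ^ (q + n') * (\<epsilon> * (v - u))" using \<gamma> by simp
    also have "\<dots> = (\<gamma> ^ n' * \<epsilon>) * (v' - u')" by (simp add: im(2) power_add mult_ac)
    also have "\<dots> \<le> (C * \<epsilon>) * L"
      using Cj[OF jJ] \<epsilon> C im L by (intro mult_mono) (auto simp: n'_def)
    also have "\<dots> \<le> e" using \<epsilon>(3) by (simp add: mult_ac)
    finally show "measure M (Z l - B) < e" .
  qed
qed

end

section \<open>Renormalization of tent maps\<close>

text \<open>\<open>C i u v n j u' v'\<close> stands for: the \<open>n\<close>-th iterate maps a part of the interval \<open>{u<..<v}\<close> in
  chart \<open>i\<close> onto the interval \<open>{u'<..<v'}\<close> in chart \<open>j\<close>.\<close>

type_synonym covering = "nat \<Rightarrow> real \<Rightarrow> real \<Rightarrow> nat \<Rightarrow> nat \<Rightarrow> real \<Rightarrow> real \<Rightarrow> bool"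

text \<open>The skew product over the core of the tent map with slope \<open>\<sigma>\<close>: the core is rescaled to
  \<open>{0..1}\<close>, its branches are \<open>z \<mapsto> 2 - \<sigma> + \<sigma> z\<close> on the left and \<open>z \<mapsto> \<sigma> - \<sigma> z\<close> on the right of the
  turning point \<open>1 - 1 / \<sigma>\<close>, and the fibre maps are \<open>a\<close> and \<open>b\<close>.\<close>

locale tent_cover =
  fixes \<sigma> :: real and a b :: "nat \<Rightarrow> nat" and S :: "nat set" and C :: covering
  assumes slope: "1 < \<sigma>" "\<sigma> \<le> 2"
    and a_in: "\<And>i. i \<in> S \<Longrightarrow> a i \<in> S" and b_in: "\<And>i. i \<in> S \<Longrightarrow> b i \<in> S"
    and C_sub: "\<And>i u v w w'. i \<in> S \<Longrightarrow> 0 \<le> u \<Longrightarrow> v \<le> 1 \<Longrightarrow> u \<le> w \<Longrightarrow> w < w' \<Longrightarrow> w' \<le> v \<Longrightarrow> C i u v 0 i w w'"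
    and C_trans: "\<And>i u v n j u' v' m q w w'. C i u v n j u' v' \<Longrightarrow> C j u' v' m q w w' \<Longrightarrow> C i u v (n + m) q w w'"
    and C_left: "\<And>i u v. i \<in> S \<Longrightarrow> 0 \<le> u \<Longrightarrow> u < v \<Longrightarrow> v \<le> 1 - 1 / \<sigma> \<Longrightarrow> C i u v 1 (a i) (2 - \<sigma> + \<sigma> * u) (2 - \<sigma> + \<sigma> * v)"
    and C_right: "\<And>i u v. i \<in> S \<Longrightarrow> 1 - 1 / \<sigma> \<le> u \<Longrightarrow> u < v \<Longrightarrow> v \<le> 1 \<Longrightarrow> C i u v 1 (b i) (\<sigma> - \<sigma> * v) (\<sigma> - \<sigma> * u)"
begin

definition c :: real where "c = 1 - 1 / \<sigma>"

lemma c: "0 < c" "c < 1" "\<sigma> * c = \<sigma> - 1" "c \<le> 1 / 2"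
  using slope by (auto simp: c_def field_simps)

lemma C_shrink: "C i u v n j u' v' \<Longrightarrow> j \<in> S \<Longrightarrow> 0 \<le> u' \<Longrightarrow> v' \<le> 1 \<Longrightarrow> u' \<le> w \<Longrightarrow> w < w' \<Longrightarrow> w' \<le> v' \<Longrightarrow> C i u v n j w w'"
  using C_trans[OF _ C_sub, of i u v n j u' v' w w'] by simp

lemma b_pow_in: "i \<in> S \<Longrightarrow> (b ^^ n) i \<in> S"
  by (induction n) (auto intro: b_in)

text \<open>As long as an interval does not contain the turning point \<open>c\<close> in its
  interior, one step multiplies its length by \<sigma>. Lengths are at most 1, so this must
  stop.\<close>

lemma expand:
  assumes "i \<in> S" "0 \<le> u" "u < v" "v \<le> 1"
  obtains n j u' v' where "C i u v n j u' v'" "j \<in> S" "0 \<le> u'" "u' < c" "c < v'" "v' \<le> 1" "v - u \<le> v' - u'"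
proof -
  have main: "\<exists>n j u' v'. C i u v n j u' v' \<and> j \<in> S \<and> 0 \<le> u' \<and> u' < c \<and> c < v' \<and> v' \<le> 1 \<and> v - u \<le> v' - u'"
    if "1 < (v - u) * \<sigma> ^ m" "i \<in> S" "0 \<le> u" "u < v" "v \<le> 1" for m i u v
    using that
  proof (induction m arbitrary: i u v)
    case (Suc m)
    consider "u < c" "c < v" | "v \<le> c" | "c \<le> u" by linarith
    then show ?case
    proof cases
      case 1
      then show ?thesis using C_sub[of i u v u v] Suc.prems by (intro exI[of _ 0] exI[of _ i] exI[of _ u] exI[of _ v]) auto
    next
      case 2
      have st: "C i u v 1 (a i) (2 - \<sigma> + \<sigma> * u) (2 - \<sigma> + \<sigma> * v)"
        using C_left[of i u v] Suc.prems 2 by (simp add: c_def)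
      have "\<sigma> * v \<le> \<sigma> - 1" using mult_left_mono[OF 2, of \<sigma>] slope c by simp
      moreover have "\<sigma> * u < \<sigma> * v" "0 \<le> \<sigma> * u" using Suc.prems slope by auto
      ultimately have p: "0 \<le> 2 - \<sigma> + \<sigma> * u" "2 - \<sigma> + \<sigma> * u < 2 - \<sigma> + \<sigma> * v" "2 - \<sigma> + \<sigma> * v \<le> 1"
        using slope by linarith+
      have "1 < ((2 - \<sigma> + \<sigma> * v) - (2 - \<sigma> + \<sigma> * u)) * \<sigma> ^ m"
        using Suc.prems(1) by (simp add: algebra_simps)
      from Suc.IH[OF this a_in[OF Suc.prems(2)] p] obtain n j u' v' where n: "C (a i) (2 - \<sigma> + \<sigma> * u) (2 - \<sigma> + \<sigma> * v) n j u' v'" "j \<in> S" "0 \<le> u'" "u' < c"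
        "c < v'" "v' \<le> 1" "(2 - \<sigma> + \<sigma> * v) - (2 - \<sigma> + \<sigma> * u) \<le> v' - u'"
        by blast
      have "v - u \<le> \<sigma> * (v - u)" using Suc.prems slope by (simp add: mult_le_cancel_right1)
      then have "v - u \<le> v' - u'" using n(7) by (simp add: algebra_simps)
      then show ?thesis using C_trans[OF st n(1)] n by blast
    next
      case 3
      have st: "C i u v 1 (b i) (\<sigma> - \<sigma> * v) (\<sigma> - \<sigma> * u)"
        using C_right[of i u v] Suc.prems 3 by (simp add: c_def)
      have "\<sigma> - 1 \<le> \<sigma> * u" using mult_left_mono[OF 3, of \<sigma>] slope c by simp
      moreover have "\<sigma> * u < \<sigma> * v" "\<sigma> * v \<le> \<sigma>" using Suc.prems slope by auto
      ultimately have p: "0 \<le> \<sigma> - \<sigma> * v" "\<sigma> - \<sigma> * v < \<sigma> - \<sigma> * u" "\<sigma> - \<sigma> * u \<le> 1"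
        using slope by linarith+
      have "1 < ((\<sigma> - \<sigma> * u) - (\<sigma> - \<sigma> * v)) * \<sigma> ^ m"
        using Suc.prems(1) by (simp add: algebra_simps)
      from Suc.IH[OF this b_in[OF Suc.prems(2)] p] obtain n j u' v' where n: "C (b i) (\<sigma> - \<sigma> * v) (\<sigma> - \<sigma> * u) n j u' v'" "j \<in> S" "0 \<le> u'" "u' < c"
        "c < v'" "v' \<le> 1" "(\<sigma> - \<sigma> * u) - (\<sigma> - \<sigma> * v) \<le> v' - u'"
        by blast
      have "v - u \<le> \<sigma> * (v - u)" using Suc.prems slope by (simp add: mult_le_cancel_right1)
      then have "v - u \<le> v' - u'" using n(7) by (simp add: algebra_simps)
      then show ?thesis using C_trans[OF st n(1)] n by blast
    qed
  qed simp
  obtain m where "1 / (v - u) < \<sigma> ^ m" using real_arch_pow[OF slope(1)] by blast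
  then have "1 < (v - u) * \<sigma> ^ m" using assms by (simp add: field_simps)
  from main[OF this assms] show thesis using that by blast
qed

lemma full_from_c: "j \<in> S \<Longrightarrow> C i u v n j c 1 \<Longrightarrow> C i u v (n + 1) (b j) 0 1"
  using C_trans[OF _ C_right[of j c 1]] slope c by (simp add: c_def[symmetric])

text \<open>If an interval contains \<open>c\<close>, its longer half has an image with right end 1
  and length at least \<open>\<sigma> * (v - u) / 2\<close>. Either this image reaches down to
  \<open>c\<close>, and the next image is the whole core, or it lies in the right branch and grows
  by another factor \<sigma>. So each round gains at least the factor
  \<open>\<sigma>\<^sup>2 / 2 > 1\<close>.\<close>

lemma cover_full:
  assumes large: "2 < \<sigma>\<^sup>2" and "i \<in> S" "0 \<le> u" "u < v" "v \<le> 1"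
  obtains n j where "C i u v n j 0 1" "j \<in> S"
proof -
  have main: "\<exists>n j. C i u v n j 0 1 \<and> j \<in> S"
    if "1 < (v - u) * (\<sigma>\<^sup>2 / 2) ^ m" "i \<in> S" "0 \<le> u" "u < v" "v \<le> 1" for m i u v
    using that
  proof (induction m arbitrary: i u v)
    case (Suc m)
    obtain n j u' v' where n: "C i u v n j u' v'" "j \<in> S" "0 \<le> u'" "u' < c" "c < v'" "v' \<le> 1" "v - u \<le> v' - u'"
      using expand[OF Suc.prems(2-5)] by blast
    have "\<exists>q w. C i u v (n + 1) q w 1 \<and> q \<in> S \<and> 0 \<le> w \<and> w < 1 \<and> \<sigma> * (v - u) / 2 \<le> 1 - w"
    proof (cases "v' - c \<ge> (v - u) / 2")
      case True
      have "C i u v n j c v'" using C_shrink[OF n(1)] n c by auto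
      then have "C i u v (n + 1) (b j) (\<sigma> - \<sigma> * v') (\<sigma> - \<sigma> * c)"
        using C_trans[OF _ C_right[of j c v']] n c by (simp add: c_def[symmetric])
      then have Cw: "C i u v (n + 1) (b j) (\<sigma> - \<sigma> * v') 1" using c by simp
      have "\<sigma> * v' \<le> \<sigma>" using n slope by simp
      moreover have "\<sigma> * ((v - u) / 2) \<le> \<sigma> * (v' - c)" using True slope by (intro mult_left_mono) auto
      moreover have "0 < \<sigma> * (v - u)" using Suc.prems slope by simp
      moreover have "\<sigma> * (v' - c) = \<sigma> * v' - (\<sigma> - 1)" "\<sigma> * ((v - u) / 2) = \<sigma> * (v - u) / 2"
        using c by (simp_all add: algebra_simps)
      ultimately have "0 \<le> \<sigma> - \<sigma> * v'" "\<sigma> - \<sigma> * v' < 1"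
        "\<sigma> * (v - u) / 2 \<le> 1 - (\<sigma> - \<sigma> * v')" by linarith+
      then show ?thesis using Cw b_in[OF n(2)] by blast
    next
      case False
      have "C i u v n j u' c" using C_shrink[OF n(1)] n c by auto
      then have "C i u v (n + 1) (a j) (2 - \<sigma> + \<sigma> * u') (2 - \<sigma> + \<sigma> * c)"
        using C_trans[OF _ C_left[of j u' c]] n c by (simp add: c_def[symmetric])
      then have Cw: "C i u v (n + 1) (a j) (2 - \<sigma> + \<sigma> * u') 1" using c by simp
      have "0 \<le> \<sigma> * u'" using n slope by simp
      moreover have "\<sigma> * ((v - u) / 2) \<le> \<sigma> * (c - u')" using False n slope by (intro mult_left_mono) auto
      moreover have "0 < \<sigma> * (v - u)" using Suc.prems slope by simp
      moreover have "\<sigma> * (c - u') = (\<sigma> - 1) - \<sigma> * u'" "\<sigma> * ((v - u) / 2) = \<sigma> * (v - u) / 2"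
        using c by (simp_all add: algebra_simps)
      ultimately have "0 \<le> 2 - \<sigma> + \<sigma> * u'" "2 - \<sigma> + \<sigma> * u' < 1"
        "\<sigma> * (v - u) / 2 \<le> 1 - (2 - \<sigma> + \<sigma> * u')" using slope by linarith+
      then show ?thesis using Cw a_in[OF n(2)] by blast
    qed
    then obtain q w where q: "C i u v (n + 1) q w 1" "q \<in> S" "0 \<le> w" "w < 1" "\<sigma> * (v - u) / 2 \<le> 1 - w" by blast
    show ?case
    proof (cases "w \<le> c")
      case True
      then have "C i u v (n + 1) q c 1" using C_shrink[OF q(1)] q c by auto
      then show ?thesis using full_from_c[OF q(2)] b_in q by blast
    next
      case False
      have "C i u v (n + 1 + 1) (b q) 0 (\<sigma> - \<sigma> * w)"
        using C_trans[OF q(1) C_right[of q w 1]] False q by (simp add: c_def)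
      moreover have "1 < (\<sigma> - \<sigma> * w) * (\<sigma>\<^sup>2 / 2) ^ m"
      proof -
        have "\<sigma> * (\<sigma> * (v - u) / 2) \<le> \<sigma> * (1 - w)" using q slope by (intro mult_left_mono) auto
        then have "(v - u) * (\<sigma>\<^sup>2 / 2) \<le> \<sigma> - \<sigma> * w" by (simp add: power2_eq_square algebra_simps)
        then have "(v - u) * (\<sigma>\<^sup>2 / 2) * (\<sigma>\<^sup>2 / 2) ^ m \<le> (\<sigma> - \<sigma> * w) * (\<sigma>\<^sup>2 / 2) ^ m"
          using slope by (intro mult_right_mono) auto
        then show ?thesis using Suc.prems(1) by (simp add: mult.assoc)
      qed
      moreover have "\<sigma> - \<sigma> * w \<le> 1" using mult_left_mono[of c w \<sigma>] False slope c by simp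
      moreover have "0 < \<sigma> - \<sigma> * w" using q slope by simp
      ultimately show ?thesis using Suc.IH[of "\<sigma> - \<sigma> * w" 0 "b q"] b_in[OF q(2)] C_trans by (metis diff_zero order_refl)
    qed
  qed simp
  have "1 < \<sigma>\<^sup>2 / 2" using large by simp
  then obtain m where "1 / (v - u) < (\<sigma>\<^sup>2 / 2) ^ m" using real_arch_pow by blast
  then have "1 < (v - u) * (\<sigma>\<^sup>2 / 2) ^ m" using assms by (simp add: field_simps)
  from main[OF this assms(2-)] show thesis using that by blast
qed

lemma full_right: "i \<in> S \<Longrightarrow> C i 0 1 1 (b i) 0 1"
  using full_from_c[of i i 0 1 0] C_sub[of i 0 1 c 1] c by simp

lemma full_right_pow: "i \<in> S \<Longrightarrow> C i 0 1 n ((b ^^ n) i) 0 1"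
proof (induction n)
  case 0
  then show ?case using C_sub[of i 0 1 0 1] by simp
next
  case (Suc n)
  then show ?case using C_trans[OF Suc.IH full_right] b_pow_in by simp
qed

text \<open>The fixed point \<open>p = \<sigma> / (1 + \<sigma>)\<close> of the right branch is interior to the image of the left
  branch, so going around it an even number of times recovers the whole core.\<close>

lemma full_left:
  assumes large: "2 < \<sigma>\<^sup>2"
  obtains q where "odd q" "\<And>i. i \<in> S \<Longrightarrow> C i 0 1 (q + 1) ((b ^^ q) (a i)) 0 1"
proof -
  define p where "p = \<sigma> / (1 + \<sigma>)"
  have p: "\<sigma> * p = \<sigma> - p" "c < p" "p < 1" using slope by (auto simp: p_def c_def field_simps power2_eq_square)
  \<comment> \<open>Two passes through the right branch multiply the distance of the left end from
    \<open>p\<close> by \<open>\<sigma>\<^sup>2\<close>; the closing step, from \<open>c\<close> and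
    1 onto the core, makes the number of steps odd.\<close>
  have main: "\<exists>q. odd q \<and> (\<forall>j\<in>S. C j (p - x) 1 q ((b ^^ q) j) 0 1)"
    if "p - c \<le> x * (\<sigma>\<^sup>2) ^ m" "0 < x" "x \<le> p" for m x
    using that
  proof (induction m arbitrary: x)
    case 0
    have "C j (p - x) 1 1 ((b ^^ 1) j) 0 1" if "j \<in> S" for j
      using full_from_c[of j j "p - x" 1 0] C_sub[of j "p - x" 1 c 1] 0 that c by simp
    then show ?case by (intro exI[of _ 1]) auto
  next
    case (Suc m)
    show ?case
    proof (cases "p - x \<le> c")
      case True
      have "C j (p - x) 1 1 ((b ^^ 1) j) 0 1" if "j \<in> S" for j
        using full_from_c[of j j "p - x" 1 0] C_sub[of j "p - x" 1 c 1] True that c Suc.prems by simp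
      then show ?thesis by (intro exI[of _ 1]) auto
    next
      case False
      have s0: "\<sigma> * (p - x) > \<sigma> * c" using False slope by (intro mult_strict_left_mono) auto
      then have s1: "p + \<sigma> * x < 1" using p c by (simp add: algebra_simps)
      have sx: "0 < \<sigma> * x" using Suc.prems slope by simp
      have "\<sigma> * (p + \<sigma> * x) < \<sigma> * 1" using s1 slope by (intro mult_strict_left_mono) auto
      then have s2: "\<sigma>\<^sup>2 * x < p" using p by (simp add: algebra_simps power2_eq_square)
      obtain q where q: "odd q" "\<And>j. j \<in> S \<Longrightarrow> C j (p - \<sigma>\<^sup>2 * x) 1 q ((b ^^ q) j) 0 1"
        using Suc.IH[of "\<sigma>\<^sup>2 * x"] Suc.prems s2 slope by (auto simp: mult_ac)
      have "C j (p - x) 1 (q + 2) ((b ^^ (q + 2)) j) 0 1" if j: "j \<in> S" for j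
      proof -
        have "C j (p - x) 1 1 (b j) (\<sigma> - \<sigma> * 1) (\<sigma> - \<sigma> * (p - x))"
          using C_right[of j "p - x" 1] False j Suc.prems p by (simp add: c_def)
        then have "C j (p - x) 1 1 (b j) 0 (p + \<sigma> * x)" using p by (simp add: algebra_simps)
        then have 1: "C j (p - x) 1 1 (b j) c (p + \<sigma> * x)"
          using C_shrink[of j "p - x" 1 1 "b j" 0 "p + \<sigma> * x" c] b_in[OF j] c p s1 sx by simp
        have "C (b j) c (p + \<sigma> * x) 1 (b (b j)) (\<sigma> - \<sigma> * (p + \<sigma> * x)) (\<sigma> - \<sigma> * c)"
          using C_right[of "b j" c "p + \<sigma> * x"] b_in[OF j] s1 sx p by (simp add: c_def[symmetric])
        then have "C (b j) c (p + \<sigma> * x) 1 (b (b j)) (p - \<sigma>\<^sup>2 * x) 1"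
          using p c by (simp add: algebra_simps power2_eq_square)
        from C_trans[OF C_trans[OF 1 this] q(2)[OF b_in[OF b_in[OF j]]]]
        show ?thesis by (simp add: funpow_swap1)
      qed
      then show ?thesis using q(1) by (intro exI[of _ "q + 2"]) auto
    qed
  qed
  \<comment> \<open>The image of the left branch starts at \<open>2 - \<sigma>\<close>, and
    \<open>2 < \<sigma>\<^sup>2\<close> says precisely that this lies to the left of
    \<open>p\<close>.\<close>
  define x where "x = p - (2 - \<sigma>)"
  have "(2 - \<sigma>) * (1 + \<sigma>) < \<sigma>" using large by (simp add: algebra_simps power2_eq_square)
  then have x: "0 < x" "x \<le> p" using slope by (simp_all add: x_def p_def less_divide_eq)
  have "1 < \<sigma>\<^sup>2" using large by simp
  then obtain m where "(p - c) / x < (\<sigma>\<^sup>2) ^ m" using real_arch_pow by blast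
  then have "p - c \<le> x * (\<sigma>\<^sup>2) ^ m" using x by (simp add: field_simps)
  from main[OF this x] obtain q where q: "odd q" "\<And>j. j \<in> S \<Longrightarrow> C j (2 - \<sigma>) 1 q ((b ^^ q) j) 0 1"
    by (auto simp: x_def)
  have "C i 0 1 (q + 1) ((b ^^ q) (a i)) 0 1" if i: "i \<in> S" for i
  proof -
    have "C i 0 c 1 (a i) (2 - \<sigma>) 1" using C_left[of i 0 c] i c by (simp add: c_def[symmetric])
    moreover have "C i 0 1 0 i 0 c" using C_sub[of i 0 1 0 c] i c by simp
    ultimately have "C i 0 1 1 (a i) (2 - \<sigma>) 1" using C_trans by fastforce
    from C_trans[OF this q(2)[OF a_in[OF i]]] show ?thesis by simp
  qed
  then show thesis using that q(1) by blast
qed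

text \<open>If \<open>\<sigma>\<^sup>2 \<le> 2\<close>, the second iterate restricted to \<open>{0..A}\<close> with \<open>A = \<sigma> (\<sigma> - 1)\<close> is, after reversing
  the orientation, again such a skew product with slope \<open>\<sigma>\<^sup>2\<close>.\<close>

lemma renormalize:
  assumes small: "\<sigma>\<^sup>2 \<le> 2"
  defines "A \<equiv> \<sigma> * (\<sigma> - 1)"
  shows "tent_cover (\<sigma>\<^sup>2) (b \<circ> b) (b \<circ> a) S
     (\<lambda>i u v n j u' v'. C i (A * (1 - v)) (A * (1 - u)) (2 * n) j (A * (1 - v')) (A * (1 - u')))"
proof -
  have A: "0 < A" "A \<le> 2 - \<sigma>" "A \<le> 1" using slope small by (auto simp: A_def algebra_simps power2_eq_square)
  have mA: "x \<le> y \<Longrightarrow> A * x \<le> A * y" and sA: "x < y \<Longrightarrow> A * x < A * y" for x y :: real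
    using A by (auto intro: mult_left_mono)
  \<comment> \<open>The turning point \<open>1 - 1 / \<sigma>\<^sup>2\<close> of the new map
    corresponds to \<open>c\<close> under \<open>z \<mapsto> A * (1 - z)\<close>.\<close>
  have cs: "A * (1 / \<sigma>\<^sup>2) = c" using slope by (simp add: A_def c_def field_simps power2_eq_square)
  show ?thesis
  proof
    show "1 < \<sigma>\<^sup>2" using slope by (simp add: one_less_power)
    show "\<sigma>\<^sup>2 \<le> 2" by fact
    show "(b \<circ> b) i \<in> S" "(b \<circ> a) i \<in> S" if "i \<in> S" for i using that a_in b_in by auto
  next
    fix i u v w w' assume H: "i \<in> S" "0 \<le> u" "v \<le> 1" "u \<le> w" "w < w'" "w' \<le> (v::real)"
    have "A * (1 - u) \<le> A * 1" "A * (1 - w') < A * (1 - w)" "A * 0 \<le> A * (1 - v)"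
        "A * (1 - w) \<le> A * (1 - u)" "A * (1 - v) \<le> A * (1 - w')"
      using H by (intro mA sA; simp)+
    then have "C i (A * (1 - v)) (A * (1 - u)) 0 i (A * (1 - w')) (A * (1 - w))"
      using A by (intro C_sub H(1)) linarith+
    then show "C i (A * (1 - v)) (A * (1 - u)) (2 * 0) i (A * (1 - w')) (A * (1 - w))" by simp
  next
    fix i u v n j u' v' m q w w'
    assume "C i (A * (1 - v)) (A * (1 - u)) (2 * n) j (A * (1 - v')) (A * (1 - u'))"
      "C j (A * (1 - v')) (A * (1 - u')) (2 * m) q (A * (1 - w')) (A * (1 - w))"
    from C_trans[OF this] show "C i (A * (1 - v)) (A * (1 - u)) (2 * (n + m)) q (A * (1 - w')) (A * (1 - w))"
      by (simp add: algebra_simps)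
  next
    fix i u v assume H: "i \<in> S" "0 \<le> u" "u < v" "v \<le> 1 - 1 / \<sigma>\<^sup>2"
    have 1: "A * (1 / \<sigma>\<^sup>2) \<le> A * (1 - v)" "A * (1 - v) < A * (1 - u)" "A * (1 - u) \<le> A * 1"
      by (rule mA sA, use H in linarith)+
    have R1: "C i (A * (1 - v)) (A * (1 - u)) 1 (b i) (\<sigma> - \<sigma> * (A * (1 - u))) (\<sigma> - \<sigma> * (A * (1 - v)))"
      using 1 A cs unfolding c_def by (intro C_right H(1)) linarith+
    \<comment> \<open>Whichever branch the first step uses, its image lies to the right of
      \<open>c\<close>, so the second step always uses the right branch and contributes
      \<open>b\<close>. This rests on \<open>A \<le> 2 - \<sigma>\<close>, which is equivalent to
      \<open>\<sigma>\<^sup>2 \<le> 2\<close>.\<close>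
    have 2: "c \<le> \<sigma> - \<sigma> * (A * (1 - u))"
    proof -
      have "A * (1 - u) \<le> 2 - \<sigma>" using 1 A by linarith
      then have "\<sigma> * (A * (1 - u)) \<le> \<sigma> * (2 - \<sigma>)" using slope by (intro mult_left_mono) auto
      then have "A \<le> \<sigma> - \<sigma> * (A * (1 - u))" by (simp add: A_def algebra_simps)
      moreover have "c \<le> A" using 1 cs by linarith
      ultimately show ?thesis by linarith
    qed
    have 3: "\<sigma> * (A * (1 - v)) < \<sigma> * (A * (1 - u))" using mult_strict_left_mono[OF 1(2), of \<sigma>] slope by linarith
    have 4: "\<sigma> - \<sigma> * (A * (1 - v)) \<le> 1"
    proof -
      have "\<sigma> * c \<le> \<sigma> * (A * (1 - v))" using 1 cs slope by (intro mult_left_mono) linarith+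
      then show ?thesis using c by simp
    qed
    have "C (b i) (\<sigma> - \<sigma> * (A * (1 - u))) (\<sigma> - \<sigma> * (A * (1 - v))) 1 (b (b i))
        (\<sigma> - \<sigma> * (\<sigma> - \<sigma> * (A * (1 - v)))) (\<sigma> - \<sigma> * (\<sigma> - \<sigma> * (A * (1 - u))))"
      using 2 3 4 unfolding c_def by (intro C_right b_in[OF H(1)]) linarith+
    from C_trans[OF R1 this]
    have "C i (A * (1 - v)) (A * (1 - u)) 2 (b (b i))
        (\<sigma> - \<sigma> * (\<sigma> - \<sigma> * (A * (1 - v)))) (\<sigma> - \<sigma> * (\<sigma> - \<sigma> * (A * (1 - u))))" by (simp add: numeral_2_eq_2)
    moreover have "\<sigma> - \<sigma> * (\<sigma> - \<sigma> * (A * (1 - z))) = A * (1 - (2 - \<sigma>\<^sup>2 + \<sigma>\<^sup>2 * z))" for z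
      by (simp add: A_def algebra_simps power2_eq_square)
    ultimately show "C i (A * (1 - v)) (A * (1 - u)) (2 * 1) ((b \<circ> b) i)
        (A * (1 - (2 - \<sigma>\<^sup>2 + \<sigma>\<^sup>2 * v))) (A * (1 - (2 - \<sigma>\<^sup>2 + \<sigma>\<^sup>2 * u)))" by simp
  next
    fix i u v assume H: "i \<in> S" "1 - 1 / \<sigma>\<^sup>2 \<le> u" "u < v" "v \<le> (1::real)"
    have "A * (1 - u) \<le> A * (1 / \<sigma>\<^sup>2)" "A * (1 - v) < A * (1 - u)" "A * 0 \<le> A * (1 - v)"
      by (rule mA sA, use H in linarith)+
    then have 1: "A * (1 - u) \<le> A * (1 / \<sigma>\<^sup>2)" "A * (1 - v) < A * (1 - u)" "0 \<le> A * (1 - v)"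
      by simp_all
    have L1: "C i (A * (1 - v)) (A * (1 - u)) 1 (a i) (2 - \<sigma> + \<sigma> * (A * (1 - v))) (2 - \<sigma> + \<sigma> * (A * (1 - u)))"
      using 1 cs unfolding c_def by (intro C_left H(1)) linarith+
    have 2: "c \<le> 2 - \<sigma> + \<sigma> * (A * (1 - v))"
    proof -
      have "0 \<le> \<sigma> * (A * (1 - v))" using 1 slope by simp
      moreover have "c \<le> A" using cs A slope mult_left_mono[of "1 / \<sigma>\<^sup>2" 1 A] by (simp add: one_le_power)
      ultimately show ?thesis using A by linarith
    qed
    have 3: "\<sigma> * (A * (1 - v)) < \<sigma> * (A * (1 - u))" using mult_strict_left_mono[OF 1(2), of \<sigma>] slope by linarith
    have 4: "2 - \<sigma> + \<sigma> * (A * (1 - u)) \<le> 1"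
    proof -
      have "\<sigma> * (A * (1 - u)) \<le> \<sigma> * c" using 1 cs slope by (intro mult_left_mono) linarith+
      then show ?thesis using c by simp
    qed
    have "C (a i) (2 - \<sigma> + \<sigma> * (A * (1 - v))) (2 - \<sigma> + \<sigma> * (A * (1 - u))) 1 (b (a i))
        (\<sigma> - \<sigma> * (2 - \<sigma> + \<sigma> * (A * (1 - u)))) (\<sigma> - \<sigma> * (2 - \<sigma> + \<sigma> * (A * (1 - v))))"
      using 2 3 4 unfolding c_def by (intro C_right a_in[OF H(1)]) linarith+
    from C_trans[OF L1 this]
    have "C i (A * (1 - v)) (A * (1 - u)) 2 (b (a i))
        (\<sigma> - \<sigma> * (2 - \<sigma> + \<sigma> * (A * (1 - u)))) (\<sigma> - \<sigma> * (2 - \<sigma> + \<sigma> * (A * (1 - v))))" by (simp add: numeral_2_eq_2)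
    moreover have "\<sigma> - \<sigma> * (2 - \<sigma> + \<sigma> * (A * (1 - z))) = A * (1 - (\<sigma>\<^sup>2 - \<sigma>\<^sup>2 * z))" for z
      by (simp add: A_def algebra_simps power2_eq_square)
    ultimately show "C i (A * (1 - v)) (A * (1 - u)) (2 * 1) ((b \<circ> a) i)
        (A * (1 - (\<sigma>\<^sup>2 - \<sigma>\<^sup>2 * u))) (A * (1 - (\<sigma>\<^sup>2 - \<sigma>\<^sup>2 * v)))" by simp
  qed
qed

end

section \<open>Windows: cores of repeatedly renormalised maps in the original coordinate\<close>

fun win_lo win_hi :: "nat \<Rightarrow> real \<Rightarrow> real" where
  "win_lo 0 \<sigma> = 0"
| "win_lo (Suc m) \<sigma> = \<sigma> * (\<sigma> - 1) * (1 - win_hi m (\<sigma>\<^sup>2))"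
| "win_hi 0 \<sigma> = 1"
| "win_hi (Suc m) \<sigma> = \<sigma> * (\<sigma> - 1) * (1 - win_lo m (\<sigma>\<^sup>2))"

text \<open>The change of coordinates from the core of the \<open>m\<close>-th renormalisation to
  the original core. Each factor reverses the orientation, which is why \<open>win_lo\<close> and
  \<open>win_hi\<close> call each other.\<close>

fun win :: "nat \<Rightarrow> real \<Rightarrow> real \<Rightarrow> real" where
  "win 0 \<sigma> z = z"
| "win (Suc m) \<sigma> z = \<sigma> * (\<sigma> - 1) * (1 - win m (\<sigma>\<^sup>2) z)"

text \<open>The fibre maps after \<open>m\<close> renormalisations, the one of the left branch as
  first component.\<close>

fun coc :: "nat \<Rightarrow> (nat \<Rightarrow> nat) \<Rightarrow> (nat \<Rightarrow> nat) \<Rightarrow> (nat \<Rightarrow> nat) \<times> (nat \<Rightarrow> nat)" where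
  "coc 0 a b = (a, b)"
| "coc (Suc m) a b = coc m (b \<circ> b) (b \<circ> a)"

lemma slope_Suc:
  assumes "1 < \<sigma>" "\<sigma> ^ 2 ^ Suc m \<le> (2::real)"
  shows "1 < \<sigma>\<^sup>2" "(\<sigma>\<^sup>2) ^ 2 ^ m \<le> 2" "\<sigma>\<^sup>2 \<le> 2" "0 < \<sigma> * (\<sigma> - 1)" "\<sigma> * (\<sigma> - 1) \<le> 2 - \<sigma>" "\<sigma> * (\<sigma> - 1) \<le> 1"
proof -
  show 1: "1 < \<sigma>\<^sup>2" using assms by (simp add: one_less_power)
  show 2: "(\<sigma>\<^sup>2) ^ 2 ^ m \<le> 2" using assms by (simp add: power_mult[symmetric])
  have "\<sigma>\<^sup>2 \<le> (\<sigma>\<^sup>2) ^ 2 ^ m" using 1 by (intro self_le_power) auto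
  with 2 show 3: "\<sigma>\<^sup>2 \<le> 2" by simp
  show "0 < \<sigma> * (\<sigma> - 1)" using assms by simp
  show "\<sigma> * (\<sigma> - 1) \<le> 2 - \<sigma>" "\<sigma> * (\<sigma> - 1) \<le> 1" using 3 assms by (simp_all add: algebra_simps power2_eq_square)
qed

lemma win_bounds:
  "1 < \<sigma> \<Longrightarrow> \<sigma> ^ 2 ^ m \<le> 2 \<Longrightarrow> 0 \<le> win_lo m \<sigma> \<and> win_lo m \<sigma> < win_hi m \<sigma> \<and> win_hi m \<sigma> \<le> 1"
proof (induction m arbitrary: \<sigma>)
  case (Suc m)
  note s = slope_Suc[OF Suc.prems]
  define A where "A = \<sigma> * (\<sigma> - 1)"
  have A: "0 < A" "A \<le> 1" using s by (auto simp: A_def)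
  have IH: "0 \<le> win_lo m (\<sigma>\<^sup>2)" "win_lo m (\<sigma>\<^sup>2) < win_hi m (\<sigma>\<^sup>2)" "win_hi m (\<sigma>\<^sup>2) \<le> 1" using Suc.IH[OF s(1,2)] by auto
  have "0 \<le> A * (1 - win_hi m (\<sigma>\<^sup>2))" "A * (1 - win_hi m (\<sigma>\<^sup>2)) < A * (1 - win_lo m (\<sigma>\<^sup>2))"
    using IH A by simp_all
  moreover have "A * (1 - win_lo m (\<sigma>\<^sup>2)) \<le> 1 * 1" using IH A by (intro mult_mono) auto
  ultimately show ?case by (simp add: A_def)
qed simp

lemma win_image:
  assumes "1 < \<sigma>" "\<sigma> ^ 2 ^ m \<le> 2"
  shows "win m \<sigma> ` {0<..<1} = {win_lo m \<sigma><..<win_hi m \<sigma>}" "win m \<sigma> ` {0..1} = {win_lo m \<sigma>..win_hi m \<sigma>}"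
proof -
  have "win m \<sigma> ` {0<..<1} = {win_lo m \<sigma><..<win_hi m \<sigma>} \<and> win m \<sigma> ` {0..1} = {win_lo m \<sigma>..win_hi m \<sigma>}"
    using assms
  proof (induction m arbitrary: \<sigma>)
    case (Suc m)
    note s = slope_Suc[OF Suc.prems]
    define A where "A = \<sigma> * (\<sigma> - 1)"
    have A: "0 < A" using s by (simp add: A_def)
    have im: "(\<lambda>z. A * (1 - z)) ` {x<..<y} = {A * (1 - y)<..<A * (1 - x)}"
      "(\<lambda>z. A * (1 - z)) ` {x..y} = {A * (1 - y)..A * (1 - x)}" for x y
    proof -
      have inv: "w = A * (1 - (1 - w / A))" for w using A by simp
      have "w \<in> (\<lambda>z. A * (1 - z)) ` {x<..<y}" if "A * (1 - y) < w" "w < A * (1 - x)" for w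
        by (rule image_eqI[where x = "1 - w / A"]) (use that A inv in \<open>auto simp: field_simps\<close>)
      then show "(\<lambda>z. A * (1 - z)) ` {x<..<y} = {A * (1 - y)<..<A * (1 - x)}" using A by auto
      have "w \<in> (\<lambda>z. A * (1 - z)) ` {x..y}" if "A * (1 - y) \<le> w" "w \<le> A * (1 - x)" for w
        by (rule image_eqI[where x = "1 - w / A"]) (use that A inv in \<open>auto simp: field_simps\<close>)
      then show "(\<lambda>z. A * (1 - z)) ` {x..y} = {A * (1 - y)..A * (1 - x)}" using A by auto
    qed
    have w: "win (Suc m) \<sigma> = (\<lambda>z. A * (1 - z)) \<circ> win m (\<sigma>\<^sup>2)" by (simp add: fun_eq_iff A_def)
    have "win (Suc m) \<sigma> ` X = (\<lambda>z. A * (1 - z)) ` (win m (\<sigma>\<^sup>2) ` X)" for X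
      unfolding w by (simp only: image_comp)
    then show ?case using Suc.IH[OF s(1,2)] by (simp only: im[unfolded A_def] win_lo.simps win_hi.simps A_def simp_thms)
  qed (auto simp: image_def)
  then show "win m \<sigma> ` {0<..<1} = {win_lo m \<sigma><..<win_hi m \<sigma>}" "win m \<sigma> ` {0..1} = {win_lo m \<sigma>..win_hi m \<sigma>}" by auto
qed

text \<open>\<open>R i\<close> stands for the half sides to be reached from \<open>i\<close> at one
  common time; the assumption on \<open>C'\<close> provides this at the deepest level. On the way
  down, an interval around \<open>c\<close> is cut back to \<open>{0..A}\<close>, which is possible
  because \<open>c < A\<close>, and rewritten in the coordinate of the renormalised map.\<close>

lemma cover_window:
  assumes "tent_cover \<sigma> a b S C" "\<sigma> ^ 2 ^ m \<le> 2" "2 < (\<sigma> ^ 2 ^ m)\<^sup>2"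
    and "\<And>C' i. tent_cover (\<sigma> ^ 2 ^ m) (fst (coc m a b)) (snd (coc m a b)) S C' \<Longrightarrow> i \<in> S \<Longrightarrow>
           \<exists>n. \<forall>j\<in>R i. C' i 0 1 n j 0 1"
    and "i \<in> S" "0 \<le> u" "u < v" "v \<le> 1"
  shows "\<exists>n. \<exists>i'\<in>S. \<forall>j\<in>R i'. C i u v n j (win_lo m \<sigma>) (win_hi m \<sigma>)"
  using assms
proof (induction m arbitrary: \<sigma> a b C i u v)
  case 0
  interpret tent_cover \<sigma> a b S C by (rule 0)
  obtain n i' where n: "C i u v n i' 0 1" "i' \<in> S" using cover_full[of i u v] 0 by auto
  have "\<exists>q. \<forall>j\<in>R i'. C i' 0 1 q j 0 1" using "0.prems"(1) n(2) by (intro "0.prems"(4)) simp_all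
  then obtain q where "\<forall>j\<in>R i'. C i' 0 1 q j 0 1" by blast
  then have "\<forall>j\<in>R i'. C i u v (n + q) j 0 1" using C_trans[OF n(1)] by blast
  then show ?case using n(2) by auto
next
  case (Suc m)
  interpret tent_cover \<sigma> a b S C by (rule Suc)
  define A where "A = \<sigma> * (\<sigma> - 1)"
  note s = slope_Suc[OF slope(1) Suc.prems(2)]
  have A: "0 < A" "A \<le> 1" using s by (auto simp: A_def)
  have cA: "c < A"
  proof -
    have "c * \<sigma> < A * \<sigma>"
    proof -
      have "1 * (\<sigma> - 1) < \<sigma>\<^sup>2 * (\<sigma> - 1)" using s slope by (intro mult_strict_right_mono) auto
      then show ?thesis using c by (simp add: A_def power2_eq_square algebra_simps)
    qed
    then show ?thesis using slope by simp
  qed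
  define C' where "C' = (\<lambda>i u v n j u' v'. C i (A * (1 - v)) (A * (1 - u)) (2 * n) j (A * (1 - v')) (A * (1 - u')))"
  have C': "tent_cover (\<sigma>\<^sup>2) (b \<circ> b) (b \<circ> a) S C'"
    using renormalize[OF s(3)] by (simp add: C'_def A_def)
  obtain n j u' v' where n: "C i u v n j u' v'" "j \<in> S" "0 \<le> u'" "u' < c" "c < v'" "v' \<le> 1"
    by (rule expand[OF Suc.prems(5-8)])
  define w where "w = min v' A"
  have w: "u' < w" "w \<le> A" "w \<le> v'" using n cA by (auto simp: w_def)
  have nw: "C i u v n j u' w" using C_shrink[OF n(1)] n w by auto
  have e: "(\<sigma>\<^sup>2) ^ 2 ^ m = \<sigma> ^ 2 ^ Suc m" by (simp add: power_mult[symmetric])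
  have "\<exists>q. \<exists>i'\<in>S. \<forall>j'\<in>R i'. C' j (1 - w / A) (1 - u' / A) q j' (win_lo m (\<sigma>\<^sup>2)) (win_hi m (\<sigma>\<^sup>2))"
  proof (rule Suc.IH[OF C'])
    show "(\<sigma>\<^sup>2) ^ 2 ^ m \<le> 2" "2 < ((\<sigma>\<^sup>2) ^ 2 ^ m)\<^sup>2" unfolding e using Suc.prems by auto
    show "\<exists>n. \<forall>j\<in>R i. C' i 0 1 n j 0 1"
      if "tent_cover ((\<sigma>\<^sup>2) ^ 2 ^ m) (fst (coc m (b \<circ> b) (b \<circ> a))) (snd (coc m (b \<circ> b) (b \<circ> a))) S C'" "i \<in> S" for C' i
      using Suc.prems(4)[of C' i] that unfolding e by simp
    show "j \<in> S" "0 \<le> 1 - w / A" "1 - w / A < 1 - u' / A" "1 - u' / A \<le> 1"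
      using n w A by (auto simp: field_simps)
  qed
  then obtain q i' where q: "i' \<in> S"
    "\<And>j'. j' \<in> R i' \<Longrightarrow> C' j (1 - w / A) (1 - u' / A) q j' (win_lo m (\<sigma>\<^sup>2)) (win_hi m (\<sigma>\<^sup>2))" by blast
  have "C j u' w (2 * q) j' (win_lo (Suc m) \<sigma>) (win_hi (Suc m) \<sigma>)" if "j' \<in> R i'" for j'
  proof -
    have "A * (1 - (1 - w / A)) = w" "A * (1 - (1 - u' / A)) = u'" using A by simp_all
    then show ?thesis using q(2)[OF that] by (simp only: C'_def A_def win_lo.simps win_hi.simps)
  qed
  then have "\<forall>j'\<in>R i'. C i u v (n + 2 * q) j' (win_lo (Suc m) \<sigma>) (win_hi (Suc m) \<sigma>)"
    using C_trans[OF nw] by blast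
  then show ?case using q(1) by blast
qed

text \<open>The flag decides to which branch the turning point belongs; renormalisation reverses the
  orientation and hence negates it.\<close>

fun skew :: "bool \<Rightarrow> real \<Rightarrow> (nat \<Rightarrow> nat) \<Rightarrow> (nat \<Rightarrow> nat) \<Rightarrow> nat \<times> real \<Rightarrow> nat \<times> real" where
  "skew fl \<sigma> a b (i, z) = (if z < 1 - 1 / \<sigma> \<or> fl \<and> z = 1 - 1 / \<sigma> then (a i, 2 - \<sigma> + \<sigma> * z) else (b i, \<sigma> - \<sigma> * z))"

section \<open>Pointwise orbits of the skew product\<close>

lemma skew_range:
  assumes "1 < \<sigma>" "\<sigma> \<le> 2" "0 \<le> z" "z \<le> 1"
  shows "snd (skew fl \<sigma> a b (i, z)) \<in> {0..1}"
proof -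
  have "\<sigma> * (1 - 1 / \<sigma>) = \<sigma> - 1" using assms by (simp add: field_simps)
  moreover have "z \<le> 1 - 1 / \<sigma> \<Longrightarrow> \<sigma> * z \<le> \<sigma> * (1 - 1 / \<sigma>)" "1 - 1 / \<sigma> \<le> z \<Longrightarrow> \<sigma> * (1 - 1 / \<sigma>) \<le> \<sigma> * z"
    "0 \<le> \<sigma> * z" "\<sigma> * z \<le> \<sigma>"
    using assms by (auto intro: mult_left_mono)
  ultimately show ?thesis using assms by (auto simp: not_less)
qed

lemma skew_range_funpow:
  assumes "1 < \<sigma>" "\<sigma> \<le> 2" "z \<in> {0..1}"
  shows "snd ((skew fl \<sigma> a b ^^ n) (i, z)) \<in> {0..1}"
proof (induction n)
  case (Suc n)
  then show ?case using skew_range[OF assms(1,2), of "snd ((skew fl \<sigma> a b ^^ n) (i, z))" fl a b "fst ((skew fl \<sigma> a b ^^ n) (i, z))"]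
    by simp
qed (use assms in simp)

text \<open>Since \<open>\<sigma> * (\<sigma> - 1) \<le> 2 - \<sigma>\<close>, the interval on which
  the renormalised map lives is sent off itself, up to its right end point.\<close>

lemma skew_first:
  assumes "1 < \<sigma>" "\<sigma>\<^sup>2 \<le> 2" "0 \<le> x" "x \<le> \<sigma> * (\<sigma> - 1)"
  shows "2 - \<sigma> \<le> snd (skew fl \<sigma> a b (i, x))"
proof -
  have "\<sigma> * x \<le> \<sigma> * (\<sigma> * (\<sigma> - 1))" "0 \<le> \<sigma> * x" using assms by (auto intro: mult_left_mono)
  moreover have "\<sigma>\<^sup>2 * (\<sigma> - 1) \<le> 2 * (\<sigma> - 1)" using assms by (intro mult_right_mono) auto
  ultimately show ?thesis by (auto simp: algebra_simps power2_eq_square)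
qed

text \<open>The pointwise counterpart of \<open>renormalize\<close>, for statements about single
  orbits. The left branch of the new map comes from the right branch of the old one, so a turning
  point attached to one branch changes sides.\<close>

lemma skew_renormalize:
  assumes "1 < \<sigma>" "\<sigma>\<^sup>2 \<le> 2" "0 \<le> z" "z \<le> 1"
  defines "A \<equiv> \<sigma> * (\<sigma> - 1)"
  shows "(skew fl \<sigma> a b ^^ 2) (i, A * (1 - z)) = apsnd (\<lambda>z. A * (1 - z)) (skew (\<not> fl) (\<sigma>\<^sup>2) (b \<circ> b) (b \<circ> a) (i, z))"
proof -
  have A: "0 < A" "A \<le> 2 - \<sigma>" using assms by (auto simp: A_def algebra_simps power2_eq_square)
  define c where "c = 1 - 1 / \<sigma>"
  have Ac: "A * (1 / \<sigma>\<^sup>2) = c" using assms by (simp add: A_def c_def field_simps power2_eq_square)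
  have cA: "c < 2 - \<sigma>"
  proof -
    have "1 / \<sigma>\<^sup>2 < 1" using assms by (simp add: one_less_power)
    then have "A * (1 / \<sigma>\<^sup>2) < A * 1" using A by (intro mult_strict_left_mono)
    then show ?thesis using Ac A by simp
  qed
  have lt: "A * (1 - z) < c \<longleftrightarrow> 1 - 1 / \<sigma>\<^sup>2 < z" and eq: "A * (1 - z) = c \<longleftrightarrow> z = 1 - 1 / \<sigma>\<^sup>2"
    using mult_less_cancel_left_pos[OF A(1), of "1 - z" "1 / \<sigma>\<^sup>2"] mult_left_cancel[of A "1 - z" "1 / \<sigma>\<^sup>2"] A(1)
    unfolding Ac by linarith+
  have x: "0 \<le> A * (1 - z)" "A * (1 - z) \<le> \<sigma> * (\<sigma> - 1)"
    using A(1) assms(3,4) mult_left_mono[of "1 - z" 1 A] unfolding A_def[symmetric] by simp_all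
  obtain j y where jy: "skew fl \<sigma> a b (i, A * (1 - z)) = (j, y)" by fastforce
  have y: "c < y" using skew_first[OF assms(1,2) x, of fl a b i] jy cA by simp
  have "(skew fl \<sigma> a b ^^ 2) (i, A * (1 - z)) = skew fl \<sigma> a b (j, y)"
    using jy by (simp add: numeral_2_eq_2)
  also have "\<dots> = (b j, \<sigma> - \<sigma> * y)" using y by (simp add: c_def)
  also have "\<dots> = apsnd (\<lambda>z. A * (1 - z)) (skew (\<not> fl) (\<sigma>\<^sup>2) (b \<circ> b) (b \<circ> a) (i, z))"
  proof (cases "A * (1 - z) < c \<or> fl \<and> A * (1 - z) = c")
    case True
    then have "j = a i" "y = 2 - \<sigma> + \<sigma> * (A * (1 - z))" using jy by (auto simp: c_def)
    moreover have "\<not> (z < 1 - 1 / \<sigma>\<^sup>2 \<or> \<not> fl \<and> z = 1 - 1 / \<sigma>\<^sup>2)" using True lt eq by auto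
    then have "skew (\<not> fl) (\<sigma>\<^sup>2) (b \<circ> b) (b \<circ> a) (i, z) = (b (a i), \<sigma>\<^sup>2 - \<sigma>\<^sup>2 * z)"
      by (simp only: skew.simps if_False comp_apply)
    moreover have "\<sigma> - \<sigma> * (2 - \<sigma> + \<sigma> * (A * (1 - z))) = A * (1 - (\<sigma>\<^sup>2 - \<sigma>\<^sup>2 * z))"
      by (simp add: A_def algebra_simps power2_eq_square)
    ultimately show ?thesis by simp
  next
    case False
    then have "j = b i" "y = \<sigma> - \<sigma> * (A * (1 - z))" using jy by (auto simp: c_def)
    moreover have "z < 1 - 1 / \<sigma>\<^sup>2 \<or> \<not> fl \<and> z = 1 - 1 / \<sigma>\<^sup>2" using False lt eq by linarith
    then have "skew (\<not> fl) (\<sigma>\<^sup>2) (b \<circ> b) (b \<circ> a) (i, z) = (b (b i), 2 - \<sigma>\<^sup>2 + \<sigma>\<^sup>2 * z)"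
      by (simp only: skew.simps if_True comp_apply)
    moreover have "\<sigma> - \<sigma> * (\<sigma> - \<sigma> * (A * (1 - z))) = A * (1 - (2 - \<sigma>\<^sup>2 + \<sigma>\<^sup>2 * z))"
      by (simp add: A_def algebra_simps power2_eq_square)
    ultimately show ?thesis by simp
  qed
  finally show ?thesis .
qed

lemma skew_renormalize_funpow:
  assumes "1 < \<sigma>" "\<sigma>\<^sup>2 \<le> 2" "0 \<le> z" "z \<le> 1"
  shows "(skew fl \<sigma> a b ^^ (2 * n)) (i, \<sigma> * (\<sigma> - 1) * (1 - z)) =
    apsnd (\<lambda>z. \<sigma> * (\<sigma> - 1) * (1 - z)) ((skew (\<not> fl) (\<sigma>\<^sup>2) (b \<circ> b) (b \<circ> a) ^^ n) (i, z))"
proof -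
  define T where "T = skew (\<not> fl) (\<sigma>\<^sup>2) (b \<circ> b) (b \<circ> a)"
  define A where "A = \<sigma> * (\<sigma> - 1)"
  have "(skew fl \<sigma> a b ^^ (2 * n)) (i, A * (1 - z)) = apsnd (\<lambda>z. A * (1 - z)) ((T ^^ n) (i, z))"
  proof (induction n)
    case (Suc n)
    obtain j y where jy: "(T ^^ n) (i, z) = (j, y)" by fastforce
    have "1 < \<sigma>\<^sup>2" using assms by (simp add: one_less_power)
    then have y: "0 \<le> y" "y \<le> 1"
      using skew_range_funpow[of "\<sigma>\<^sup>2" z n "\<not> fl" "b \<circ> b" "b \<circ> a" i] assms jy by (auto simp: T_def)
    have "(skew fl \<sigma> a b ^^ (2 * Suc n)) (i, A * (1 - z)) = (skew fl \<sigma> a b ^^ 2) ((skew fl \<sigma> a b ^^ (2 * n)) (i, A * (1 - z)))"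
      by (simp add: numeral_2_eq_2)
    also have "\<dots> = (skew fl \<sigma> a b ^^ 2) (j, A * (1 - y))" by (simp only: Suc jy apsnd_conv)
    also have "\<dots> = apsnd (\<lambda>z. A * (1 - z)) (T (j, y))"
      unfolding A_def T_def by (rule skew_renormalize[OF assms(1,2) y])
    finally show ?case by (simp only: funpow.simps comp_apply jy)
  qed simp
  then show ?thesis by (simp only: A_def T_def)
qed

text \<open>The resulting flag is \<open>fl\<close> negated \<open>m\<close> times and is left
  existential.\<close>

lemma skew_window_return:
  assumes "1 < \<sigma>" "\<sigma> ^ 2 ^ m \<le> 2" "0 \<le> z" "z \<le> 1"
  shows "\<exists>fl'. (skew fl \<sigma> a b ^^ 2 ^ m) (i, win m \<sigma> z) =
    apsnd (win m \<sigma>) (skew fl' (\<sigma> ^ 2 ^ m) (fst (coc m a b)) (snd (coc m a b)) (i, z))"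
  using assms
proof (induction m arbitrary: \<sigma> a b fl)
  case 0
  then show ?case by (intro exI[of _ fl]) (auto simp: apsnd_def map_prod_def)
next
  case (Suc m)
  note s = slope_Suc[OF Suc.prems(1,2)]
  define A where "A = \<sigma> * (\<sigma> - 1)"
  have w: "win m (\<sigma>\<^sup>2) z \<in> {0..1}"
  proof -
    have "win m (\<sigma>\<^sup>2) z \<in> win m (\<sigma>\<^sup>2) ` {0..1}" using Suc.prems(3,4) by simp
    then show ?thesis unfolding win_image(2)[OF s(1,2)] using win_bounds[OF s(1,2)] by auto
  qed
  have e: "(\<sigma>\<^sup>2) ^ 2 ^ m = \<sigma> ^ 2 ^ Suc m" by (simp add: power_mult[symmetric])
  have wc: "(\<lambda>z. \<sigma> * (\<sigma> - 1) * (1 - z)) \<circ> win m (\<sigma>\<^sup>2) = win (Suc m) \<sigma>" by (simp add: fun_eq_iff)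
  obtain fl' where fl': "(skew (\<not> fl) (\<sigma>\<^sup>2) (b \<circ> b) (b \<circ> a) ^^ 2 ^ m) (i, win m (\<sigma>\<^sup>2) z) =
    apsnd (win m (\<sigma>\<^sup>2)) (skew fl' ((\<sigma>\<^sup>2) ^ 2 ^ m) (fst (coc m (b \<circ> b) (b \<circ> a))) (snd (coc m (b \<circ> b) (b \<circ> a))) (i, z))"
    using Suc.IH[OF s(1,2) Suc.prems(3,4)] by blast
  have "(skew fl \<sigma> a b ^^ 2 ^ Suc m) (i, win (Suc m) \<sigma> z) =
      (skew fl \<sigma> a b ^^ (2 * 2 ^ m)) (i, \<sigma> * (\<sigma> - 1) * (1 - win m (\<sigma>\<^sup>2) z))" by simp
  also have "\<dots> = apsnd (\<lambda>z. \<sigma> * (\<sigma> - 1) * (1 - z)) ((skew (\<not> fl) (\<sigma>\<^sup>2) (b \<circ> b) (b \<circ> a) ^^ 2 ^ m) (i, win m (\<sigma>\<^sup>2) z))"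
    using w by (intro skew_renormalize_funpow[OF Suc.prems(1) s(3)]) auto
  finally have "(skew fl \<sigma> a b ^^ 2 ^ Suc m) (i, win (Suc m) \<sigma> z) = apsnd (win (Suc m) \<sigma>)
      (skew fl' (\<sigma> ^ 2 ^ Suc m) (fst (coc (Suc m) a b)) (snd (coc (Suc m) a b)) (i, z))"
    unfolding fl' e by (simp only: coc.simps apsnd_compose wc)
  then show ?case by blast
qed

text \<open>At odd times the orbit is at or above \<open>2 - \<sigma>\<close>, while the open window
  lies below it. At even times the renormalised map has taken half as many steps, and the induction
  hypothesis applies.\<close>

lemma skew_window_escape:
  assumes "1 < \<sigma>" "\<sigma> ^ 2 ^ m \<le> 2" "z \<in> {win_lo m \<sigma><..<win_hi m \<sigma>}" "0 < j" "j < 2 ^ m"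
  shows "snd ((skew fl \<sigma> a b ^^ j) (i, z)) \<notin> {win_lo m \<sigma><..<win_hi m \<sigma>}"
  using assms
proof (induction m arbitrary: \<sigma> a b fl z j)
  case (Suc m)
  note s = slope_Suc[OF Suc.prems(1,2)]
  define A where "A = \<sigma> * (\<sigma> - 1)"
  define x where "x = 1 - z / A"
  have A: "0 < A" using s by (simp add: A_def)
  have zx: "z = A * (1 - x)" using A by (simp add: x_def)
  have x: "x \<in> {win_lo m (\<sigma>\<^sup>2)<..<win_hi m (\<sigma>\<^sup>2)}"
    using Suc.prems(3) A unfolding zx by (simp add: A_def[symmetric])
  have x01: "0 \<le> x" "x \<le> 1" using x win_bounds[OF s(1,2)] by auto
  define q where "q = j div 2"
  have conj: "snd ((skew fl \<sigma> a b ^^ (2 * q)) (i, z)) = A * (1 - snd ((skew (\<not> fl) (\<sigma>\<^sup>2) (b \<circ> b) (b \<circ> a) ^^ q) (i, x)))"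
    unfolding zx A_def by (subst skew_renormalize_funpow[OF Suc.prems(1) s(3) x01]) simp
  show ?case
  proof (cases "even j")
    case True
    then have j: "j = 2 * q" by (simp add: q_def)
    have "snd ((skew (\<not> fl) (\<sigma>\<^sup>2) (b \<circ> b) (b \<circ> a) ^^ q) (i, x)) \<notin> {win_lo m (\<sigma>\<^sup>2)<..<win_hi m (\<sigma>\<^sup>2)}"
      using Suc.prems(4,5) j by (intro Suc.IH[OF s(1,2) x]) auto
    then show ?thesis using A unfolding j conj by (auto simp: A_def[symmetric])
  next
    case False
    then have j: "j = Suc (2 * q)" by (simp add: q_def)
    define y where "y = snd ((skew fl \<sigma> a b ^^ (2 * q)) (i, z))"
    have "snd ((skew (\<not> fl) (\<sigma>\<^sup>2) (b \<circ> b) (b \<circ> a) ^^ q) (i, x)) \<in> {0..1}"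
      using s(1,3) x01 by (intro skew_range_funpow) auto
    then have y: "0 \<le> y" "y \<le> A" using A unfolding y_def conj by (auto intro: mult_left_le)
    have "2 - \<sigma> \<le> snd (skew fl \<sigma> a b (fst ((skew fl \<sigma> a b ^^ (2 * q)) (i, z)), y))"
      using y by (intro skew_first[OF Suc.prems(1) s(3)]) (auto simp: A_def)
    then have "2 - \<sigma> \<le> snd ((skew fl \<sigma> a b ^^ j) (i, z))" by (simp add: j y_def)
    moreover have "win_hi (Suc m) \<sigma> \<le> 2 - \<sigma>"
    proof -
      have "win_hi (Suc m) \<sigma> \<le> A * 1" unfolding win_hi.simps A_def[symmetric]
        using A win_bounds[OF s(1,2)] by (intro mult_left_mono) auto
      then show ?thesis using s(5) by (simp add: A_def)
    qed
    ultimately show ?thesis by simp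
  qed
qed simp

section \<open>Permutations of the half sides\<close>

definition shift :: "nat \<Rightarrow> nat \<Rightarrow> nat \<Rightarrow> nat" where
  "shift d x i = (i + x) mod (2 * d)"

text \<open>Half sides are numbered along the boundary, side \<open>k\<close> consisting of
  \<open>2 * k\<close> and \<open>2 * k + 1\<close>. Reflections of the polygon exchange the
  parities, so the increments for odd indices are the negatives modulo \<open>2 * d\<close> of those
  for even ones.\<close>

definition slap_a :: "nat \<Rightarrow> nat \<Rightarrow> nat" where
  "slap_a d i = shift d (if even i then d + 2 else d - 2) i"

definition slap_b :: "nat \<Rightarrow> nat \<Rightarrow> nat" where
  "slap_b d i = shift d (if even i then d + 1 else d - 1) i"

text \<open>The fibre map of the right branch from the second renormalisation on.\<close>

definition flip :: "nat \<Rightarrow> nat \<Rightarrow> nat" where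
  "flip d i = shift d (if even i then 3 else 2 * d - 3) i"

lemma even_shift: "even (shift d x i) \<longleftrightarrow> even (i + x)"
  by (simp add: shift_def dvd_mod_iff)

lemma shift_shift: "shift d y (shift d x i) = shift d (x + y) i"
  by (simp add: shift_def mod_add_left_eq add.assoc)

lemma shift_period: "x = y + 2 * d \<Longrightarrow> shift d x i = shift d y i"
  by (simp add: shift_def add.assoc[symmetric])

lemma shift_zero: "i < 2 * d \<Longrightarrow> shift d (2 * d) i = i"
  by (simp add: shift_def)

lemma slap_in: "d > 0 \<Longrightarrow> slap_a d i < 2 * d" "d > 0 \<Longrightarrow> slap_b d i < 2 * d" "d > 0 \<Longrightarrow> flip d i < 2 * d"
  by (simp_all add: slap_a_def slap_b_def flip_def shift_def)

lemma bb:
  assumes "odd d" "d \<ge> 3"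
  shows "slap_b d (slap_b d i) = shift d (if even i then 2 else 2 * d - 2) i"
proof (cases "even i")
  case True
  then have "slap_b d (slap_b d i) = shift d (d + 1 + (d + 1)) i"
    using assms by (simp add: slap_b_def even_shift shift_shift)
  also have "\<dots> = shift d 2 i" by (rule shift_period) simp
  finally show ?thesis using True by simp
next
  case False
  then have "slap_b d (slap_b d i) = shift d (d - 1 + (d - 1)) i"
    using assms by (simp add: slap_b_def even_shift shift_shift)
  also have "d - 1 + (d - 1) = 2 * d - 2" using assms by simp
  finally show ?thesis using False by simp
qed

lemma ba:
  assumes "odd d" "d \<ge> 3"
  shows "slap_b d (slap_a d i) = shift d (if even i then 1 else 2 * d - 1) i"
proof (cases "even i")
  case True
  then have "slap_b d (slap_a d i) = shift d (d + 2 + (d - 1)) i"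
    using assms by (simp add: slap_b_def slap_a_def even_shift shift_shift)
  also have "\<dots> = shift d 1 i" by (rule shift_period) (use assms in simp)
  finally show ?thesis using True by simp
next
  case False
  then have "slap_b d (slap_a d i) = shift d (d - 2 + (d + 1)) i"
    using assms by (simp add: slap_b_def slap_a_def even_shift shift_shift)
  also have "d - 2 + (d + 1) = 2 * d - 1" using assms by simp
  finally show ?thesis using False by simp
qed

lemma flip_flip:
  assumes "d \<ge> 3" "i < 2 * d"
  shows "flip d (flip d i) = i"
proof (cases "even i")
  case True
  then have "flip d (flip d i) = shift d (3 + (2 * d - 3)) i"
    by (simp add: flip_def even_shift shift_shift)
  also have "3 + (2 * d - 3) = 2 * d" using assms by simp
  finally show ?thesis using assms shift_zero by simp
next
  case False
  then have "flip d (flip d i) = shift d (2 * d - 3 + 3) i"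
    using assms by (simp add: flip_def even_shift shift_shift del: le_add_diff_inverse2)
  also have "2 * d - 3 + 3 = 2 * d" using assms by simp
  finally show ?thesis using assms shift_zero by simp
qed

text \<open>The fibre maps after two renormalisations are
  \<open>(b \<circ> a) \<circ> (b \<circ> a)\<close> and
  \<open>(b \<circ> a) \<circ> (b \<circ> b)\<close>. Here \<open>b \<circ> a\<close> exchanges the
  two halves of each side, and \<open>b \<circ> b\<close> shifts by one side, in opposite directions
  for the two parities.\<close>

lemma coc_two:
  assumes d: "odd d" "d \<ge> 3" and i: "i < 2 * d"
  shows "slap_b d (slap_a d (slap_b d (slap_a d i))) = i"
    and "slap_b d (slap_a d (slap_b d (slap_b d i))) = flip d i"
proof -
  show "slap_b d (slap_a d (slap_b d (slap_a d i))) = i"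
  proof (cases "even i")
    case True
    then have "slap_b d (slap_a d (slap_b d (slap_a d i))) = shift d (1 + (2 * d - 1)) i"
      unfolding ba[OF d] by (simp add: even_shift shift_shift)
    also have "1 + (2 * d - 1) = 2 * d" using d by simp
    finally show ?thesis using i shift_zero by simp
  next
    case False
    then have "slap_b d (slap_a d (slap_b d (slap_a d i))) = shift d (2 * d - 1 + 1) i"
      using d unfolding ba[OF d] by (simp add: even_shift shift_shift)
    also have "2 * d - 1 + 1 = 2 * d" using d by simp
    finally show ?thesis using i shift_zero by simp
  qed
  show "slap_b d (slap_a d (slap_b d (slap_b d i))) = flip d i"
  proof (cases "even i")
    case True
    then have "slap_b d (slap_a d (slap_b d (slap_b d i))) = shift d (2 + 1) i"
      unfolding ba[OF d] bb[OF d] by (simp add: even_shift shift_shift)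
    then show ?thesis using True by (simp add: flip_def)
  next
    case False
    then have "slap_b d (slap_a d (slap_b d (slap_b d i))) = shift d (2 * d - 2 + (2 * d - 1)) i"
      using d unfolding ba[OF d] bb[OF d] by (simp add: even_shift shift_shift)
    also have "\<dots> = shift d (2 * d - 3) i" by (rule shift_period) (use d in simp)
    finally show ?thesis using False by (simp add: flip_def)
  qed
qed

text \<open>A pair consisting of the identity and an involution \<open>b\<close> is fixed under
  renormalisation: \<open>b \<circ> b\<close> is again the identity and \<open>b \<circ> a\<close>
  is again \<open>b\<close>.\<close>

lemma coc_stable:
  assumes "d \<ge> 3" "\<And>i. i < 2 * d \<Longrightarrow> a i = i" "\<And>i. i < 2 * d \<Longrightarrow> b i = flip d i" "i < 2 * d"
  shows "fst (coc m a b) i = i \<and> snd (coc m a b) i = flip d i"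
  using assms
proof (induction m arbitrary: a b)
  case (Suc m)
  show ?case unfolding coc.simps
    by (rule Suc.IH) (use Suc.prems flip_flip slap_in(3)[of d] in auto)
qed simp

lemma coc_slap:
  assumes "odd d" "d \<ge> 3" "m \<ge> 2" "i < 2 * d"
  shows "fst (coc m (slap_a d) (slap_b d)) i = i" "snd (coc m (slap_a d) (slap_b d)) i = flip d i"
proof -
  obtain q where m: "m = Suc (Suc q)" using assms(3) by (metis add_2_eq_Suc le_iff_add)
  have "fst (coc m (slap_a d) (slap_b d)) i = i \<and> snd (coc m (slap_a d) (slap_b d)) i = flip d i"
    unfolding m coc.simps by (rule coc_stable) (use assms coc_two in auto)
  then show "fst (coc m (slap_a d) (slap_b d)) i = i" "snd (coc m (slap_a d) (slap_b d)) i = flip d i" by auto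
qed

text \<open>\<open>flip\<close> changes the parity, so each of its orbits contains exactly one even
  index \<open>2 * l\<close>, and \<open>l < d\<close> enumerates the orbits.\<close>

definition orbit :: "nat \<Rightarrow> nat \<Rightarrow> nat set" where
  "orbit d l = {2 * l, flip d (2 * l)}"

lemma orbit_ex:
  assumes "d \<ge> 3" "i < 2 * d"
  shows "\<exists>l<d. orbit d l = {i, flip d i}"
proof (cases "even i")
  case True
  then show ?thesis using assms by (intro exI[of _ "i div 2"]) (auto simp: orbit_def)
next
  case False
  then have "even (flip d i)" using assms by (simp add: flip_def even_shift)
  then show ?thesis using assms flip_flip[OF assms] slap_in(3)[of d i]
    by (intro exI[of _ "flip d i div 2"]) (auto simp: orbit_def)
qed

lemma orbit_disj:
  assumes "d \<ge> 3" "l < d" "l' < d" "l \<noteq> l'"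
  shows "orbit d l \<inter> orbit d l' = {}"
proof -
  have "odd (flip d (2 * l))" for l by (simp add: flip_def even_shift)
  then have ne: "2 * l \<noteq> flip d (2 * l')" for l l' by (metis even_mult_iff even_numeral)
  have "flip d (2 * l) \<noteq> flip d (2 * l')"
    using flip_flip[of d "2 * l"] flip_flip[of d "2 * l'"] assms by auto
  then show ?thesis using ne assms unfolding orbit_def by (metis Int_insert_left_if0 Int_empty_left insertE mult_cancel1 singletonD zero_neq_numeral)
qed

section \<open>Covering all half sides of an orbit at one common time\<close>

context tent_cover
begin

text \<open>The iterated list consists of the half sides reachable by words of length
  \<open>n\<close> in the maps \<open>fs\<close>. All generators take the same time
  \<open>q\<close>, so all words of one length take the same time; \<open>remdups\<close> keeps the
  lists short for evaluation.\<close>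

lemma word_cover:
  assumes step: "\<And>f i. f \<in> set fs \<Longrightarrow> i \<in> S \<Longrightarrow> f i \<in> S \<and> C i 0 1 q (f i) 0 1"
  shows "i \<in> S \<Longrightarrow> j \<in> set (((\<lambda>xs. remdups (concat (map (\<lambda>f. map f xs) fs))) ^^ n) [i]) \<Longrightarrow> j \<in> S \<and> C i 0 1 (q * n) j 0 1"
proof (induction n arbitrary: j)
  case 0
  then show ?case using C_sub[of i 0 1 0 1] by simp
next
  case (Suc n)
  then obtain f y where f: "f \<in> set fs" "j = f y"
    "y \<in> set (((\<lambda>xs. remdups (concat (map (\<lambda>f. map f xs) fs))) ^^ n) [i])" by auto
  have y: "y \<in> S" "C i 0 1 (q * n) y 0 1" using Suc.IH[OF Suc.prems(1) f(3)] by auto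
  then show ?case using step[OF f(1) y(1)] C_trans[OF y(2)] by (auto simp: f(2) add.commute)
qed

text \<open>The words \<open>b ^^ (q + 1)\<close> and \<open>b ^^ q \<circ> a\<close> have equal
  length; with \<open>q\<close> odd they act as the identity and as \<open>b\<close>.\<close>

lemma cover_involution:
  assumes large: "2 < \<sigma>\<^sup>2" and ab: "\<And>i. i \<in> S \<Longrightarrow> a i = i" "\<And>i. i \<in> S \<Longrightarrow> b (b i) = i" and i: "i \<in> S"
  shows "\<exists>n. \<forall>j\<in>{i, b i}. C i 0 1 n j 0 1"
proof -
  obtain q where q: "odd q" "\<And>i. i \<in> S \<Longrightarrow> C i 0 1 (q + 1) ((b ^^ q) (a i)) 0 1" using full_left[OF large] by blast
  have ev: "(b ^^ (2 * p)) i = i" for p by (induction p) (use i ab in auto)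
  obtain p where p: "q = 2 * p + 1" using q(1) by (auto elim: oddE)
  have "(b ^^ (q + 1)) i = i" using ev[of "Suc p"] by (simp add: p)
  moreover have "(b ^^ q) (a i) = b i" using ev[of p] i ab by (simp add: p)
  ultimately show ?thesis using full_right_pow[OF i, of "q + 1"] q(2)[OF i] by (intro exI[of _ "q + 1"]) auto
qed

end

text \<open>For slope 2 both branches are onto the core, so every word in the two fibre maps is
  realized; words of length 3 connect any two of the six half sides.\<close>

lemma cover_triangle:
  assumes "tent_cover 2 (slap_a 3) (slap_b 3) {..<6} C" "i < 6" "j < 6"
  shows "C i 0 1 3 j 0 1"
proof -
  interpret tent_cover 2 "slap_a 3" "slap_b 3" "{..<6}" C by (rule assms)
  have "f i \<in> {..<6} \<and> C i 0 1 1 (f i) 0 1" if "f \<in> set [slap_a 3, slap_b 3]" "i \<in> {..<6}" for f i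
  proof -
    have "C i 0 1 1 (slap_a 3 i) 0 1"
      using C_trans[OF C_sub[of i 0 1 0 "1/2"] C_left[of i 0 "1/2"]] that by simp
    then show ?thesis using that full_right[of i] a_in b_in by auto
  qed
  then have w: "i \<in> {..<6} \<Longrightarrow> j \<in> set (((\<lambda>xs. remdups (concat (map (\<lambda>f. map f xs) [slap_a 3, slap_b 3]))) ^^ 3) [i]) \<Longrightarrow> j \<in> {..<6} \<and> C i 0 1 (1 * 3) j 0 1" for i j
    by (rule word_cover)
  have "\<forall>i\<in>set [0..<6]. \<forall>j\<in>set [0..<6]. j \<in> set (((\<lambda>xs. remdups (concat (map (\<lambda>f. map f xs) [slap_a 3, slap_b 3]))) ^^ 3) [i])"
    by code_simp
  then show ?thesis using w[of i j] assms by auto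
qed

lemma funpow_five: "(g ^^ 5) x = g (g (g (g (g x))))"
  by (simp add: numeral_eq_Suc)

text \<open>A finite computation, for which both fibre maps are tabulated. The lists are distinct,
  so length ten means that every half side is reached.\<close>

lemma pentagon_words:
  defines "a \<equiv> slap_b 5 \<circ> slap_b 5" and "b \<equiv> slap_b 5 \<circ> slap_a 5"
  shows "\<forall>i\<in>set [0..<10]. length (((\<lambda>xs. remdups (concat (map (\<lambda>f. map f xs) [a, b, b \<circ> a \<circ> b]))) ^^ 5) [i]) = 10"
proof -
  have up: "[0..<10] = [0, 1, 2, 3, 4, 5, 6, 7, 8, 9]" by (simp add: upt_rec)
  have "map a [0..<10] = [2, 9, 4, 1, 6, 3, 8, 5, 0, 7]" "map b [0..<10] = [1, 0, 3, 2, 5, 4, 7, 6, 9, 8]"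
    by (simp_all add: a_def b_def slap_a_def slap_b_def shift_def up)
  then have "a 0 = 2" "a 1 = 9" "a 2 = 4" "a 3 = 1" "a 4 = 6" "a 5 = 3" "a 6 = 8" "a 7 = 5" "a 8 = 0" "a 9 = 7"
    "b 0 = 1" "b 1 = 0" "b 2 = 3" "b 3 = 2" "b 4 = 5" "b 5 = 4" "b 6 = 7" "b 7 = 6" "b 8 = 9" "b 9 = 8"
    by (simp_all add: up)
  then show ?thesis by (simp add: funpow_five up)
qed

lemma cover_pentagon:
  assumes "tent_cover \<sigma> (slap_b 5 \<circ> slap_b 5) (slap_b 5 \<circ> slap_a 5) {..<10} C" "2 < \<sigma>\<^sup>2" "i < 10"
  shows "\<exists>n. \<forall>j<10. C i 0 1 n j 0 1"
proof -
  define a where "a = slap_b 5 \<circ> slap_b 5"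
  define b where "b = slap_b 5 \<circ> slap_a 5"
  interpret tent_cover \<sigma> a b "{..<10}" C using assms by (simp add: a_def b_def)
  obtain q where q: "odd q" "\<And>i. i \<in> {..<10} \<Longrightarrow> C i 0 1 (q + 1) ((b ^^ q) (a i)) 0 1" using full_left[OF assms(2)] by blast
  have bb: "b (b i) = i" if "i \<in> {..<10}" for i using coc_two(1)[of 5 i] that by (simp add: b_def)
  have ev: "(b ^^ (2 * p)) i = i" if "i \<in> {..<10}" for p i
    by (induction p) (use that bb in auto)
  obtain p where p: "q = 2 * p + 1" using q(1) by (auto elim: oddE)
  have od: "(b ^^ q) i = b i" if "i \<in> {..<10}" for i using ev[OF that, of p] by (simp add: p)
  \<comment> \<open>The words are padded to the common length \<open>q + 2\<close>: as
    \<open>b\<close> is an involution and \<open>q\<close> is odd,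
    \<open>b ^^ (q + 1) \<circ> a\<close>, \<open>b ^^ (q + 2)\<close> and
    \<open>b ^^ q \<circ> a \<circ> b\<close> act as \<open>a\<close>, \<open>b\<close> and
    \<open>b \<circ> a \<circ> b\<close>.\<close>
  have "f i \<in> {..<10} \<and> C i 0 1 (q + 2) (f i) 0 1" if f: "f \<in> set [a, b, b \<circ> a \<circ> b]" and i: "i \<in> {..<10}" for f i
  proof -
    have "C i 0 1 (q + 1 + 1) (b ((b ^^ q) (a i))) 0 1"
      using C_trans[OF q(2)[OF i] full_right[OF b_pow_in[OF a_in[OF i]]]] .
    then have 1: "C i 0 1 (q + 2) (a i) 0 1" using od[OF a_in[OF i]] bb[OF a_in[OF i]] by simp
    have "(b ^^ (q + 2)) i = b i" using od[OF i] bb[OF b_in[OF i]] by simp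
    then have 2: "C i 0 1 (q + 2) (b i) 0 1" using full_right_pow[OF i, of "q + 2"] by (simp only:)
    have "C i 0 1 (1 + (q + 1)) ((b ^^ q) (a (b i))) 0 1"
      using C_trans[OF full_right[OF i] q(2)[OF b_in[OF i]]] .
    then have 3: "C i 0 1 (q + 2) (b (a (b i))) 0 1" using od[OF a_in[OF b_in[OF i]]] by simp
    show ?thesis using 1 2 3 f a_in[OF i] b_in[OF i] b_in[OF a_in[OF b_in[OF i]]] by auto
  qed
  then have w: "i \<in> {..<10} \<Longrightarrow> j \<in> set (((\<lambda>xs. remdups (concat (map (\<lambda>f. map f xs) [a, b, b \<circ> a \<circ> b]))) ^^ 5) [i]) \<Longrightarrow> j \<in> {..<10} \<and> C i 0 1 ((q + 2) * 5) j 0 1" for i j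
    by (rule word_cover)
  define ys where "ys = ((\<lambda>xs. remdups (concat (map (\<lambda>f. map f xs) [a, b, b \<circ> a \<circ> b]))) ^^ 5) [i]"
  have "length ys = 10" using pentagon_words assms(3) unfolding ys_def a_def b_def by auto
  moreover have "distinct ys" by (simp add: ys_def funpow_five)
  moreover have "set ys \<subseteq> {..<10}" using w[of i] assms(3) by (auto simp: ys_def)
  ultimately have "set ys = {..<10}" by (intro card_subset_eq) (auto simp: distinct_card)
  then have "\<forall>j<10. C i 0 1 ((q + 2) * 5) j 0 1" using w[of i] assms(3) unfolding ys_def by blast
  then show ?thesis by blast
qed

text \<open>\<open>m\<close> is the number of renormalisations.\<close>

lemma fibre_components:
  assumes d: "odd d" "d \<ge> 3" and m: "(d = 3 \<and> m = 0 \<and> \<sigma> = 2) \<or> (d = 5 \<and> m = 1) \<or> (m \<ge> 2)"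
    and large: "2 < (\<sigma> ^ 2 ^ m :: real)\<^sup>2"
  obtains Q :: "nat \<Rightarrow> nat set" where
    "\<And>l. l < (if m \<ge> 2 then d else 1) \<Longrightarrow> Q l \<noteq> {} \<and> Q l \<subseteq> {..<2 * d}"
    "\<And>l l'. l < (if m \<ge> 2 then d else 1) \<Longrightarrow> l' < (if m \<ge> 2 then d else 1) \<Longrightarrow> l \<noteq> l' \<Longrightarrow> Q l \<inter> Q l' = {}"
    "\<And>l i. l < (if m \<ge> 2 then d else 1) \<Longrightarrow> i \<in> Q l \<Longrightarrow>
        fst (coc m (slap_a d) (slap_b d)) i \<in> Q l \<and> snd (coc m (slap_a d) (slap_b d)) i \<in> Q l"
    "\<And>i. i < 2 * d \<Longrightarrow> \<exists>l<(if m \<ge> 2 then d else 1). i \<in> Q l"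
    "\<And>C i l. tent_cover (\<sigma> ^ 2 ^ m) (fst (coc m (slap_a d) (slap_b d))) (snd (coc m (slap_a d) (slap_b d))) {..<2 * d} C \<Longrightarrow>
        l < (if m \<ge> 2 then d else 1) \<Longrightarrow> i \<in> Q l \<Longrightarrow> \<exists>n. \<forall>j\<in>Q l. C i 0 1 n j 0 1"
proof (cases "m \<ge> 2")
  case True
  note ab = coc_slap[OF d True]
  show thesis
  proof (rule that[of "orbit d"], unfold if_P[OF True])
    fix l l' assume l: "l < d"
    have l2: "2 * l < 2 * d" using l by simp
    then show "orbit d l \<noteq> {} \<and> orbit d l \<subseteq> {..<2 * d}" using slap_in(3)[of d "2 * l"] d by (auto simp: orbit_def)
    show "orbit d l \<inter> orbit d l' = {}" if "l' < d" "l \<noteq> l'" using orbit_disj d l that by auto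
    show "fst (coc m (slap_a d) (slap_b d)) i \<in> orbit d l \<and> snd (coc m (slap_a d) (slap_b d)) i \<in> orbit d l"
      if "i \<in> orbit d l" for i
    proof -
      have "i < 2 * d" using that l2 slap_in(3)[of d "2 * l"] d by (auto simp: orbit_def)
      then show ?thesis using that ab flip_flip[OF d(2) l2] by (auto simp: orbit_def)
    qed
  next
    fix i assume "i < 2 * d"
    then show "\<exists>l<d. i \<in> orbit d l" using orbit_ex[OF d(2)] by blast
  next
    fix C i l
    assume T: "tent_cover (\<sigma> ^ 2 ^ m) (fst (coc m (slap_a d) (slap_b d))) (snd (coc m (slap_a d) (slap_b d))) {..<2 * d} C"
      and l: "l < d" "i \<in> orbit d l"
    interpret tent_cover "\<sigma> ^ 2 ^ m" "fst (coc m (slap_a d) (slap_b d))" "snd (coc m (slap_a d) (slap_b d))" "{..<2 * d}" C by (rule T)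
    have l2: "2 * l < 2 * d" using l by simp
    have i: "i < 2 * d" using l l2 slap_in(3)[of d "2 * l"] d by (auto simp: orbit_def)
    have o: "orbit d l = {i, flip d i}" using l flip_flip[OF d(2) l2] by (auto simp: orbit_def)
    have "\<exists>n. \<forall>j\<in>{i, snd (coc m (slap_a d) (slap_b d)) i}. C i 0 1 n j 0 1"
      using i ab slap_in(3)[of d] d flip_flip[OF d(2)] by (intro cover_involution[OF large]) auto
    then show "\<exists>n. \<forall>j\<in>orbit d l. C i 0 1 n j 0 1" unfolding o ab(2)[OF i] .
  qed
next
  case False
  then have cs: "(d = 3 \<and> m = 0 \<and> \<sigma> = 2) \<or> (d = 5 \<and> m = 1)" using m by auto
  show thesis
  proof (rule that[of "\<lambda>_. {..<2 * d}"], unfold if_not_P[OF False])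
    fix l i assume "i \<in> {..<2 * d}"
    then show "fst (coc m (slap_a d) (slap_b d)) i \<in> {..<2 * d} \<and> snd (coc m (slap_a d) (slap_b d)) i \<in> {..<2 * d}"
      using cs slap_in[of d] d by (auto simp: numeral_eq_Suc)
  next
    fix C i l
    assume T: "tent_cover (\<sigma> ^ 2 ^ m) (fst (coc m (slap_a d) (slap_b d))) (snd (coc m (slap_a d) (slap_b d))) {..<2 * d} C"
      and i: "i \<in> {..<2 * d}"
    show "\<exists>n. \<forall>j\<in>{..<2 * d}. C i 0 1 n j 0 1"
    proof (cases "d = 3")
      case True
      then have "m = 0" "\<sigma> = 2" using cs by auto
      then have "\<forall>j<6. C i 0 1 3 j 0 1" using cover_triangle[of C i] T True i by simp
      then show ?thesis using True by auto
    next
      case False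
      then have "d = 5" "m = 1" using cs by auto
      then have "\<exists>n. \<forall>j<10. C i 0 1 n j 0 1" using cover_pentagon[of "\<sigma>\<^sup>2" C i] T i large by simp
      then show ?thesis using \<open>d = 5\<close> by auto
    qed
  qed (use d in \<open>auto simp: lessThan_empty_iff\<close>)
qed

section \<open>The invariant density of a tent map\<close>

definition tent :: "real \<Rightarrow> real \<Rightarrow> real" where
  "tent \<sigma> z = (if z < 1 - 1 / \<sigma> then 2 - \<sigma> + \<sigma> * z else \<sigma> - \<sigma> * z)"

locale tent_density =
  fixes \<sigma> :: real
  assumes slope: "1 < \<sigma>" "\<sigma> \<le> 2"
begin

definition orb :: "nat \<Rightarrow> real" where "orb n = (tent \<sigma> ^^ n) 0"

definition sg :: "nat \<Rightarrow> real" where "sg n = (if orb n < 1 - 1 / \<sigma> then 1 else -1)"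

definition co :: "nat \<Rightarrow> real" where "co n = (\<Prod>k<n. sg k) / \<sigma> ^ n"

text \<open>Parry's series for the invariant density. The orbit starts at 0, the second image of the
  turning point, and \<open>co n\<close> is the reciprocal of the formal derivative of the
  \<open>n\<close>-th iterate along it.\<close>

definition dens :: "real \<Rightarrow> real" where "dens x = (\<Sum>n. co n * (if orb n \<le> x then 1 else 0))"

lemma turn: "\<sigma> * (1 - 1 / \<sigma>) = \<sigma> - 1"
  using slope by (simp add: field_simps)

lemma tent_range: "z \<in> {0..1} \<Longrightarrow> tent \<sigma> z \<in> {0..1}"
proof -
  assume z: "z \<in> {0..1}"
  have "z \<le> 1 - 1 / \<sigma> \<Longrightarrow> \<sigma> * z \<le> \<sigma> * (1 - 1 / \<sigma>)" "1 - 1 / \<sigma> \<le> z \<Longrightarrow> \<sigma> * (1 - 1 / \<sigma>) \<le> \<sigma> * z"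
    "0 \<le> \<sigma> * z" "\<sigma> * z \<le> \<sigma> * 1"
    using slope z by (auto intro: mult_left_mono)
  then show ?thesis using slope turn by (auto simp: tent_def not_less)
qed

lemma orb_range: "orb n \<in> {0..1}"
proof (induction n)
  case (Suc n)
  then show ?case using tent_range[of "orb n"] by (simp add: orb_def)
qed (simp add: orb_def)

lemma sg_abs: "\<bar>sg n\<bar> = 1" "sg n * sg n = 1"
  by (simp_all add: sg_def)

lemma orb_Suc: "orb (Suc n) = sg n * ((1 - \<sigma> + sg n) + \<sigma> * orb n)"
proof -
  have "orb (Suc n) = tent \<sigma> (orb n)" by (simp add: orb_def)
  then show ?thesis by (simp add: tent_def sg_def algebra_simps)
qed

lemma co_0: "co 0 = 1" by (simp add: co_def)

lemma co_Suc: "co (Suc n) = co n * sg n / \<sigma>"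
  by (simp add: co_def)

lemma co_abs: "\<bar>co n\<bar> = (1 / \<sigma>) ^ n"
  using slope by (induction n) (auto simp: co_0 co_Suc abs_mult sg_abs)

lemma geo: "summable (\<lambda>n. (1 / \<sigma>) ^ n)"
  using slope by (intro summable_geometric) auto

lemma summable_dom: "(\<And>n. \<bar>g n\<bar> \<le> (1 / \<sigma>) ^ n) \<Longrightarrow> summable (g :: nat \<Rightarrow> real)"
  by (rule summable_comparison_test'[OF geo, of 0]) auto

lemma co_ind_le: "\<bar>co n * (if b then 1 else 0)\<bar> \<le> (1 / \<sigma>) ^ n"
  using slope by (simp add: abs_mult co_abs)

lemma summable_co: "summable co"
  by (rule summable_dom) (simp add: co_abs)

lemma summable_dens: "summable (\<lambda>n. co n * (if P n then 1 else 0))"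
  by (rule summable_dom) (rule co_ind_le)

text \<open>The sum follows by telescoping from \<open>co (Suc n) * orb (Suc n) = co n * (orb n + (1 - \<sigma> + sg n) / \<sigma>)\<close>.\<close>

lemma suminf_co: "suminf co = \<sigma>"
proof -
  have step: "co n * (1 - \<sigma>) + \<sigma> * co (Suc n) = \<sigma> * (co (Suc n) * orb (Suc n) - co n * orb n)" for n
  proof -
    have "co (Suc n) * orb (Suc n) = co n / \<sigma> * (sg n * sg n) * ((1 - \<sigma> + sg n) + \<sigma> * orb n)"
      unfolding co_Suc orb_Suc by simp
    then have e1: "\<sigma> * (co (Suc n) * orb (Suc n)) = co n * ((1 - \<sigma> + sg n) + \<sigma> * orb n)"
      using slope by (simp add: sg_abs)
    have e2: "\<sigma> * co (Suc n) = co n * sg n" using slope by (simp add: co_Suc)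
    show ?thesis unfolding right_diff_distrib e1 e2 by (simp add: algebra_simps)
  qed
  have lim: "(\<lambda>n. co n * orb n) \<longlonglongrightarrow> 0"
  proof (rule summable_LIMSEQ_zero, rule summable_dom)
    fix n
    have "\<bar>orb n\<bar> \<le> 1" using orb_range[of n] by auto
    then show "\<bar>co n * orb n\<bar> \<le> (1 / \<sigma>) ^ n"
      using mult_left_mono[of "\<bar>orb n\<bar>" 1 "\<bar>co n\<bar>"] slope by (simp add: abs_mult co_abs)
  qed
  have "(\<lambda>n. co (Suc n) * orb (Suc n) - co n * orb n) sums (0 - co 0 * orb 0)"
    by (rule telescope_sums[OF lim])
  then have "(\<lambda>n. \<sigma> * (co (Suc n) * orb (Suc n) - co n * orb n)) sums (\<sigma> * (0 - co 0 * orb 0))"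
    by (rule sums_mult)
  then have "(\<lambda>n. co n * (1 - \<sigma>) + \<sigma> * co (Suc n)) sums 0" unfolding step by (simp add: orb_def)
  moreover have "(\<lambda>n. co n * (1 - \<sigma>) + \<sigma> * co (Suc n)) sums (suminf co * (1 - \<sigma>) + \<sigma> * (suminf co - co 0))"
  proof (intro sums_add sums_mult sums_mult2)
    show "co sums suminf co" by (rule summable_sums[OF summable_co])
    then show "(\<lambda>n. co (Suc n)) sums (suminf co - co 0)" using sums_Suc_iff[of co] by simp
  qed
  ultimately have "suminf co * (1 - \<sigma>) + \<sigma> * (suminf co - co 0) = 0" by (rule sums_unique2[symmetric])
  then show ?thesis by (simp add: co_0 algebra_simps)
qed

text \<open>The fixed point equation of the transfer operator, with the two preimages of
  \<open>x\<close> on the right. It is checked term by term and summed with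
  \<open>suminf co = \<sigma>\<close>. Points of the orbit are excluded because the right branch
  turns \<open>\<le>\<close> into \<open>\<ge>\<close>.\<close>

lemma dens_transfer:
  assumes x: "0 < x" "x < 1" "x \<notin> range orb"
  shows "\<sigma> * dens x = dens (1 - x / \<sigma>) + (if 2 - \<sigma> < x then dens ((x - 2 + \<sigma>) / \<sigma>) else 0)"
proof -
  define c where "c = 1 - 1 / \<sigma>"
  define yR where "yR = 1 - x / \<sigma>"
  define yL where "yL = (x - 2 + \<sigma>) / \<sigma>"
  have yR: "\<sigma> - \<sigma> * yR = x" "c < yR" using slope x by (auto simp: yR_def c_def field_simps)
  have yL: "2 - \<sigma> + \<sigma> * yL = x" "yL < c" using slope x by (auto simp: yL_def c_def field_simps)
  define iR where "iR n = (if orb n \<le> yR then 1 else 0 :: real)" for n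
  define iL where "iL n = (if 2 - \<sigma> < x \<and> orb n \<le> yL then 1 else 0 :: real)" for n
  define ix where "ix n = (if orb n \<le> x then 1 else 0 :: real)" for n
  have mono: "\<sigma> * p \<le> \<sigma> * q \<longleftrightarrow> p \<le> q" for p q using slope by simp
  \<comment> \<open>An orbit point on the left branch always counts for the right preimage, and for
    the left one exactly if its image is below \<open>x\<close>. On the right branch it counts
    exactly if its image is above \<open>x\<close>, and for the right preimage only.\<close>
  have tm: "iR n + iL n = 1 + sg n * ix (Suc n)" for n
  proof -
    have ne: "orb (Suc n) \<noteq> x" using x(3) by auto
    have o: "orb (Suc n) = tent \<sigma> (orb n)" by (simp add: orb_def)
    show ?thesis
    proof (cases "orb n < c")
      case True
      then have t: "orb (Suc n) = 2 - \<sigma> + \<sigma> * orb n" by (simp add: o tent_def c_def)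
      have "iR n = 1" using True yR(2) by (simp add: iR_def)
      moreover have "orb n \<le> yL \<longleftrightarrow> orb (Suc n) \<le> x" using mono[of "orb n" yL] yL(1) t by linarith
      moreover have "2 - \<sigma> \<le> orb (Suc n)" using orb_range[of n] slope t by simp
      ultimately show ?thesis using True ne by (auto simp: iL_def ix_def sg_def c_def)
    next
      case False
      then have t: "orb (Suc n) = \<sigma> - \<sigma> * orb n" by (simp add: o tent_def c_def)
      have "orb n \<le> yR \<longleftrightarrow> x \<le> orb (Suc n)" using mono[of "orb n" yR] yR(1) t by linarith
      moreover have "iL n = 0" using False yL(2) by (simp add: iL_def)
      ultimately show ?thesis using False ne by (auto simp: iR_def ix_def sg_def c_def)
    qed
  qed
  have sR: "summable (\<lambda>n. co n * iR n)" and sL: "summable (\<lambda>n. co n * iL n)" and sx: "summable (\<lambda>n. co n * ix n)"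
    unfolding iR_def iL_def ix_def by (rule summable_dens)+
  have "dens yR + (if 2 - \<sigma> < x then dens yL else 0) = (\<Sum>n. co n * iR n) + (\<Sum>n. co n * iL n)"
    by (simp add: dens_def iR_def iL_def)
  also have "\<dots> = (\<Sum>n. co n * iR n + co n * iL n)" by (rule suminf_add[OF sR sL])
  also have "(\<lambda>n. co n * iR n + co n * iL n) = (\<lambda>n. co n + \<sigma> * (co (Suc n) * ix (Suc n)))"
  proof
    fix n
    have "co n * iR n + co n * iL n = co n * (1 + sg n * ix (Suc n))" unfolding tm[symmetric] by (simp add: distrib_left)
    also have "\<dots> = co n + \<sigma> * (co (Suc n) * ix (Suc n))" using slope by (simp add: co_Suc algebra_simps)
    finally show "co n * iR n + co n * iL n = co n + \<sigma> * (co (Suc n) * ix (Suc n))" .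
  qed
  also have "(\<Sum>n. co n + \<sigma> * (co (Suc n) * ix (Suc n))) = suminf co + \<sigma> * (\<Sum>n. co (Suc n) * ix (Suc n))"
  proof -
    have sS: "summable (\<lambda>n. co (Suc n) * ix (Suc n))" using sx by (subst summable_Suc_iff)
    show ?thesis using suminf_add[OF summable_co summable_mult[OF sS, of \<sigma>]] suminf_mult[OF sS, of \<sigma>] by simp
  qed
  \<comment> \<open>The missing term is that of \<open>n = 0\<close>, equal to 1 because
    \<open>orb 0 = 0\<close> lies below \<open>x\<close>.\<close>
  also have "(\<Sum>n. co (Suc n) * ix (Suc n)) = dens x - 1"
    using suminf_split_head[OF sx] x by (simp add: dens_def ix_def orb_def co_0)
  also have "suminf co + \<sigma> * (dens x - 1) = \<sigma> * dens x" by (simp add: suminf_co algebra_simps)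
  finally show ?thesis unfolding yR_def yL_def by (rule sym)
qed

lemma dens_measurable: "dens \<in> borel_measurable borel"
  unfolding dens_def by measurable

lemma dens_bounded: "\<bar>dens x\<bar> \<le> (\<Sum>n. (1 / \<sigma>) ^ n)"
proof -
  have s: "summable (\<lambda>n. \<bar>co n * (if orb n \<le> x then 1 else 0)\<bar>)"
    by (rule summable_dom) (use co_ind_le in simp)
  have "\<bar>dens x\<bar> \<le> (\<Sum>n. \<bar>co n * (if orb n \<le> x then 1 else 0)\<bar>)" unfolding dens_def by (rule summable_rabs[OF s])
  also have "\<dots> \<le> (\<Sum>n. (1 / \<sigma>) ^ n)" by (rule suminf_le[OF co_ind_le s geo])
  finally show ?thesis .
qed

text \<open>The sum is the limit of \<open>dens\<close> at 0 from the right. If 0 returns after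
  \<open>p\<close> steps, the weights repeat up to the factor \<open>co p\<close>, so the sum
  \<open>s\<close> satisfies \<open>s = co p * s + 1\<close>; otherwise it is 1.\<close>

lemma dens_zero_limit: "(\<Sum>n. co n * (if orb n = 0 then 1 else 0)) \<noteq> 0"
proof (cases "\<exists>n>0. orb n = 0")
  case False
  then have "co n * (if orb n = 0 then 1 else 0) = 0" if "n \<notin> {0}" for n
  proof -
    have "0 < n" using that by simp
    then have "orb n \<noteq> 0" using False by blast
    then show ?thesis by simp
  qed
  then have "(\<Sum>n. co n * (if orb n = 0 then 1 else 0)) = (\<Sum>n\<in>{0}. co n * (if orb n = 0 then 1 else 0))"
    by (intro suminf_finite) auto
  then show ?thesis by (simp add: co_0 orb_def)
next
  case True
  define p where "p = (LEAST n. 0 < n \<and> orb n = 0)"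
  have p: "0 < p" "orb p = 0" using LeastI_ex[of "\<lambda>n. 0 < n \<and> orb n = 0"] True by (auto simp: p_def)
  have min: "orb n \<noteq> 0" if "0 < n" "n < p" for n using not_less_Least[of n "\<lambda>n. 0 < n \<and> orb n = 0"] that by (auto simp: p_def)
  have orb_p: "orb (n + p) = orb n" for n using p(2) by (simp add: orb_def funpow_add)
  have co_p: "co (n + p) = co p * co n" for n
  proof (induction n)
    case (Suc n)
    have "sg (n + p) = sg n" by (simp add: sg_def orb_p)
    then show ?case using Suc by (simp add: co_Suc)
  qed (simp add: co_0)
  define s where "s = (\<Sum>n. co n * (if orb n = 0 then 1 else 0 :: real))"
  have "s = (\<Sum>n. co (n + p) * (if orb (n + p) = 0 then 1 else 0)) + (\<Sum>n<p. co n * (if orb n = 0 then 1 else 0))"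
    unfolding s_def by (rule suminf_split_initial_segment[OF summable_dens])
  also have "(\<Sum>n. co (n + p) * (if orb (n + p) = 0 then 1 else 0)) = co p * s"
    unfolding s_def orb_p co_p mult.assoc by (rule suminf_mult[OF summable_dens])
  also have "(\<Sum>n<p. co n * (if orb n = 0 then 1 else 0)) = (\<Sum>n\<in>{0}. co n * (if orb n = 0 then 1 else 0))"
    using p(1) min by (intro sum.mono_neutral_right) auto
  also have "\<dots> = 1" by (simp add: co_0 orb_def)
  finally have "s \<noteq> 0" by (intro notI) simp
  then show ?thesis by (simp add: s_def)
qed

text \<open>Between 0 and the nonzero points among the first \<open>N\<close> of the orbit,
  \<open>dens\<close> differs from its limit at 0 by the tail of a geometric series.\<close>

lemma dens_nonzero: "\<exists>\<delta>>0. \<delta> \<le> 1 \<and> (\<forall>x. 0 < x \<longrightarrow> x < \<delta> \<longrightarrow> dens x \<noteq> 0)"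
proof -
  define s where "s = (\<Sum>n. co n * (if orb n = 0 then 1 else 0 :: real))"
  define K where "K = (\<Sum>n. (1 / \<sigma>) ^ n)"
  have K: "0 < K" unfolding K_def using slope geo by (intro suminf_pos) auto
  have "(\<lambda>n. (1 / \<sigma>) ^ n) \<longlonglongrightarrow> 0" using slope by (intro LIMSEQ_realpow_zero) auto
  moreover have "0 < \<bar>s\<bar> / K" using dens_zero_limit K by (simp add: s_def)
  ultimately have "\<forall>\<^sub>F n in sequentially. (1 / \<sigma>) ^ n < \<bar>s\<bar> / K" by (rule order_tendstoD(2))
  then obtain N where N: "(1 / \<sigma>) ^ N < \<bar>s\<bar> / K" by (auto simp: eventually_sequentially)
  define \<delta> where "\<delta> = Min (insert 1 {orb n |n. n < N \<and> orb n \<noteq> 0})"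
  have fin: "finite {orb n |n. n < N \<and> orb n \<noteq> 0}" by simp
  have pos: "0 < orb n" if "orb n \<noteq> 0" for n using orb_range[of n] that by auto
  have \<delta>: "0 < \<delta>" "\<delta> \<le> 1" unfolding \<delta>_def using fin pos by (auto simp: Min_gr_iff)
  have "dens x \<noteq> 0" if x: "0 < x" "x < \<delta>" for x
  proof
    assume 0: "dens x = 0"
    define g where "g n = co n * (if orb n = 0 then 1 else 0) - co n * (if orb n \<le> x then 1 else 0)" for n
    have small: "g n = 0" if "n < N" for n
    proof (cases "orb n = 0")
      case False
      then have "\<delta> \<le> orb n" unfolding \<delta>_def using fin that by (intro Min_le) auto
      then show ?thesis using False x by (simp add: g_def)
    qed (use x in \<open>simp add: g_def\<close>)
    have gb: "\<bar>g n\<bar> \<le> (1 / \<sigma>) ^ n" for n using x slope by (simp add: g_def co_abs)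
    have sg: "summable g" by (rule summable_dom[OF gb])
    have sg': "summable (\<lambda>n. \<bar>g (n + N)\<bar>)"
      using summable_ignore_initial_segment[OF summable_dom[of "\<lambda>n. \<bar>g n\<bar>"], of N] gb by simp
    have sN: "summable (\<lambda>n. (1 / \<sigma>) ^ N * (1 / \<sigma>) ^ n)" by (rule summable_mult[OF geo])
    have "s - dens x = suminf g" unfolding s_def dens_def g_def by (rule suminf_diff[OF summable_dens summable_dens])
    also have "\<dots> = (\<Sum>n. g (n + N)) + (\<Sum>n<N. g n)" by (rule suminf_split_initial_segment[OF sg])
    also have "(\<Sum>n<N. g n) = 0" using small by (intro sum.neutral) auto
    finally have "\<bar>s\<bar> = \<bar>\<Sum>n. g (n + N)\<bar>" using 0 by simp
    also have "\<dots> \<le> (\<Sum>n. \<bar>g (n + N)\<bar>)" by (rule summable_rabs[OF sg'])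
    also have "\<dots> \<le> (\<Sum>n. (1 / \<sigma>) ^ N * (1 / \<sigma>) ^ n)"
    proof (rule suminf_le[OF _ sg' sN])
      show "\<bar>g (n + N)\<bar> \<le> (1 / \<sigma>) ^ N * (1 / \<sigma>) ^ n" for n using gb[of "n + N"] by (simp add: power_add mult.commute)
    qed
    also have "\<dots> = (1 / \<sigma>) ^ N * K" unfolding K_def by (rule suminf_mult[OF geo])
    also have "\<dots> < \<bar>s\<bar>" using N K by (simp add: field_simps)
    finally show False by simp
  qed
  then show ?thesis using \<delta> by blast
qed

lemma dens_pos: "(\<integral>\<^sup>+z. ennreal \<bar>dens z\<bar> * indicator {0<..<1} z \<partial>lborel) \<noteq> 0"
proof
  assume "(\<integral>\<^sup>+z. ennreal \<bar>dens z\<bar> * indicator {0<..<1} z \<partial>lborel) = 0"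
  then have ae: "AE z in lborel. ennreal \<bar>dens z\<bar> * indicator {0<..<1} z = 0"
    using dens_measurable by (subst (asm) nn_integral_0_iff_AE) auto
  obtain \<delta> where \<delta>: "0 < \<delta>" "\<delta> \<le> 1" "\<And>x. 0 < x \<Longrightarrow> x < \<delta> \<Longrightarrow> dens x \<noteq> 0" using dens_nonzero by blast
  have "AE z in lborel. z \<notin> {0<..<\<delta>}"
    using ae by eventually_elim (use \<delta> in \<open>auto split: split_indicator_asm simp: ennreal_eq_0_iff\<close>)
  then have "{0<..<\<delta>} \<in> null_sets lborel" by (subst AE_iff_null_sets) auto
  then have "emeasure lborel {0<..<\<delta>} = 0" by (rule null_setsD1)
  then show False using \<delta>(1) by simp
qed

text \<open>Taking absolute values in the transfer equation leaves an inequality; it is integrated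
  branch by branch. The test function \<open>W\<close> allows all half sides to be treated at
  once.\<close>

lemma dens_invariant:
  fixes W :: "real \<Rightarrow> ennreal"
  assumes W: "W \<in> borel_measurable borel"
  shows "(\<integral>\<^sup>+z. W z * (ennreal \<bar>dens z\<bar> * indicator {0<..<1} z) \<partial>lborel)
    \<le> (\<integral>\<^sup>+z. W (tent \<sigma> z) * (ennreal \<bar>dens z\<bar> * indicator {0<..<1} z) \<partial>lborel)"
proof -
  define c where "c = 1 - 1 / \<sigma>"
  have c: "0 < c" "c < 1" "\<sigma> * c = \<sigma> - 1" using slope by (auto simp: c_def field_simps)
  note [measurable] = dens_measurable W
  define GL where "GL x = W x * (ennreal \<bar>dens ((x - 2 + \<sigma>) / \<sigma>)\<bar> * indicator {2 - \<sigma><..<1} x)" for x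
  define GR where "GR x = W x * (ennreal \<bar>dens (1 - x / \<sigma>)\<bar> * indicator {0<..<1} x)" for x
  have [measurable]: "GL \<in> borel_measurable borel" "GR \<in> borel_measurable borel" unfolding GL_def GR_def by measurable
  have lt: "\<sigma> * p < \<sigma> * q \<longleftrightarrow> p < q" for p q using slope by simp
  have L: "(\<integral>\<^sup>+x. GL x \<partial>lborel) = ennreal \<sigma> * (\<integral>\<^sup>+z. W (2 - \<sigma> + \<sigma> * z) * (ennreal \<bar>dens z\<bar> * indicator {0<..<c} z) \<partial>lborel)"
  proof -
    have "(\<integral>\<^sup>+x. GL x \<partial>lborel) = ennreal \<bar>\<sigma>\<bar> * (\<integral>\<^sup>+z. GL ((2 - \<sigma>) + \<sigma> * z) \<partial>lborel)"
      using slope by (intro nn_integral_real_affine) auto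
    also have "(\<integral>\<^sup>+z. GL ((2 - \<sigma>) + \<sigma> * z) \<partial>lborel)
        = (\<integral>\<^sup>+z. W (2 - \<sigma> + \<sigma> * z) * (ennreal \<bar>dens z\<bar> * indicator {0<..<c} z) \<partial>lborel)"
    proof (rule nn_integral_cong)
      fix z
      have "((2 - \<sigma> + \<sigma> * z) - 2 + \<sigma>) / \<sigma> = z" using slope by simp
      moreover have "2 - \<sigma> + \<sigma> * z \<in> {2 - \<sigma><..<1} \<longleftrightarrow> z \<in> {0<..<c}"
        using lt[of z c] lt[of 0 z] c by auto
      ultimately show "GL ((2 - \<sigma>) + \<sigma> * z) = W (2 - \<sigma> + \<sigma> * z) * (ennreal \<bar>dens z\<bar> * indicator {0<..<c} z)"
        by (simp only: GL_def indicator_def)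
    qed
    finally show ?thesis using slope by simp
  qed
  have R: "(\<integral>\<^sup>+x. GR x \<partial>lborel) = ennreal \<sigma> * (\<integral>\<^sup>+z. W (\<sigma> - \<sigma> * z) * (ennreal \<bar>dens z\<bar> * indicator {c<..<1} z) \<partial>lborel)"
  proof -
    have "(\<integral>\<^sup>+x. GR x \<partial>lborel) = ennreal \<bar>- \<sigma>\<bar> * (\<integral>\<^sup>+z. GR (\<sigma> + (- \<sigma>) * z) \<partial>lborel)"
      using slope by (intro nn_integral_real_affine) auto
    also have "(\<integral>\<^sup>+z. GR (\<sigma> + (- \<sigma>) * z) \<partial>lborel)
        = (\<integral>\<^sup>+z. W (\<sigma> - \<sigma> * z) * (ennreal \<bar>dens z\<bar> * indicator {c<..<1} z) \<partial>lborel)"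
    proof (rule nn_integral_cong)
      fix z
      have "1 - (\<sigma> + (- \<sigma>) * z) / \<sigma> = z" using slope by (simp add: field_simps)
      moreover have "\<sigma> + (- \<sigma>) * z \<in> {0<..<1} \<longleftrightarrow> z \<in> {c<..<1}"
        using lt[of c z] lt[of z 1] c by auto
      moreover have "\<sigma> + (- \<sigma>) * z = \<sigma> - \<sigma> * z" by simp
      ultimately show "GR (\<sigma> + (- \<sigma>) * z) = W (\<sigma> - \<sigma> * z) * (ennreal \<bar>dens z\<bar> * indicator {c<..<1} z)"
        by (simp only: GR_def indicator_def)
    qed
    finally show ?thesis using slope by simp
  qed
  have "countable (range orb)" by simp
  then have "range orb \<in> null_sets lborel" by (rule countable_imp_null_set_lborel)
  then have "AE x in lborel. x \<notin> range orb" by (rule AE_not_in)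
  then have le: "AE x in lborel. ennreal \<sigma> * (W x * (ennreal \<bar>dens x\<bar> * indicator {0<..<1} x)) \<le> GL x + GR x"
  proof eventually_elim
    fix x assume x: "x \<notin> range orb"
    show "ennreal \<sigma> * (W x * (ennreal \<bar>dens x\<bar> * indicator {0<..<1} x)) \<le> GL x + GR x"
    proof (cases "x \<in> {0<..<1}")
      case True
      have "\<sigma> * \<bar>dens x\<bar> \<le> \<bar>dens (1 - x / \<sigma>)\<bar> + (if 2 - \<sigma> < x then \<bar>dens ((x - 2 + \<sigma>) / \<sigma>)\<bar> else 0)"
      proof -
        have "\<sigma> * \<bar>dens x\<bar> = \<bar>\<sigma> * dens x\<bar>" using slope by (simp add: abs_mult)
        then show ?thesis using dens_transfer[of x] True x by (auto simp: abs_triangle_ineq)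
      qed
      then have "ennreal (\<sigma> * \<bar>dens x\<bar>) \<le> ennreal (\<bar>dens (1 - x / \<sigma>)\<bar> + (if 2 - \<sigma> < x then \<bar>dens ((x - 2 + \<sigma>) / \<sigma>)\<bar> else 0))"
        by (rule ennreal_leI)
      also have "\<dots> = ennreal \<bar>dens (1 - x / \<sigma>)\<bar> + ennreal (if 2 - \<sigma> < x then \<bar>dens ((x - 2 + \<sigma>) / \<sigma>)\<bar> else 0)"
        by (rule ennreal_plus) auto
      finally have "ennreal (\<sigma> * \<bar>dens x\<bar>) \<le> ennreal \<bar>dens (1 - x / \<sigma>)\<bar> + ennreal (if 2 - \<sigma> < x then \<bar>dens ((x - 2 + \<sigma>) / \<sigma>)\<bar> else 0)" .
      then have "W x * ennreal (\<sigma> * \<bar>dens x\<bar>) \<le> W x * (ennreal \<bar>dens (1 - x / \<sigma>)\<bar> + ennreal (if 2 - \<sigma> < x then \<bar>dens ((x - 2 + \<sigma>) / \<sigma>)\<bar> else 0))"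
        by (rule mult_left_mono) simp
      also have "\<dots> = GL x + GR x" using True by (auto simp: GL_def GR_def distrib_left add.commute)
      also have "W x * ennreal (\<sigma> * \<bar>dens x\<bar>) = ennreal \<sigma> * (W x * (ennreal \<bar>dens x\<bar> * indicator {0<..<1} x))"
        using True slope by (simp add: ennreal_mult mult_ac)
      finally show ?thesis .
    qed simp
  qed
  have "ennreal \<sigma> * (\<integral>\<^sup>+z. W z * (ennreal \<bar>dens z\<bar> * indicator {0<..<1} z) \<partial>lborel)
      = (\<integral>\<^sup>+z. ennreal \<sigma> * (W z * (ennreal \<bar>dens z\<bar> * indicator {0<..<1} z)) \<partial>lborel)"
    by (rule nn_integral_cmult[symmetric]) measurable
  also have "\<dots> \<le> (\<integral>\<^sup>+x. GL x + GR x \<partial>lborel)" by (rule nn_integral_mono_AE[OF le])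
  also have "\<dots> = (\<integral>\<^sup>+x. GL x \<partial>lborel) + (\<integral>\<^sup>+x. GR x \<partial>lborel)" by (rule nn_integral_add) measurable
  also have "\<dots> = ennreal \<sigma> * ((\<integral>\<^sup>+z. W (2 - \<sigma> + \<sigma> * z) * (ennreal \<bar>dens z\<bar> * indicator {0<..<c} z) \<partial>lborel) +
      (\<integral>\<^sup>+z. W (\<sigma> - \<sigma> * z) * (ennreal \<bar>dens z\<bar> * indicator {c<..<1} z) \<partial>lborel))"
    unfolding L R by (simp add: distrib_left)
  also have "(\<integral>\<^sup>+z. W (2 - \<sigma> + \<sigma> * z) * (ennreal \<bar>dens z\<bar> * indicator {0<..<c} z) \<partial>lborel) +
      (\<integral>\<^sup>+z. W (\<sigma> - \<sigma> * z) * (ennreal \<bar>dens z\<bar> * indicator {c<..<1} z) \<partial>lborel)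
    = (\<integral>\<^sup>+z. W (2 - \<sigma> + \<sigma> * z) * (ennreal \<bar>dens z\<bar> * indicator {0<..<c} z) + W (\<sigma> - \<sigma> * z) * (ennreal \<bar>dens z\<bar> * indicator {c<..<1} z) \<partial>lborel)"
    by (rule nn_integral_add[symmetric]) measurable
  also have "\<dots> \<le> (\<integral>\<^sup>+z. W (tent \<sigma> z) * (ennreal \<bar>dens z\<bar> * indicator {0<..<1} z) \<partial>lborel)"
    using c by (intro nn_integral_mono) (auto simp: tent_def c_def[symmetric] split: split_indicator)
  finally have "ennreal \<sigma> * (\<integral>\<^sup>+z. W z * (ennreal \<bar>dens z\<bar> * indicator {0<..<1} z) \<partial>lborel)
      \<le> ennreal \<sigma> * (\<integral>\<^sup>+z. W (tent \<sigma> z) * (ennreal \<bar>dens z\<bar> * indicator {0<..<1} z) \<partial>lborel)"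
    by (simp add: mult_left_mono)
  then show ?thesis using slope by (simp add: ennreal_mult_le_mult_iff)
qed

end

section \<open>Skew products over tent maps on a closed curve\<close>

text \<open>\<open>chart r i z\<close> is the point of the \<open>i\<close>-th half side (of length \<open>r\<close>) at distance \<open>r * z\<close> from the
  vertex at its end.\<close>

definition chart :: "real \<Rightarrow> nat \<Rightarrow> real \<Rightarrow> real" where
  "chart r i z = r * (real i + (if even i then z else 1 - z))"

definition coord :: "real \<Rightarrow> nat \<Rightarrow> real \<Rightarrow> real" where
  "coord r i x = (if even i then x / r - real i else real i + 1 - x / r)"

definition half :: "real \<Rightarrow> nat \<Rightarrow> real \<Rightarrow> real \<Rightarrow> real set" where
  "half r i u v = chart r i ` {u<..<v}"

lemma chart_coord: "r > 0 \<Longrightarrow> chart r i (coord r i x) = x" "r > 0 \<Longrightarrow> coord r i (chart r i z) = z"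
  by (auto simp: chart_def coord_def)

lemma chart_affine: "\<exists>s e. (s = 1 \<or> s = -1) \<and> (\<forall>z. chart r i z = s * r * z + e)"
proof (cases "even i")
  case True
  then show ?thesis by (intro exI[of _ 1] exI[of _ "r * real i"]) (auto simp: chart_def algebra_simps)
next
  case False
  then show ?thesis by (intro exI[of _ "-1"] exI[of _ "r * (real i + 1)"]) (auto simp: chart_def algebra_simps)
qed

lemma coord_affine: "r > 0 \<Longrightarrow> \<exists>s e. (s = 1 \<or> s = -1) \<and> (\<forall>x. coord r i x = s * x / r + e)"
proof (cases "even i")
  case True
  then show ?thesis by (intro exI[of _ 1] exI[of _ "- real i"]) (auto simp: coord_def)
next
  case False
  then show ?thesis by (intro exI[of _ "-1"] exI[of _ "real i + 1"]) (auto simp: coord_def)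
qed

lemma coord_range:
  assumes "r > 0"
  shows "0 < coord r i x \<and> coord r i x < 1 \<longleftrightarrow> r * real i < x \<and> x < r * (real i + 1)"
  using assms by (auto simp: coord_def field_simps)

lemma chart_range: "r > 0 \<Longrightarrow> 0 < z \<Longrightarrow> z < 1 \<Longrightarrow> r * real i < chart r i z \<and> chart r i z < r * (real i + 1)"
  using coord_range[of r i "chart r i z"] chart_coord by simp

lemma half_interval:
  assumes "r > 0" "u < v"
  obtains p q where "half r i u v = {p<..<q}" "q - p = r * (v - u)" "p < q"
proof -
  obtain s e where "s = 1 \<or> s = -1" "\<forall>z. chart r i z = s * r * z + e" using chart_affine by blast
  then have "affine_on (chart r i) r u v" unfolding affine_on_def by blast
  from affine_on_image[OF this assms] obtain p q where pq: "chart r i ` {u<..<v} = {p<..<q}" "q - p = r * (v - u)" by blast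
  moreover have "0 < r * (v - u)" using assms by simp
  ultimately show thesis using that by (simp add: half_def)
qed

lemma half_sub: "r > 0 \<Longrightarrow> 0 \<le> u \<Longrightarrow> v \<le> 1 \<Longrightarrow> x \<in> half r i u v \<Longrightarrow> r * real i < x \<and> x < r * (real i + 1)"
  unfolding half_def using chart_range by fastforce

lemma cell_unique:
  assumes "r > 0" "r * real i < x" "x < r * (real i + 1)" "r * real j < x" "x < r * (real j + 1)"
  shows "i = j"
proof -
  have "r * real i < r * (real j + 1)" "r * real j < r * (real i + 1)" using assms by linarith+
  then have "real i < real j + 1" "real j < real i + 1" using assms(1) by (simp_all only: mult_less_cancel_left_pos)
  then show ?thesis by linarith
qed

lemma chart_inj:
  assumes "r > 0" "0 < z" "z < 1" "0 < w" "w < 1" "chart r i z = chart r j w"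
  shows "i = j \<and> z = w"
proof -
  have "i = j" using cell_unique[of r i "chart r i z" j] chart_range[of r z i] chart_range[of r w j] assms by simp
  moreover have "coord r i (chart r i z) = coord r i (chart r j w)" using assms(6) by simp
  ultimately show ?thesis by (simp add: chart_coord(2)[OF assms(1)])
qed

text \<open>The map is prescribed on the open branches only; at vertices and turning points it just
  has to stay in range.\<close>

locale slap_system =
  fixes d :: nat and \<beta> r :: real and f :: "real \<Rightarrow> real"
  assumes d: "odd d" "d \<ge> 3" and \<beta>: "1 < \<beta>" "\<beta> \<le> 2" and r: "r > 0"
    and f_range: "\<And>x. x \<in> {0..real (2 * d) * r} \<Longrightarrow> f x \<in> {0..real (2 * d) * r}"
    and f_left: "\<And>i z. i < 2 * d \<Longrightarrow> 0 < z \<Longrightarrow> z < 1 - 1 / \<beta> \<Longrightarrow> f (chart r i z) = chart r (slap_a d i) (2 - \<beta> + \<beta> * z)"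
    and f_right: "\<And>i z. i < 2 * d \<Longrightarrow> 1 - 1 / \<beta> < z \<Longrightarrow> z < 1 \<Longrightarrow> f (chart r i z) = chart r (slap_b d i) (\<beta> - \<beta> * z)"
begin

definition c :: real where "c = 1 - 1 / \<beta>"

definition len :: real where "len = real (2 * d) * r"

definition cuts :: "real set" where
  "cuts = (\<lambda>k. r * real k) ` {..2 * d} \<union> (\<lambda>i. chart r i c) ` {..<2 * d}"

lemma c: "0 < c" "c < 1" using \<beta> by (auto simp: c_def field_simps)

lemma fibre_in: "i < 2 * d \<Longrightarrow> slap_a d i < 2 * d" "i < 2 * d \<Longrightarrow> slap_b d i < 2 * d"
  using slap_in d by auto

lemma len: "0 < len" using d r by (simp add: len_def)

lemma finite_cuts: "finite cuts" by (simp add: cuts_def)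

lemma cell_le: "i < 2 * d \<Longrightarrow> r * (real i + 1) \<le> len"
proof -
  assume "i < 2 * d"
  then have "real i + 1 \<le> real (2 * d)" by linarith
  then show ?thesis using r mult_left_mono[of "real i + 1" "real (2 * d)" r] by (simp add: len_def mult.commute)
qed

lemma cell_ex:
  assumes "0 \<le> u" "u < len"
  obtains i where "i < 2 * d" "r * real i \<le> u" "u < r * (real i + 1)"
proof -
  define i where "i = nat \<lfloor>u / r\<rfloor>"
  have i: "real i = of_int \<lfloor>u / r\<rfloor>" using assms r by (simp add: i_def)
  have b: "real i \<le> u / r" "u / r < real i + 1" unfolding i by linarith+
  then have "r * real i \<le> u" "u < r * (real i + 1)" using r by (simp_all add: field_simps)
  moreover have "u / r < real (2 * d)" using assms(2) r by (simp add: len_def divide_less_eq)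
  then have "real i < real (2 * d)" using b by linarith
  then have "i < 2 * d" by linarith
  ultimately show thesis using that by blast
qed

lemma chart_ex:
  assumes "x \<in> {0..len}" "x \<notin> cuts"
  obtains i z where "i < 2 * d" "0 < z" "z < 1" "z \<noteq> c" "x = chart r i z"
proof -
  have nk: "x \<noteq> r * real k" if "k \<le> 2 * d" for k using assms(2) that by (auto simp: cuts_def)
  have "x \<noteq> len" using nk[of "2 * d"] by (simp add: len_def mult.commute)
  then have "x < len" using assms(1) by simp
  then obtain i where i: "i < 2 * d" "r * real i \<le> x" "x < r * (real i + 1)" using cell_ex[of x] assms(1) by auto
  have "r * real i < x" using i nk[of i] by auto
  then have "0 < coord r i x" "coord r i x < 1" using coord_range[OF r] i by auto
  moreover have "coord r i x \<noteq> c"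
  proof
    assume "coord r i x = c"
    then have "x = chart r i c" using chart_coord(1)[OF r, of i x] by simp
    then show False using assms(2) i(1) by (auto simp: cuts_def)
  qed
  ultimately show thesis by (rule that[OF i(1)]) (simp add: chart_coord(1)[OF r])
qed

lemma affine_piece:
  assumes i: "i < 2 * d" and sub: "\<And>x. x \<in> {u<..<v} \<Longrightarrow> r * real i < x \<and> x < r * (real i + 1)"
    and side: "(\<forall>x\<in>{u<..<v}. coord r i x < c) \<or> (\<forall>x\<in>{u<..<v}. c < coord r i x)"
  shows "affine_on f \<beta> u v"
proof -
  obtain s e where s: "s = 1 \<or> s = -1" "\<forall>x. coord r i x = s * x / r + e" using coord_affine[OF r] by blast
  have rng: "0 < coord r i x \<and> coord r i x < 1" if "x \<in> {u<..<v}" for x using coord_range[OF r] sub[OF that] by blast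
  show ?thesis
  proof (cases "\<forall>x\<in>{u<..<v}. coord r i x < c")
    case True
    obtain s' e' where s': "s' = 1 \<or> s' = -1" "\<forall>z. chart r (slap_a d i) z = s' * r * z + e'" using chart_affine by blast
    have "f x = (s' * s) * \<beta> * x + (s' * r * (2 - \<beta> + \<beta> * e) + e')" if "x \<in> {u<..<v}" for x
    proof -
      have "f x = f (chart r i (coord r i x))" by (simp add: chart_coord r)
      also have "\<dots> = chart r (slap_a d i) (2 - \<beta> + \<beta> * coord r i x)"
        using rng[OF that] True that by (intro f_left i) (auto simp: c_def)
      also have "\<dots> = s' * r * (2 - \<beta> + \<beta> * (s * x / r + e)) + e'" using s(2) s'(2) by simp
      finally show ?thesis using r by (simp add: algebra_simps)
    qed
    moreover have "s' * s = 1 \<or> s' * s = -1" using s s' by auto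
    ultimately show ?thesis unfolding affine_on_def by blast
  next
    case False
    then have gt: "\<forall>x\<in>{u<..<v}. c < coord r i x" using side by blast
    obtain s' e' where s': "s' = 1 \<or> s' = -1" "\<forall>z. chart r (slap_b d i) z = s' * r * z + e'" using chart_affine by blast
    have "f x = (- s' * s) * \<beta> * x + (s' * r * (\<beta> - \<beta> * e) + e')" if "x \<in> {u<..<v}" for x
    proof -
      have "f x = f (chart r i (coord r i x))" by (simp add: chart_coord r)
      also have "\<dots> = chart r (slap_b d i) (\<beta> - \<beta> * coord r i x)"
        using rng[OF that] gt that by (intro f_right i) (auto simp: c_def)
      also have "\<dots> = s' * r * (\<beta> - \<beta> * (s * x / r + e)) + e'" using s(2) s'(2) by simp
      finally show ?thesis using r by (simp add: algebra_simps)
    qed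
    moreover have "- s' * s = 1 \<or> - s' * s = -1" using s s' by auto
    ultimately show ?thesis unfolding affine_on_def by blast
  qed
qed

lemma f_affine:
  assumes uv: "0 \<le> u" "u < v" "v \<le> len" "{u<..<v} \<inter> cuts = {}"
  shows "affine_on f \<beta> u v"
proof -
  obtain i where i: "i < 2 * d" "r * real i \<le> u" "u < r * (real i + 1)" using cell_ex[of u] uv by auto
  have "r * (real i + 1) \<in> cuts" using i by (auto simp: cuts_def intro!: image_eqI[of _ _ "Suc i"])
  then have v: "v \<le> r * (real i + 1)" using uv(4) i(3) by force
  have cc: "chart r i c \<notin> {u<..<v}" using uv(4) i(1) by (auto simp: cuts_def)
  obtain s e where s: "s = 1 \<or> s = -1" "\<forall>x. coord r i x = s * x / r + e" using coord_affine[OF r] by blast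
  have cx: "coord r i (chart r i c) = c" by (simp add: chart_coord r)
  have lt: "coord r i x < coord r i y \<longleftrightarrow> s * x < s * y" for x y using s(2) r by (simp add: divide_less_cancel)
  have "(\<forall>x\<in>{u<..<v}. coord r i x < c) \<or> (\<forall>x\<in>{u<..<v}. c < coord r i x)"
  proof (cases "v \<le> chart r i c")
    case True
    then have *: "x < chart r i c" if "x \<in> {u<..<v}" for x using that by simp
    from s(1) show ?thesis
    proof
      assume "s = 1"
      then have "coord r i x < coord r i (chart r i c)" if "x \<in> {u<..<v}" for x using lt *[OF that] by simp
      then show ?thesis unfolding cx by blast
    next
      assume "s = -1"
      then have "coord r i (chart r i c) < coord r i x" if "x \<in> {u<..<v}" for x using lt *[OF that] by simp
      then show ?thesis unfolding cx by blast
    qed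
  next
    case False
    then have "chart r i c \<le> u" using cc by simp
    then have *: "chart r i c < x" if "x \<in> {u<..<v}" for x using that by simp
    from s(1) show ?thesis
    proof
      assume "s = 1"
      then have "coord r i (chart r i c) < coord r i x" if "x \<in> {u<..<v}" for x using lt *[OF that] by simp
      then show ?thesis unfolding cx by blast
    next
      assume "s = -1"
      then have "coord r i x < coord r i (chart r i c)" if "x \<in> {u<..<v}" for x using lt *[OF that] by simp
      then show ?thesis unfolding cx by blast
    qed
  qed
  then show ?thesis using i v by (intro affine_piece[OF i(1)]) auto
qed

lemma finite_fibre: "finite {x \<in> {0..len}. f x = y}"
proof -
  define P where "P i = {x. r * real i < x \<and> x < r * (real i + 1) \<and> coord r i x < c \<and> f x = y}" for i
  define Q where "Q i = {x. r * real i < x \<and> x < r * (real i + 1) \<and> c < coord r i x \<and> f x = y}" for i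
  \<comment> \<open>On each branch within a half side \<open>f\<close> is injective and contributes
    at most one point.\<close>
  have sing: "finite (T i)" if i: "i < 2 * d" and T: "T = P \<or> T = Q" for T i
  proof -
    have "x = x'" if "x \<in> T i" "x' \<in> T i" for x x'
    proof -
      have *: "coord r i w = coord r i w' \<Longrightarrow> w = w'" for w w' using chart_coord(1)[OF r, of i] by metis
      have eq: "f w = f (chart r i (coord r i w))" for w by (simp add: chart_coord r)
      have fx: "f x = f x'" using that T by (auto simp: P_def Q_def)
      have rg: "0 < coord r i x" "coord r i x < 1" "0 < coord r i x'" "coord r i x' < 1"
      proof -
        have "r * real i < x \<and> x < r * (real i + 1)" "r * real i < x' \<and> x' < r * (real i + 1)"
          using that T by (auto simp: P_def Q_def)
        then show "0 < coord r i x" "coord r i x < 1" "0 < coord r i x'" "coord r i x' < 1"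
          using coord_range[OF r, of i x] coord_range[OF r, of i x'] by blast+
      qed
      have cinj: "chart r j w = chart r j w' \<Longrightarrow> w = w'" for j w w' using chart_coord(2)[OF r, of j] by metis
      show ?thesis
      proof (cases "T = P")
        case True
        then have "coord r i x < c" "coord r i x' < c" using that by (auto simp: P_def)
        then have "chart r (slap_a d i) (2 - \<beta> + \<beta> * coord r i x) = chart r (slap_a d i) (2 - \<beta> + \<beta> * coord r i x')"
          using f_left[OF i, of "coord r i x"] f_left[OF i, of "coord r i x'"] rg fx eq[of x] eq[of x'] by (simp add: c_def)
        then have "2 - \<beta> + \<beta> * coord r i x = 2 - \<beta> + \<beta> * coord r i x'" by (rule cinj)
        then have "coord r i x = coord r i x'" using \<beta> by simp
        then show ?thesis by (rule *)
      next
        case False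
        then have "c < coord r i x" "c < coord r i x'" using that T by (auto simp: Q_def)
        then have "chart r (slap_b d i) (\<beta> - \<beta> * coord r i x) = chart r (slap_b d i) (\<beta> - \<beta> * coord r i x')"
          using f_right[OF i, of "coord r i x"] f_right[OF i, of "coord r i x'"] rg fx eq[of x] eq[of x'] by (simp add: c_def)
        then have "\<beta> - \<beta> * coord r i x = \<beta> - \<beta> * coord r i x'" by (rule cinj)
        then have "coord r i x = coord r i x'" using \<beta> by simp
        then show ?thesis by (rule *)
      qed
    qed
    then have "T i \<subseteq> {x}" if "x \<in> T i" for x using that by blast
    then show ?thesis by (cases "T i = {}") (auto dest: finite_subset)
  qed
  have sub: "{x \<in> {0..len}. f x = y} \<subseteq> cuts \<union> (\<Union>i<2 * d. P i \<union> Q i)"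
  proof
    fix x assume x: "x \<in> {x \<in> {0..len}. f x = y}"
    show "x \<in> cuts \<union> (\<Union>i<2 * d. P i \<union> Q i)"
    proof (cases "x \<in> cuts")
      case False
      then obtain i z where i: "i < 2 * d" "0 < z" "z < 1" "z \<noteq> c" "x = chart r i z" using chart_ex[of x] x by auto
      have "coord r i x = z" by (simp add: i(5) chart_coord r)
      then have "x \<in> P i \<union> Q i" using i x chart_range[OF r i(2,3), of i] by (auto simp: P_def Q_def)
      then show ?thesis using i(1) by blast
    qed simp
  qed
  have "finite (\<Union>i<2 * d. P i \<union> Q i)" using sing[of _ P] sing[of _ Q] by (intro finite_UN_I) auto
  then have "finite (cuts \<union> (\<Union>i<2 * d. P i \<union> Q i))" using finite_cuts by blast
  with sub show ?thesis by (rule finite_subset)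
qed

sublocale pw_affine len \<beta> f cuts
  using len \<beta> finite_cuts f_range finite_fibre f_affine by unfold_locales (auto simp: len_def)

lemma half_bounds:
  assumes "i < 2 * d" "0 \<le> u" "u < v" "v \<le> 1"
  obtains p q where "half r i u v = {p<..<q}" "q - p = r * (v - u)" "0 \<le> p" "p < q" "q \<le> len"
proof -
  obtain p q where pq: "half r i u v = {p<..<q}" "q - p = r * (v - u)" "p < q"
    by (rule half_interval[OF r assms(3)])
  have "{p<..<q} \<subseteq> {r * real i..r * (real i + 1)}"
    using half_sub[OF r assms(2,4), of _ i] unfolding pq(1) by fastforce
  then have "r * real i \<le> p" "q \<le> r * (real i + 1)"
    using pq(3) by (simp_all add: greaterThanLessThan_subseteq_atLeastAtMost_iff)
  moreover have "0 \<le> r * real i" using r by simp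
  ultimately show thesis using that[OF pq(1,2)] pq(3) cell_le[OF assms(1)] by linarith
qed

lemma half_M: "i < 2 * d \<Longrightarrow> 0 \<le> u \<Longrightarrow> v \<le> 1 \<Longrightarrow> half r i u v \<in> sets M"
proof (cases "u < v")
  case True
  assume a: "i < 2 * d" "0 \<le> u" "v \<le> 1"
  obtain p q where "half r i u v = {p<..<q}" "q - p = r * (v - u)" "0 \<le> p" "p < q" "q \<le> len"
    by (rule half_bounds[OF a(1,2) True a(3)])
  then show ?thesis using interval_M by simp
qed (simp add: half_def)

lemma covers_piece:
  assumes i: "i < 2 * d" and uv: "0 \<le> u" "u < v" "v \<le> 1" and side: "v \<le> c \<or> c \<le> u"
  shows "covers (half r i u v) 1 (f ` half r i u v)"
proof -
  obtain p q where pq: "half r i u v = {p<..<q}" "q - p = r * (v - u)" "0 \<le> p" "p < q" "q \<le> len"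
    by (rule half_bounds[OF i uv])
  have co: "coord r i x \<in> {u<..<v}" if "x \<in> {p<..<q}" for x
    using that unfolding pq(1)[symmetric] half_def by (auto simp: chart_coord r)
  have "affine_on f \<beta> p q"
  proof (rule affine_piece[OF i])
    show "r * real i < x \<and> x < r * (real i + 1)" if "x \<in> {p<..<q}" for x
      using half_sub[OF r uv(1,3), of x i] that pq(1) by simp
    show "(\<forall>x\<in>{p<..<q}. coord r i x < c) \<or> (\<forall>x\<in>{p<..<q}. c < coord r i x)"
      using co side by fastforce
  qed
  then have "affine_on (f ^^ 1) (\<beta> ^ 1) p q" by simp
  from covers_affine[OF pq(3-5) this] show ?thesis by (simp add: pq(1))
qed

definition cov :: covering where
  "cov i u v n j u' v' \<longleftrightarrow> i < 2 * d \<and> j < 2 * d \<and> 0 \<le> u \<and> v \<le> 1 \<and> 0 \<le> u' \<and> v' \<le> 1 \<and>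
     covers (half r i u v) n (half r j u' v')"

lemma image_affine_pos: "0 < k \<Longrightarrow> (\<lambda>z. e + k * z) ` {u<..<v} = {e + k * u<..<e + k * (v :: real)}"
proof -
  assume k: "0 < k"
  have "y \<in> (\<lambda>z. e + k * z) ` {u<..<v}" if "e + k * u < y" "y < e + k * v" for y
    by (rule image_eqI[where x = "(y - e) / k"]) (use k that in \<open>auto simp: field_simps\<close>)
  then show ?thesis using k by auto
qed

lemma image_affine_neg: "0 < k \<Longrightarrow> (\<lambda>z. e - k * z) ` {u<..<v} = {e - k * v<..<e - k * (u :: real)}"
proof -
  assume k: "0 < k"
  have "y \<in> (\<lambda>z. e - k * z) ` {u<..<v}" if "e - k * v < y" "y < e - k * u" for y
    by (rule image_eqI[where x = "(e - y) / k"]) (use k that in \<open>auto simp: field_simps\<close>)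
  then show ?thesis using k by auto
qed

lemma tent_cover_cov: "tent_cover \<beta> (slap_a d) (slap_b d) {..<2 * d} cov"
proof
  show "1 < \<beta>" "\<beta> \<le> 2" by (rule \<beta>)+
  show "slap_a d i \<in> {..<2 * d}" "slap_b d i \<in> {..<2 * d}" if "i \<in> {..<2 * d}" for i using that fibre_in by auto
  have bc: "\<beta> * c = \<beta> - 1" using \<beta> by (simp add: c_def field_simps)
  show "cov i u v 0 i w w'" if "i \<in> {..<2 * d}" "0 \<le> u" "v \<le> 1" "u \<le> w" "w < w'" "w' \<le> v" for i u v w w'
  proof -
    have "half r i w w' \<subseteq> half r i u v" unfolding half_def using that by (intro image_mono) auto
    then show ?thesis using that unfolding cov_def by (auto intro!: covers_sub half_M)
  qed
  show "cov i u v (n + m) q w w'" if "cov i u v n j u' v'" "cov j u' v' m q w w'" for i u v n j u' v' m q w w'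
    using that unfolding cov_def by (auto intro!: covers_trans[of "half r i u v" n "half r j u' v'"] half_M)
  show "cov i u v 1 (slap_a d i) (2 - \<beta> + \<beta> * u) (2 - \<beta> + \<beta> * v)"
    if a: "i \<in> {..<2 * d}" "0 \<le> u" "u < v" "v \<le> 1 - 1 / \<beta>" for i u v
  proof -
    have v: "v \<le> c" using a(4) by (simp add: c_def)
    then have v1: "v \<le> 1" using c by linarith
    have "f ` half r i u v = (\<lambda>z. chart r (slap_a d i) (2 - \<beta> + \<beta> * z)) ` {u<..<v}"
      unfolding half_def image_image using a f_left by (intro image_cong) auto
    also have "\<dots> = chart r (slap_a d i) ` ((\<lambda>z. 2 - \<beta> + \<beta> * z) ` {u<..<v})" by (simp only: image_image)
    also have "\<dots> = half r (slap_a d i) (2 - \<beta> + \<beta> * u) (2 - \<beta> + \<beta> * v)"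
      unfolding half_def using image_affine_pos[of \<beta> "2 - \<beta>" u v] \<beta> by simp
    finally have "covers (half r i u v) 1 (half r (slap_a d i) (2 - \<beta> + \<beta> * u) (2 - \<beta> + \<beta> * v))"
      using covers_piece[of i u v] a v v1 by simp
    moreover have "0 \<le> \<beta> * u" "\<beta> * v \<le> \<beta> - 1" using a \<beta> mult_left_mono[OF v, of \<beta>] bc by auto
    ultimately show ?thesis using a v1 fibre_in \<beta> by (auto simp: cov_def)
  qed
  show "cov i u v 1 (slap_b d i) (\<beta> - \<beta> * v) (\<beta> - \<beta> * u)"
    if a: "i \<in> {..<2 * d}" "1 - 1 / \<beta> \<le> u" "u < v" "v \<le> 1" for i u v
  proof -
    have u: "c \<le> u" using a(2) by (simp add: c_def)
    then have u0: "0 \<le> u" using c by linarith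
    have "f ` half r i u v = (\<lambda>z. chart r (slap_b d i) (\<beta> - \<beta> * z)) ` {u<..<v}"
      unfolding half_def image_image using a f_right by (intro image_cong) auto
    also have "\<dots> = chart r (slap_b d i) ` ((\<lambda>z. \<beta> - \<beta> * z) ` {u<..<v})" by (simp only: image_image)
    also have "\<dots> = half r (slap_b d i) (\<beta> - \<beta> * v) (\<beta> - \<beta> * u)"
      unfolding half_def using image_affine_neg[of \<beta> \<beta> u v] \<beta> by simp
    finally have "covers (half r i u v) 1 (half r (slap_b d i) (\<beta> - \<beta> * v) (\<beta> - \<beta> * u))"
      using covers_piece[of i u v] a u u0 by simp
    moreover have "\<beta> * v \<le> \<beta>" "\<beta> - 1 \<le> \<beta> * u" using a \<beta> mult_left_mono[OF u, of \<beta>] bc by auto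
    ultimately show ?thesis using a u0 fibre_in \<beta> by (auto simp: cov_def)
  qed
qed

end

lemma slap_a_slap_a:
  assumes "odd d" "d \<ge> 3" "i < 2 * d"
  shows "slap_a d (slap_a d i) = i"
proof (cases "even i")
  case True
  then have "slap_a d (slap_a d i) = shift d (d + 2 + (d - 2)) i"
    using assms by (simp add: slap_a_def even_shift shift_shift)
  also have "d + 2 + (d - 2) = 2 * d" using assms by simp
  finally show ?thesis using assms shift_zero by simp
next
  case False
  then have "slap_a d (slap_a d i) = shift d (d - 2 + (d + 2)) i"
    using assms by (simp add: slap_a_def even_shift shift_shift)
  also have "d - 2 + (d + 2) = 2 * d" using assms by simp
  finally show ?thesis using assms shift_zero by simp
qed

lemma slap_a_bij: "odd d \<Longrightarrow> d \<ge> 3 \<Longrightarrow> bij_betw (slap_a d) {..<2 * d} {..<2 * d}"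
  by (rule bij_betw_byWitness[where f' = "slap_a d"]) (use slap_a_slap_a slap_in(1)[of d] in auto)

lemma slap_b_bij:
  assumes "odd d" "d \<ge> 3"
  shows "bij_betw (slap_b d) {..<2 * d} {..<2 * d}"
proof -
  define g where "g i = shift d (if even i then d - 1 else d + 1) i" for i
  have e: "d + 1 + (d - 1) = 2 * d" "d - 1 + (d + 1) = 2 * d" using assms by simp_all
  have 1: "g (slap_b d i) = i" if "i < 2 * d" for i
    by (cases "even i") (use assms that e in \<open>simp_all add: g_def slap_b_def even_shift shift_shift shift_zero[OF that, unfolded mult_2] mult_2 del: add_Suc_right\<close>)
  have 2: "slap_b d (g i) = i" if "i < 2 * d" for i
    by (cases "even i") (use assms that e in \<open>simp_all add: g_def slap_b_def even_shift shift_shift shift_zero[OF that, unfolded mult_2] mult_2 del: add_Suc_right\<close>)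
  have 3: "g i < 2 * d" for i using assms by (simp add: g_def shift_def)
  show ?thesis
    by (rule bij_betw_byWitness[where f' = g]) (use 1 2 3 slap_in(2)[of d] assms in auto)
qed

section \<open>An invariant measure with the same density on every half side\<close>

context slap_system
begin

sublocale td: tent_density \<beta>
  using \<beta> by unfold_locales auto

text \<open>Folds the boundary onto the core. The half sides are disjoint, so at most one summand
  differs from zero.\<close>

definition q :: "real \<Rightarrow> real" where
  "q x = (\<Sum>i<2 * d. indicator (half r i 0 1) x * coord r i x)"

definition nu :: "real measure" where
  "nu = density M (\<lambda>x. ennreal \<bar>td.dens (q x)\<bar>)"

lemma chart_measurable: "chart r i \<in> borel_measurable borel"
  unfolding chart_def by (cases "even i") simp_all

lemma half_full: "i < 2 * d \<Longrightarrow> half r i 0 1 \<in> sets borel"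
  using half_M[of i 0 1] by (simp add: sets_M)

lemma half_full_iff:
  assumes "0 < z" "z < 1"
  shows "chart r i z \<in> half r j 0 1 \<longleftrightarrow> i = j"
proof
  assume "chart r i z \<in> half r j 0 1"
  then obtain w where "w \<in> {0<..<1}" "chart r i z = chart r j w" unfolding half_def by blast
  then show "i = j" using chart_inj[OF r assms, of w i j] by simp
qed (use assms in \<open>auto simp: half_def\<close>)

lemma chart_space: "i < 2 * d \<Longrightarrow> 0 < z \<Longrightarrow> z < 1 \<Longrightarrow> chart r i z \<in> space M"
  using half_M[of i 0 1] half_full_iff[of z i i] sets.sets_into_space by blast

lemma q_chart: "i < 2 * d \<Longrightarrow> 0 < z \<Longrightarrow> z < 1 \<Longrightarrow> q (chart r i z) = z"
proof -
  assume a: "i < 2 * d" "0 < z" "z < 1"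
  have "q (chart r i z) = (\<Sum>j<2 * d. if i = j then z else 0)"
    unfolding q_def by (rule sum.cong) (auto simp: half_full_iff[OF a(2,3)] chart_coord r indicator_def)
  then show ?thesis using a(1) by simp
qed

lemma q_measurable: "q \<in> borel_measurable borel"
proof -
  have "(\<lambda>x. indicator (half r i 0 1) x * coord r i x) \<in> borel_measurable borel" if "i < 2 * d" for i
  proof (intro borel_measurable_times)
    show "indicat_real (half r i 0 1) \<in> borel_measurable borel" using half_full[OF that] by simp
    show "coord r i \<in> borel_measurable borel" unfolding coord_def by (cases "even i") simp_all
  qed
  then show ?thesis unfolding q_def by (intro borel_measurable_sum) auto
qed

lemma chart_integral:
  assumes F: "F \<in> borel_measurable borel"
  shows "(\<integral>\<^sup>+x. F x \<partial>M) = (\<Sum>i<2 * d. ennreal r * (\<integral>\<^sup>+z. F (chart r i z) * indicator {0<..<1} z \<partial>lborel))"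
proof -
  have "(\<integral>\<^sup>+x. F x \<partial>M) = (\<integral>\<^sup>+x. F x * indicator {0..len} x \<partial>lborel)"
    unfolding M_def by (rule nn_integral_restrict_space) simp
  also have "\<dots> = (\<integral>\<^sup>+x. (\<Sum>i<2 * d. F x * indicator (half r i 0 1) x) \<partial>lborel)"
  proof (rule nn_integral_cong_AE)
    have "cuts \<in> null_sets lborel" by (rule countable_imp_null_set_lborel[OF countable_finite[OF finite_cuts]])
    then have "AE x in lborel. x \<notin> cuts" by (rule AE_not_in)
    then show "AE x in lborel. F x * indicator {0..len} x = (\<Sum>i<2 * d. F x * indicator (half r i 0 1) x)"
    proof eventually_elim
      fix x assume x: "x \<notin> cuts"
      show "F x * indicator {0..len} x = (\<Sum>i<2 * d. F x * indicator (half r i 0 1) x)"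
      proof (cases "x \<in> {0..len}")
        case True
        obtain i z where i: "i < 2 * d" "0 < z" "z < 1" "z \<noteq> c" "x = chart r i z" by (rule chart_ex[OF True x])
        have "(\<Sum>j<2 * d. F x * indicator (half r j 0 1) x) = (\<Sum>j<2 * d. if i = j then F x else 0)"
          by (rule sum.cong) (auto simp: i(5) half_full_iff[OF i(2,3)] indicator_def)
        then show ?thesis using True i(1) by simp
      next
        case False
        have "x \<notin> half r i 0 1" if "i < 2 * d" for i using half_M[OF that, of 0 1] False by (auto simp: sets_M)
        then show ?thesis using False by simp
      qed
    qed
  qed
  also have "\<dots> = (\<Sum>i<2 * d. \<integral>\<^sup>+x. F x * indicator (half r i 0 1) x \<partial>lborel)"
    using F half_full by (intro nn_integral_sum) auto
  also have "\<dots> = (\<Sum>i<2 * d. ennreal r * (\<integral>\<^sup>+z. F (chart r i z) * indicator {0<..<1} z \<partial>lborel))"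
  proof (rule sum.cong[OF refl])
    fix i assume i: "i \<in> {..<2 * d}"
    obtain s e where s: "s = 1 \<or> s = -1" "\<And>z. chart r i z = s * r * z + e" using chart_affine by blast
    have "(\<integral>\<^sup>+x. F x * indicator (half r i 0 1) x \<partial>lborel)
      = ennreal \<bar>s * r\<bar> * (\<integral>\<^sup>+z. F (e + s * r * z) * indicator (half r i 0 1) (e + s * r * z) \<partial>lborel)"
      using F half_full i s r by (intro nn_integral_real_affine) auto
    also have "(\<integral>\<^sup>+z. F (e + s * r * z) * indicator (half r i 0 1) (e + s * r * z) \<partial>lborel)
      = (\<integral>\<^sup>+z. F (chart r i z) * indicator {0<..<1} z \<partial>lborel)"
    proof (rule nn_integral_cong)
      fix z
      have e: "e + s * r * z = chart r i z" by (simp add: s(2))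
      have "chart r i z \<in> half r i 0 1 \<longleftrightarrow> z \<in> {0<..<1}"
      proof
        assume "chart r i z \<in> half r i 0 1"
        then obtain w where "w \<in> {0<..<1}" "chart r i z = chart r i w" by (auto simp: half_def)
        then show "z \<in> {0<..<1}" using chart_coord(2)[OF r, of i] by metis
      qed (auto simp: half_def)
      then show "F (e + s * r * z) * indicator (half r i 0 1) (e + s * r * z) = F (chart r i z) * indicator {0<..<1} z"
        unfolding e by (simp add: indicator_def)
    qed
    also have "\<bar>s * r\<bar> = r" using s(1) r by (auto simp: abs_mult)
    finally show "(\<integral>\<^sup>+x. F x * indicator (half r i 0 1) x \<partial>lborel)
      = ennreal r * (\<integral>\<^sup>+z. F (chart r i z) * indicator {0<..<1} z \<partial>lborel)" .
  qed
  finally show ?thesis .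
qed

lemma sets_nu: "sets nu = sets M" by (simp add: nu_def)

lemma dens_q_measurable: "(\<lambda>x. ennreal \<bar>td.dens (q x)\<bar>) \<in> borel_measurable borel"
  using measurable_compose[OF q_measurable td.dens_measurable] by simp

lemma emeasure_nu:
  assumes E: "E \<in> sets M"
  shows "emeasure nu E = ennreal r * (\<integral>\<^sup>+z. (\<Sum>i<2 * d. indicator E (chart r i z)) * (ennreal \<bar>td.dens z\<bar> * indicator {0<..<1} z) \<partial>lborel)"
proof -
  have Eb: "E \<in> sets borel" using E by (simp add: sets_M)
  have mi: "(\<lambda>z. indicator E (chart r i z) :: ennreal) \<in> borel_measurable borel" for i
    by (rule measurable_compose[OF chart_measurable borel_measurable_indicator[OF Eb]])
  note [measurable] = mi td.dens_measurable
  have dm: "(\<lambda>x. ennreal \<bar>td.dens (q x)\<bar>) \<in> borel_measurable M"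
    unfolding M_def by (rule measurable_restrict_space1) (simp add: dens_q_measurable)
  have "emeasure nu E = (\<integral>\<^sup>+x. ennreal \<bar>td.dens (q x)\<bar> * indicator E x \<partial>M)"
    unfolding nu_def by (rule emeasure_density[OF dm E])
  also have "\<dots> = (\<Sum>i<2 * d. ennreal r * (\<integral>\<^sup>+z. (ennreal \<bar>td.dens (q (chart r i z))\<bar> * indicator E (chart r i z)) * indicator {0<..<1} z \<partial>lborel))"
    using dens_q_measurable Eb by (intro chart_integral borel_measurable_times_ennreal) auto
  also have "\<dots> = (\<Sum>i<2 * d. ennreal r * (\<integral>\<^sup>+z. indicator E (chart r i z) * (ennreal \<bar>td.dens z\<bar> * indicator {0<..<1} z) \<partial>lborel))"
  proof (rule sum.cong[OF refl], rule arg_cong[of _ _ "\<lambda>t. ennreal r * t"], rule nn_integral_cong)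
    fix i and z :: real assume "i \<in> {..<2 * d}"
    then show "(ennreal \<bar>td.dens (q (chart r i z))\<bar> * indicator E (chart r i z)) * indicator {0<..<1} z
      = indicator E (chart r i z) * (ennreal \<bar>td.dens z\<bar> * indicator {0<..<1} z)"
      by (cases "z \<in> {0<..<1}") (simp_all add: q_chart mult.commute)
  qed
  also have "\<dots> = ennreal r * (\<Sum>i<2 * d. \<integral>\<^sup>+z. indicator E (chart r i z) * (ennreal \<bar>td.dens z\<bar> * indicator {0<..<1} z) \<partial>lborel)"
    by (simp add: sum_distrib_left)
  also have "(\<Sum>i<2 * d. \<integral>\<^sup>+z. indicator E (chart r i z) * (ennreal \<bar>td.dens z\<bar> * indicator {0<..<1} z) \<partial>lborel)
    = (\<integral>\<^sup>+z. (\<Sum>i<2 * d. indicator E (chart r i z) * (ennreal \<bar>td.dens z\<bar> * indicator {0<..<1} z)) \<partial>lborel)"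
    by (rule nn_integral_sum[symmetric]) measurable
  finally show ?thesis by (simp add: sum_distrib_right)
qed

text \<open>\<open>W z\<close> counts the half sides on which the point with coordinate
  \<open>z\<close> lies in \<open>E\<close>. The fibre maps are bijections, so the count for the
  preimage of \<open>E\<close> is \<open>W\<close> at the image of \<open>z\<close>, whichever
  branch is used.\<close>

lemma nu_subinvariant:
  assumes E: "E \<in> sets M"
  shows "emeasure nu E \<le> emeasure nu (f -` E \<inter> space M)"
proof -
  define W :: "real \<Rightarrow> ennreal" where "W z = (\<Sum>i<2 * d. indicator E (chart r i z))" for z
  have Eb: "E \<in> sets borel" using E by (simp add: sets_M)
  have "(\<lambda>z. indicator E (chart r i z) :: ennreal) \<in> borel_measurable borel" for i
    by (rule measurable_compose[OF chart_measurable borel_measurable_indicator[OF Eb]])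
  then have W: "W \<in> borel_measurable borel" unfolding W_def by (intro borel_measurable_sum) auto
  define E' where "E' = f -` E \<inter> space M"
  have E': "E' \<in> sets M" unfolding E'_def using meas_f E by (rule measurable_sets)
  have ind: "(\<Sum>i<2 * d. indicator E' (chart r i z)) = W (tent \<beta> z)" if z: "0 < z" "z < 1" "z \<noteq> c" for z
  proof -
    have inM: "chart r i z \<in> space M" if "i < 2 * d" for i
      by (rule chart_space[OF that z(1,2)])
    show ?thesis
    proof (cases "z < c")
      case True
      have "(\<Sum>i<2 * d. indicator E' (chart r i z)) = (\<Sum>i<2 * d. indicator E (chart r (slap_a d i) (tent \<beta> z)) :: ennreal)"
        by (intro sum.cong refl)
          (use True z inM in \<open>auto simp: E'_def f_left tent_def c_def indicator_def\<close>)
      also have "\<dots> = W (tent \<beta> z)" unfolding W_def by (rule sum.reindex_bij_betw[OF slap_a_bij[OF d]])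
      finally show ?thesis .
    next
      case False
      have "(\<Sum>i<2 * d. indicator E' (chart r i z)) = (\<Sum>i<2 * d. indicator E (chart r (slap_b d i) (tent \<beta> z)) :: ennreal)"
        by (intro sum.cong refl)
          (use False z inM in \<open>auto simp: E'_def f_right tent_def c_def indicator_def\<close>)
      also have "\<dots> = W (tent \<beta> z)" unfolding W_def by (rule sum.reindex_bij_betw[OF slap_b_bij[OF d]])
      finally show ?thesis .
    qed
  qed
  have "emeasure nu E = ennreal r * (\<integral>\<^sup>+z. W z * (ennreal \<bar>td.dens z\<bar> * indicator {0<..<1} z) \<partial>lborel)"
    unfolding W_def by (rule emeasure_nu[OF E])
  also have "\<dots> \<le> ennreal r * (\<integral>\<^sup>+z. W (tent \<beta> z) * (ennreal \<bar>td.dens z\<bar> * indicator {0<..<1} z) \<partial>lborel)"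
    by (intro mult_left_mono td.dens_invariant[OF W]) simp
  also have "(\<integral>\<^sup>+z. W (tent \<beta> z) * (ennreal \<bar>td.dens z\<bar> * indicator {0<..<1} z) \<partial>lborel)
    = (\<integral>\<^sup>+z. (\<Sum>i<2 * d. indicator E' (chart r i z)) * (ennreal \<bar>td.dens z\<bar> * indicator {0<..<1} z) \<partial>lborel)"
  proof (rule nn_integral_cong_AE)
    have "{c} \<in> null_sets lborel" by (rule countable_imp_null_set_lborel) simp
    then have "AE z in lborel. z \<notin> {c}" by (rule AE_not_in)
    then show "AE z in lborel. W (tent \<beta> z) * (ennreal \<bar>td.dens z\<bar> * indicator {0<..<1} z)
      = (\<Sum>i<2 * d. indicator E' (chart r i z)) * (ennreal \<bar>td.dens z\<bar> * indicator {0<..<1} z)"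
      by eventually_elim (use ind in \<open>auto split: split_indicator\<close>)
  qed
  also have "ennreal r * \<dots> = emeasure nu E'" by (rule emeasure_nu[OF E', symmetric])
  finally show ?thesis unfolding E'_def .
qed

lemma nu_finite: "finite_measure nu"
proof (rule finite_measureI)
  define K where "K = (\<Sum>n. (1 / \<beta>) ^ n)"
  have K: "\<bar>td.dens z\<bar> \<le> K" for z unfolding K_def by (rule td.dens_bounded)
  have "(\<integral>\<^sup>+z. (\<Sum>i<2 * d. indicator (space M) (chart r i z)) * (ennreal \<bar>td.dens z\<bar> * indicator {0<..<1} z) \<partial>lborel)
    \<le> (\<integral>\<^sup>+z. (of_nat (2 * d) * ennreal K) * indicator {0<..<1::real} z \<partial>lborel)"
  proof (rule nn_integral_mono)
    fix z
    have "(\<Sum>i<2 * d. indicator (space M) (chart r i z) :: ennreal) \<le> (\<Sum>i<2 * d. 1)"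
      by (intro sum_mono) (auto split: split_indicator)
    also have "\<dots> = of_nat (2 * d)" by simp
    finally have "(\<Sum>i<2 * d. indicator (space M) (chart r i z) :: ennreal) * ennreal \<bar>td.dens z\<bar> \<le> of_nat (2 * d) * ennreal K"
      using K by (intro mult_mono ennreal_leI) auto
    then show "(\<Sum>i<2 * d. indicator (space M) (chart r i z)) * (ennreal \<bar>td.dens z\<bar> * indicator {0<..<1} z)
      \<le> (of_nat (2 * d) * ennreal K) * indicator {0<..<1} z" by (auto split: split_indicator)
  qed
  also have "\<dots> = of_nat (2 * d) * ennreal K" by (subst nn_integral_cmult_indicator) auto
  also have "\<dots> < \<infinity>" by (simp add: ennreal_mult_less_top ennreal_of_nat_eq_real_of_nat)
  finally have fin: "(\<integral>\<^sup>+z. (\<Sum>i<2 * d. indicator (space M) (chart r i z)) * (ennreal \<bar>td.dens z\<bar> * indicator {0<..<1} z) \<partial>lborel) < \<infinity>" .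
  have "space nu = space M" by (simp add: nu_def)
  then have "emeasure nu (space nu) = ennreal r * (\<integral>\<^sup>+z. (\<Sum>i<2 * d. indicator (space M) (chart r i z)) * (ennreal \<bar>td.dens z\<bar> * indicator {0<..<1} z) \<partial>lborel)"
    using emeasure_nu[of "space M"] by simp
  also have "\<dots> < \<infinity>" using fin by (simp add: ennreal_mult_less_top)
  finally show "emeasure nu (space nu) \<noteq> \<infinity>" by simp
qed

lemma nu_ac: "absolutely_continuous M nu"
proof -
  have dm: "(\<lambda>x. ennreal \<bar>td.dens (q x)\<bar>) \<in> borel_measurable M"
    unfolding M_def by (rule measurable_restrict_space1) (simp add: dens_q_measurable)
  show ?thesis unfolding nu_def by (rule absolutely_continuousI_density[OF dm])
qed

lemma nu_pos: "measure nu (space M) > 0"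
proof -
  interpret nu: finite_measure nu by (rule nu_finite)
  have "emeasure nu (space M) \<noteq> 0"
  proof
    assume "emeasure nu (space M) = 0"
    then have 0: "(\<integral>\<^sup>+z. (\<Sum>i<2 * d. indicator (space M) (chart r i z)) * (ennreal \<bar>td.dens z\<bar> * indicator {0<..<1} z) \<partial>lborel) = 0"
      using emeasure_nu[of "space M"] r by simp
    have "(\<integral>\<^sup>+z. ennreal \<bar>td.dens z\<bar> * indicator {0<..<1} z \<partial>lborel)
      \<le> (\<integral>\<^sup>+z. (\<Sum>i<2 * d. indicator (space M) (chart r i z)) * (ennreal \<bar>td.dens z\<bar> * indicator {0<..<1} z) \<partial>lborel)"
    proof (rule nn_integral_mono)
      fix z :: real
      show "ennreal \<bar>td.dens z\<bar> * indicator {0<..<1} z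
        \<le> (\<Sum>i<2 * d. indicator (space M) (chart r i z)) * (ennreal \<bar>td.dens z\<bar> * indicator {0<..<1} z)"
      proof (cases "z \<in> {0<..<1}")
        case True
        have d0: "0 < 2 * d" using d by simp
        have "chart r 0 z \<in> space M" using chart_space[OF d0] True by simp
        then have "1 = (indicator (space M) (chart r 0 z) :: ennreal)" by simp
        also have "\<dots> \<le> (\<Sum>i<2 * d. indicator (space M) (chart r i z))" using d0 by (intro member_le_sum) auto
        finally show ?thesis using True mult_right_mono[of 1 "\<Sum>i<2 * d. indicator (space M) (chart r i z)" "ennreal \<bar>td.dens z\<bar>"] by simp
      qed simp
    qed
    then show False using td.dens_pos 0 by simp
  qed
  then show ?thesis by (simp add: nu.emeasure_eq_measure zero_less_measure_iff)
qed

text \<open>An orbit that avoids \<open>cuts\<close> never meets a turning point, so the flag may be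
  fixed as \<open>True\<close>. The coordinate stays strictly between 0 and 1 because the ends of
  the half sides are cuts.\<close>

lemma orbit_skew:
  assumes x: "x = chart r i z" "i < 2 * d" "0 < z" "z < 1" and gen: "\<And>n. (f ^^ n) x \<notin> cuts"
  defines "sk \<equiv> skew True \<beta> (slap_a d) (slap_b d)"
  shows "fst ((sk ^^ n) (i, z)) < 2 * d \<and> 0 < snd ((sk ^^ n) (i, z)) \<and> snd ((sk ^^ n) (i, z)) < 1 \<and>
    (f ^^ n) x = chart r (fst ((sk ^^ n) (i, z))) (snd ((sk ^^ n) (i, z)))"
proof (induction n)
  case 0
  then show ?case using x by simp
next
  case (Suc n)
  obtain j y where jy: "(sk ^^ n) (i, z) = (j, y)" by fastforce
  obtain j' y' where jy': "sk (j, y) = (j', y')" by fastforce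
  have S: "(sk ^^ Suc n) (i, z) = (j', y')" using jy jy' by simp
  have IH: "j < 2 * d" "0 < y" "y < 1" "(f ^^ n) x = chart r j y" using Suc jy by auto
  have "y \<noteq> c"
  proof
    assume "y = c"
    then have "(f ^^ n) x \<in> cuts" using IH by (auto simp: cuts_def)
    then show False using gen by blast
  qed
  then have st: "j' < 2 * d \<and> f (chart r j y) = chart r j' y'"
    using jy' IH f_left[of j y] f_right[of j y] fibre_in[of j] unfolding sk_def c_def
    by (cases "y < 1 - 1 / \<beta>") auto
  then have fS: "(f ^^ Suc n) x = chart r j' y'" using IH by simp
  have "y' \<in> {0..1}" using skew_range[OF \<beta>, of y True "slap_a d" "slap_b d" j] jy' IH by (simp add: sk_def)
  moreover have "y' \<noteq> 0 \<and> y' \<noteq> 1"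
  proof -
    have kc: "r * real k \<in> cuts" if "k \<le> 2 * d" for k using that by (auto simp: cuts_def)
    have "chart r j' 0 = r * real (if even j' then j' else Suc j')" "chart r j' 1 = r * real (if even j' then Suc j' else j')"
      by (simp_all add: chart_def)
    moreover have "j' \<le> 2 * d" "Suc j' \<le> 2 * d" using st by simp_all
    ultimately have "chart r j' 0 \<in> cuts" "chart r j' 1 \<in> cuts" using kc by presburger+
    then show ?thesis using gen[of "Suc n"] unfolding fS by auto
  qed
  ultimately show ?case unfolding S fst_conv snd_conv using fS st by auto
qed

lemma acip_on_iff: "acip_on \<mu> \<and> ergodic f \<mu> \<longleftrightarrow> ergodic_acip {0..len} f \<mu>"
proof -
  have "sets M = sets (restrict_space borel {0..len})" unfolding M_def by (rule sets_restrict_space_cong) simp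
  then have "sets \<mu> = sets M \<longleftrightarrow> sets \<mu> = sets (restrict_space borel {0..len})" by (simp only:)
  moreover have "absolutely_continuous M \<mu> \<longleftrightarrow> absolutely_continuous (restrict_space lborel {0..len}) \<mu>"
    by (simp only: M_def)
  ultimately show ?thesis unfolding acip_on_def ergodic_acip_def acip_def by blast
qed

theorem ergodic_acips:
  assumes small: "\<beta> ^ 2 ^ m \<le> 2" and large: "2 < (\<beta> ^ 2 ^ m)\<^sup>2"
    and cs: "(d = 3 \<and> m = 0 \<and> \<beta> = 2) \<or> (d = 5 \<and> m = 1) \<or> m \<ge> 2"
  shows "\<exists>h. bij_betw h {..<(if m \<ge> 2 then d else 1)} {\<mu>. ergodic_acip {0..len} f \<mu>}"
    and "ergodic_acip {0..len} f \<mu> \<Longrightarrow> (\<exists>\<Sigma>. mixing_components f \<mu> k \<Sigma>) \<longleftrightarrow> k = 2 ^ m"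
proof -
  define nl where "nl = (if m \<ge> 2 then d else 1)"
  define lo where "lo = win_lo m \<beta>"
  define hi where "hi = win_hi m \<beta>"
  have lh: "0 \<le> lo" "lo < hi" "hi \<le> 1" using win_bounds[OF \<beta>(1) small] by (auto simp: lo_def hi_def)
  define am where "am = fst (coc m (slap_a d) (slap_b d))"
  define bm where "bm = snd (coc m (slap_a d) (slap_b d))"
  obtain Q where Q: "\<And>l. l < nl \<Longrightarrow> Q l \<noteq> {} \<and> Q l \<subseteq> {..<2 * d}"
    "\<And>l l'. l < nl \<Longrightarrow> l' < nl \<Longrightarrow> l \<noteq> l' \<Longrightarrow> Q l \<inter> Q l' = {}"
    "\<And>l i. l < nl \<Longrightarrow> i \<in> Q l \<Longrightarrow> am i \<in> Q l \<and> bm i \<in> Q l"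
    "\<And>i. i < 2 * d \<Longrightarrow> \<exists>l<nl. i \<in> Q l"
    "\<And>C i l. tent_cover (\<beta> ^ 2 ^ m) am bm {..<2 * d} C \<Longrightarrow> l < nl \<Longrightarrow> i \<in> Q l \<Longrightarrow> \<exists>n. \<forall>j\<in>Q l. C i 0 1 n j 0 1"
    unfolding nl_def am_def bm_def by (rule fibre_components[OF d cs large]) blast
  have finQ: "finite (Q l)" if "l < nl" for l using Q(1)[OF that] by (meson finite_lessThan finite_subset)
  have Qd: "i < 2 * d" if "i \<in> Q l" "l < nl" for i l using Q(1)[OF that(2)] that(1) by auto
  define Z where "Z l = (\<Union>i\<in>Q l. half r i lo hi)" for l
  have Z_chart: "chart r i z \<in> Z l \<longleftrightarrow> i \<in> Q l \<and> lo < z \<and> z < hi" if "0 < z" "z < 1" for i z l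
  proof
    assume "chart r i z \<in> Z l"
    then obtain j w where "j \<in> Q l" "w \<in> {lo<..<hi}" "chart r i z = chart r j w" by (auto simp: Z_def half_def)
    then show "i \<in> Q l \<and> lo < z \<and> z < hi" using chart_inj[OF r that, of w i j] lh by auto
  next
    assume "i \<in> Q l \<and> lo < z \<and> z < hi"
    then show "chart r i z \<in> Z l" unfolding Z_def half_def by (intro UN_I[of i] imageI) auto
  qed
  have Z_M: "Z l \<in> sets M" if "l < nl" for l
    unfolding Z_def using finQ[OF that] Qd[OF _ that] lh by (intro sets.finite_UN half_M) auto
  \<comment> \<open>The ends of the window are included because the return map is only known to
    reach the closed window.\<close>
  define Bad where "Bad = cuts \<union> (\<lambda>i. chart r i lo) ` {..<2 * d} \<union> (\<lambda>i. chart r i hi) ` {..<2 * d}"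
  have finB: "finite Bad" using finite_cuts by (simp add: Bad_def)
  define G where "G = {x \<in> space M. \<forall>n. (f ^^ n) x \<notin> Bad}"
  have G_cuts: "(f ^^ n) x \<notin> cuts" if "x \<in> G" for x n using that by (auto simp: G_def Bad_def)
  have G_chart: "\<exists>i z. i < 2 * d \<and> 0 < z \<and> z < 1 \<and> x = chart r i z" if x: "x \<in> G" for x
  proof -
    have "x \<in> {0..len}" "x \<notin> cuts" using x G_cuts[OF x, of 0] by (auto simp: G_def space_M)
    then show ?thesis by (metis chart_ex)
  qed
  have "cyclic_system M f nl (2 ^ m) Z G"
  proof
    show "1 \<le> (2::nat) ^ m" by simp
    show "Z l \<in> sets M" if "l < nl" for l by (rule Z_M[OF that])
    show "0 < measure M (Z l)" if l: "l < nl" for l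
    proof -
      obtain i where i: "i \<in> Q l" using Q(1)[OF l] by blast
      obtain p q where pq: "half r i lo hi = {p<..<q}" "q - p = r * (hi - lo)" "0 \<le> p" "p < q" "q \<le> len"
        by (rule half_bounds[OF Qd[OF i l] lh])
      have "0 < measure M (half r i lo hi)" using measure_interval[of p q] pq by simp
      also have "\<dots> \<le> measure M (Z l)" using i Z_M[OF l] by (intro M.finite_measure_mono) (auto simp: Z_def)
      finally show ?thesis .
    qed
    show "Z l \<inter> Z l' = {}" if "l < nl" "l' < nl" "l \<noteq> l'" for l l'
    proof -
      have "chart r i z \<notin> Z l'" if "i \<in> Q l" "lo < z" "z < hi" for i z
        using Z_chart[of z i l'] that lh Q(2)[OF \<open>l < nl\<close> \<open>l' < nl\<close> \<open>l \<noteq> l'\<close>] by auto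
      then show ?thesis by (auto simp: Z_def[of l] half_def)
    qed
    have cB: "countable (Bad \<inter> {0..len})" using finB by (intro countable_finite) simp
    have Bnull: "Bad \<inter> {0..len} \<in> null_sets M" by (rule countable_null[OF cB]) simp
    then have BM: "Bad \<inter> {0..len} \<in> sets M" by (rule null_setsD2)
    have G_eq: "G = space M - (\<Union>n. (f ^^ n) -` (Bad \<inter> {0..len}) \<inter> space M)"
      using space_funpow by (auto simp: G_def space_M)
    show "G \<in> sets M" unfolding G_eq
      by (intro sets.Diff sets.top sets.countable_UN'' measurable_sets[OF meas_funpow BM]) auto
    have "AE x in M. x \<notin> Bad \<inter> {0..len}"
      by (rule AE_not_in[OF Bnull])
    then have "AE x in M. \<forall>n. (f ^^ n) x \<notin> Bad \<inter> {0..len}"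
      unfolding AE_all_countable using AE_shift_funpow by blast
    then have "AE x in M. x \<notin> space M - G"
      by (rule AE_mp) (intro AE_I2 impI, use space_funpow in \<open>auto simp: G_def space_M\<close>)
    then show "space M - G \<in> null_sets M" using \<open>G \<in> sets M\<close> by (subst AE_iff_null_sets) auto
    show "f x \<in> G" if "x \<in> G" for x
    proof -
      have "(f ^^ Suc n) x \<notin> Bad" for n using that unfolding G_def by blast
      then have "(f ^^ n) (f x) \<notin> Bad" for n unfolding funpow_Suc_right comp_apply .
      moreover have "f x \<in> space M" using that space_funpow[of x 1] by (simp add: G_def)
      ultimately show ?thesis unfolding G_def by blast
    qed
    show "(f ^^ 2 ^ m) x \<in> Z l" if x: "x \<in> G" "l < nl" "x \<in> Z l" for x l
    proof -
      obtain i z where iz: "i < 2 * d" "0 < z" "z < 1" "x = chart r i z" using G_chart[OF x(1)] by blast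
      have il: "i \<in> Q l" "z \<in> {lo<..<hi}" using x(3) Z_chart[OF iz(2,3)] iz(4) by auto
      then obtain z0 where z0: "z0 \<in> {0<..<1}" "z = win m \<beta> z0"
        using win_image(1)[OF \<beta>(1) small] unfolding lo_def hi_def by blast
      obtain fl where fl: "(skew True \<beta> (slap_a d) (slap_b d) ^^ 2 ^ m) (i, win m \<beta> z0) =
          apsnd (win m \<beta>) (skew fl (\<beta> ^ 2 ^ m) am bm (i, z0))"
        using skew_window_return[OF \<beta>(1) small, of z0 True "slap_a d" "slap_b d" i] z0(1) unfolding am_def bm_def by auto
      obtain j w where jw: "skew fl (\<beta> ^ 2 ^ m) am bm (i, z0) = (j, w)" by fastforce
      have "1 < \<beta> ^ 2 ^ m" using \<beta>(1) by (simp add: one_less_power)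
      then have w: "w \<in> {0..1}" using skew_range[of "\<beta> ^ 2 ^ m" z0 fl am bm i] small z0(1) jw by auto
      have jQ: "j \<in> Q l" using jw Q(3)[OF x(2) il(1)] by (auto split: if_splits)
      have "win m \<beta> w \<in> {lo..hi}" using w win_image(2)[OF \<beta>(1) small] unfolding lo_def hi_def by blast
      moreover have fx: "(f ^^ 2 ^ m) x = chart r j (win m \<beta> w)"
        using orbit_skew[OF iz(4,1,2,3) G_cuts[OF x(1)], of "2 ^ m"] fl jw unfolding z0(2) by simp
      moreover have "win m \<beta> w \<noteq> lo \<and> win m \<beta> w \<noteq> hi"
      proof -
        have "(f ^^ 2 ^ m) x \<notin> Bad" using x(1) by (simp add: G_def)
        then show ?thesis using Qd[OF jQ x(2)] unfolding fx by (auto simp: Bad_def)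
      qed
      ultimately show ?thesis unfolding Z_def half_def fx using jQ by (intro UN_I[of j] imageI) auto
    qed
    show "(f ^^ j) x \<notin> Z l'" if x: "x \<in> G" "l < nl" "l' < nl" "x \<in> Z l" "0 < j" "j < 2 ^ m" for x l l' j
    proof
      assume in_Z: "(f ^^ j) x \<in> Z l'"
      obtain i z where iz: "i < 2 * d" "0 < z" "z < 1" "x = chart r i z" using G_chart[OF x(1)] by blast
      have z: "z \<in> {win_lo m \<beta><..<win_hi m \<beta>}" using x(4) Z_chart[OF iz(2,3)] iz(4) by (auto simp: lo_def hi_def)
      define s where "s = (skew True \<beta> (slap_a d) (slap_b d) ^^ j) (i, z)"
      have s: "0 < snd s" "snd s < 1" "(f ^^ j) x = chart r (fst s) (snd s)"
        using orbit_skew[OF iz(4,1,2,3) G_cuts[OF x(1)], of j] by (auto simp: s_def)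
      have "snd s \<notin> {lo<..<hi}"
        unfolding s_def lo_def hi_def by (rule skew_window_escape[OF \<beta>(1) small z x(5,6)])
      then show False using in_Z Z_chart[OF s(1,2)] unfolding s(3) by auto
    qed
    show "\<exists>n. \<exists>l<nl. \<forall>B\<in>sets M. (AE x in M. x \<in> A \<longrightarrow> (f ^^ n) x \<in> B) \<longrightarrow> measure M (Z l - B) < e"
      if A: "A \<in> sets M" "0 < measure M A" and e: "0 < e" for A e
    proof (rule spread[OF _ Z_M A e])
      fix u v :: real assume uv: "0 \<le> u" "u < v" "v \<le> len"
      obtain i where i: "i < 2 * d" "r * real i \<le> u" "u < r * (real i + 1)" using cell_ex[of u] uv by auto
      \<comment> \<open>The interval is cut down to the first half side it meets and rewritten in
        the coordinate there, with the ends exchanged if the index is odd.\<close>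
      define v' where "v' = min v (r * (real i + 1))"
      have v': "u < v'" "v' \<le> v" "v' \<le> r * (real i + 1)" using uv i by (auto simp: v'_def)
      define u1 where "u1 = (if even i then u / r - real i else real i + 1 - v' / r)"
      define v1 where "v1 = (if even i then v' / r - real i else real i + 1 - u / r)"
      have d1: "real i \<le> u / r" "u / r < v' / r" "v' / r \<le> real i + 1"
        using i v' r by (simp_all add: field_simps)
      have uv1: "0 \<le> u1" "u1 < v1" "v1 \<le> 1" using d1 by (auto simp: u1_def v1_def)
      have sub: "half r i u1 v1 \<subseteq> {u<..<v}"
      proof
        fix x assume "x \<in> half r i u1 v1"
        then obtain z where z: "u1 < z" "z < v1" "x = chart r i z" by (auto simp: half_def)
        have "u / r < x / r \<and> x / r < v' / r" using z r by (auto simp: chart_def u1_def v1_def split: if_splits)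
        then have "u < x \<and> x < v'" using r by (simp add: divide_less_cancel)
        then show "x \<in> {u<..<v}" using v' by simp
      qed
      \<comment> \<open>The half sides to be reached from \<open>i\<close> are those of the orbit
        containing \<open>i\<close>.\<close>
      define R where "R i = Q (SOME l. l < nl \<and> i \<in> Q l)" for i
      have R: "(SOME l. l < nl \<and> i \<in> Q l) < nl \<and> i \<in> R i" if "i < 2 * d" for i
        using someI_ex[of "\<lambda>l. l < nl \<and> i \<in> Q l"] Q(4)[OF that] by (simp add: R_def)
      have "\<exists>n. \<exists>i'\<in>{..<2 * d}. \<forall>j\<in>R i'. cov i u1 v1 n j (win_lo m \<beta>) (win_hi m \<beta>)"
      proof (rule cover_window[OF tent_cover_cov small large _ _ uv1])
        fix C' i assume T: "tent_cover (\<beta> ^ 2 ^ m) (fst (coc m (slap_a d) (slap_b d))) (snd (coc m (slap_a d) (slap_b d))) {..<2 * d} C'"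
          and i: "i \<in> {..<2 * d}"
        have "i < 2 * d" using i by simp
        from R[OF this] show "\<exists>n. \<forall>j\<in>R i. C' i 0 1 n j 0 1"
          unfolding R_def by (intro Q(5)[OF T[folded am_def bm_def]]) auto
      qed (use i in auto)
      then obtain n i' where n: "i' < 2 * d" "\<And>j. j \<in> R i' \<Longrightarrow> cov i u1 v1 n j lo hi"
        unfolding lo_def hi_def by blast
      define l where "l = (SOME l. l < nl \<and> i' \<in> Q l)"
      have l: "l < nl" "R i' = Q l" using R[OF n(1)] by (auto simp: l_def R_def)
      have "covers (half r i u1 v1) n (Z l)" unfolding Z_def
      proof (rule covers_Union[OF finQ[OF l(1)]])
        show "half r i u1 v1 \<in> sets M" using i uv1 by (intro half_M) auto
        fix j assume j: "j \<in> Q l"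
        then show "half r j lo hi \<in> sets M \<and> covers (half r i u1 v1) n (half r j lo hi)"
          using n(2)[of j] l(2) Qd[OF j l(1)] lh by (auto simp: cov_def intro: half_M)
      qed
      moreover have "covers {u<..<v} 0 (half r i u1 v1)" using uv by (intro covers_sub[OF _ sub] interval_M) auto
      ultimately have "covers {u<..<v} (0 + n) (Z l)"
        using uv i uv1 by (intro covers_trans[of _ 0 "half r i u1 v1" n] interval_M half_M) auto
      then show "\<exists>n. \<exists>l<nl. covers {u<..<v} n (Z l)" using l(1) by blast
    qed
  qed
  then interpret cs: cyclic_system M f nl "2 ^ m" Z G .
  interpret nu: finite_measure nu by (rule nu_finite)
  have sub: "measure nu E \<le> measure nu (f -` E \<inter> space M)" if "E \<in> sets M" for E
    using nu_subinvariant[OF that] by (simp add: nu.emeasure_eq_measure)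
  \<comment> \<open>All half sides carry the same density, so the mass of \<open>Z l\<close> is
    \<open>card (Q l)\<close> times a factor independent of \<open>l\<close>. Since some seed has
    positive mass, every seed has.\<close>
  define I where "I = (\<integral>\<^sup>+z. ennreal \<bar>td.dens z\<bar> * indicator {lo<..<hi} z \<partial>lborel)"
  have nuZ: "emeasure nu (Z l) = ennreal r * (of_nat (card (Q l)) * I)" if l: "l < nl" for l
  proof -
    have "emeasure nu (Z l) = ennreal r * (\<integral>\<^sup>+z. (\<Sum>i<2 * d. indicator (Z l) (chart r i z)) * (ennreal \<bar>td.dens z\<bar> * indicator {0<..<1} z) \<partial>lborel)"
      by (rule emeasure_nu[OF Z_M[OF l]])
    also have "(\<integral>\<^sup>+z. (\<Sum>i<2 * d. indicator (Z l) (chart r i z)) * (ennreal \<bar>td.dens z\<bar> * indicator {0<..<1} z) \<partial>lborel)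
      = (\<integral>\<^sup>+z. of_nat (card (Q l)) * (ennreal \<bar>td.dens z\<bar> * indicator {lo<..<hi} z) \<partial>lborel)"
    proof (rule nn_integral_cong)
      fix z :: real
      show "(\<Sum>i<2 * d. indicator (Z l) (chart r i z)) * (ennreal \<bar>td.dens z\<bar> * indicator {0<..<1} z)
        = of_nat (card (Q l)) * (ennreal \<bar>td.dens z\<bar> * indicator {lo<..<hi} z)"
      proof (cases "z \<in> {0<..<1}")
        case True
        have "(\<Sum>i<2 * d. indicator (Z l) (chart r i z) :: ennreal) = (\<Sum>i<2 * d. indicator (Q l) i * indicator {lo<..<hi} z)"
          by (rule sum.cong) (use True Z_chart[of z _ l] in \<open>auto simp: indicator_def\<close>)
        also have "\<dots> = (\<Sum>i<2 * d. indicator (Q l) i) * indicator {lo<..<hi} z" by (simp add: sum_distrib_right)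
        also have "(\<Sum>i<2 * d. indicator (Q l) i :: ennreal) = of_nat (card (Q l))"
        proof -
          have "{..<2 * d} \<inter> Q l = Q l" using Q(1)[OF l] by blast
          then show ?thesis by (simp add: indicator_def sum.If_cases)
        qed
        finally show ?thesis using True by (simp add: mult_ac)
      next
        case False
        then have "z \<notin> {lo<..<hi}" using lh by auto
        then show ?thesis using False by simp
      qed
    qed
    also have "\<dots> = of_nat (card (Q l)) * I" unfolding I_def
      using td.dens_measurable by (intro nn_integral_cmult) simp
    finally show ?thesis .
  qed
  have "I \<noteq> 0"
  proof -
    obtain l where l: "l < nl" "measure nu (Z l) > 0"
      using cs.seed_charged[OF nu_finite sets_nu nu_ac sub nu_pos] by blast
    then show ?thesis using nuZ[OF l(1)] by (auto simp: nu.emeasure_eq_measure)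
  qed
  have Zpos: "measure nu (Z l) > 0" if l: "l < nl" for l
  proof -
    have "card (Q l) \<noteq> 0" using Q(1)[OF l] finQ[OF l] by simp
    then have "emeasure nu (Z l) \<noteq> 0" using nuZ[OF l] \<open>I \<noteq> 0\<close> r by simp
    then show ?thesis by (simp add: nu.emeasure_eq_measure zero_less_measure_iff)
  qed
  obtain h where h: "bij_betw h {..<nl} {\<mu>. acip_on \<mu> \<and> ergodic f \<mu>}"
    using cs.ergodic_acip_enumeration[OF nu_finite sets_nu nu_ac sub Zpos] by blast
  then show "\<exists>h. bij_betw h {..<(if m \<ge> 2 then d else 1)} {\<mu>. ergodic_acip {0..len} f \<mu>}"
    unfolding acip_on_iff nl_def by blast
  assume mu: "ergodic_acip {0..len} f \<mu>"
  then have mu': "acip_on \<mu>" "ergodic f \<mu>" using acip_on_iff by blast+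
  have P: "prob_space \<mu>" "sets \<mu> = sets (restrict_space borel {0..len})" "invariant_measure f \<mu>"
    using mu by (auto simp: ergodic_acip_def acip_def)
  have supp: "AE x in \<mu>. x \<in> measure_support \<mu>" by (rule AE_measure_support[OF P(1,2)])
  obtain l where l: "l < nl" "measure \<mu> (cs.basin l) = 1" using cs.ergodic_acip_basin[OF mu'] by blast
  have mc: "mixing_components f \<mu> (2 ^ m) (cs.phase l)"
    by (rule cyclic_mixing_components[OF cs.cyclic_system_axioms mu'(1) l supp])
  show "(\<exists>\<Sigma>. mixing_components f \<mu> k \<Sigma>) \<longleftrightarrow> k = 2 ^ m"
  proof
    assume "\<exists>\<Sigma>. mixing_components f \<mu> k \<Sigma>"
    then obtain \<Sigma> where S: "mixing_components f \<mu> k \<Sigma>" by blast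
    show "k = 2 ^ m"
      using mixing_period_le[OF P(1,3) supp S mc] mixing_period_le[OF P(1,3) supp mc S] by simp
  qed (use mc in blast)
qed

end

section \<open>Geometry of regular polygons\<close>

locale regular_gon =
  fixes d :: nat and ctr a :: complex and P :: "complex list"
  assumes d: "d \<ge> 3" and a: "a \<noteq> 0"
    and P: "P = map (\<lambda>j. ctr + a * cis (2 * pi * real j / real d)) [0..<d]"
begin

definition th :: real where "th = pi / real d"
text \<open>\<open>h\<close> is the apothem and \<open>r\<close> half the length of a side.\<close>

definition h :: real where "h = norm a * cos th"
definition r :: real where "r = norm a * sin th"

text \<open>\<open>E k x y\<close> is the point with coordinates \<open>(x, y)\<close> in the frame whose first axis is the outer
  normal of side \<open>k\<close>; side \<open>k\<close> is \<open>{E k h y |y. \<bar>y\<bar> \<le> r}\<close>.\<close>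

definition nrm :: "nat \<Rightarrow> complex" where "nrm k = sgn a * cis (real (2 * k + 1) * th)"
definition E :: "nat \<Rightarrow> real \<Rightarrow> real \<Rightarrow> complex" where "E k x y = ctr + nrm k * Complex x y"

lemma th: "0 < th" "th \<le> pi / 3" "real d * th = pi"
  using d by (auto simp: th_def field_simps)

lemma trig: "0 < sin th" "1 / 2 \<le> cos th" "0 < cos th"
proof -
  have pi: "th < pi" using th pi_gt_zero by linarith
  show "0 < sin th" using th pi by (intro sin_gt_zero) auto
  have "cos (pi / 3) \<le> cos th" using th pi_gt_zero by (intro cos_monotone_0_pi_le) auto
  then show "1 / 2 \<le> cos th" by (simp add: cos_60)
  then show "0 < cos th" by simp
qed

lemma hr: "0 < h" "0 < r"
  using trig a by (auto simp: h_def r_def)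

lemma norm_nrm: "norm (nrm k) = 1"
  using a by (simp add: nrm_def norm_mult norm_sgn)

lemma E_inj: "E k x y = E k x' y' \<longleftrightarrow> x = x' \<and> y = y'"
proof -
  have "nrm k \<noteq> 0" using norm_nrm[of k] by auto
  then show ?thesis by (simp add: E_def)
qed

lemma vertex_eq: "vertex P i = ctr + a * cis (2 * real i * th)"
proof -
  have len: "length P = d" by (simp add: P)
  have m: "i mod d < d" using d by simp
  have "real i = real d * real (i div d) + real (i mod d)"
    by (metis mult_div_mod_eq of_nat_add of_nat_mult)
  then have "2 * real i * th = 2 * real (i mod d) * th + 2 * (real d * th) * real (i div d)"
    by (simp add: algebra_simps)
  also have "\<dots> = 2 * real (i mod d) * th + 2 * pi * real (i div d)" by (simp add: th)
  finally have e: "2 * real i * th = 2 * real (i mod d) * th + 2 * pi * real (i div d)" .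
  have "cis (2 * real i * th) = cis (2 * real (i mod d) * th) * cis (2 * pi * real (i div d))"
    by (simp only: e cis_mult)
  also have "cis (2 * pi * real (i div d)) = 1" by (rule cis_multiple_2pi) simp
  finally have "cis (2 * real i * th) = cis (2 * real (i mod d) * th)" by simp
  moreover have "2 * pi * real (i mod d) / real d = 2 * real (i mod d) * th" by (simp add: th_def)
  ultimately show ?thesis using m by (simp add: vertex_def len) (simp add: P)
qed

lemma a_eq: "a = sgn a * of_real (norm a)"
  using a by (simp add: sgn_div_norm scaleR_conv_of_real)

lemma vertex_E: "vertex P i = E i h (- r)" "vertex P (Suc i) = E i h r"
proof -
  have 1: "of_real (norm a) * cis (- th) = Complex h (- r)" "of_real (norm a) * cis th = Complex h r"
    by (simp_all add: complex_eq_iff h_def r_def)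
  have "a * cis (2 * real i * th) = sgn a * (cis (real (2 * i + 1) * th) * (of_real (norm a) * cis (- th)))"
    by (subst a_eq) (simp add: cis_mult mult_ac algebra_simps)
  then show "vertex P i = E i h (- r)" unfolding 1 by (simp add: vertex_eq E_def nrm_def mult.assoc)
  have "a * cis (2 * real (Suc i) * th) = sgn a * (cis (real (2 * i + 1) * th) * (of_real (norm a) * cis th))"
    by (subst a_eq) (simp add: cis_mult mult_ac algebra_simps)
  then show "vertex P (Suc i) = E i h r" unfolding 1 by (simp add: vertex_eq E_def nrm_def mult.assoc)
qed

lemma E_diff: "E k x y - E k x y' = (y - y') *\<^sub>R (nrm k * \<i>)"
proof -
  have "Complex x y - Complex x y' = of_real (y - y') * \<i>" by (simp add: complex_eq_iff)
  moreover have "E k x y - E k x y' = nrm k * (Complex x y - Complex x y')"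
    unfolding E_def by (simp only: add_diff_cancel_left right_diff_distrib)
  ultimately show ?thesis by (simp only: scaleR_conv_of_real mult.left_commute mult.assoc)
qed

lemma side_vec: "vertex P (Suc i) - vertex P i = (2 * r) *\<^sub>R (nrm i * \<i>)"
  unfolding vertex_E(2) vertex_E(1)[of i] E_diff by simp

lemma side_dist: "dist (vertex P i) (vertex P (Suc i)) = 2 * r"
proof -
  have "dist (vertex P i) (vertex P (Suc i)) = norm (vertex P (Suc i) - vertex P i)"
    by (simp add: dist_norm norm_minus_commute)
  then show ?thesis using hr norm_nrm[of i] by (simp add: side_vec norm_mult)
qed

lemma vertex_param_eq: "vertex_param P i = real i * (2 * r)"
  by (simp add: vertex_param_def side_dist)

lemma length_P: "length P = d" by (simp add: P)

lemma perimeter_eq: "perimeter P = real (2 * d) * r"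
  by (simp add: perimeter_def vertex_param_eq length_P)

lemma side_at_eq:
  assumes "k = 0 \<and> s \<le> 2 * r \<or> real k * (2 * r) < s \<and> s \<le> real (Suc k) * (2 * r)"
  shows "side_at P s = k"
  unfolding side_at_def vertex_param_eq
proof (rule Least_equality)
  show "s \<le> real (Suc k) * (2 * r)" using assms by auto
  fix j assume j: "s \<le> real (Suc j) * (2 * r)"
  show "k \<le> j"
  proof (rule ccontr)
    assume "\<not> k \<le> j"
    then have "Suc j \<le> k" by simp
    then have "real (Suc j) * (2 * r) \<le> real k * (2 * r)" using hr by (intro mult_right_mono) auto
    then show False using assms j \<open>Suc j \<le> k\<close> by auto
  qed
qed

lemma tangent_eq: "side_at P s = k \<Longrightarrow> tangent P s = nrm k * \<i>"
  using hr norm_nrm[of k] by (simp add: tangent_def side_vec sgn_scaleR sgn_div_norm norm_mult)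

lemma boundary_point_eq:
  assumes "k = 0 \<and> s \<le> 2 * r \<or> real k * (2 * r) < s \<and> s \<le> real (Suc k) * (2 * r)"
  shows "boundary_point P s = E k h (s - real k * (2 * r) - r)"
proof -
  have k: "side_at P s = k" by (rule side_at_eq[OF assms])
  have "boundary_point P s = E k h (- r) + (s - real k * (2 * r)) *\<^sub>R (nrm k * \<i>)"
    by (simp add: boundary_point_def k tangent_eq vertex_param_eq vertex_E(1))
  also have "\<dots> = E k h (s - real k * (2 * r) - r)"
    using E_diff[of k h "s - real k * (2 * r) - r" "- r"] by (simp add: algebra_simps)
  finally show ?thesis .
qed

section \<open>Sides seen from the frames of other sides\<close>

lemma frame_inner: "nrm j \<bullet> (E k x y - ctr) = cos (2 * of_int (int j - int k) * th) * x + sin (2 * of_int (int j - int k) * th) * y"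
proof -
  define A where "A = real (2 * j + 1) * th"
  define B where "B = real (2 * k + 1) * th"
  have AB: "2 * of_int (int j - int k) * th = A - B" by (simp add: A_def B_def algebra_simps)
  have "norm (sgn a) = 1" using a by (simp add: norm_sgn)
  then have sq: "Re (sgn a) * Re (sgn a) + Im (sgn a) * Im (sgn a) = 1"
    using cmod_power2[of "sgn a"] by (simp add: power2_eq_square)
  have inner_mult: "(v * w) \<bullet> (v * w') = (Re v * Re v + Im v * Im v) * (w \<bullet> w')" for v w w' :: complex
    by (simp add: inner_complex_def algebra_simps)
  have "E k x y - ctr = sgn a * (cis B * Complex x y)" by (simp add: E_def nrm_def B_def mult.assoc)
  then have "nrm j \<bullet> (E k x y - ctr) = (sgn a * cis A) \<bullet> (sgn a * (cis B * Complex x y))" by (simp only: nrm_def A_def)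
  also have "\<dots> = (Re (sgn a) * Re (sgn a) + Im (sgn a) * Im (sgn a)) * (cis A \<bullet> (cis B * Complex x y))" by (rule inner_mult)
  also have "\<dots> = cis A \<bullet> (cis B * Complex x y)" by (simp only: sq mult_1)
  also have "\<dots> = cos (A - B) * x + sin (A - B) * y"
    by (simp add: inner_complex_def cos_diff sin_diff algebra_simps)
  finally show ?thesis unfolding AB .
qed

text \<open>After reduction modulo \<open>2 * d\<close> and the reflection
  \<open>e \<mapsto> 2 * d - e\<close> the angle lies between \<open>th\<close> and pi, where the
  cosine decreases.\<close>

lemma cos_odd:
  fixes n :: int
  assumes "odd n"
  shows "cos (of_int n * th) \<le> cos th"
    and "n mod (2 * int d) \<noteq> 1 \<Longrightarrow> n mod (2 * int d) \<noteq> 2 * int d - 1 \<Longrightarrow> cos (of_int n * th) < cos th"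
proof -
  define e where "e = n mod (2 * int d)"
  have "odd e" using assms unfolding e_def by (simp add: dvd_mod_iff)
  moreover have "0 \<le> e" "e < 2 * int d" using d by (simp_all add: e_def)
  ultimately have e: "1 \<le> e" "e \<le> 2 * int d - 1" by (cases "e = 0"; auto)+
  have "n = 2 * int d * (n div (2 * int d)) + e" by (simp add: e_def)
  then have "(of_int n :: real) = of_int (2 * int d * (n div (2 * int d)) + e)" by (rule arg_cong)
  then have "(of_int n :: real) = 2 * real d * of_int (n div (2 * int d)) + of_int e"
    by (simp only: of_int_add of_int_mult of_int_numeral of_int_of_nat_eq)
  then have "of_int n * th = of_int e * th + 2 * (real d * th) * of_int (n div (2 * int d))" by (simp add: algebra_simps)
  then have "of_int n * th = of_int e * th + 2 * pi * of_int (n div (2 * int d))" by (simp only: th mult.assoc)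
  then have 1: "cos (of_int n * th) = cos (of_int e * th)" by (simp only: cos_add sin_int_2pin cos_int_2pin mult_1_right mult_zero_right diff_zero)
  define g where "g = (if e \<le> int d then e else 2 * int d - e)"
  have g: "1 \<le> g" "g \<le> int d" using e by (auto simp: g_def)
  have 2: "cos (of_int e * th) = cos (of_int g * th)"
  proof (cases "e \<le> int d")
    case False
    then have "of_int g * th = 2 * (real d * th) - of_int e * th" by (simp add: g_def algebra_simps)
    then have "of_int g * th = 2 * pi - of_int e * th" by (simp add: th)
    then show ?thesis by (simp add: cos_diff)
  qed (simp add: g_def)
  have "of_int g * th \<le> real d * th" using g th by (intro mult_right_mono) auto
  then have gp: "of_int g * th \<le> pi" by (simp add: th)
  have "1 * th \<le> of_int g * th" using g th by (intro mult_right_mono) auto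
  then show "cos (of_int n * th) \<le> cos th" unfolding 1 2 using gp th by (intro cos_monotone_0_pi_le) auto
  assume "n mod (2 * int d) \<noteq> 1" "n mod (2 * int d) \<noteq> 2 * int d - 1"
  then have "g \<noteq> 1" by (auto simp: g_def e_def[symmetric])
  then have "1 < (of_int g :: real)" using g by simp
  then have "1 * th < of_int g * th" using th by (intro mult_strict_right_mono) auto
  then show "cos (of_int n * th) < cos th" unfolding 1 2 using gp th by (intro cos_monotone_0_pi) auto
qed

text \<open>A point of a side is a convex combination of the two end points, with weights
  \<open>(1 + y / r) / 2\<close> and \<open>(1 - y / r) / 2\<close>. The two cosines are the
  coordinates of these end points along the other normal, in units of \<open>norm a\<close>.\<close>

lemma frame_split:
  "cos (2 * of_int q * th) * h + sin (2 * of_int q * th) * y =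
    norm a * ((1 + y / r) / 2 * cos (of_int (2 * q - 1) * th) + (1 - y / r) / 2 * cos (of_int (2 * q + 1) * th))"
proof -
  define A where "A = 2 * of_int q * th"
  have 1: "of_int (2 * q - 1) * th = A - th" "of_int (2 * q + 1) * th = A + th" by (simp_all add: A_def algebra_simps)
  define t where "t = y / r"
  have "y = t * r" using hr by (simp add: t_def)
  then have y: "y = t * (norm a * sin th)" by (simp only: r_def)
  show ?thesis unfolding 1 A_def[symmetric] t_def[symmetric]
    by (subst y) (simp add: cos_diff cos_add h_def algebra_simps add_divide_distrib diff_divide_distrib)
qed

lemma frame_le:
  assumes "\<bar>y\<bar> \<le> r"
  shows "cos (2 * of_int q * th) * h + sin (2 * of_int q * th) * y \<le> h"
proof -
  have t: "0 \<le> (1 + y / r) / 2" "0 \<le> (1 - y / r) / 2" using assms hr by (auto simp: field_simps)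
  have "(1 + y / r) / 2 * cos (of_int (2 * q - 1) * th) + (1 - y / r) / 2 * cos (of_int (2 * q + 1) * th)
    \<le> (1 + y / r) / 2 * cos th + (1 - y / r) / 2 * cos th"
    using t by (intro add_mono mult_left_mono cos_odd(1)) auto
  also have "\<dots> = cos th" by (simp add: field_simps)
  finally have "(1 + y / r) / 2 * cos (of_int (2 * q - 1) * th) + (1 - y / r) / 2 * cos (of_int (2 * q + 1) * th) \<le> cos th" .
  from mult_left_mono[OF this norm_ge_zero[of a]] show ?thesis unfolding frame_split by (simp only: h_def)
qed

lemma frame_less:
  assumes "\<bar>y\<bar> < r" and q: "\<not> int d dvd q"
  shows "cos (2 * of_int q * th) * h + sin (2 * of_int q * th) * y < h"
proof -
  have t: "0 < (1 + y / r) / 2" "0 < (1 - y / r) / 2" using assms hr by (auto simp: field_simps)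
  have le: "cos (of_int (2 * q - 1) * th) \<le> cos th" "cos (of_int (2 * q + 1) * th) \<le> cos th" by (rule cos_odd; simp)+
  have "cos (of_int (2 * q - 1) * th) < cos th \<or> cos (of_int (2 * q + 1) * th) < cos th"
  proof (rule ccontr)
    assume neg: "\<not> ?thesis"
    define D where "D = 2 * int d"
    have A: "(2 * q + 1) mod D = 1 \<or> (2 * q + 1) mod D = D - 1" "(2 * q - 1) mod D = 1 \<or> (2 * q - 1) mod D = D - 1"
      using cos_odd(2)[of "2 * q + 1"] cos_odd(2)[of "2 * q - 1"] neg by (auto simp: D_def)
    have "D dvd 2 * q + 1 - 1 \<or> D dvd 2 * q + 1 - (D - 1)" "D dvd 2 * q - 1 - 1 \<or> D dvd 2 * q - 1 - (D - 1)"
      using A by (metis dvd_minus_mod)+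
    then have "D dvd 2 * q \<or> D dvd 2 * q + 2" "D dvd 2 * q - 2 \<or> D dvd 2 * q"
      by (auto simp: dvd_diff_right_iff algebra_simps)
    moreover have "\<not> D dvd 2 * q" using q by (simp add: D_def)
    \<comment> \<open>If both end points attained the maximum, \<open>2 * d\<close> would divide 4
      and so \<open>d\<close> would divide 2, against \<open>d \<ge> 3\<close>.\<close>
    ultimately have "D dvd 2 * q + 2" "D dvd 2 * q - 2" by blast+
    from dvd_diff[OF this] have "D dvd 4" by simp
    then have "2 * int d dvd 2 * 2" by (simp add: D_def)
    then have "int d dvd 2" by (simp only: dvd_mult_cancel_left) simp
    then show False using d zdvd_imp_le[of "int d" 2] by simp
  qed
  then have "(1 + y / r) / 2 * cos (of_int (2 * q - 1) * th) + (1 - y / r) / 2 * cos (of_int (2 * q + 1) * th)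
    < (1 + y / r) / 2 * cos th + (1 - y / r) / 2 * cos th"
  proof
    assume "cos (of_int (2 * q - 1) * th) < cos th"
    then show ?thesis using t le by (intro add_less_le_mono mult_strict_left_mono mult_left_mono) auto
  next
    assume "cos (of_int (2 * q + 1) * th) < cos th"
    then show ?thesis using t le by (intro add_le_less_mono mult_strict_left_mono mult_left_mono) auto
  qed
  also have "\<dots> = cos th" by (simp add: field_simps)
  finally have F: "(1 + y / r) / 2 * cos (of_int (2 * q - 1) * th) + (1 - y / r) / 2 * cos (of_int (2 * q + 1) * th) < cos th" .
  have "0 < norm a" using a by simp
  from mult_strict_left_mono[OF F this] show ?thesis unfolding frame_split by (simp only: h_def)
qed

text \<open>The polygon as an intersection of half planes. Its boundary is the frontier of this
  bounded convex set, so \<open>inside\<close> becomes the interior and is tested by linear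
  inequalities.\<close>

definition body :: "complex set" where
  "body = {z. \<forall>k<d. nrm k \<bullet> (z - ctr) \<le> h}"

lemma body_half: "body = (\<Inter>k<d. {z. nrm k \<bullet> z \<le> h + nrm k \<bullet> ctr})"
  by (auto simp: body_def inner_diff_right algebra_simps)

lemma interior_finite_INT:
  "finite I \<Longrightarrow> interior (\<Inter>i\<in>I. A i) = (\<Inter>i\<in>I. interior (A i))"
  by (induction I rule: finite_induct) auto

lemma interior_body: "interior body = {z. \<forall>k<d. nrm k \<bullet> (z - ctr) < h}"
proof -
  have n0: "nrm k \<noteq> 0" for k using norm_nrm[of k] by auto
  have "interior body = (\<Inter>k<d. interior {z. nrm k \<bullet> z \<le> h + nrm k \<bullet> ctr})"
    unfolding body_half by (rule interior_finite_INT) simp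
  also have "\<dots> = (\<Inter>k<d. {z. nrm k \<bullet> z < h + nrm k \<bullet> ctr})" using n0 by (simp add: interior_halfspace_le)
  also have "\<dots> = {z. \<forall>k<d. nrm k \<bullet> (z - ctr) < h}" by (auto simp: inner_diff_right algebra_simps)
  finally show ?thesis .
qed

lemma frame_ex: obtains x y where "z = E k x y"
proof -
  have "nrm k \<noteq> 0" using norm_nrm[of k] by auto
  then have "z = E k (Re ((z - ctr) / nrm k)) (Im ((z - ctr) / nrm k))" by (simp add: E_def)
  then show thesis using that by blast
qed

lemma own_frame: "nrm k \<bullet> (E k x y - ctr) = x"
  using frame_inner[of k k x y] by simp

lemma side_body: "\<bar>y\<bar> \<le> r \<Longrightarrow> E k h y \<in> body"
  unfolding body_def mem_Collect_eq frame_inner using frame_le by blast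

text \<open>The constraints of the two neighbouring sides bound \<open>y\<close>.\<close>

lemma tight_side:
  assumes z: "z \<in> body" and k: "k < d" and tight: "nrm k \<bullet> (z - ctr) = h"
  obtains y where "z = E k h y" "\<bar>y\<bar> \<le> r"
proof -
  obtain x y where zy: "z = E k x y" by (rule frame_ex)
  have x: "x = h" using tight own_frame[of k x y] zy by simp
  have bound: "s * y \<le> r" if q: "q < d" "int d dvd int q - int k - s'" and s: "s' = 1 \<and> s = 1 \<or> s' = -1 \<and> s = -1" for q s' and s :: real
  proof -
    obtain p where p: "int q - int k = s' + int d * p" using q(2) by (auto simp: dvd_def algebra_simps)
    have "2 * of_int (int q - int k) * th = 2 * of_int s' * th + 2 * (real d * th) * of_int p"
      unfolding p by (simp add: algebra_simps)
    then have ang: "2 * of_int (int q - int k) * th = s * (2 * th) + 2 * pi * of_int p" using s by (auto simp: th)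
    have "nrm q \<bullet> (z - ctr) \<le> h" using z q(1) by (simp add: body_def)
    then have "cos (s * (2 * th)) * h + sin (s * (2 * th)) * y \<le> h"
      unfolding zy x frame_inner ang by (simp add: cos_add sin_add sin_int_2pin cos_int_2pin)
    then have "cos (2 * th) * h + sin (2 * th) * (s * y) \<le> h" using s by auto
    then have "(1 - 2 * (sin th)\<^sup>2) * h + 2 * sin th * cos th * (s * y) \<le> h"
      by (simp only: cos_double_sin sin_double)
    then have "2 * sin th * cos th * (s * y) \<le> 2 * (sin th)\<^sup>2 * h" by (simp add: left_diff_distrib)
    then have "(2 * sin th) * (cos th * (s * y)) \<le> (2 * sin th) * (sin th * h)" by (simp add: power2_eq_square mult_ac)
    then have "cos th * (s * y) \<le> sin th * h" using trig by (simp add: mult_le_cancel_left_pos)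
    also have "sin th * h = cos th * r" by (simp add: h_def r_def)
    finally show ?thesis using trig by (simp add: mult_le_cancel_left_pos)
  qed
  define q1 where "q1 = Suc k mod d"
  define q2 where "q2 = (k + (d - 1)) mod d"
  have "q1 < d" "q2 < d" using d by (auto simp: q1_def q2_def)
  moreover have "int d dvd int q1 - int k - 1"
  proof -
    have "int d dvd int (Suc k) - int q1" unfolding q1_def by (simp only: zmod_int dvd_minus_mod)
    moreover have e: "int q1 - int k - 1 = - (int (Suc k) - int q1)" by simp
    ultimately show ?thesis unfolding e dvd_minus_iff by blast
  qed
  moreover have "int d dvd int q2 - int k - (-1)"
  proof -
    have "int d dvd int (k + (d - 1)) - int q2" unfolding q2_def by (simp only: zmod_int dvd_minus_mod)
    from dvd_diff[OF dvd_refl this] have "int d dvd int d - (int (k + (d - 1)) - int q2)" .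
    moreover have "int q2 - int k - (-1) = int d - (int (k + (d - 1)) - int q2)" using d by (simp add: of_nat_diff)
    ultimately show ?thesis by (simp only:)
  qed
  ultimately have "1 * y \<le> r" "-1 * y \<le> r" using bound[of q1 1 1] bound[of q2 "-1" "-1"] by auto
  then show thesis using that zy x by auto
qed

lemma E_affine: "(1 - u) *\<^sub>R E k x y + u *\<^sub>R E k x' y' = E k ((1 - u) * x + u * x') ((1 - u) * y + u * y')"
  by (simp add: E_def complex_eq_iff algebra_simps)

lemma mem_boundary: "z \<in> polygon_boundary P \<longleftrightarrow> (\<exists>k<d. \<exists>y. \<bar>y\<bar> \<le> r \<and> z = E k h y)"
proof -
  have seg: "z \<in> closed_segment (E k h (- r)) (E k h r) \<longleftrightarrow> (\<exists>y. \<bar>y\<bar> \<le> r \<and> z = E k h y)" for k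
  proof
    assume "z \<in> closed_segment (E k h (- r)) (E k h r)"
    then obtain u where u: "0 \<le> u" "u \<le> 1" "z = (1 - u) *\<^sub>R E k h (- r) + u *\<^sub>R E k h r"
      by (auto simp: in_segment)
    have "(1 - u) * h + u * h = h" by (simp add: algebra_simps)
    then have "z = E k h ((2 * u - 1) * r)" unfolding u(3) E_affine by (simp add: algebra_simps)
    moreover have "\<bar>(2 * u - 1) * r\<bar> \<le> 1 * r" unfolding abs_mult using u hr by (intro mult_mono) auto
    ultimately show "\<exists>y. \<bar>y\<bar> \<le> r \<and> z = E k h y" by auto
  next
    assume "\<exists>y. \<bar>y\<bar> \<le> r \<and> z = E k h y"
    then obtain y where y: "\<bar>y\<bar> \<le> r" "z = E k h y" by blast
    define u where "u = (y + r) / (2 * r)"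
    have u: "0 \<le> u" "u \<le> 1" using y hr by (auto simp: u_def field_simps)
    have "(1 - u) * h + u * h = h" "(1 - u) * - r + u * r = y" using hr by (simp_all add: u_def field_simps)
    then have "z = (1 - u) *\<^sub>R E k h (- r) + u *\<^sub>R E k h r" unfolding E_affine y by simp
    then show "z \<in> closed_segment (E k h (- r)) (E k h r)" using u by (auto simp: in_segment)
  qed
  show ?thesis unfolding polygon_boundary_def length_P vertex_E(2)
    by (auto simp: vertex_E(1) seg)
qed

lemma closed_body: "closed body"
  unfolding body_half by (intro closed_INT ballI closed_halfspace_le)

lemma convex_body: "convex body"
  unfolding body_half by (intro convex_INT convex_halfspace_le)

lemma boundary_frontier: "polygon_boundary P = frontier body"
proof -
  have "z \<in> polygon_boundary P \<longleftrightarrow> z \<in> body - interior body" for z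
  proof
    assume "z \<in> polygon_boundary P"
    then obtain k y where k: "k < d" "\<bar>y\<bar> \<le> r" "z = E k h y" using mem_boundary by blast
    then have "z \<in> body" "nrm k \<bullet> (z - ctr) = h" using side_body own_frame by auto
    then show "z \<in> body - interior body" using k(1) by (auto simp: interior_body)
  next
    assume z: "z \<in> body - interior body"
    then obtain k where k: "k < d" "\<not> nrm k \<bullet> (z - ctr) < h" by (auto simp: interior_body)
    moreover have "nrm k \<bullet> (z - ctr) \<le> h" using z k(1) by (simp add: body_def)
    ultimately have "nrm k \<bullet> (z - ctr) = h" by linarith
    then show "z \<in> polygon_boundary P" using tight_side[of z k] z k(1) mem_boundary by (metis DiffD1)
  qed
  then show ?thesis by (simp add: frontier_def closed_body set_eq_iff)
qed

text \<open>The direction of \<open>z\<close> from the centre is within angle \<open>th\<close> of the normal of the side whose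
  sector contains \<open>z\<close>.\<close>

lemma bounded_body: "bounded body"
proof -
  have "dist ctr z \<le> h / cos th" if z: "z \<in> body" for z
  proof -
    define w where "w = (z - ctr) / sgn a"
    have na: "norm (sgn a) = 1" using a by (simp add: norm_sgn)
    have nw: "norm w = dist ctr z" using na by (simp add: w_def norm_divide dist_norm norm_minus_commute)
    define A where "A = Arg2pi w"
    define k where "k = nat \<lfloor>A / (2 * th)\<rfloor>"
    have A: "0 \<le> A" "A < 2 * pi" by (simp_all add: A_def Arg2pi_ge_0 Arg2pi_lt_2pi)
    have k: "real k = of_int \<lfloor>A / (2 * th)\<rfloor>" using A th by (simp add: k_def)
    then have "real k \<le> A / (2 * th)" "A / (2 * th) < real k + 1" by linarith+
    then have kA: "real k * (2 * th) \<le> A" "A < (real k + 1) * (2 * th)" using th by (simp_all add: field_simps)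
    have "real d * (2 * th) = 2 * pi" by (metis th(3) mult.left_commute)
    then have "real k * (2 * th) < real d * (2 * th)" using kA A by linarith
    moreover have "0 < 2 * th" using th by simp
    ultimately have kd: "k < d" by (simp only: mult_less_cancel_right_pos of_nat_less_iff)
    define B where "B = A - real (2 * k + 1) * th"
    have B: "\<bar>B\<bar> \<le> th" using kA by (simp add: B_def abs_le_iff algebra_simps)
    have "w = of_real (norm w) * cis A" by (simp add: A_def cis_conv_exp Arg2pi_eq[symmetric])
    moreover have "cis A = cis (real (2 * k + 1) * th) * cis B" by (simp add: cis_mult B_def)
    moreover have "z = ctr + sgn a * w" using na by (auto simp: w_def)
    ultimately have "z = ctr + nrm k * (of_real (norm w) * cis B)" by (simp add: nrm_def mult_ac)
    moreover have "of_real (norm w) * cis B = Complex (norm w * cos B) (norm w * sin B)" by (simp add: complex_eq_iff)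
    ultimately have "z = E k (norm w * cos B) (norm w * sin B)" by (simp add: E_def)
    then have "norm w * cos B \<le> h" using z kd own_frame by (auto simp: body_def)
    moreover have "cos th \<le> cos \<bar>B\<bar>" using B th pi_gt_zero by (intro cos_monotone_0_pi_le) linarith+
    then have "norm w * cos th \<le> norm w * cos B" by (intro mult_left_mono) auto
    ultimately have "norm w * cos th \<le> h" by linarith
    then show ?thesis using trig by (simp add: nw field_simps)
  qed
  then have "body \<subseteq> cball ctr (h / cos th)" by auto
  then show ?thesis using bounded_cball bounded_subset by blast
qed

lemma inside_boundary: "inside (polygon_boundary P) = interior body"
  unfolding boundary_frontier by (rule inside_frontier_eq_interior[OF bounded_body convex_body])

lemma not_dvd_index: "j < d \<Longrightarrow> k < d \<Longrightarrow> j \<noteq> k \<Longrightarrow> \<not> int d dvd int j - int k"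
  by (auto simp: mod_eq_dvd_iff[symmetric])

lemma side_less: "\<bar>y\<bar> < r \<Longrightarrow> j < d \<Longrightarrow> k < d \<Longrightarrow> j \<noteq> k \<Longrightarrow> nrm j \<bullet> (E k h y - ctr) < h"
  unfolding frame_inner by (rule frame_less[OF _ not_dvd_index])

text \<open>At an inner point of a side the constraints of all other sides are strict, hence stable
  under small displacements.\<close>

lemma near_side:
  assumes y: "\<bar>y\<bar> < r" and k: "k < d"
  shows "\<forall>\<^sub>F t in at_right 0. E k (h - t) y \<in> interior body"
proof -
  have "\<forall>\<^sub>F t in at_right 0. nrm j \<bullet> (E k (h - t) y - ctr) < h" if j: "j < d" for j
  proof (cases "j = k")
    case True
    then show ?thesis using eventually_at_right_less[of "0::real"] by (simp add: own_frame)
  next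
    case False
    let ?q = "2 * of_int (int j - int k) * th :: real"
    have "((\<lambda>t. cos ?q * (h - t) + sin ?q * y) \<longlongrightarrow> cos ?q * (h - 0) + sin ?q * y) (at_right 0)"
      by (intro tendsto_intros)
    moreover have "cos ?q * (h - 0) + sin ?q * y < h" using side_less[OF y j k False] by (simp add: frame_inner)
    ultimately show ?thesis unfolding frame_inner by (rule order_tendstoD(2))
  qed
  then have "\<forall>\<^sub>F t in at_right 0. \<forall>j\<in>{..<d}. nrm j \<bullet> (E k (h - t) y - ctr) < h"
    by (intro eventually_ball_finite) auto
  then show ?thesis by (simp add: interior_body Ball_def)
qed

lemma E_normal: "E k x y + t *\<^sub>R nrm k = E k (x + t) y"
  by (simp add: E_def complex_eq_iff algebra_simps)

text \<open>The only other unit vector orthogonal to the side is \<open>nrm k\<close>, which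
  violates the constraint of side \<open>k\<close> at once.\<close>

lemma inner_normal_eq:
  assumes y: "\<bar>y\<bar> < r" and k: "k < d" and side: "side_at P s = k" and bp: "boundary_point P s = E k h y"
  shows "inner_normal P s = - nrm k"
  unfolding inner_normal_def bp tangent_eq[OF side] inside_boundary
proof (rule the_equality)
  have "E k h y + t *\<^sub>R - nrm k = E k (h - t) y" for t using E_normal[of k h y "- t"] by simp
  then show "norm (- nrm k) = 1 \<and> - nrm k \<bullet> (nrm k * \<i>) = 0 \<and>
    (\<forall>\<^sub>F t in at_right 0. E k h y + t *\<^sub>R - nrm k \<in> interior body)"
    using near_side[OF y k] by (simp add: norm_nrm inner_complex_def)
  fix u assume u: "norm u = 1 \<and> u \<bullet> (nrm k * \<i>) = 0 \<and>
    (\<forall>\<^sub>F t in at_right 0. E k h y + t *\<^sub>R u \<in> interior body)"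
  define w where "w = u / nrm k"
  have n: "nrm k \<noteq> 0" using norm_nrm[of k] by auto
  have uw: "u = nrm k * w" using n by (simp add: w_def)
  have sq: "Re (nrm k) * Re (nrm k) + Im (nrm k) * Im (nrm k) = 1"
    using cmod_power2[of "nrm k"] by (simp add: norm_nrm power2_eq_square)
  have "u \<bullet> (nrm k * \<i>) = (Re (nrm k) * Re (nrm k) + Im (nrm k) * Im (nrm k)) * Im w"
    by (simp add: uw inner_complex_def algebra_simps)
  then have im: "Im w = 0" using u sq by simp
  have "norm w = 1" using u by (simp add: w_def norm_divide norm_nrm)
  then have "\<bar>Re w\<bar> = 1" using im by (simp add: cmod_def)
  then have "w = 1 \<or> w = -1" using im by (auto simp: complex_eq_iff abs_if split: if_splits)
  then show "u = - nrm k"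
  proof
    assume "w = 1"
    then have "\<forall>\<^sub>F t in at_right 0. E k (h + t) y \<in> interior body" using u uw by (simp add: E_normal)
    with eventually_at_right_less[of "0::real"] have "\<forall>\<^sub>F t in at_right (0::real). False"
      by eventually_elim (use k in \<open>auto simp: interior_body own_frame dest: spec[of _ k]\<close>)
    then show ?thesis by simp
  qed (simp add: uw)
qed

text \<open>The constraint of side \<open>k\<close> is strict once the ray has left it. Every other
  one is strict at the starting point and holds at the target, so it is strict in between by
  convexity. Thus the ray meets the boundary at the target first.\<close>

lemma slap_point_eq:
  assumes y: "\<bar>y\<bar> < r" and k: "k < d" and side: "side_at P s = k" and bp: "boundary_point P s = E k h y"
    and T: "0 < T" and target: "E k (h - T) y \<in> polygon_boundary P"
  shows "slap_point P s = E k (h - T) y"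
proof -
  define H where "H = slap_ray P s \<inter> polygon_boundary P - {E k h y}"
  have dist: "dist (E k h y) (E k (h - t) y) = \<bar>t\<bar>" for t
  proof -
    have "E k h y - E k (h - t) y = nrm k * of_real t" by (simp add: E_def complex_eq_iff algebra_simps)
    then show ?thesis by (simp add: dist_norm norm_mult norm_nrm)
  qed
  have "E k h y + t *\<^sub>R - nrm k = E k (h - t) y" for t using E_normal[of k h y "- t"] by simp
  then have ray: "slap_ray P s = {E k (h - t) y |t. 0 \<le> t}"
    by (simp only: slap_ray_def inner_normal_eq[OF y k side bp] bp)
  have hT: "E k (h - T) y \<in> H" using T target by (auto simp: H_def ray E_inj)
  have far: "T \<le> t" if t: "0 \<le> t" "E k (h - t) y \<in> H" for t
  proof (rule ccontr)
    assume "\<not> T \<le> t"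
    then have tT: "t < T" by simp
    have t0: "0 < t" using t by (cases "t = 0") (auto simp: H_def)
    have "nrm j \<bullet> (E k (h - t) y - ctr) < h" if j: "j < d" for j
    proof (cases "j = k")
      case True
      then show ?thesis using t0 by (simp add: own_frame)
    next
      case False
      define C where "C = cos (2 * of_int (int j - int k) * th)"
      define S where "S = sin (2 * of_int (int j - int k) * th)"
      have "C * h + S * y < h" using side_less[OF y j k False] by (simp add: frame_inner C_def S_def)
      then have "(T - t) * (C * h + S * y) < (T - t) * h" using tT by simp
      moreover have "E k (h - T) y \<in> body"
        using target closed_body by (auto simp: boundary_frontier frontier_def)
      then have "C * (h - T) + S * y \<le> h" using j by (simp add: body_def frame_inner C_def S_def)
      then have "t * (C * (h - T) + S * y) \<le> t * h" using t0 by simp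
      ultimately have "T * (C * (h - t) + S * y) < T * h" by (simp add: algebra_simps)
      then show ?thesis using T by (simp add: frame_inner C_def S_def)
    qed
    then have "E k (h - t) y \<in> interior body" by (simp add: interior_body)
    moreover have "E k (h - t) y \<in> frontier body" using t by (simp add: H_def boundary_frontier)
    ultimately show False by (simp add: frontier_def)
  qed
  show ?thesis unfolding slap_point_def Let_def bp H_def[symmetric]
  proof (rule the_equality)
    have "dist (E k h y) (E k (h - T) y) \<le> dist (E k h y) w" if w: "w \<in> H" for w
    proof -
      obtain t where "0 \<le> t" "w = E k (h - t) y" using w by (auto simp: H_def ray)
      then show ?thesis using far[of t] w T by (simp add: dist)
    qed
    then show "E k (h - T) y \<in> H \<and> (\<forall>w\<in>H. dist (E k h y) (E k (h - T) y) \<le> dist (E k h y) w)" using hT by blast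
    fix z assume z: "z \<in> H \<and> (\<forall>w\<in>H. dist (E k h y) z \<le> dist (E k h y) w)"
    then obtain t where t: "0 \<le> t" "z = E k (h - t) y" by (auto simp: H_def ray)
    then have "T \<le> t" using far z by blast
    moreover have "dist (E k h y) z \<le> dist (E k h y) (E k (h - T) y)" using z hT by blast
    ultimately show "z = E k (h - T) y" using T t by (simp add: dist)
  qed
qed

section \<open>Arc length parameters of boundary points\<close>

lemma nrm_mod: "nrm (j mod d) = nrm j"
proof -
  have "real j = real d * real (j div d) + real (j mod d)"
    by (metis mult_div_mod_eq of_nat_add of_nat_mult)
  then have "real (2 * j + 1) * th = real (2 * (j mod d) + 1) * th + 2 * (real d * th) * real (j div d)"
    by (simp add: algebra_simps)
  also have "\<dots> = real (2 * (j mod d) + 1) * th + 2 * pi * real (j div d)" by (simp add: th)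
  finally have e: "real (2 * j + 1) * th = real (2 * (j mod d) + 1) * th + 2 * pi * real (j div d)" .
  have "cis (real (2 * j + 1) * th) = cis (real (2 * (j mod d) + 1) * th) * cis (2 * pi * real (j div d))"
    by (simp only: e cis_mult)
  also have "cis (2 * pi * real (j div d)) = 1" by (rule cis_multiple_2pi) simp
  finally show ?thesis by (simp add: nrm_def)
qed

lemma E_mod: "E (j mod d) x y = E j x y"
  by (simp add: E_def nrm_mod)

text \<open>At \<open>y = - r\<close> with \<open>k > 0\<close> the parameter belongs to the side
  that ends there, and both frames give the same vertex. Half-open sides parametrize the boundary
  without repetition.\<close>

lemma boundary_point_half_open:
  assumes "- r \<le> y" "y < r"
  shows "boundary_point P (real k * (2 * r) + r + y) = E k h y"
proof (cases "y = - r \<and> k > 0")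
  case True
  then obtain j where j: "k = Suc j" using gr0_implies_Suc by auto
  have "boundary_point P (real k * (2 * r) + r + y) = E j h (real k * (2 * r) + r + y - real j * (2 * r) - r)"
    using True j hr by (intro boundary_point_eq) (auto simp: algebra_simps)
  also have "real k * (2 * r) + r + y - real j * (2 * r) - r = r" using True j by (simp add: algebra_simps)
  also have "E j h r = E k h y" using vertex_E[of j] vertex_E(1)[of k] True j by simp
  finally show ?thesis .
next
  case False
  then show ?thesis using assms hr
    by (subst boundary_point_eq[where k = k]) (auto simp: algebra_simps)
qed

lemma vertex_inj:
  assumes "j < d" "k < d" "vertex P j = vertex P k"
  shows "j = k"
proof -
  have "cis (2 * real i * th) = exp (2 * of_real pi * \<i> * of_nat i / of_nat d)" for i
    by (simp add: cis_conv_exp th_def mult_ac)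
  then have "exp (2 * of_real pi * \<i> * of_nat j / of_nat d) = exp (2 * of_real pi * \<i> * of_nat k / of_nat d)"
    using assms(3) a by (simp add: vertex_eq)
  then show ?thesis using assms d by (subst (asm) complex_root_unity_eq) auto
qed

text \<open>A point on two different sides is an end point of both, and a half-open side contains
  only its starting vertex.\<close>

lemma side_inj:
  assumes "j < d" "k < d" "- r \<le> y" "y < r" "- r \<le> y'" "y' < r" "E j h y = E k h y'"
  shows "j = k \<and> y = y'"
proof (cases "j = k")
  case True
  then show ?thesis using assms by (simp add: E_inj)
next
  case False
  have "\<not> \<bar>y\<bar> < r" using side_less[of y k j] assms False own_frame[of k h y'] by auto
  moreover have "\<not> \<bar>y'\<bar> < r" using side_less[of y' j k] assms False own_frame[of j h y] by auto
  ultimately have "y = - r" "y' = - r" using assms by auto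
  then have "vertex P j = vertex P k" using assms by (simp add: vertex_E(1))
  then show ?thesis using vertex_inj assms False by blast
qed

lemma param_split:
  assumes "0 \<le> s" "s < perimeter P"
  obtains k y where "k < d" "- r \<le> y" "y < r" "s = real k * (2 * r) + r + y"
proof -
  define k where "k = nat \<lfloor>s / (2 * r)\<rfloor>"
  have "real k = of_int \<lfloor>s / (2 * r)\<rfloor>" using assms hr by (simp add: k_def)
  then have "real k \<le> s / (2 * r)" "s / (2 * r) < real k + 1" by linarith+
  then have k: "real k * (2 * r) \<le> s" "s < (real k + 1) * (2 * r)" using hr by (simp_all add: field_simps)
  have "real k * (2 * r) < real d * (2 * r)" using k assms by (simp add: perimeter_eq)
  then have "k < d" using hr by simp
  then show thesis using that[of k "s - real k * (2 * r) - r"] k by (simp add: algebra_simps)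
qed

lemma param_less:
  assumes "k < d" "- r \<le> y" "y < r"
  shows "0 \<le> real k * (2 * r) + r + y" "real k * (2 * r) + r + y < perimeter P"
proof -
  have "0 \<le> real k * (2 * r)" using hr by simp
  then show "0 \<le> real k * (2 * r) + r + y" using assms by linarith
  have "(real k + 1) * (2 * r) \<le> real d * (2 * r)" using assms hr by (intro mult_right_mono) auto
  then show "real k * (2 * r) + r + y < perimeter P" using assms by (simp add: perimeter_eq algebra_simps)
qed

lemma slap_map_eq:
  assumes y: "\<bar>y\<bar> < r" and k: "k < d" and T: "0 < T" and k': "k' < d" and y': "- r \<le> y'" "y' < r"
    and target: "E k (h - T) y = E k' h y'"
  shows "slap_map P (real k * (2 * r) + r + y) = real k' * (2 * r) + r + y'"
proof -
  define s where "s = real k * (2 * r) + r + y"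
  have bp: "boundary_point P s = E k h y" using boundary_point_half_open[of y k] y by (auto simp: s_def)
  have side: "side_at P s = k" using y by (intro side_at_eq) (auto simp: s_def algebra_simps)
  have "E k (h - T) y \<in> polygon_boundary P" unfolding target mem_boundary using k' y' by (intro exI[of _ k'] conjI exI[of _ y']) auto
  then have sp: "slap_point P s = E k' h y'" using slap_point_eq[OF y k side bp T] target by simp
  have "boundary_point P s \<notin> set P"
  proof
    assume "boundary_point P s \<in> set P"
    then obtain j where "j < d" "E k h y = P ! j" unfolding bp in_set_conv_nth length_P by metis
    then have "j < d" "E k h y = E j h (- r)" by (auto simp: vertex_E(1)[symmetric] vertex_def length_P)
    then show False using side_inj[of k j y "- r"] k y hr by (auto simp: abs_less_iff)
  qed
  moreover have "s \<in> {0..perimeter P}" using param_less[of k y] k y by (auto simp: s_def abs_less_iff)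
  moreover have "(THE s'. s' \<in> {0..<perimeter P} \<and> boundary_point P s' = E k' h y') = real k' * (2 * r) + r + y'"
  proof (rule the_equality)
    show "real k' * (2 * r) + r + y' \<in> {0..<perimeter P} \<and> boundary_point P (real k' * (2 * r) + r + y') = E k' h y'"
      using param_less[OF k' y'] boundary_point_half_open[OF y'] by auto
    fix s' assume s': "s' \<in> {0..<perimeter P} \<and> boundary_point P s' = E k' h y'"
    then obtain j v where j: "j < d" "- r \<le> v" "v < r" "s' = real j * (2 * r) + r + v"
      using param_split[of s'] by auto
    then have "E j h v = E k' h y'" using s' boundary_point_half_open[of v j] by simp
    then show "s' = real k' * (2 * r) + r + y'" using side_inj[of j k' v y'] j k' y' by auto
  qed
  ultimately show ?thesis by (simp add: slap_map_def sp s_def[symmetric])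
qed

section \<open>The slap map on half sides\<close>

definition \<beta> :: real where "\<beta> = 1 / cos th"

lemma \<beta>: "1 < \<beta>" "\<beta> \<le> 2"
proof -
  have "cos th < cos 0" using th pi_gt_zero by (intro cos_monotone_0_pi) linarith+
  then show "1 < \<beta>" "\<beta> \<le> 2" using trig by (auto simp: \<beta>_def field_simps)
qed

text \<open>\<open>s\<close> selects one of the two sides that meet at the vertex opposite to side
  \<open>k\<close>. Projecting along the normal of side \<open>k\<close> stretches lengths by
  \<open>1 / cos th\<close>. The last condition excludes the end of the target side away from the
  opposite vertex.\<close>

lemma slap_opposite:
  assumes y: "\<bar>y\<bar> < r" and k: "k < d" and j: "j < d" and s: "s = 1 \<or> s = -1"
    and nrm: "nrm j = - (nrm k * cis (s * th))"
    and y': "y' = - \<beta> * y - s * r" "- r \<le> y'" "y' < r" "- s * y' > - r"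
  shows "slap_map P (real k * (2 * r) + r + y) = real j * (2 * r) + r + y'"
proof (rule slap_map_eq[OF y k _ j y'(2,3)])
  define T where "T = h + h * cos th - s * y' * sin th"
  have cs: "cos (s * th) = cos th" "sin (s * th) = s * sin th" using s by auto
  have "- r * sin th < (- s * y') * sin th" using y'(4) trig by (intro mult_strict_right_mono) auto
  \<comment> \<open>This is nonnegative because \<open>cos th \<ge> 1 / 2\<close>. For the triangle
    it is zero, since there the excluded end of the target side is a vertex of side
    \<open>k\<close>; hence the strict inequality above.\<close>
  moreover have "h + h * cos th - r * sin th = norm a * (cos th + 2 * (cos th * cos th) - 1)"
  proof -
    have "sin th * sin th = 1 - cos th * cos th" using sin_cos_squared_add[of th] by (simp add: power2_eq_square)
    then have "r * sin th = norm a * (1 - cos th * cos th)" by (simp only: r_def mult.assoc)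
    then show ?thesis by (simp only: h_def) (simp add: algebra_simps)
  qed
  moreover have "(1 / 2) * (1 / 2) \<le> cos th * cos th" using trig by (intro mult_mono) auto
  then have "0 \<le> norm a * (cos th + 2 * (cos th * cos th) - 1)" using trig by (intro mult_nonneg_nonneg) auto
  ultimately show "0 < T" unfolding T_def by linarith
  have "cos th * y' = - y - s * (cos th * r)" using trig by (simp add: y'(1) \<beta>_def field_simps)
  also have "cos th * r = h * sin th" by (simp add: h_def r_def)
  finally have y: "y = - (cos th * y' + s * (h * sin th))" by simp
  have "- (cis (s * th) * Complex h y') = Complex (h - T) y"
    by (subst y) (simp add: complex_eq_iff cs T_def algebra_simps)
  moreover have "E j h y' = ctr + nrm k * - (cis (s * th) * Complex h y')" by (simp add: E_def nrm mult.assoc)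
  ultimately show "E k (h - T) y = E j h y'" by (simp add: E_def)
qed

text \<open>Half a turn is \<open>d / 2\<close> side steps, so for odd \<open>d\<close> the two
  sides \<open>(d + 1) / 2\<close> and \<open>(d - 1) / 2\<close> steps away deviate from it by
  \<open>th\<close> in either direction.\<close>

lemma nrm_opposite:
  assumes "odd d"
  shows "nrm ((k + (d + 1) div 2) mod d) = - (nrm k * cis (1 * th))"
    "nrm ((k + (d - 1) div 2) mod d) = - (nrm k * cis (-1 * th))"
proof -
  obtain e where e: "d = 2 * e + 1" using assms by (elim oddE)
  have rd: "real d = 2 * real e + 1" using e by simp
  have pi: "(2 * real e + 1) * th = pi" using th(3) unfolding rd .
  have "real (2 * (k + (d + 1) div 2) + 1) * th = real (2 * k + 1) * th + (2 * real e + 1) * th + th"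
    by (simp add: e algebra_simps)
  then have "real (2 * (k + (d + 1) div 2) + 1) * th = real (2 * k + 1) * th + (th + pi)" by (simp add: pi)
  then have "cis (real (2 * (k + (d + 1) div 2) + 1) * th) = cis (real (2 * k + 1) * th) * (cis th * cis pi)"
    by (simp only: cis_mult)
  then show "nrm ((k + (d + 1) div 2) mod d) = - (nrm k * cis (1 * th))" unfolding nrm_mod by (simp add: nrm_def cis_pi)
  have "real (2 * (k + (d - 1) div 2) + 1) * th = real (2 * k + 1) * th + (2 * real e + 1) * th - th"
    by (simp add: e algebra_simps)
  then have "real (2 * (k + (d - 1) div 2) + 1) * th = real (2 * k + 1) * th + (- th + pi)" by (simp add: pi)
  then have "cis (real (2 * (k + (d - 1) div 2) + 1) * th) = cis (real (2 * k + 1) * th) * (cis (- th) * cis pi)"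
    by (simp only: cis_mult)
  then show "nrm ((k + (d - 1) div 2) mod d) = - (nrm k * cis (-1 * th))" unfolding nrm_mod by (simp add: nrm_def cis_pi)
qed

text \<open>The midpoint \<open>y = 0\<close> is treated here: it hits the opposite vertex, which is
  the starting vertex of this target side.\<close>

lemma slap_left:
  assumes "odd d" "- r < y" "y \<le> 0" "k < d"
  shows "slap_map P (real k * (2 * r) + r + y) = real ((k + (d + 1) div 2) mod d) * (2 * r) - \<beta> * y"
proof -
  have "0 \<le> \<beta> * (- y)" using \<beta> assms by (intro mult_nonneg_nonneg) auto
  moreover have "\<beta> * (- y) \<le> 2 * (- y)" using \<beta> assms by (intro mult_right_mono) auto
  ultimately have "slap_map P (real k * (2 * r) + r + y) = real ((k + (d + 1) div 2) mod d) * (2 * r) + r + (- \<beta> * y - 1 * r)"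
    using assms hr d by (intro slap_opposite[where s = 1, OF _ _ _ _ nrm_opposite(1)[OF assms(1)] refl]) auto
  then show ?thesis by simp
qed

lemma slap_right:
  assumes "odd d" "0 < y" "y < r" "k < d"
  shows "slap_map P (real k * (2 * r) + r + y) = real ((k + (d - 1) div 2) mod d) * (2 * r) + 2 * r - \<beta> * y"
proof -
  have "0 < \<beta> * y" using \<beta> assms by (intro mult_pos_pos) auto
  moreover have "\<beta> * y \<le> 2 * y" using \<beta> assms by (intro mult_right_mono) auto
  then have "\<beta> * y < 2 * r" using assms by linarith
  ultimately have "slap_map P (real k * (2 * r) + r + y) = real ((k + (d - 1) div 2) mod d) * (2 * r) + r + (- \<beta> * y - -1 * r)"
    using assms hr d by (intro slap_opposite[where s = "-1", OF _ _ _ _ nrm_opposite(2)[OF assms(1)] refl]) auto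
  then show ?thesis by simp
qed

lemma slap_map_range:
  assumes "odd d" and s: "s \<in> {0..perimeter P}"
  shows "slap_map P s \<in> {0..perimeter P}"
proof -
  have zero: "slap_map P s = 0" if "boundary_point P s \<in> set P"
    using that by (simp add: slap_map_def)
  have per: "0 \<in> {0..perimeter P}" using hr by (simp add: perimeter_eq)
  have vert: "E k h (- r) \<in> set P" if "k < d" for k
    using that by (auto simp: vertex_E(1)[symmetric] vertex_def length_P)
  consider "s = perimeter P" | "s < perimeter P" using s by force
  then show ?thesis
  proof cases
    case 1
    obtain e where e: "d = Suc e" using d by (cases d) auto
    have dd: "real d * (2 * r) = real e * (2 * r) + 2 * r" by (simp add: e algebra_simps)
    have sd: "s = real e * (2 * r) + 2 * r" using 1 dd by (simp add: perimeter_eq)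
    have "boundary_point P s = E e h (s - real e * (2 * r) - r)"
      using hr by (intro boundary_point_eq) (auto simp: sd algebra_simps)
    also have "s - real e * (2 * r) - r = r" by (simp add: sd)
    also have "E e h r = E d h (- r)" using vertex_E(2)[of e] vertex_E(1)[of d] e by simp
    also have "E d h (- r) = E 0 h (- r)" using E_mod[of d h "- r"] by simp
    finally show ?thesis using zero vert[of 0] per d by simp
  next
    case 2
    then obtain k y where k: "k < d" "- r \<le> y" "y < r" "s = real k * (2 * r) + r + y"
      using param_split[of s] s by auto
    consider "y = - r" | "- r < y" "y \<le> 0" | "0 < y" using k by linarith
    then show ?thesis
    proof cases
      case 1
      then show ?thesis using zero vert[OF k(1)] per boundary_point_half_open[of y k] k by simp
    next
      case 2
      have j: "(k + (d + 1) div 2) mod d < d" using d by simp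
      have "0 \<le> \<beta> * (- y)" using \<beta> 2 by (intro mult_nonneg_nonneg) auto
      moreover have "\<beta> * (- y) \<le> 2 * (- y)" using \<beta> 2 by (intro mult_right_mono) auto
      ultimately have "- r \<le> - (\<beta> * y) - r" "- (\<beta> * y) - r < r" using 2 by linarith+
      from param_less[OF j this] show ?thesis
        unfolding k(4) slap_left[OF assms(1) 2 k(1)] atLeastAtMost_iff by linarith
    next
      case 3
      have j: "(k + (d - 1) div 2) mod d < d" using d by simp
      have "0 < \<beta> * y" using \<beta> 3 by (intro mult_pos_pos) auto
      moreover have "\<beta> * y \<le> 2 * y" using \<beta> 3 by (intro mult_right_mono) auto
      ultimately have "- r \<le> r - \<beta> * y" "r - \<beta> * y < r" using 3 k(3) by linarith+
      from param_less[OF j this] show ?thesis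
        unfolding k(4) slap_right[OF assms(1) 3 k(3,1)] atLeastAtMost_iff by linarith
    qed
  qed
qed

lemma mod_double: "2 * m mod (2 * d) = 2 * (m mod d)" "(2 * m + 1) mod (2 * d) = 2 * (m mod d) + 1"
proof -
  show "2 * m mod (2 * d) = 2 * (m mod d)" by (rule mult_mod_right[symmetric])
  have "2 * m + 1 = 2 * (m mod d) + 1 + 2 * d * (m div d)"
    by (metis add.commute add.left_commute distrib_left mod_mult_div_eq mult.assoc)
  then have "(2 * m + 1) mod (2 * d) = (2 * (m mod d) + 1) mod (2 * d)" by (metis mod_mult_self2)
  moreover have "m mod d < d" using d by simp
  then have "2 * (m mod d) + 1 < 2 * d" by linarith
  ultimately show "(2 * m + 1) mod (2 * d) = 2 * (m mod d) + 1" by simp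
qed

text \<open>Both formulas hold on the whole half side: they describe the same point in the charts of
  the two halves of the target side. The turning point is the one that hits the middle of that side,
  where both coordinates are 1.\<close>

lemma slap_chart:
  assumes "odd d" and i: "i < 2 * d" and z: "0 < z" "z < 1"
  shows "slap_map P (chart r i z) = chart r (slap_a d i) (2 - \<beta> + \<beta> * z)"
    and "slap_map P (chart r i z) = chart r (slap_b d i) (\<beta> - \<beta> * z)"
proof -
  obtain e where e: "d = 2 * e + 1" using assms(1) by (elim oddE)
  have de: "(d + 1) div 2 = e + 1" "(d - 1) div 2 = e" by (simp_all add: e)
  have "slap_map P (chart r i z) = chart r (slap_a d i) (2 - \<beta> + \<beta> * z) \<and>
    slap_map P (chart r i z) = chart r (slap_b d i) (\<beta> - \<beta> * z)"
  proof (cases "even i")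
    case True
    then obtain k where k: "i = 2 * k" by (elim evenE)
    define j where "j = (k + (d + 1) div 2) mod d"
    have b: "slap_b d i = 2 * j"
      using mod_double(1)[of "k + e + 1"] by (simp add: slap_b_def shift_def k j_def de e algebra_simps)
    have a: "slap_a d i = 2 * j + 1"
      using mod_double(2)[of "k + e + 1"] by (simp add: slap_a_def shift_def k j_def de e algebra_simps)
    have 1: "chart r i z = real k * (2 * r) + r + r * (z - 1)" by (simp add: chart_def k algebra_simps)
    have 2: "slap_map P (real k * (2 * r) + r + r * (z - 1)) = real j * (2 * r) - \<beta> * (r * (z - 1))"
      unfolding j_def using assms k hr z by (intro slap_left) (auto simp: algebra_simps mult_le_0_iff)
    show ?thesis unfolding 1 2 a b by (simp add: chart_def algebra_simps)
  next
    case False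
    then obtain k where k: "i = 2 * k + 1" by (elim oddE)
    define j where "j = (k + (d - 1) div 2) mod d"
    have b: "slap_b d i = 2 * j + 1"
      using mod_double(2)[of "k + e"] by (simp add: slap_b_def shift_def k j_def de e algebra_simps)
    have a: "slap_a d i = 2 * j"
      using mod_double(1)[of "k + e"] d by (simp add: slap_a_def shift_def k j_def de e algebra_simps)
    have 1: "chart r i z = real k * (2 * r) + r + r * (1 - z)" by (simp add: chart_def k algebra_simps)
    have 2: "slap_map P (real k * (2 * r) + r + r * (1 - z)) = real j * (2 * r) + 2 * r - \<beta> * (r * (1 - z))"
      unfolding j_def using assms k hr z by (intro slap_right) (auto simp: algebra_simps)
    show ?thesis unfolding 1 2 a b by (simp add: chart_def algebra_simps)
  qed
  then show "slap_map P (chart r i z) = chart r (slap_a d i) (2 - \<beta> + \<beta> * z)"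
    "slap_map P (chart r i z) = chart r (slap_b d i) (\<beta> - \<beta> * z)" by blast+
qed

lemma slap_system:
  assumes "odd d"
  shows "slap_system d \<beta> r (slap_map P)"
proof
  show "odd d" "d \<ge> 3" "1 < \<beta>" "\<beta> \<le> 2" "r > 0" using assms d \<beta> hr by auto
  have b: "1 / \<beta> < 1" "0 < 1 / \<beta>" using \<beta> by auto
  show "slap_map P x \<in> {0..real (2 * d) * r}" if "x \<in> {0..real (2 * d) * r}" for x
    using slap_map_range[OF assms, of x] that by (simp only: perimeter_eq)
  show "slap_map P (chart r i z) = chart r (slap_a d i) (2 - \<beta> + \<beta> * z)" if "i < 2 * d" "0 < z" "z < 1 - 1 / \<beta>" for i z
    using that b by (intro slap_chart(1)[OF assms]) linarith+
  show "slap_map P (chart r i z) = chart r (slap_b d i) (\<beta> - \<beta> * z)" if "i < 2 * d" "1 - 1 / \<beta> < z" "z < 1" for i z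
    using that b by (intro slap_chart(2)[OF assms]) linarith+
qed

end

section \<open>The mixing exponent\<close>

text \<open>For \<open>u = log 2 b\<close> the inequality \<open>k \<le> - log 2 u\<close> says
  \<open>2 ^ k * u \<le> 1\<close>, that is \<open>b ^ 2 ^ k \<le> 2\<close>. So the double
  logarithm counts how often the slope can be squared without exceeding 2.\<close>

lemma floor_double_log_eq_iff:
  fixes b :: real
  assumes b: "1 < b"
  shows "\<lfloor>- log 2 (- log 2 (1 / b))\<rfloor> = int m \<longleftrightarrow> b ^ 2 ^ m \<le> 2 \<and> 2 < (b ^ 2 ^ m)\<^sup>2"
proof -
  define u where "u = log 2 b"
  have u: "0 < u" "- log 2 (1 / b) = u" using b by (auto simp: u_def log_divide)
  have pw: "b ^ 2 ^ k \<le> 2 \<longleftrightarrow> 2 ^ k * u \<le> 1" for k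
  proof -
    have "b ^ 2 ^ k \<le> 2 \<longleftrightarrow> log 2 (b ^ 2 ^ k) \<le> log 2 2" using b by (subst log_le_cancel_iff) auto
    then show ?thesis using b by (simp add: log_nat_power u_def)
  qed
  have lg: "real k \<le> - log 2 u \<longleftrightarrow> 2 ^ k * u \<le> 1" for k
  proof -
    have "real k \<le> - log 2 u \<longleftrightarrow> log 2 u \<le> - real k" by linarith
    also have "\<dots> \<longleftrightarrow> u \<le> 2 powr - real k" using u by (simp add: log_le_iff)
    also have "2 powr - real k = 1 / 2 ^ k" by (simp add: powr_minus powr_realpow divide_inverse)
    finally show ?thesis by (simp add: field_simps)
  qed
  have "\<lfloor>- log 2 u\<rfloor> = int m \<longleftrightarrow> real m \<le> - log 2 u \<and> \<not> real (Suc m) \<le> - log 2 u"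
    by (auto simp: floor_eq_iff)
  moreover have "(b ^ 2 ^ m)\<^sup>2 = b ^ 2 ^ Suc m" by (simp add: power_mult[symmetric] mult.commute)
  ultimately show ?thesis unfolding u(2) lg pw[symmetric] by auto
qed

lemma floor_double_log_nonneg:
  fixes b :: real
  assumes "1 < b" "b \<le> 2"
  shows "0 \<le> \<lfloor>- log 2 (- log 2 (1 / b))\<rfloor>"
proof -
  have "- log 2 (1 / b) = log 2 b" using assms by (simp add: log_divide)
  moreover have "0 < log 2 b" "log 2 b \<le> 1" using assms by (auto simp: log_le_iff)
  ultimately show ?thesis by (simp add: log_le_iff)
qed

section \<open>Bounds for the cosines that decide the small cases\<close>

lemma cos_multiples:
  fixes x :: real
  shows "cos (2 * x) = 2 * cos x ^ 2 - 1" "cos (3 * x) = 4 * cos x ^ 3 - 3 * cos x"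
    "cos (4 * x) = 8 * cos x ^ 4 - 8 * cos x ^ 2 + 1"
proof -
  show 2: "cos (2 * x) = 2 * cos x ^ 2 - 1" for x :: real by (rule cos_double_cos)
  show "cos (3 * x) = 4 * cos x ^ 3 - 3 * cos x" by (rule cos_treble_cos)
  have "cos (4 * x) = 2 * cos (2 * x) ^ 2 - 1" using 2[of "2 * x"] by simp
  then show "cos (4 * x) = 8 * cos x ^ 4 - 8 * cos x ^ 2 + 1" unfolding 2[of x] by algebra
qed

text \<open>From \<open>cos (3 * x) = - cos (2 * x)\<close> at \<open>x = pi / 5\<close>. The factor
  \<open>c + 1\<close> belongs to the root \<open>cos pi\<close> and is divided out, leaving
  \<open>4 * c ^ 2 - 2 * c - 1 = 0\<close>.\<close>

lemma cos_pi_5: "1 / 2 \<le> cos (pi / 5) ^ 2" "cos (pi / 5) ^ 4 < 1 / 2"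
proof -
  define c where "c = cos (pi / 5)"
  have "cos (pi / 3) < c" "c < cos 0" unfolding c_def by (intro cos_monotone_0_pi; simp)+
  then have c: "1 / 2 < c" "c < 1" by (simp_all add: cos_60)
  have "cos (3 * (pi / 5)) = cos (pi - 2 * (pi / 5))" by (rule arg_cong[where f = cos]) simp
  then have "4 * c ^ 3 - 3 * c = - (2 * c ^ 2 - 1)"
    unfolding c_def cos_pi_minus cos_multiples .
  then have "(c + 1) * (4 * c ^ 2 - 2 * c - 1) = 0" by algebra
  then have 2: "c ^ 2 = (2 * c + 1) / 4" using c by simp
  then show "1 / 2 \<le> cos (pi / 5) ^ 2" using c by (simp add: c_def[symmetric])
  have "16 * c ^ 4 = 6 * c + 2" using 2 by algebra
  then show "cos (pi / 5) ^ 4 < 1 / 2" using c by (simp add: c_def[symmetric])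
qed

text \<open>The relation \<open>cos (4 * x) = - cos (3 * x)\<close> at \<open>x = pi / 7\<close>
  leaves a cubic after division by \<open>c + 1\<close>. The rational bounds 0.85 and 0.91 for its
  root are close enough for both inequalities.\<close>

lemma cos_pi_7: "1 / 2 \<le> cos (pi / 7) ^ 4" "cos (pi / 7) ^ 8 < 1 / 2"
proof -
  define c where "c = cos (pi / 7)"
  have "cos (pi / 3) < c" unfolding c_def by (intro cos_monotone_0_pi; simp)
  then have c: "1 / 2 < c" by (simp add: cos_60)
  have "cos (4 * (pi / 7)) = cos (pi - 3 * (pi / 7))" by (rule arg_cong[where f = cos]) simp
  then have "8 * c ^ 4 - 8 * c ^ 2 + 1 = - (4 * c ^ 3 - 3 * c)"
    unfolding c_def cos_pi_minus cos_multiples .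
  then have "(c + 1) * (4 * c ^ 2 * (2 * c - 1) - 4 * c + 1) = 0" by algebra
  then have p: "4 * c ^ 2 * (2 * c - 1) = 4 * c - 1" using c by simp
  have lo: "85 / 100 \<le> c"
  proof (rule ccontr)
    assume n: "\<not> 85 / 100 \<le> c"
    then have "c ^ 2 \<le> (85 / 100) ^ 2" using c by (intro power_mono) auto
    then have "4 * c ^ 2 * (2 * c - 1) \<le> 4 * (85 / 100) ^ 2 * (2 * c - 1)" using c by (intro mult_right_mono) auto
    then show False using n c unfolding p by (simp add: power2_eq_square)
  qed
  have hi: "c \<le> 91 / 100"
  proof (rule ccontr)
    assume n: "\<not> c \<le> 91 / 100"
    then have "(91 / 100) ^ 2 \<le> c ^ 2" by (intro power_mono) auto
    then have "4 * (91 / 100) ^ 2 * (2 * c - 1) \<le> 4 * c ^ 2 * (2 * c - 1)" using c by (intro mult_right_mono) auto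
    then show False using n unfolding p by (simp add: power2_eq_square)
  qed
  have "(85 / 100) ^ 4 \<le> c ^ 4" using lo by (intro power_mono) auto
  then show "1 / 2 \<le> cos (pi / 7) ^ 4" by (simp add: c_def[symmetric] power_divide)
  have "c ^ 8 \<le> (91 / 100) ^ 8" using hi c by (intro power_mono) auto
  also have "\<dots> < (1 / 2 :: real)" by (simp add: power_divide)
  finally show "cos (pi / 7) ^ 8 < 1 / 2" by (simp add: c_def)
qed

lemma mixing_exponent_eq_iff:
  assumes "d \<ge> 3"
  shows "mixing_exponent d = int m \<longleftrightarrow>
    (1 / cos (pi / real d)) ^ 2 ^ m \<le> 2 \<and> 2 < ((1 / cos (pi / real d)) ^ 2 ^ m)\<^sup>2"
    and "0 \<le> mixing_exponent d"
proof -
  have "pi / real d \<le> pi / 3" using assms by (intro divide_left_mono) auto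
  then have "cos (pi / 3) \<le> cos (pi / real d)" by (intro cos_monotone_0_pi_le) auto
  then have 1: "1 / 2 \<le> cos (pi / real d)" by (simp add: cos_60)
  have "pi / real d \<le> pi" using assms by (simp add: field_simps)
  then have "cos (pi / real d) < cos 0" using assms by (intro cos_monotone_0_pi) auto
  then have b: "1 < 1 / cos (pi / real d)" "1 / cos (pi / real d) \<le> 2" using 1 by (auto simp: field_simps)
  show "mixing_exponent d = int m \<longleftrightarrow>
    (1 / cos (pi / real d)) ^ 2 ^ m \<le> 2 \<and> 2 < ((1 / cos (pi / real d)) ^ 2 ^ m)\<^sup>2"
    using floor_double_log_eq_iff[OF b(1), of m] by (simp add: mixing_exponent_def)
  show "0 \<le> mixing_exponent d"
    using floor_double_log_nonneg[OF b] by (simp add: mixing_exponent_def)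
qed

lemma mixing_exponent_values: "mixing_exponent 3 = 0" "mixing_exponent 5 = 1" "mixing_exponent 7 = 2"
proof -
  show "mixing_exponent 3 = 0" using mixing_exponent_eq_iff(1)[of 3 0] by (simp add: cos_60)
  have "0 < cos (pi / 5)" by (intro cos_gt_zero) auto
  then show "mixing_exponent 5 = 1"
    using mixing_exponent_eq_iff(1)[of 5 1] cos_pi_5
    by (simp add: power_divide power_mult[symmetric] field_simps power2_eq_square[symmetric])
  have "0 < cos (pi / 7)" by (intro cos_gt_zero) auto
  then show "mixing_exponent 7 = 2"
    using mixing_exponent_eq_iff(1)[of 7 2] cos_pi_7
    by (simp add: power_divide power_mult[symmetric] field_simps)
qed

text \<open>The cosine increases with \<open>d\<close>, so the bound \<open>b ^ 4 \<le> 2\<close>,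
  valid for \<open>d = 7\<close>, persists and excludes the exponents 0 and 1.\<close>

lemma mixing_exponent_ge_2:
  assumes "d \<ge> 7"
  shows "mixing_exponent d \<ge> 2"
proof (rule ccontr)
  define b where "b = 1 / cos (pi / real d)"
  assume "\<not> mixing_exponent d \<ge> 2"
  moreover have "0 \<le> mixing_exponent d" using assms by (intro mixing_exponent_eq_iff(2)) simp
  ultimately have "mixing_exponent d = int 0 \<or> mixing_exponent d = int 1" by auto
  then have "2 < b ^ 2 \<or> 2 < b ^ 4"
    using mixing_exponent_eq_iff(1)[of d 0] mixing_exponent_eq_iff(1)[of d 1] assms
    by (auto simp: b_def power_mult[symmetric])
  have 7: "0 < cos (pi / 7)" by (intro cos_gt_zero) auto
  have "pi / real d \<le> pi / 7" using assms by (intro divide_left_mono) auto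
  then have le: "cos (pi / 7) \<le> cos (pi / real d)" by (intro cos_monotone_0_pi_le) auto
  then have "cos (pi / 7) ^ 4 \<le> cos (pi / real d) ^ 4" using 7 by (intro power_mono) auto
  then have "1 / 2 \<le> cos (pi / real d) ^ 4" using cos_pi_7 by linarith
  then have b4: "b ^ 4 \<le> 2" using le 7 by (simp add: b_def power_divide field_simps)
  have "1 \<le> b" using le 7 by (simp add: b_def field_simps)
  then have "b ^ 2 \<le> b ^ 4" by (intro power_increasing) auto
  then show False using b4 \<open>2 < b ^ 2 \<or> 2 < b ^ 4\<close> by linarith
qed

theorem theorem1p1:
  fixes P :: "complex list" and d :: nat
  assumes "regular_polygon d P" and "odd d"
  shows "(d = 3 \<or> d = 5 \<longrightarrow> (\<exists>!\<mu>. ergodic_acip {0..perimeter P} (slap_map P) \<mu>)) \<and>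
    (d \<ge> 7 \<longrightarrow> card {\<mu>. ergodic_acip {0..perimeter P} (slap_map P) \<mu>} = d) \<and>
    (\<forall>\<mu>. ergodic_acip {0..perimeter P} (slap_map P) \<mu> \<longrightarrow>
      (\<forall>k. (\<exists>\<Sigma>. mixing_components (slap_map P) \<mu> k \<Sigma>) \<longleftrightarrow>
           k = 2 ^ nat (mixing_exponent d))) \<and>
    mixing_exponent 3 = 0 \<and> mixing_exponent 5 = 1 \<and> mixing_exponent 7 = 2"
proof -
  obtain c a where ca: "a \<noteq> 0" "P = map (\<lambda>j. c + a * cis (2 * pi * real j / real d)) [0..<d]" and d: "d \<ge> 3"
    using assms(1) by (auto simp: regular_polygon_def)
  interpret G: regular_gon d c a P using ca d by unfold_locales auto
  interpret S: slap_system d G.\<beta> G.r "slap_map P" by (rule G.slap_system[OF assms(2)])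
  have per: "perimeter P = S.len" by (simp add: G.perimeter_eq S.len_def)
  have \<beta>: "G.\<beta> = 1 / cos (pi / real d)" by (simp add: G.\<beta>_def G.th_def)
  define m where "m = nat (mixing_exponent d)"
  have "mixing_exponent d = int m" using mixing_exponent_eq_iff(2)[OF d] by (simp add: m_def)
  then have bounds: "G.\<beta> ^ 2 ^ m \<le> 2" "2 < (G.\<beta> ^ 2 ^ m)\<^sup>2" using mixing_exponent_eq_iff(1)[OF d] by (simp_all add: \<beta>)
  have "d \<noteq> 4" "d \<noteq> 6" using assms(2) by auto
  then have cases: "d = 3 \<or> d = 5 \<or> d \<ge> 7" using d by linarith
  then have cs: "(d = 3 \<and> m = 0 \<and> G.\<beta> = 2) \<or> (d = 5 \<and> m = 1) \<or> m \<ge> 2"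
    using mixing_exponent_ge_2[of d] by (auto simp: m_def mixing_exponent_values \<beta> cos_60)
  define A where "A = {\<mu>. ergodic_acip {0..perimeter P} (slap_map P) \<mu>}"
  obtain g where g: "bij_betw g {..<(if m \<ge> 2 then d else 1)} A"
    using S.ergodic_acips(1)[OF bounds cs] by (auto simp: A_def per)
  then have card: "card A = (if m \<ge> 2 then d else 1)" using bij_betw_same_card by fastforce
  have "\<exists>!\<mu>. \<mu> \<in> A" if "d = 3 \<or> d = 5"
  proof -
    have "card A = 1" using card that by (auto simp: m_def mixing_exponent_values)
    then show ?thesis by (auto simp: card_1_singleton_iff)
  qed
  moreover have "card A = d" if "d \<ge> 7"
  proof -
    have "2 \<le> m" using mixing_exponent_ge_2[OF that] by (simp add: m_def)
    then show ?thesis using card by simp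
  qed
  moreover have "(\<exists>\<Sigma>. mixing_components (slap_map P) \<mu> k \<Sigma>) \<longleftrightarrow> k = 2 ^ m" if "\<mu> \<in> A" for \<mu> k
    using S.ergodic_acips(2)[OF bounds cs] that by (simp add: A_def per)
  ultimately show ?thesis by (simp add: A_def m_def mixing_exponent_values)
qed

end
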